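(* Let $k$ be a field of characteristic zero, let $A,B$ be a matched pair of finite dimensional Hopf algebras over $k$, with actions $\triangleright: B\otimes A\to A$ and $\triangleleft: B\otimes A\to B$, and let $H=A\bowtie B$ be their double cross product. Then: (i) $d(A,H)\le 2$ if and only if the action $\triangleleft$ of $A$ on $B$ is trivial, i.e. $b\triangleleft a=\varepsilon(a)\,b$ for all $a\in A$, $b\in B$; (ii) $d(B,H)\le 2$ if and only if the action $\triangleright$ of $B$ on $A$ is trivial, i.e. $b\triangleright a=\varepsilon(b)\,a$ for all $a\in A$, $b\in B$.
   Context: All algebras and modules are finite dimensional over $k$; Sweedler notation $\Delta(x)=x_1\otimes x_2$ is used. Matched pair: $A$ is a left $B$-module coalgebra via $\triangleright$ and $B$ is a right $A$-module coalgebra via $\triangleleft$ (so both maps are coalgebra maps), such that for all $a,c\in A$, $b,d\in B$: $(bd)\triangleleft a=\sum (b\triangleleft(d_1\triangleright a_1))(d_2\triangleleft a_2)$, $1_B\triangleleft a=\varepsilon(a)1_B$, $b\triangleright(ac)=\sum (b_1\triangleright a_1)((b_2\triangleleft a_2)\triangleright c)$, $b\triangleright 1_A=\varepsilon(b)1_A$, and $\sum b_1\triangleleft a_1\otimes b_2\triangleright a_2=\sum b_2\triangleleft a_2\otimes b_1\triangleright a_1$. Double cross product: $A\bowtie B$ is the vector space $A\otimes B$ (elements written $a\bowtie b$) with product $(a\bowtie b)(c\bowtie d)=\sum a(b_1\triangleright c_1)\bowtie(b_2\triangleleft c_2)d$, unit $1_A\bowtie 1_B$, and the tensor product coalgebra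 structure; it is a Hopf algebra. $A$ and $B$ are regarded as Hopf subalgebras via $a\mapsto a\bowtie 1_B$ and $b\mapsto 1_A\bowtie b$. Depth: two modules $M,N$ over a ring are similar, $M\sim N$, if there are positive integers $p,q$ such that $M$ is isomorphic to a direct summand of $N^{p}$ and $N$ is isomorphic to a direct summand of $M^{q}$ (similarly for bimodules). For a ring extension $R\subseteq H$ put $H^{\otimes_R(0)}=R$ and $H^{\otimes_R(n)}=H\otimes_R\cdots\otimes_R H$ ($n$ factors). The extension has depth $2n+1$ ($n\ge 0$) if $H^{\otimes_R(n+1)}\sim H^{\otimes_R(n)}$ as $R$-$R$-bimodules, and depth $2n$ ($n\ge1$) if $H^{\otimes_R(n+1)}\sim H^{\otimes_R(n)}$ as $R$-$H$-bimodules or as $H$-$R$-bimodules. The minimum depth $d(R,H)$ is the least positive integer $m$ such that the extension has depth $m$ ($\infty$ if none). Thus $d(R,H)\le 2$ means that the extension has depth $1$ or depth $2$. *)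

theory Defs
  imports
    "HOL-Algebra.Algebra"
    "HOL-Library.Extended_Nat"
    "HOL-Library.Poly_Mapping"
    "Jordan_Normal_Form.Missing_VectorSpace"
begin

section \<open>Abelian groups given by generators and relations\<close>

text \<open>The quotient of the free abelian group on \<open>gens\<close> by the subgroup generated by \<open>Rel\<close>,
  in additive notation. As usual in \<^theory>\<open>HOL-Algebra.Module\<close>, an additive structure is a ring
  record whose multiplicative fields carry no meaning.\<close>

definition presented_group :: "'x set \<Rightarrow> ('x \<Rightarrow>\<^sub>0 int) set \<Rightarrow> ('x \<Rightarrow>\<^sub>0 int) set ring" where
  "presented_group gens Rel =
    (let Q = free_Abelian_group gens Mod generate (free_Abelian_group gens) Rel
     in \<lparr>carrier = carrier Q, monoid.mult = undefined, monoid.one = undefined,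
         ring.zero = monoid.one Q, ring.add = monoid.mult Q\<rparr>)"

definition presented_class :: "'x set \<Rightarrow> ('x \<Rightarrow>\<^sub>0 int) set \<Rightarrow> 'x \<Rightarrow> ('x \<Rightarrow>\<^sub>0 int) set" where
  "presented_class gens Rel x =
    generate (free_Abelian_group gens) Rel #>\<^bsub>free_Abelian_group gens\<^esub> frag_of x"

text \<open>The value at the class \<open>c\<close> of the homomorphism into \<open>P\<close> that sends the class of each
  generator \<open>x\<close> to \<open>f x\<close>. It is independent of the chosen representative whenever the
  extension of \<open>f\<close> to the free abelian group kills the relations.\<close>

definition presented_lift ::
  "('p, 'm) ring_scheme \<Rightarrow> ('x \<Rightarrow>\<^sub>0 int) set \<Rightarrow> ('x \<Rightarrow> 'p) \<Rightarrow> 'p" where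
  "presented_lift P c f =
    (let g = (SOME g. g \<in> c)
     in \<Oplus>\<^bsub>P\<^esub>x \<in> Poly_Mapping.keys g. [Poly_Mapping.lookup g x] \<cdot>\<^bsub>P\<^esub> f x)"


section \<open>Tensor products over the ground field\<close>

definition tensor_rels ::
  "('k, 'm) ring_scheme \<Rightarrow> ('k, 'a, 'n) module_scheme \<Rightarrow> ('k, 'b, 'o) module_scheme
    \<Rightarrow> ('a \<times> 'b \<Rightarrow>\<^sub>0 int) set" where
  "tensor_rels K M N =
    {frag_of (x \<oplus>\<^bsub>M\<^esub> x', y) - frag_of (x, y) - frag_of (x', y) | x x' y.
       x \<in> carrier M \<and> x' \<in> carrier M \<and> y \<in> carrier N} \<union>
    {frag_of (x, y \<oplus>\<^bsub>N\<^esub> y') - frag_of (x, y) - frag_of (x, y') | x y y'.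
       x \<in> carrier M \<and> y \<in> carrier N \<and> y' \<in> carrier N} \<union>
    {frag_of (r \<odot>\<^bsub>M\<^esub> x, y) - frag_of (x, r \<odot>\<^bsub>N\<^esub> y) | r x y.
       r \<in> carrier K \<and> x \<in> carrier M \<and> y \<in> carrier N}"

definition pure_tensor ::
  "('k, 'm) ring_scheme \<Rightarrow> ('k, 'a, 'n) module_scheme \<Rightarrow> ('k, 'b, 'o) module_scheme
    \<Rightarrow> 'a \<Rightarrow> 'b \<Rightarrow> ('a \<times> 'b \<Rightarrow>\<^sub>0 int) set" where
  "pure_tensor K M N x y =
    presented_class (carrier M \<times> carrier N) (tensor_rels K M N) (x, y)"

text \<open>For a balanced biadditive \<open>f\<close>, the sum of all \<open>f x y\<close> over the simple tensors
  in an expression \<open>t = \<Sum> x \<otimes> y\<close>; thus \<open>tensor_lift P (\<Delta> c) f\<close> is what Sweedler notation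
  writes as the sum of all \<open>f c\<^sub>1 c\<^sub>2\<close>.\<close>

definition tensor_lift ::
  "('p, 'm) ring_scheme \<Rightarrow> ('a \<times> 'b \<Rightarrow>\<^sub>0 int) set \<Rightarrow> ('a \<Rightarrow> 'b \<Rightarrow> 'p) \<Rightarrow> 'p" where
  "tensor_lift P t f = presented_lift P t (\<lambda>(x, y). f x y)"

definition tensor ::
  "('k, 'm) ring_scheme \<Rightarrow> ('k, 'a, 'n) module_scheme \<Rightarrow> ('k, 'b, 'o) module_scheme
    \<Rightarrow> ('k, ('a \<times> 'b \<Rightarrow>\<^sub>0 int) set) module" where
  "tensor K M N =
    (let T = presented_group (carrier M \<times> carrier N) (tensor_rels K M N)
     in \<lparr>carrier = carrier T, monoid.mult = monoid.mult T, monoid.one = monoid.one T,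
         ring.zero = ring.zero T, ring.add = ring.add T,
         smult = (\<lambda>r t. tensor_lift T t (\<lambda>x y. pure_tensor K M N (r \<odot>\<^bsub>M\<^esub> x) y))\<rparr>)"


section \<open>Hopf algebras\<close>

record ('k, 'a) bialgebra = "('k, 'a) module" +
  comult :: "'a \<Rightarrow> ('a \<times> 'a \<Rightarrow>\<^sub>0 int) set"
  counit :: "'a \<Rightarrow> 'k"

definition scalar_module :: "'k ring \<Rightarrow> ('k, 'k) module" where
  "scalar_module K =
    \<lparr>carrier = carrier K, monoid.mult = monoid.mult K, monoid.one = monoid.one K,
     ring.zero = ring.zero K, ring.add = ring.add K,
     smult = monoid.mult K\<rparr>"

definition bilinear_map ::
  "('k, 'm) ring_scheme \<Rightarrow> ('k, 'a, 'n) module_scheme \<Rightarrow> ('k, 'b, 'o) module_scheme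
    \<Rightarrow> ('k, 'c, 'p) module_scheme \<Rightarrow> ('a \<Rightarrow> 'b \<Rightarrow> 'c) \<Rightarrow> bool" where
  "bilinear_map K U V W f \<longleftrightarrow>
    (\<forall>u\<in>carrier U. f u \<in> module_hom K V W) \<and>
    (\<forall>v\<in>carrier V. (\<lambda>u. f u v) \<in> module_hom K U W)"

locale k_algebra =
  fixes K :: "'k ring" and A :: "('k, 'a) bialgebra"
  assumes vectorspace: "vectorspace K A"
    and ring: "ring A"
    and mult_bilinear: "bilinear_map K A A A (monoid.mult A)"

locale k_coalgebra =
  fixes K :: "'k ring" and C :: "('k, 'c) bialgebra"
  assumes vectorspace: "vectorspace K C"
    and comult_linear: "comult C \<in> module_hom K C (tensor K C C)"
    and counit_linear: "counit C \<in> module_hom K C (scalar_module K)"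
    and coassoc: "\<And>x. x \<in> carrier C \<Longrightarrow>
      tensor_lift (tensor K C (tensor K C C)) (comult C x) (\<lambda>x\<^sub>1 x\<^sub>2.
        tensor_lift (tensor K C (tensor K C C)) (comult C x\<^sub>1) (\<lambda>x\<^sub>1\<^sub>1 x\<^sub>1\<^sub>2.
          pure_tensor K C (tensor K C C) x\<^sub>1\<^sub>1 (pure_tensor K C C x\<^sub>1\<^sub>2 x\<^sub>2))) =
      tensor_lift (tensor K C (tensor K C C)) (comult C x) (\<lambda>x\<^sub>1 x\<^sub>2.
        pure_tensor K C (tensor K C C) x\<^sub>1 (comult C x\<^sub>2))"
    and counit_left: "\<And>x. x \<in> carrier C \<Longrightarrow>
      tensor_lift C (comult C x) (\<lambda>x\<^sub>1 x\<^sub>2. counit C x\<^sub>1 \<odot>\<^bsub>C\<^esub> x\<^sub>2) = x"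
    and counit_right: "\<And>x. x \<in> carrier C \<Longrightarrow>
      tensor_lift C (comult C x) (\<lambda>x\<^sub>1 x\<^sub>2. counit C x\<^sub>2 \<odot>\<^bsub>C\<^esub> x\<^sub>1) = x"

locale k_bialgebra = k_algebra K A + k_coalgebra K A
  for K :: "'k ring" and A :: "('k, 'a) bialgebra" +
  assumes comult_mult: "\<And>x y. x \<in> carrier A \<Longrightarrow> y \<in> carrier A \<Longrightarrow>
      comult A (x \<otimes>\<^bsub>A\<^esub> y) =
      tensor_lift (tensor K A A) (comult A x) (\<lambda>x\<^sub>1 x\<^sub>2.
        tensor_lift (tensor K A A) (comult A y) (\<lambda>y\<^sub>1 y\<^sub>2.
          pure_tensor K A A (x\<^sub>1 \<otimes>\<^bsub>A\<^esub> y\<^sub>1) (x\<^sub>2 \<otimes>\<^bsub>A\<^esub> y\<^sub>2)))"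
    and comult_one: "comult A \<one>\<^bsub>A\<^esub> = pure_tensor K A A \<one>\<^bsub>A\<^esub> \<one>\<^bsub>A\<^esub>"
    and counit_mult: "\<And>x y. x \<in> carrier A \<Longrightarrow> y \<in> carrier A \<Longrightarrow>
      counit A (x \<otimes>\<^bsub>A\<^esub> y) = counit A x \<otimes>\<^bsub>K\<^esub> counit A y"
    and counit_one: "counit A \<one>\<^bsub>A\<^esub> = \<one>\<^bsub>K\<^esub>"

text \<open>The antipode is unique, hence its existence is a property of the bialgebra.\<close>

locale hopf_algebra = k_bialgebra K A
  for K :: "'k ring" and A :: "('k, 'a) bialgebra" +
  assumes antipode_exists: "\<exists>S \<in> module_hom K A A. \<forall>x\<in>carrier A.
      tensor_lift A (comult A x) (\<lambda>x\<^sub>1 x\<^sub>2. S x\<^sub>1 \<otimes>\<^bsub>A\<^esub> x\<^sub>2) = counit A x \<odot>\<^bsub>A\<^esub> \<one>\<^bsub>A\<^esub> \<and>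
      tensor_lift A (comult A x) (\<lambda>x\<^sub>1 x\<^sub>2. x\<^sub>1 \<otimes>\<^bsub>A\<^esub> S x\<^sub>2) = counit A x \<odot>\<^bsub>A\<^esub> \<one>\<^bsub>A\<^esub>"


section \<open>Matched pairs and double cross products\<close>

locale left_module_coalgebra =
  fixes K :: "'k ring" and B :: "('k, 'b) bialgebra" and C :: "('k, 'c) bialgebra"
    and act :: "'b \<Rightarrow> 'c \<Rightarrow> 'c"  (infixr \<open>\<rhd>\<close> 75)
  assumes bialgebra: "k_bialgebra K B"
    and coalgebra: "k_coalgebra K C"
    and act_bilinear: "bilinear_map K B C C (\<rhd>)"
    and act_one: "\<And>c. c \<in> carrier C \<Longrightarrow> \<one>\<^bsub>B\<^esub> \<rhd> c = c"
    and act_mult: "\<And>b d c. b \<in> carrier B \<Longrightarrow> d \<in> carrier B \<Longrightarrow> c \<in> carrier C \<Longrightarrow>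
      (b \<otimes>\<^bsub>B\<^esub> d) \<rhd> c = b \<rhd> (d \<rhd> c)"
    and act_comult: "\<And>b c. b \<in> carrier B \<Longrightarrow> c \<in> carrier C \<Longrightarrow>
      comult C (b \<rhd> c) =
      tensor_lift (tensor K C C) (comult B b) (\<lambda>b\<^sub>1 b\<^sub>2.
        tensor_lift (tensor K C C) (comult C c) (\<lambda>c\<^sub>1 c\<^sub>2.
          pure_tensor K C C (b\<^sub>1 \<rhd> c\<^sub>1) (b\<^sub>2 \<rhd> c\<^sub>2)))"
    and act_counit: "\<And>b c. b \<in> carrier B \<Longrightarrow> c \<in> carrier C \<Longrightarrow>
      counit C (b \<rhd> c) = counit B b \<otimes>\<^bsub>K\<^esub> counit C c"

text \<open>The subscript in \<open>\<lhd>\<^sub>r\<close> only avoids a clash with the library notation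
  for normal subgroups.\<close>

locale right_module_coalgebra =
  fixes K :: "'k ring" and A :: "('k, 'a) bialgebra" and C :: "('k, 'c) bialgebra"
    and act :: "'c \<Rightarrow> 'a \<Rightarrow> 'c"  (infixl \<open>\<lhd>\<^sub>r\<close> 75)
  assumes bialgebra: "k_bialgebra K A"
    and coalgebra: "k_coalgebra K C"
    and act_bilinear: "bilinear_map K C A C (\<lhd>\<^sub>r)"
    and act_one: "\<And>c. c \<in> carrier C \<Longrightarrow> c \<lhd>\<^sub>r \<one>\<^bsub>A\<^esub> = c"
    and act_mult: "\<And>c a a'. c \<in> carrier C \<Longrightarrow> a \<in> carrier A \<Longrightarrow> a' \<in> carrier A \<Longrightarrow>
      c \<lhd>\<^sub>r (a \<otimes>\<^bsub>A\<^esub> a') = (c \<lhd>\<^sub>r a) \<lhd>\<^sub>r a'"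
    and act_comult: "\<And>c a. c \<in> carrier C \<Longrightarrow> a \<in> carrier A \<Longrightarrow>
      comult C (c \<lhd>\<^sub>r a) =
      tensor_lift (tensor K C C) (comult C c) (\<lambda>c\<^sub>1 c\<^sub>2.
        tensor_lift (tensor K C C) (comult A a) (\<lambda>a\<^sub>1 a\<^sub>2.
          pure_tensor K C C (c\<^sub>1 \<lhd>\<^sub>r a\<^sub>1) (c\<^sub>2 \<lhd>\<^sub>r a\<^sub>2)))"
    and act_counit: "\<And>c a. c \<in> carrier C \<Longrightarrow> a \<in> carrier A \<Longrightarrow>
      counit C (c \<lhd>\<^sub>r a) = counit C c \<otimes>\<^bsub>K\<^esub> counit A a"

locale matched_pair =
  fixes K :: "'k ring" and A :: "('k, 'a) bialgebra" and B :: "('k, 'b) bialgebra"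
    and lact :: "'b \<Rightarrow> 'a \<Rightarrow> 'a"  (infixr \<open>\<rhd>\<close> 75)
    and ract :: "'b \<Rightarrow> 'a \<Rightarrow> 'b"  (infixl \<open>\<lhd>\<^sub>r\<close> 75)
  assumes hopf_A: "hopf_algebra K A"
    and hopf_B: "hopf_algebra K B"
    and left_action: "left_module_coalgebra K B A (\<rhd>)"
    and right_action: "right_module_coalgebra K A B (\<lhd>\<^sub>r)"
    and mult_ract: "\<And>b d a. b \<in> carrier B \<Longrightarrow> d \<in> carrier B \<Longrightarrow> a \<in> carrier A \<Longrightarrow>
      (b \<otimes>\<^bsub>B\<^esub> d) \<lhd>\<^sub>r a =
      tensor_lift B (comult B d) (\<lambda>d\<^sub>1 d\<^sub>2. tensor_lift B (comult A a) (\<lambda>a\<^sub>1 a\<^sub>2.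
        (b \<lhd>\<^sub>r (d\<^sub>1 \<rhd> a\<^sub>1)) \<otimes>\<^bsub>B\<^esub> (d\<^sub>2 \<lhd>\<^sub>r a\<^sub>2)))"
    and one_ract: "\<And>a. a \<in> carrier A \<Longrightarrow> \<one>\<^bsub>B\<^esub> \<lhd>\<^sub>r a = counit A a \<odot>\<^bsub>B\<^esub> \<one>\<^bsub>B\<^esub>"
    and lact_mult: "\<And>b a c. b \<in> carrier B \<Longrightarrow> a \<in> carrier A \<Longrightarrow> c \<in> carrier A \<Longrightarrow>
      b \<rhd> (a \<otimes>\<^bsub>A\<^esub> c) =
      tensor_lift A (comult B b) (\<lambda>b\<^sub>1 b\<^sub>2. tensor_lift A (comult A a) (\<lambda>a\<^sub>1 a\<^sub>2.
        (b\<^sub>1 \<rhd> a\<^sub>1) \<otimes>\<^bsub>A\<^esub> ((b\<^sub>2 \<lhd>\<^sub>r a\<^sub>2) \<rhd> c)))"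
    and lact_one: "\<And>b. b \<in> carrier B \<Longrightarrow> b \<rhd> \<one>\<^bsub>A\<^esub> = counit B b \<odot>\<^bsub>A\<^esub> \<one>\<^bsub>A\<^esub>"
    and compatible: "\<And>b a. b \<in> carrier B \<Longrightarrow> a \<in> carrier A \<Longrightarrow>
      tensor_lift (tensor K B A) (comult B b) (\<lambda>b\<^sub>1 b\<^sub>2.
        tensor_lift (tensor K B A) (comult A a) (\<lambda>a\<^sub>1 a\<^sub>2.
          pure_tensor K B A (b\<^sub>1 \<lhd>\<^sub>r a\<^sub>1) (b\<^sub>2 \<rhd> a\<^sub>2))) =
      tensor_lift (tensor K B A) (comult B b) (\<lambda>b\<^sub>1 b\<^sub>2.
        tensor_lift (tensor K B A) (comult A a) (\<lambda>a\<^sub>1 a\<^sub>2.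
          pure_tensor K B A (b\<^sub>2 \<lhd>\<^sub>r a\<^sub>2) (b\<^sub>1 \<rhd> a\<^sub>1)))"

definition double_cross_product ::
  "'k ring \<Rightarrow> ('k, 'a) bialgebra \<Rightarrow> ('k, 'b) bialgebra
    \<Rightarrow> ('b \<Rightarrow> 'a \<Rightarrow> 'a) \<Rightarrow> ('b \<Rightarrow> 'a \<Rightarrow> 'b) \<Rightarrow> ('k, ('a \<times> 'b \<Rightarrow>\<^sub>0 int) set) bialgebra" where
  "double_cross_product K A B lact ract =
    (let T = tensor K A B
     in \<lparr>carrier = carrier T,
         monoid.mult = (\<lambda>s t. tensor_lift T s (\<lambda>a b. tensor_lift T t (\<lambda>c d.
            tensor_lift T (comult B b) (\<lambda>b\<^sub>1 b\<^sub>2. tensor_lift T (comult A c) (\<lambda>c\<^sub>1 c\<^sub>2.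
              pure_tensor K A B (a \<otimes>\<^bsub>A\<^esub> lact b\<^sub>1 c\<^sub>1) (ract b\<^sub>2 c\<^sub>2 \<otimes>\<^bsub>B\<^esub> d)))))),
         monoid.one = pure_tensor K A B \<one>\<^bsub>A\<^esub> \<one>\<^bsub>B\<^esub>,
         ring.zero = ring.zero T,
         ring.add = ring.add T,
         smult = smult T,
         comult = (\<lambda>t. tensor_lift (tensor K T T) t (\<lambda>a b.
            tensor_lift (tensor K T T) (comult A a) (\<lambda>a\<^sub>1 a\<^sub>2.
              tensor_lift (tensor K T T) (comult B b) (\<lambda>b\<^sub>1 b\<^sub>2.
                pure_tensor K T T (pure_tensor K A B a\<^sub>1 b\<^sub>1) (pure_tensor K A B a\<^sub>2 b\<^sub>2))))),
         counit = (\<lambda>t. tensor_lift K t (\<lambda>a b. counit A a \<otimes>\<^bsub>K\<^esub> counit B b))\<rparr>)"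

text \<open>The images of the embeddings \<open>a \<mapsto> a \<bowtie> 1\<close> and \<open>b \<mapsto> 1 \<bowtie> b\<close>.\<close>

definition left_factor ::
  "'k ring \<Rightarrow> ('k, 'a) bialgebra \<Rightarrow> ('k, 'b) bialgebra \<Rightarrow> ('a \<times> 'b \<Rightarrow>\<^sub>0 int) set set" where
  "left_factor K A B = (\<lambda>a. pure_tensor K A B a \<one>\<^bsub>B\<^esub>) ` carrier A"

definition right_factor ::
  "'k ring \<Rightarrow> ('k, 'a) bialgebra \<Rightarrow> ('k, 'b) bialgebra \<Rightarrow> ('a \<times> 'b \<Rightarrow>\<^sub>0 int) set set" where
  "right_factor K A B = (\<lambda>b. pure_tensor K A B \<one>\<^bsub>A\<^esub> b) ` carrier B"


section \<open>Bimodules and similarity\<close>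

text \<open>The scalars of the two sides are not part of the record: below, \<open>L\<close> and \<open>S\<close> are the
  carriers of the rings acting from the left and from the right, so that restriction of scalars
  to subrings leaves the record unchanged.\<close>

record ('l, 's, 'm) bimodule = "'m ring" +
  left_smult :: "'l \<Rightarrow> 'm \<Rightarrow> 'm"
  right_smult :: "'m \<Rightarrow> 's \<Rightarrow> 'm"

definition bimodule_iso ::
  "'l set \<Rightarrow> 's set \<Rightarrow> ('l, 's, 'm) bimodule \<Rightarrow> ('l, 's, 'n) bimodule \<Rightarrow> ('m \<Rightarrow> 'n) \<Rightarrow> bool" where
  "bimodule_iso L S M N h \<longleftrightarrow>
    bij_betw h (carrier M) (carrier N) \<and>
    (\<forall>x\<in>carrier M. \<forall>y\<in>carrier M. h (x \<oplus>\<^bsub>M\<^esub> y) = h x \<oplus>\<^bsub>N\<^esub> h y) \<and>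
    (\<forall>l\<in>L. \<forall>x\<in>carrier M. h (left_smult M l x) = left_smult N l (h x)) \<and>
    (\<forall>s\<in>S. \<forall>x\<in>carrier M. h (right_smult M x s) = right_smult N (h x) s)"

definition sub_bimodule :: "'l set \<Rightarrow> 's set \<Rightarrow> 'm set \<Rightarrow> ('l, 's, 'm) bimodule \<Rightarrow> bool" where
  "sub_bimodule L S U N \<longleftrightarrow>
    additive_subgroup U N \<and>
    (\<forall>l\<in>L. \<forall>x\<in>U. left_smult N l x \<in> U) \<and> (\<forall>s\<in>S. \<forall>x\<in>U. right_smult N x s \<in> U)"

definition direct_summand :: "'l set \<Rightarrow> 's set \<Rightarrow> 'm set \<Rightarrow> ('l, 's, 'm) bimodule \<Rightarrow> bool" where
  "direct_summand L S U N \<longleftrightarrow>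
    sub_bimodule L S U N \<and>
    (\<exists>V. sub_bimodule L S V N \<and> U <+>\<^bsub>N\<^esub> V = carrier N \<and> U \<inter> V = {\<zero>\<^bsub>N\<^esub>})"

definition bimodule_power :: "('l, 's, 'm) bimodule \<Rightarrow> nat \<Rightarrow> ('l, 's, nat \<Rightarrow> 'm) bimodule" where
  "bimodule_power N p =
    \<lparr>carrier = {..<p} \<rightarrow>\<^sub>E carrier N, monoid.mult = undefined, monoid.one = undefined,
     ring.zero = (\<lambda>i\<in>{..<p}. \<zero>\<^bsub>N\<^esub>),
     ring.add = (\<lambda>f g. \<lambda>i\<in>{..<p}. f i \<oplus>\<^bsub>N\<^esub> g i),
     left_smult = (\<lambda>l f. \<lambda>i\<in>{..<p}. left_smult N l (f i)),
     right_smult = (\<lambda>f s. \<lambda>i\<in>{..<p}. right_smult N (f i) s)\<rparr>"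

definition iso_to_direct_summand ::
  "'l set \<Rightarrow> 's set \<Rightarrow> ('l, 's, 'm) bimodule \<Rightarrow> ('l, 's, 'n) bimodule \<Rightarrow> bool" where
  "iso_to_direct_summand L S M N \<longleftrightarrow>
    (\<exists>U h. direct_summand L S U N \<and> bimodule_iso L S M (N\<lparr>carrier := U\<rparr>) h)"

definition bimodule_similar ::
  "'l set \<Rightarrow> 's set \<Rightarrow> ('l, 's, 'm) bimodule \<Rightarrow> ('l, 's, 'n) bimodule \<Rightarrow> bool" where
  "bimodule_similar L S M N \<longleftrightarrow>
    (\<exists>p>0. iso_to_direct_summand L S M (bimodule_power N p)) \<and>
    (\<exists>q>0. iso_to_direct_summand L S N (bimodule_power M q))"


section \<open>Depth of a ring extension\<close>

text \<open>For \<open>n \<ge> 1\<close>, the \<open>n\<close>-fold tensor product of \<open>H\<close> over the subring with carrier \<open>R\<close>,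
  as an \<open>H\<close>-\<open>H\<close>-bimodule. A list of length \<open>n\<close> stands for a simple tensor.\<close>

definition tensor_power_words :: "('h, 'm) ring_scheme \<Rightarrow> nat \<Rightarrow> 'h list set" where
  "tensor_power_words H n = {xs. length xs = n \<and> set xs \<subseteq> carrier H}"

definition tensor_power_rels ::
  "'h set \<Rightarrow> ('h, 'm) ring_scheme \<Rightarrow> nat \<Rightarrow> ('h list \<Rightarrow>\<^sub>0 int) set" where
  "tensor_power_rels R H n =
    {frag_of (xs @ (x \<oplus>\<^bsub>H\<^esub> y) # ys) - frag_of (xs @ x # ys) - frag_of (xs @ y # ys) | xs x y ys.
       set xs \<union> set ys \<union> {x, y} \<subseteq> carrier H \<and> length xs + length ys + 1 = n} \<union>
    {frag_of (xs @ (x \<otimes>\<^bsub>H\<^esub> r) # y # ys) - frag_of (xs @ x # (r \<otimes>\<^bsub>H\<^esub> y) # ys) | xs x r y ys.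
       set xs \<union> set ys \<union> {x, y} \<subseteq> carrier H \<and> r \<in> R \<and> length xs + length ys + 2 = n}"

definition tensor_power ::
  "'h set \<Rightarrow> ('h, 'm) ring_scheme \<Rightarrow> nat \<Rightarrow> ('h, 'h, ('h list \<Rightarrow>\<^sub>0 int) set) bimodule" where
  "tensor_power R H n =
    (let gens = tensor_power_words H n; Rel = tensor_power_rels R H n; T = presented_group gens Rel
     in \<lparr>carrier = carrier T, monoid.mult = monoid.mult T, monoid.one = monoid.one T,
         ring.zero = ring.zero T, ring.add = ring.add T,
         left_smult = (\<lambda>h t. presented_lift T t
           (\<lambda>xs. presented_class gens Rel ((h \<otimes>\<^bsub>H\<^esub> hd xs) # tl xs))),
         right_smult = (\<lambda>t h. presented_lift T t
           (\<lambda>xs. presented_class gens Rel (butlast xs @ [last xs \<otimes>\<^bsub>H\<^esub> h])))\<rparr>)"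

text \<open>The zeroth tensor power: \<open>R\<close> as an \<open>R\<close>-\<open>R\<close>-bimodule.\<close>

definition base_bimodule :: "'h set \<Rightarrow> ('h, 'm) ring_scheme \<Rightarrow> ('h, 'h, 'h) bimodule" where
  "base_bimodule R H =
    \<lparr>carrier = R, monoid.mult = monoid.mult H, monoid.one = monoid.one H,
     ring.zero = ring.zero H, ring.add = ring.add H,
     left_smult = monoid.mult H, right_smult = monoid.mult H\<rparr>"

text \<open>Depth 1 is listed separately because the zeroth tensor power lives on another type.\<close>

definition has_depth :: "'h set \<Rightarrow> ('h, 'm) ring_scheme \<Rightarrow> nat \<Rightarrow> bool" where
  "has_depth R H m \<longleftrightarrow>
    (m = 1 \<and> bimodule_similar R R (tensor_power R H 1) (base_bimodule R H)) \<or>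
    (\<exists>n\<ge>1. m = 2 * n + 1 \<and>
       bimodule_similar R R (tensor_power R H (n + 1)) (tensor_power R H n)) \<or>
    (\<exists>n\<ge>1. m = 2 * n \<and>
       (bimodule_similar R (carrier H) (tensor_power R H (n + 1)) (tensor_power R H n) \<or>
        bimodule_similar (carrier H) R (tensor_power R H (n + 1)) (tensor_power R H n)))"

definition min_depth :: "'h set \<Rightarrow> ('h, 'm) ring_scheme \<Rightarrow> enat" where
  "min_depth R H = Inf {enat m | m. m > 0 \<and> has_depth R H m}"

end

theory Submission
  imports Defs
begin

text \<open>Let \<open>p : H \<rightarrow> B\<close> be the projection \<open>a \<bowtie> b \<mapsto> \<epsilon>(a) b\<close>, a homomorphism of left \<open>A\<close>-modules for
  the trivial action of \<open>A\<close> on \<open>B\<close>. If \<open>H \<otimes>\<^sub>A H\<close> is an \<open>H\<close>-\<open>A\<close>-direct summand of a power of \<open>H\<close>, then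
  \<open>x \<otimes> y \<mapsto> \<epsilon>(x) p(y)\<close> is defined on a bimodule spanned by images of \<open>H\<close>, on which trivial left action
  forces trivial right action; hence \<open>p(x a) = \<epsilon>(a) p(x)\<close>, and \<open>x = b\<close> gives \<open>b \<lhd> a = \<epsilon>(a) b\<close>.
  Depth one is treated in the same way. For \<open>A\<close>-\<open>H\<close>-bimodules the argument is applied to \<open>p\<close>
  composed with the antipode of \<open>H\<close>, which yields \<open>S(b \<lhd> a) = \<epsilon>(a) S(b)\<close>; the antipode \<open>S\<close> of \<open>B\<close>
  is then cancelled by convolution, so that its bijectivity is not required.

  Conversely, if \<open>\<lhd>\<close> is trivial, let \<open>b\<^sub>k\<close> be a basis of \<open>B\<close> with dual basis \<open>f\<^sub>k\<close>. The elements
  \<open>u\<^sub>k = \<Sum> S(b\<^sub>k\<^sub>1) \<otimes> b\<^sub>k\<^sub>2\<close> commute with \<open>A\<close>, the maps \<open>\<gamma>\<^sub>k(a \<bowtie> b) = \<Sum> f\<^sub>k(b\<^sub>2) a \<bowtie> b\<^sub>1\<close> are \<open>A\<close>-\<open>A\<close>-linear,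
  and \<open>\<Sum> \<gamma>\<^sub>k(y) u\<^sub>k = 1 \<otimes> y\<close>, so they form a depth two quasi-basis. The second part is the mirror image.\<close>

section \<open>Groups given by generators and relations\<close>

text \<open>Bimodules are given by an addition and two actions alone, so maps extracted from a
  direct summand are only additive. The necessary direction therefore uses additive maps throughout;
  in the converse the field acts on the tensor square by scalar multiples of one, which lie in the
  subring. Only one half of similarity carries information: multiplication always splits H off its
  tensor square. Why trivial left action forces trivial right action: an H-linear g satisfies g(y) =
  y g(1), so a map on which H acts through \<epsilon> takes at g(y) the value \<epsilon>(y) times a
  constant, and \<epsilon>(y r) = \<epsilon>(r) \<epsilon>(y) as the field is commutative. The
  quasi-basis comes from Galois theory: for trivial \<open>\<lhd>\<^sub>r\<close> the algebra H is a
  smash product, and \<Sum> S(b_1) \<otimes> b_2 is the preimage of 1 \<otimes> b under the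
  canonical map x \<otimes> y \<mapsto> \<Sum> x y_0 \<otimes> y_1 into H \<otimes> B. Counit and
  antipode of H are rebuilt from the factors. That the antipode reverses b a as well as a b is where
  the compatibility condition enters.\<close>

definition add_hom :: "('a, 'm) ring_scheme \<Rightarrow> ('b, 'n) ring_scheme \<Rightarrow> ('a \<Rightarrow> 'b) set" where
  "add_hom M N = {f \<in> carrier M \<rightarrow> carrier N.
    \<forall>x\<in>carrier M. \<forall>y\<in>carrier M. f (x \<oplus>\<^bsub>M\<^esub> y) = f x \<oplus>\<^bsub>N\<^esub> f y}"

lemma add_homI:
  assumes "\<And>x. x \<in> carrier M \<Longrightarrow> f x \<in> carrier N"
    and "\<And>x y. x \<in> carrier M \<Longrightarrow> y \<in> carrier M \<Longrightarrow> f (x \<oplus>\<^bsub>M\<^esub> y) = f x \<oplus>\<^bsub>N\<^esub> f y"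
  shows "f \<in> add_hom M N"
  using assms by (auto simp: add_hom_def)

lemma add_hom_closed: "f \<in> add_hom M N \<Longrightarrow> x \<in> carrier M \<Longrightarrow> f x \<in> carrier N"
  by (auto simp: add_hom_def)

lemma add_hom_add:
  "f \<in> add_hom M N \<Longrightarrow> x \<in> carrier M \<Longrightarrow> y \<in> carrier M \<Longrightarrow> f (x \<oplus>\<^bsub>M\<^esub> y) = f x \<oplus>\<^bsub>N\<^esub> f y"
  by (auto simp: add_hom_def)

lemma add_hom_group_hom:
  assumes "abelian_group M" "abelian_group N" "f \<in> add_hom M N"
  shows "abelian_group_hom M N f"
  using assms
  by (intro abelian_group_homI group_hom.intro group_hom_axioms.intro)
    (auto simp: add_hom_def hom_def abelian_group.a_group)

lemma add_hom_zero:
  assumes "abelian_group M" "abelian_group N" "f \<in> add_hom M N"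
  shows "f \<zero>\<^bsub>M\<^esub> = \<zero>\<^bsub>N\<^esub>"
  using abelian_group_hom.hom_zero[OF add_hom_group_hom[OF assms]] .

lemma add_hom_a_inv:
  assumes "abelian_group M" "abelian_group N" "f \<in> add_hom M N" "x \<in> carrier M"
  shows "f (\<ominus>\<^bsub>M\<^esub> x) = \<ominus>\<^bsub>N\<^esub> f x"
  using abelian_group_hom.hom_a_inv[OF add_hom_group_hom[OF assms(1-3)] assms(4)] .

lemma add_hom_finsum:
  assumes M: "abelian_group M" and N: "abelian_group N" and f: "f \<in> add_hom M N"
    and g: "\<And>i. i \<in> I \<Longrightarrow> g i \<in> carrier M"
  shows "f (\<Oplus>\<^bsub>M\<^esub>i\<in>I. g i) = (\<Oplus>\<^bsub>N\<^esub>i\<in>I. f (g i))"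
proof -
  interpret M: abelian_group M by fact
  interpret N: abelian_group N by fact
  show ?thesis using g
  proof (induction I rule: infinite_finite_induct)
    case (insert i I)
    then show ?case
      by (simp add: Pi_def add_hom_add[OF f] add_hom_closed[OF f])
  qed (simp_all add: add_hom_zero[OF M N f])
qed

lemma add_hom_compose:
  "f \<in> add_hom M N \<Longrightarrow> g \<in> add_hom N P \<Longrightarrow> (\<lambda>x. g (f x)) \<in> add_hom M P"
  by (auto simp: add_hom_def Pi_iff)

lemma module_hom_add_hom: "f \<in> module_hom K M N \<Longrightarrow> f \<in> add_hom M N"
  by (auto simp: add_hom_def module_hom_def)

text \<open>The homomorphism extending \<open>f\<close> to the free abelian group, i.e.
  \<open>presented_lift\<close> without the choice of a representative. Its additivity can be proved
  first and independence of the choice deduced from it.\<close>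

definition frag_sum :: "('p, 'm) ring_scheme \<Rightarrow> ('x \<Rightarrow> 'p) \<Rightarrow> ('x \<Rightarrow>\<^sub>0 int) \<Rightarrow> 'p" where
  "frag_sum P f g = (\<Oplus>\<^bsub>P\<^esub>x \<in> Poly_Mapping.keys g. [Poly_Mapping.lookup g x] \<cdot>\<^bsub>P\<^esub> f x)"

context abelian_group begin

lemma add_pow_diff_int:
  fixes m n :: int
  assumes x: "x \<in> carrier G"
  shows "[(m - n)] \<cdot>\<^bsub>G\<^esub> x = [m] \<cdot>\<^bsub>G\<^esub> x \<ominus> [n] \<cdot>\<^bsub>G\<^esub> x"
  using add.int_pow_diff[OF x, of m n] by (simp add: a_minus_def)

text \<open>Generators outside the support have coefficient zero, so elements with different
  supports can be compared on the union of both.\<close>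

lemma frag_sum_superset:
  assumes f: "f \<in> S \<rightarrow> carrier G" and U: "Poly_Mapping.keys g \<subseteq> U" "U \<subseteq> S" "finite U"
  shows "frag_sum G f g = (\<Oplus>x \<in> U. [Poly_Mapping.lookup g x] \<cdot>\<^bsub>G\<^esub> f x)"
  unfolding frag_sum_def
proof (rule add.finprod_mono_neutral_cong_left[OF U(3,1)])
  show "[Poly_Mapping.lookup g i] \<cdot>\<^bsub>G\<^esub> f i = \<zero>" if "i \<in> U - Poly_Mapping.keys g" for i
    using that f U by (simp add: in_keys_iff add_pow_int_ge)
  show "(\<lambda>x. [Poly_Mapping.lookup g x] \<cdot>\<^bsub>G\<^esub> f x) \<in> U \<rightarrow> carrier G"
    using f U by auto
qed simp

lemma frag_sum_closed:
  assumes "f \<in> S \<rightarrow> carrier G" "Poly_Mapping.keys g \<subseteq> S"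
  shows "frag_sum G f g \<in> carrier G"
  unfolding frag_sum_def using assms by (auto intro!: finsum_closed)

text \<open>Differences come before sums because the defining relations are differences;
  \<open>g + h\<close> is later read as \<open>g - (- h)\<close>.\<close>

lemma frag_sum_diff:
  assumes f: "f \<in> S \<rightarrow> carrier G" and g: "Poly_Mapping.keys g \<subseteq> S" and h: "Poly_Mapping.keys h \<subseteq> S"
  shows "frag_sum G f (g - h) = frag_sum G f g \<ominus> frag_sum G f h"
proof -
  let ?U = "Poly_Mapping.keys g \<union> Poly_Mapping.keys h"
  have U: "?U \<subseteq> S" "finite ?U" using g h by auto
  have fU: "f x \<in> carrier G" if "x \<in> ?U" for x using that U f by auto
  have *: "frag_sum G f k = (\<Oplus>x \<in> ?U. [Poly_Mapping.lookup k x] \<cdot>\<^bsub>G\<^esub> f x)"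
    if "Poly_Mapping.keys k \<subseteq> ?U" for k
    using frag_sum_superset[OF f that U] .
  have inv: "\<ominus> (\<Oplus>x \<in> ?U. [Poly_Mapping.lookup h x] \<cdot>\<^bsub>G\<^esub> f x) =
      (\<Oplus>x \<in> ?U. \<ominus> ([Poly_Mapping.lookup h x] \<cdot>\<^bsub>G\<^esub> f x))"
    by (rule add_hom_finsum[OF abelian_group_axioms abelian_group_axioms])
      (use fU in \<open>auto intro!: add_homI simp: minus_add\<close>)
  have "frag_sum G f (g - h) =
      (\<Oplus>x \<in> ?U. [Poly_Mapping.lookup g x] \<cdot>\<^bsub>G\<^esub> f x \<oplus> \<ominus> ([Poly_Mapping.lookup h x] \<cdot>\<^bsub>G\<^esub> f x))"
    unfolding *[OF keys_diff]
    by (rule add.finprod_cong')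
      (use fU in \<open>auto simp: lookup_minus add_pow_diff_int a_minus_def\<close>)
  also have "\<dots> = frag_sum G f g \<ominus> frag_sum G f h"
    using fU by (simp add: * a_minus_def inv finsum_addf Pi_def)
  finally show ?thesis .
qed

lemma frag_sum_zero [simp]: "frag_sum G f 0 = \<zero>"
  by (simp add: frag_sum_def)

lemma frag_sum_of: "f x \<in> carrier G \<Longrightarrow> frag_sum G f (frag_of x) = f x"
  by (simp add: frag_sum_def)

lemma frag_sum_uminus:
  assumes "f \<in> S \<rightarrow> carrier G" "Poly_Mapping.keys g \<subseteq> S"
  shows "frag_sum G f (- g) = \<ominus> frag_sum G f g"
  using frag_sum_diff[OF assms(1) _ assms(2), of 0] frag_sum_closed[OF assms]
  by (simp add: a_minus_def)

lemma frag_sum_add: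
  assumes f: "f \<in> S \<rightarrow> carrier G" and g: "Poly_Mapping.keys g \<subseteq> S" and h: "Poly_Mapping.keys h \<subseteq> S"
  shows "frag_sum G f (g + h) = frag_sum G f g \<oplus> frag_sum G f h"
  using frag_sum_diff[OF f g, of "- h"] frag_sum_uminus[OF f h] frag_sum_closed[OF f g]
    frag_sum_closed[OF f h] h
  by (simp add: a_minus_def)

text \<open>A homomorphism that kills the generators of a subgroup kills the subgroup. The support
  condition has to be part of the induction, since \<open>frag_sum\<close> is additive only on
  elements supported in \<open>S\<close>.\<close>

lemma frag_sum_generate:
  assumes f: "f \<in> S \<rightarrow> carrier G" and Rel: "\<And>\<rho>. \<rho> \<in> Rel \<Longrightarrow> Poly_Mapping.keys \<rho> \<subseteq> S"
    and kill: "\<And>\<rho>. \<rho> \<in> Rel \<Longrightarrow> frag_sum G f \<rho> = \<zero>"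
    and n: "n \<in> generate (free_Abelian_group S) Rel"
  shows "Poly_Mapping.keys n \<subseteq> S \<and> frag_sum G f n = \<zero>"
  using n
proof (induction rule: generate.induct)
  case (inv h)
  then show ?case using Rel kill frag_sum_uminus[OF f] by (simp add: Rel)
next
  case (eng h1 h2)
  then show ?case using frag_sum_add[OF f, of h1 h2] by (auto dest: subsetD[OF keys_add])
qed (use Rel kill in auto)

end

section \<open>Groups given by a presentation and their universal property\<close>

locale presentation =
  fixes gens :: "'x set" and Rel :: "('x \<Rightarrow>\<^sub>0 int) set"
  assumes rels_closed: "\<And>\<rho>. \<rho> \<in> Rel \<Longrightarrow> Poly_Mapping.keys \<rho> \<subseteq> gens"
begin

abbreviation "F \<equiv> free_Abelian_group gens"
abbreviation "N \<equiv> generate F Rel"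
abbreviation "Q \<equiv> presented_group gens Rel"
abbreviation "cls \<equiv> presented_class gens Rel"

sublocale F: comm_group F by (rule abelian_free_Abelian_group)

lemma subgroup_N: "subgroup N F"
  by (rule F.generate_is_subgroup) (use rels_closed in auto)

lemma normal_N: "N \<lhd> F"
  by (rule F.subgroup_imp_normal[OF subgroup_N])

lemma comm_group_quotient: "comm_group (F Mod N)"
  by (rule F.abelian_FactGroup[OF subgroup_N])

lemma presented_group_simps:
  "carrier Q = carrier (F Mod N)" "x \<oplus>\<^bsub>Q\<^esub> y = x \<otimes>\<^bsub>F Mod N\<^esub> y" "\<zero>\<^bsub>Q\<^esub> = \<one>\<^bsub>F Mod N\<^esub>"
  by (simp_all add: presented_group_def Let_def)

lemma add_monoid_presented_group: "add_monoid Q = F Mod N"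
  by (rule monoid.equality) (simp_all add: presented_group_def Let_def)

lemma abelian_group_presented_group: "abelian_group Q"
proof -
  interpret Q: comm_group "add_monoid Q"
    unfolding add_monoid_presented_group by (rule comm_group_quotient)
  show ?thesis
    by (intro abelian_group.intro abelian_monoid.intro abelian_group_axioms.intro
      Q.comm_monoid_axioms Q.comm_group_axioms)
qed

definition coset :: "('x \<Rightarrow>\<^sub>0 int) \<Rightarrow> ('x \<Rightarrow>\<^sub>0 int) set" where
  "coset g = N #>\<^bsub>F\<^esub> g"

lemma cls_eq: "cls x = coset (frag_of x)"
  by (simp add: presented_class_def coset_def)

lemma carrier_presented_group: "carrier Q = coset ` {g. Poly_Mapping.keys g \<subseteq> gens}"
  by (simp add: presented_group_simps carrier_FactGroup coset_def image_def Bex_def)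

lemma coset_closed: "Poly_Mapping.keys g \<subseteq> gens \<Longrightarrow> coset g \<in> carrier Q"
  by (auto simp: carrier_presented_group)

lemma coset_add:
  "Poly_Mapping.keys g \<subseteq> gens \<Longrightarrow> Poly_Mapping.keys h \<subseteq> gens \<Longrightarrow>
    coset (g + h) = coset g \<oplus>\<^bsub>Q\<^esub> coset h"
  using normal.rcos_sum[OF normal_N, of g h] by (simp add: presented_group_simps coset_def)

lemma coset_zero_iff:
  assumes "Poly_Mapping.keys g \<subseteq> gens"
  shows "coset g = \<zero>\<^bsub>Q\<^esub> \<longleftrightarrow> g \<in> N"
  unfolding coset_def presented_group_simps one_FactGroup
  using F.coset_join1[OF _ _ subgroup_N, of g] F.coset_join2[OF _ subgroup_N, of g] assms
    subgroup.subset[OF subgroup_N] by auto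

lemma coset_diff:
  assumes g: "Poly_Mapping.keys g \<subseteq> gens" and h: "Poly_Mapping.keys h \<subseteq> gens"
  shows "coset (g - h) = coset g \<ominus>\<^bsub>Q\<^esub> coset h"
proof -
  interpret Q: abelian_group Q by (rule abelian_group_presented_group)
  have "coset ((g - h) + h) = coset (g - h) \<oplus>\<^bsub>Q\<^esub> coset h"
    by (rule coset_add) (use g h in \<open>auto dest: subsetD[OF keys_diff]\<close>)
  moreover have "coset (g - h) \<in> carrier Q"
    using g h by (intro coset_closed) (auto dest: subsetD[OF keys_diff])
  ultimately show ?thesis
    using coset_closed[OF g] coset_closed[OF h] by (simp add: a_minus_def Q.a_assoc Q.r_neg)
qed

lemma coset_rel: "\<rho> \<in> Rel \<Longrightarrow> coset \<rho> = \<zero>\<^bsub>Q\<^esub>"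
  using coset_zero_iff rels_closed generate.incl by metis

lemma cls_closed: "x \<in> gens \<Longrightarrow> cls x \<in> carrier Q"
  unfolding cls_eq by (rule coset_closed) simp

lemma presented_group_induct [consumes 1, case_names zero diff cls]:
  assumes t: "t \<in> carrier Q" and zero: "P \<zero>\<^bsub>Q\<^esub>"
    and diff: "\<And>x y. x \<in> carrier Q \<Longrightarrow> y \<in> carrier Q \<Longrightarrow> P x \<Longrightarrow> P y \<Longrightarrow> P (x \<ominus>\<^bsub>Q\<^esub> y)"
    and cls: "\<And>x. x \<in> gens \<Longrightarrow> P (cls x)"
  shows "P t"
proof -
  obtain g where g: "Poly_Mapping.keys g \<subseteq> gens" "t = coset g"
    using t by (auto simp: carrier_presented_group)
  have "P (coset g)" using g(1)
  proof (rule free_Abelian_group_induct[where P = "\<lambda>g. P (coset g)"])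
    show "P (coset 0)" using zero coset_zero_iff[of 0] generate.one[of F Rel] by simp
    show "P (coset (x - y))"
      if "Poly_Mapping.keys x \<subseteq> gens" "Poly_Mapping.keys y \<subseteq> gens" "P (coset x)" "P (coset y)" for x y
      using that coset_diff diff coset_closed by simp
    show "P (coset (frag_of a))" if "a \<in> gens" for a using cls[OF that] by (simp add: cls_eq)
  qed
  then show ?thesis using g by simp
qed

context
  fixes P :: "('p, 'm) ring_scheme" and f :: "'x \<Rightarrow> 'p"
  assumes P: "abelian_group P" and f: "f \<in> gens \<rightarrow> carrier P"
    and kill: "\<And>\<rho>. \<rho> \<in> Rel \<Longrightarrow> frag_sum P f \<rho> = \<zero>\<^bsub>P\<^esub>"
begin

interpretation P: abelian_group P by (rule P)

text \<open>The representative picked by choice differs from \<open>g\<close> by an element of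
  \<open>N\<close>, and \<open>frag_sum\<close> vanishes there.\<close>

lemma presented_lift_coset:
  assumes g: "Poly_Mapping.keys g \<subseteq> gens"
  shows "presented_lift P (coset g) f = frag_sum P f g"
proof -
  define g' where "g' = (SOME g'. g' \<in> coset g)"
  have "0 + g \<in> coset g"
    unfolding coset_def r_coset_def using generate.one[of F Rel] by force
  then have "g' \<in> coset g" unfolding g'_def by (rule someI)
  then obtain n where n: "n \<in> N" "g' = n + g" by (auto simp: coset_def r_coset_def)
  have "frag_sum P f g' = frag_sum P f g"
    using P.frag_sum_generate[OF f rels_closed kill n(1)] P.frag_sum_add[OF f _ g, of n]
      P.frag_sum_closed[OF f g] n(2) by simp
  then show ?thesis
    unfolding presented_lift_def Let_def g'_def[symmetric] frag_sum_def .
qed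

lemma presented_lift_add_hom: "(\<lambda>t. presented_lift P t f) \<in> add_hom Q P"
proof (rule add_homI)
  fix s t assume "s \<in> carrier Q" "t \<in> carrier Q"
  then obtain g h where gh: "Poly_Mapping.keys g \<subseteq> gens" "Poly_Mapping.keys h \<subseteq> gens"
    "s = coset g" "t = coset h" by (auto simp: carrier_presented_group)
  moreover have "Poly_Mapping.keys (g + h) \<subseteq> gens" using keys_add[of g h] gh by auto
  ultimately show "presented_lift P (s \<oplus>\<^bsub>Q\<^esub> t) f = presented_lift P s f \<oplus>\<^bsub>P\<^esub> presented_lift P t f"
    by (simp add: coset_add[symmetric] presented_lift_coset P.frag_sum_add[OF f])
qed (auto simp: carrier_presented_group presented_lift_coset P.frag_sum_closed[OF f])

lemma presented_lift_cls: "x \<in> gens \<Longrightarrow> presented_lift P (cls x) f = f x"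
  unfolding cls_eq using f by (subst presented_lift_coset) (auto simp: Pi_iff P.frag_sum_of)

end

lemma add_hom_eqI:
  assumes "abelian_group P" "f \<in> add_hom Q P" "g \<in> add_hom Q P"
    and "\<And>x. x \<in> gens \<Longrightarrow> f (cls x) = g (cls x)" and "t \<in> carrier Q"
  shows "f t = g t"
proof -
  interpret Q: abelian_group Q by (rule abelian_group_presented_group)
  show ?thesis
    using assms(5)
    by (induction rule: presented_group_induct)
      (use assms in \<open>simp_all add: a_minus_def add_hom_zero[OF Q.abelian_group_axioms]
        add_hom_add add_hom_a_inv[OF Q.abelian_group_axioms]\<close>)
qed

text \<open>The chosen representative is supported in \<open>gens\<close>, so only values on
  generators are ever read. No compatibility with the relations is assumed; hence the formulas in
  the definitions can be replaced by manageable ones before any lifting property is known.\<close>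

lemma presented_lift_cong:
  assumes P: "abelian_group P" and f: "f \<in> gens \<rightarrow> carrier P"
    and t: "t \<in> carrier Q" and fg: "\<And>x. x \<in> gens \<Longrightarrow> f x = g x"
  shows "presented_lift P t f = presented_lift P t g"
proof -
  interpret P: abelian_group P by fact
  obtain h where h: "Poly_Mapping.keys h \<subseteq> gens" "t = coset h"
    using t by (auto simp: carrier_presented_group)
  have "t \<noteq> {}" using h generate.one[of F Rel] by (auto simp: coset_def r_coset_def)
  then have "(SOME g. g \<in> t) \<in> t" by (simp add: some_in_eq)
  moreover have "t \<subseteq> carrier F"
    using F.r_coset_subset_G[of N h] h subgroup.subset[OF subgroup_N] by (simp add: coset_def)
  ultimately have *: "Poly_Mapping.keys (SOME g. g \<in> t) \<subseteq> gens"
    by (metis carrier_free_Abelian_group_iff subsetD)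
  show ?thesis unfolding presented_lift_def Let_def
    by (rule P.add.finprod_cong') (use f fg * in \<open>auto simp: Pi_iff subset_iff\<close>)
qed

end

section \<open>Tensor products\<close>

text \<open>Precisely what kills the three families of \<open>tensor_rels\<close>. The target needs
  only an addition, so the notion is available before the tensor product has its scalars, whose
  action is itself such a lift.\<close>

definition balanced_map ::
  "('k, 'm) ring_scheme \<Rightarrow> ('k, 'a, 'n) module_scheme \<Rightarrow> ('k, 'b, 'o) module_scheme
    \<Rightarrow> ('p, 'q) ring_scheme \<Rightarrow> ('a \<Rightarrow> 'b \<Rightarrow> 'p) \<Rightarrow> bool" where
  "balanced_map K U V P f \<longleftrightarrow>
    (\<forall>u\<in>carrier U. f u \<in> add_hom V P) \<and> (\<forall>v\<in>carrier V. (\<lambda>u. f u v) \<in> add_hom U P) \<and>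
    (\<forall>r\<in>carrier K. \<forall>u\<in>carrier U. \<forall>v\<in>carrier V. f (r \<odot>\<^bsub>U\<^esub> u) v = f u (r \<odot>\<^bsub>V\<^esub> v))"

lemma bilinear_mapD:
  assumes "bilinear_map K U V W f" "u \<in> carrier U" "v \<in> carrier V"
  shows "f u v \<in> carrier W"
    and "u' \<in> carrier U \<Longrightarrow> f (u \<oplus>\<^bsub>U\<^esub> u') v = f u v \<oplus>\<^bsub>W\<^esub> f u' v"
    and "v' \<in> carrier V \<Longrightarrow> f u (v \<oplus>\<^bsub>V\<^esub> v') = f u v \<oplus>\<^bsub>W\<^esub> f u v'"
    and "r \<in> carrier K \<Longrightarrow> f (r \<odot>\<^bsub>U\<^esub> u) v = r \<odot>\<^bsub>W\<^esub> f u v"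
    and "r \<in> carrier K \<Longrightarrow> f u (r \<odot>\<^bsub>V\<^esub> v) = r \<odot>\<^bsub>W\<^esub> f u v"
  using assms by (auto simp: bilinear_map_def module_hom_def Pi_iff)

lemma bilinear_map_balanced: "bilinear_map K U V P f \<Longrightarrow> balanced_map K U V P f"
  by (auto simp: balanced_map_def bilinear_map_def module_hom_def add_hom_def Pi_iff)

lemma bilinear_mapI:
  assumes "\<And>u. u \<in> carrier U \<Longrightarrow> (\<lambda>v. f u v) \<in> module_hom K V W"
    and "\<And>v. v \<in> carrier V \<Longrightarrow> (\<lambda>u. f u v) \<in> module_hom K U W"
  shows "bilinear_map K U V W f"
  using assms by (simp add: bilinear_map_def)

lemma bilinear_map_cong:
  assumes "module K U" "module K V" "\<And>u v. u \<in> carrier U \<Longrightarrow> v \<in> carrier V \<Longrightarrow> f u v = g u v"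
    and "bilinear_map K U V W f"
  shows "bilinear_map K U V W g"
proof -
  interpret U: module K U by fact
  interpret V: module K V by fact
  show ?thesis using assms(3,4) by (simp add: bilinear_map_def module_hom_def Pi_iff)
qed

lemma module_homI:
  assumes "\<And>x. x \<in> carrier M \<Longrightarrow> f x \<in> carrier N"
    and "\<And>x y. x \<in> carrier M \<Longrightarrow> y \<in> carrier M \<Longrightarrow> f (x \<oplus>\<^bsub>M\<^esub> y) = f x \<oplus>\<^bsub>N\<^esub> f y"
    and "\<And>r x. r \<in> carrier K \<Longrightarrow> x \<in> carrier M \<Longrightarrow> f (r \<odot>\<^bsub>M\<^esub> x) = r \<odot>\<^bsub>N\<^esub> f x"
  shows "f \<in> module_hom K M N"
  using assms by (auto simp: module_hom_def)

lemma module_hom_in: "f \<in> module_hom K M N \<Longrightarrow> x \<in> carrier M \<Longrightarrow> f x \<in> carrier N"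
  by (auto simp: module_hom_def)

lemma module_hom_compose:
  "f \<in> module_hom K M N \<Longrightarrow> g \<in> module_hom K N P \<Longrightarrow> (\<lambda>x. g (f x)) \<in> module_hom K M P"
  by (auto simp: module_hom_def Pi_iff)

lemma bilinear_map_left:
  "bilinear_map K U V W f \<Longrightarrow> F \<in> module_hom K M U \<Longrightarrow> v \<in> carrier V \<Longrightarrow>
    (\<lambda>x. f (F x) v) \<in> module_hom K M W"
  by (rule module_hom_compose[of F K M U]) (auto simp: bilinear_map_def)

lemma bilinear_map_right:
  "bilinear_map K U V W f \<Longrightarrow> u \<in> carrier U \<Longrightarrow> F \<in> module_hom K M V \<Longrightarrow>
    (\<lambda>x. f u (F x)) \<in> module_hom K M W"
  by (rule module_hom_compose[of F K M V]) (auto simp: bilinear_map_def)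

text \<open>The sum of \<open>f u v\<close> over a list of pairs. Closure properties of such a sum need no linearity
  of \<open>f\<close>, in contrast to the choice-free constant \<open>tensor_lift\<close>.\<close>

definition tsum :: "('p, 'm) ring_scheme \<Rightarrow> ('a \<times> 'b) list \<Rightarrow> ('a \<Rightarrow> 'b \<Rightarrow> 'p) \<Rightarrow> 'p" where
  "tsum P l f = foldr (\<lambda>(u, v) s. f u v \<oplus>\<^bsub>P\<^esub> s) l \<zero>\<^bsub>P\<^esub>"

lemma tsum_Nil [simp]: "tsum P [] f = \<zero>\<^bsub>P\<^esub>"
  and tsum_Cons [simp]: "tsum P ((u, v) # l) f = f u v \<oplus>\<^bsub>P\<^esub> tsum P l f"
  by (simp_all add: tsum_def)

lemma tsum_cong:
  assumes "set l \<subseteq> U \<times> V" "\<And>u v. u \<in> U \<Longrightarrow> v \<in> V \<Longrightarrow> f u v = g u v"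
  shows "tsum P l f = tsum P l g"
  using assms by (induction l) auto

lemma tsum_closed:
  assumes "abelian_group P" "set l \<subseteq> U \<times> V" "\<And>u v. u \<in> U \<Longrightarrow> v \<in> V \<Longrightarrow> f u v \<in> carrier P"
  shows "tsum P l f \<in> carrier P"
proof -
  interpret abelian_group P by fact
  show ?thesis using assms(2,3) by (induction l) auto
qed

lemma tsum_append:
  assumes "abelian_group P" "set l \<subseteq> U \<times> V" "set m \<subseteq> U \<times> V"
    "\<And>u v. u \<in> U \<Longrightarrow> v \<in> V \<Longrightarrow> f u v \<in> carrier P"
  shows "tsum P (l @ m) f = tsum P l f \<oplus>\<^bsub>P\<^esub> tsum P m f"
proof -
  interpret abelian_group P by fact
  show ?thesis using assms(2,3,4)
    by (induction l) (auto simp: a_assoc tsum_closed[OF assms(1)])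
qed

lemma tsum_hom:
  assumes P: "abelian_group P" and Q: "abelian_group Q" and h: "h \<in> add_hom P Q"
    and l: "set l \<subseteq> U \<times> V" and f: "\<And>u v. u \<in> U \<Longrightarrow> v \<in> V \<Longrightarrow> f u v \<in> carrier P"
  shows "h (tsum P l f) = tsum Q l (\<lambda>u v. h (f u v))"
  using l
proof (induction l)
  case (Cons p l)
  then show ?case using f tsum_closed[OF P, of l U V f]
    by (cases p) (auto simp: add_hom_add[OF h])
qed (simp add: add_hom_zero[OF P Q h])

lemma tsum_add:
  assumes P: "abelian_group P" and l: "set l \<subseteq> U \<times> V"
    and f: "\<And>u v. u \<in> U \<Longrightarrow> v \<in> V \<Longrightarrow> f u v \<in> carrier P"
    and g: "\<And>u v. u \<in> U \<Longrightarrow> v \<in> V \<Longrightarrow> g u v \<in> carrier P"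
  shows "tsum P l (\<lambda>u v. f u v \<oplus>\<^bsub>P\<^esub> g u v) = tsum P l f \<oplus>\<^bsub>P\<^esub> tsum P l g"
proof -
  interpret abelian_group P by fact
  show ?thesis using l
  proof (induction l)
    case (Cons p l)
    then have "set l \<subseteq> U \<times> V" by simp
    then have "tsum P l f \<in> carrier P" "tsum P l g \<in> carrier P"
      using f g by (blast intro: tsum_closed[OF P])+
    with Cons show ?case using f g by (cases p) (auto simp: a_ac)
  qed simp
qed

lemma tsum_zero: "abelian_group P \<Longrightarrow> tsum P l (\<lambda>u v. \<zero>\<^bsub>P\<^esub>) = \<zero>\<^bsub>P\<^esub>"
proof (induction l)
  case (Cons p l)
  interpret abelian_group P by fact
  show ?case using Cons by (cases p) simp
qed simp

lemma tsum_swap: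
  assumes P: "abelian_group P" and l: "set l \<subseteq> U \<times> V" and m: "set m \<subseteq> C \<times> D"
    and f: "\<And>u v x y. u \<in> U \<Longrightarrow> v \<in> V \<Longrightarrow> x \<in> C \<Longrightarrow> y \<in> D \<Longrightarrow> f u v x y \<in> carrier P"
  shows "tsum P l (\<lambda>u v. tsum P m (\<lambda>x y. f u v x y)) =
    tsum P m (\<lambda>x y. tsum P l (\<lambda>u v. f u v x y))"
  using l
proof (induction l)
  case Nil
  then show ?case by (simp add: tsum_zero[OF P])
next
  case (Cons p l)
  obtain u v where p: "p = (u, v)" by fastforce
  have "tsum P m (\<lambda>x y. f u v x y \<oplus>\<^bsub>P\<^esub> tsum P l (\<lambda>u v. f u v x y)) =
      tsum P m (\<lambda>x y. f u v x y) \<oplus>\<^bsub>P\<^esub> tsum P m (\<lambda>x y. tsum P l (\<lambda>u v. f u v x y))"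
    by (rule tsum_add[OF P m]) (use Cons.prems p f in \<open>auto intro!: tsum_closed[OF P, of l U V]\<close>)
  with Cons p show ?case by simp
qed

lemma (in abelian_group) minus_eq_zeroD:
  assumes "x \<ominus> y = \<zero>" "x \<in> carrier G" "y \<in> carrier G"
  shows "x = y"
  using assms by (metis a_minus_def add.inv_equality add.inv_closed minus_minus)

lemma (in abelian_group) add_minus_minus:
  assumes "x \<in> carrier G" "y \<in> carrier G"
  shows "(x \<oplus> y) \<ominus> x \<ominus> y = \<zero>"
proof -
  have "(x \<oplus> y) \<ominus> x \<ominus> y = (x \<oplus> y) \<oplus> \<ominus> (x \<oplus> y)"
    using assms by (simp add: a_minus_def minus_add a_assoc)
  then show ?thesis using assms by (simp add: r_neg)
qed

section \<open>The tensor product over the ground field and its universal property\<close>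

locale tensor_pair = U: module K U + V: module K V
  for K :: "'k ring" and U :: "('k, 'a, 'n) module_scheme" and V :: "('k, 'b, 'o) module_scheme"
begin

abbreviation "T \<equiv> tensor K U V"
abbreviation "tens \<equiv> pure_tensor K U V"

sublocale presentation "carrier U \<times> carrier V" "tensor_rels K U V"
proof
  fix \<rho> assume "\<rho> \<in> tensor_rels K U V"
  then show "Poly_Mapping.keys \<rho> \<subseteq> carrier U \<times> carrier V"
    by (auto simp: tensor_rels_def dest!: subsetD[OF keys_diff] split: if_splits)
qed

lemma tensor_simps:
  "carrier T = carrier Q" "x \<oplus>\<^bsub>T\<^esub> y = x \<oplus>\<^bsub>Q\<^esub> y" "\<zero>\<^bsub>T\<^esub> = \<zero>\<^bsub>Q\<^esub>"
  by (simp_all add: tensor_def Let_def)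

lemma add_hom_tensor: "add_hom T P = add_hom Q P" "add_hom P' T = add_hom P' Q"
  by (simp_all add: add_hom_def tensor_simps)

lemma abelian_group_tensor: "abelian_group T"
proof -
  interpret Q: abelian_group Q by (rule abelian_group_presented_group)
  show ?thesis
    by (rule abelian_groupI)
      (simp_all add: tensor_simps Q.a_assoc, auto simp: Q.a_comm intro: Q.l_neg Q.a_inv_closed)
qed

sublocale T: abelian_group T by (rule abelian_group_tensor)

lemma tens_closed [simp]: "x \<in> carrier U \<Longrightarrow> y \<in> carrier V \<Longrightarrow> tens x y \<in> carrier T"
  by (simp add: pure_tensor_def tensor_simps cls_closed)

lemma coset_diff_zeroD:
  assumes "coset (g - h) = \<zero>\<^bsub>Q\<^esub>" "Poly_Mapping.keys g \<subseteq> carrier U \<times> carrier V"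
    "Poly_Mapping.keys h \<subseteq> carrier U \<times> carrier V"
  shows "coset g = coset h"
proof -
  interpret Q: abelian_group Q by (rule abelian_group_presented_group)
  show ?thesis using assms coset_diff[OF assms(2,3)] coset_closed Q.minus_eq_zeroD by metis
qed

lemma tens_add_left:
  assumes "x \<in> carrier U" "x' \<in> carrier U" "y \<in> carrier V"
  shows "tens (x \<oplus>\<^bsub>U\<^esub> x') y = tens x y \<oplus>\<^bsub>T\<^esub> tens x' y"
proof -
  have "frag_of (x \<oplus>\<^bsub>U\<^esub> x', y) - frag_of (x, y) - frag_of (x', y) \<in> tensor_rels K U V"
    using assms unfolding tensor_rels_def by blast
  then have "coset (frag_of (x \<oplus>\<^bsub>U\<^esub> x', y) - (frag_of (x, y) + frag_of (x', y))) = \<zero>\<^bsub>Q\<^esub>"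
    using coset_rel by (metis diff_diff_eq)
  then have "coset (frag_of (x \<oplus>\<^bsub>U\<^esub> x', y)) = coset (frag_of (x, y) + frag_of (x', y))"
    by (rule coset_diff_zeroD) (use assms in \<open>auto dest!: subsetD[OF keys_add] split: if_splits\<close>)
  then show ?thesis
    using assms by (simp add: pure_tensor_def cls_eq coset_add tensor_simps)
qed

lemma tens_add_right:
  assumes "x \<in> carrier U" "y \<in> carrier V" "y' \<in> carrier V"
  shows "tens x (y \<oplus>\<^bsub>V\<^esub> y') = tens x y \<oplus>\<^bsub>T\<^esub> tens x y'"
proof -
  have "frag_of (x, y \<oplus>\<^bsub>V\<^esub> y') - frag_of (x, y) - frag_of (x, y') \<in> tensor_rels K U V"
    using assms unfolding tensor_rels_def by blast
  then have "coset (frag_of (x, y \<oplus>\<^bsub>V\<^esub> y') - (frag_of (x, y) + frag_of (x, y'))) = \<zero>\<^bsub>Q\<^esub>"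
    using coset_rel by (metis diff_diff_eq)
  then have "coset (frag_of (x, y \<oplus>\<^bsub>V\<^esub> y')) = coset (frag_of (x, y) + frag_of (x, y'))"
    by (rule coset_diff_zeroD) (use assms in \<open>auto dest!: subsetD[OF keys_add] split: if_splits\<close>)
  then show ?thesis
    using assms by (simp add: pure_tensor_def cls_eq coset_add tensor_simps)
qed

lemma tens_smult_swap:
  assumes "r \<in> carrier K" "x \<in> carrier U" "y \<in> carrier V"
  shows "tens (r \<odot>\<^bsub>U\<^esub> x) y = tens x (r \<odot>\<^bsub>V\<^esub> y)"
proof -
  have "frag_of (r \<odot>\<^bsub>U\<^esub> x, y) - frag_of (x, r \<odot>\<^bsub>V\<^esub> y) \<in> tensor_rels K U V"
    using assms unfolding tensor_rels_def by blast
  then have "coset (frag_of (r \<odot>\<^bsub>U\<^esub> x, y)) = coset (frag_of (x, r \<odot>\<^bsub>V\<^esub> y))"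
    by (intro coset_diff_zeroD coset_rel) (use assms in auto)
  then show ?thesis by (simp add: pure_tensor_def cls_eq)
qed

lemma balanced_map_tens: "balanced_map K U V T tens"
  by (auto simp: balanced_map_def add_hom_def tens_add_left tens_add_right tens_smult_swap)

lemma
  assumes P: "abelian_group P" and f: "balanced_map K U V P f"
  shows tensor_lift_add_hom: "(\<lambda>t. tensor_lift P t f) \<in> add_hom T P"
    and tensor_lift_tens: "x \<in> carrier U \<Longrightarrow> y \<in> carrier V \<Longrightarrow> tensor_lift P (tens x y) f = f x y"
proof -
  interpret P: abelian_group P by fact
  have cl: "f u v \<in> carrier P" if "u \<in> carrier U" "v \<in> carrier V" for u v
    using f that by (auto simp: balanced_map_def add_hom_def Pi_iff)
  have fc: "(\<lambda>(x, y). f x y) \<in> carrier U \<times> carrier V \<rightarrow> carrier P"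
    using cl by auto
  have frag: "frag_sum P (\<lambda>(x, y). f x y) (g - h) =
      frag_sum P (\<lambda>(x, y). f x y) g \<ominus>\<^bsub>P\<^esub> frag_sum P (\<lambda>(x, y). f x y) h"
    if "Poly_Mapping.keys g \<subseteq> carrier U \<times> carrier V" "Poly_Mapping.keys h \<subseteq> carrier U \<times> carrier V" for g h
    using P.frag_sum_diff[OF fc that] .
  have fo: "frag_sum P (\<lambda>(x, y). f x y) (frag_of (u, v)) = f u v"
    if "u \<in> carrier U" "v \<in> carrier V" for u v
    by (subst P.frag_sum_of) (use that cl in auto)
  have kd: "Poly_Mapping.keys (frag_of p - frag_of q) \<subseteq> carrier U \<times> carrier V"
    if "p \<in> carrier U \<times> carrier V" "q \<in> carrier U \<times> carrier V" for p q :: "'a \<times> 'b"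
    using that by (auto dest!: subsetD[OF keys_diff] split: if_splits)
  \<comment> \<open>The three families of relations match the three clauses of
    \<open>balanced_map\<close>.\<close>
  have kill: "frag_sum P (\<lambda>(x, y). f x y) \<rho> = \<zero>\<^bsub>P\<^esub>" if \<rho>: "\<rho> \<in> tensor_rels K U V" for \<rho>
  proof -
    consider x x' y where "\<rho> = frag_of (x \<oplus>\<^bsub>U\<^esub> x', y) - frag_of (x, y) - frag_of (x', y)"
        "x \<in> carrier U" "x' \<in> carrier U" "y \<in> carrier V"
      | x y y' where "\<rho> = frag_of (x, y \<oplus>\<^bsub>V\<^esub> y') - frag_of (x, y) - frag_of (x, y')"
        "x \<in> carrier U" "y \<in> carrier V" "y' \<in> carrier V"
      | r x y where "\<rho> = frag_of (r \<odot>\<^bsub>U\<^esub> x, y) - frag_of (x, r \<odot>\<^bsub>V\<^esub> y)"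
        "r \<in> carrier K" "x \<in> carrier U" "y \<in> carrier V"
      using \<rho> unfolding tensor_rels_def by blast
    then show ?thesis
    proof cases
      case (1 x x' y)
      have "f (x \<oplus>\<^bsub>U\<^esub> x') y = f x y \<oplus>\<^bsub>P\<^esub> f x' y"
        using f 1 by (auto simp: balanced_map_def add_hom_def)
      then show ?thesis using 1 kd cl
        by (simp add: frag fo P.add_minus_minus)
    next
      case (2 x y y')
      have "f x (y \<oplus>\<^bsub>V\<^esub> y') = f x y \<oplus>\<^bsub>P\<^esub> f x y'"
        using f 2 by (auto simp: balanced_map_def add_hom_def)
      then show ?thesis using 2 kd cl
        by (simp add: frag fo P.add_minus_minus)
    next
      case (3 r x y)
      have "f (r \<odot>\<^bsub>U\<^esub> x) y = f x (r \<odot>\<^bsub>V\<^esub> y)" using f 3 by (auto simp: balanced_map_def)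
      then show ?thesis using 3 kd cl by (simp add: frag fo a_minus_def P.r_neg)
    qed
  qed
  show "(\<lambda>t. tensor_lift P t f) \<in> add_hom T P"
    unfolding tensor_lift_def add_hom_tensor
    by (rule presented_lift_add_hom[OF P fc kill])
  show "tensor_lift P (tens x y) f = f x y" if "x \<in> carrier U" "y \<in> carrier V"
    unfolding tensor_lift_def pure_tensor_def
    using presented_lift_cls[OF P fc kill, of "(x, y)"] that by simp
qed

lemma tensor_induct [consumes 1, case_names zero diff tens]:
  assumes "t \<in> carrier T" "P \<zero>\<^bsub>T\<^esub>"
    "\<And>x y. x \<in> carrier T \<Longrightarrow> y \<in> carrier T \<Longrightarrow> P x \<Longrightarrow> P y \<Longrightarrow> P (x \<ominus>\<^bsub>T\<^esub> y)"
    "\<And>x y. x \<in> carrier U \<Longrightarrow> y \<in> carrier V \<Longrightarrow> P (tens x y)"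
  shows "P t"
proof -
  \<comment> \<open>Negation is determined by carrier, addition and zero, which \<open>Q\<close> and
    \<open>T\<close> have in common.\<close>
  have ma: "x \<ominus>\<^bsub>Q\<^esub> y = x \<ominus>\<^bsub>T\<^esub> y" for x y
    by (simp add: a_minus_def tensor_simps a_inv_def m_inv_def)
  from assms(1) have "t \<in> carrier Q" by (simp add: tensor_simps)
  then show ?thesis
    by (induction rule: presented_group_induct)
      (use assms in \<open>auto simp: tensor_simps ma pure_tensor_def\<close>)
qed

lemma tensor_add_hom_eqI:
  assumes P: "abelian_group P" and "f \<in> add_hom T P" "g \<in> add_hom T P"
    and "\<And>x y. x \<in> carrier U \<Longrightarrow> y \<in> carrier V \<Longrightarrow> f (tens x y) = g (tens x y)"
    and "t \<in> carrier T"
  shows "f t = g t"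
  using add_hom_eqI[of P f g t] assms by (auto simp: tensor_simps add_hom_tensor pure_tensor_def)

lemma tensor_lift_cong:
  assumes "abelian_group P" "balanced_map K U V P f" "t \<in> carrier T"
    and "\<And>x y. x \<in> carrier U \<Longrightarrow> y \<in> carrier V \<Longrightarrow> f x y = g x y"
  shows "tensor_lift P t f = tensor_lift P t g"
  unfolding tensor_lift_def
  by (rule presented_lift_cong[OF assms(1)])
    (use assms in \<open>auto simp: tensor_simps balanced_map_def add_hom_def Pi_iff\<close>)

lemma smult_tensor: "r \<odot>\<^bsub>T\<^esub> t = tensor_lift Q t (\<lambda>x y. tens (r \<odot>\<^bsub>U\<^esub> x) y)"
  by (simp add: tensor_def Let_def)

text \<open>Commutativity of \<open>K\<close> makes scaling of the left factor balanced. The target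
  is \<open>Q\<close>, because the definition of \<open>tensor\<close> lifts into the bare presented
  group.\<close>

lemma balanced_map_smult:
  assumes "r \<in> carrier K"
  shows "balanced_map K U V Q (\<lambda>x y. tens (r \<odot>\<^bsub>U\<^esub> x) y)"
proof -
  have "r \<odot>\<^bsub>U\<^esub> (s \<odot>\<^bsub>U\<^esub> x) = s \<odot>\<^bsub>U\<^esub> (r \<odot>\<^bsub>U\<^esub> x)" if "s \<in> carrier K" "x \<in> carrier U" for s x
    using assms that by (metis U.smult_assoc1 U.R.m_comm)
  then have "balanced_map K U V T (\<lambda>x y. tens (r \<odot>\<^bsub>U\<^esub> x) y)"
    using assms
    by (auto simp: balanced_map_def add_hom_def tens_add_left tens_add_right
      U.smult_r_distr tens_smult_swap[of _ "r \<odot>\<^bsub>U\<^esub> _"])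
  then show ?thesis by (simp add: balanced_map_def add_hom_tensor)
qed

lemma smult_tensor_add_hom: "r \<in> carrier K \<Longrightarrow> (\<lambda>t. r \<odot>\<^bsub>T\<^esub> t) \<in> add_hom T T"
  using tensor_lift_add_hom[OF abelian_group_presented_group balanced_map_smult]
  by (simp add: smult_tensor add_hom_tensor(2))

lemma smult_tens:
  "r \<in> carrier K \<Longrightarrow> x \<in> carrier U \<Longrightarrow> y \<in> carrier V \<Longrightarrow> r \<odot>\<^bsub>T\<^esub> tens x y = tens (r \<odot>\<^bsub>U\<^esub> x) y"
  using tensor_lift_tens[OF abelian_group_presented_group balanced_map_smult]
  by (simp add: smult_tensor)

text \<open>Each axiom compares two additive maps of the tensor and so needs checking on simple
  tensors only, where it reduces to the module laws of \<open>U\<close>.\<close>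

lemma module_tensor: "module K T"
proof (rule moduleI)
  show "cring K" by (rule U.R.is_cring)
  fix a b x y assume a: "a \<in> carrier K" and x: "x \<in> carrier T"
  show "a \<odot>\<^bsub>T\<^esub> x \<in> carrier T" using add_hom_closed[OF smult_tensor_add_hom[OF a] x] .
  show "a \<odot>\<^bsub>T\<^esub> (x \<oplus>\<^bsub>T\<^esub> y) = a \<odot>\<^bsub>T\<^esub> x \<oplus>\<^bsub>T\<^esub> a \<odot>\<^bsub>T\<^esub> y" if "y \<in> carrier T"
    using a x that smult_tensor_add_hom add_hom_add by fastforce
  assume b: "b \<in> carrier K"
  have "(\<lambda>x. a \<odot>\<^bsub>T\<^esub> x \<oplus>\<^bsub>T\<^esub> b \<odot>\<^bsub>T\<^esub> x) \<in> add_hom T T"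
    using smult_tensor_add_hom[OF a] smult_tensor_add_hom[OF b]
    by (auto simp: add_hom_def Pi_iff T.a_ac)
  then show "(a \<oplus>\<^bsub>K\<^esub> b) \<odot>\<^bsub>T\<^esub> x = a \<odot>\<^bsub>T\<^esub> x \<oplus>\<^bsub>T\<^esub> b \<odot>\<^bsub>T\<^esub> x"
    using a b x
    by (intro tensor_add_hom_eqI[OF abelian_group_tensor smult_tensor_add_hom, where t = x])
      (auto simp: smult_tens U.smult_l_distr tens_add_left)
  show "(a \<otimes>\<^bsub>K\<^esub> b) \<odot>\<^bsub>T\<^esub> x = a \<odot>\<^bsub>T\<^esub> (b \<odot>\<^bsub>T\<^esub> x)"
    using a b x
    by (intro tensor_add_hom_eqI[OF abelian_group_tensor smult_tensor_add_hom
          add_hom_compose[OF smult_tensor_add_hom smult_tensor_add_hom], where t = x])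
      (auto simp: smult_tens U.smult_assoc1)
next
  fix x assume x: "x \<in> carrier T"
  have "(\<lambda>x. x) \<in> add_hom T T" by (simp add: add_hom_def)
  then show "\<one>\<^bsub>K\<^esub> \<odot>\<^bsub>T\<^esub> x = x"
    using x
    by (intro tensor_add_hom_eqI[OF abelian_group_tensor smult_tensor_add_hom, where t = x and g = "\<lambda>x. x"])
      (auto simp: smult_tens)
qed (rule abelian_group_tensor)

sublocale T: module K T by (rule module_tensor)

lemma bilinear_map_tens: "bilinear_map K U V T tens"
  by (intro bilinear_mapI module_homI)
    (simp_all add: tens_add_left tens_add_right smult_tens tens_smult_swap)

lemma tensor_lift_hom:
  assumes "module K P" "bilinear_map K U V P f"
  shows "(\<lambda>t. tensor_lift P t f) \<in> module_hom K T P"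
proof -
  interpret P: module K P by fact
  note bal = bilinear_map_balanced[OF assms(2)]
  note hom = tensor_lift_add_hom[OF P.abelian_group_axioms bal]
  show ?thesis
  proof (rule module_homI)
    fix r t assume r: "r \<in> carrier K" and t: "t \<in> carrier T"
    have "(\<lambda>t. r \<odot>\<^bsub>P\<^esub> tensor_lift P t f) \<in> add_hom T P"
      using hom r by (auto simp: add_hom_def Pi_iff P.smult_r_distr)
    with r t show "tensor_lift P (r \<odot>\<^bsub>T\<^esub> t) f = r \<odot>\<^bsub>P\<^esub> tensor_lift P t f"
      by (intro tensor_add_hom_eqI[OF P.abelian_group_axioms
            add_hom_compose[OF smult_tensor_add_hom hom], where t = t])
        (simp_all add: smult_tens tensor_lift_tens[OF P.abelian_group_axioms bal]
          bilinear_mapD[OF assms(2)])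
  qed (use add_hom_closed[OF hom] add_hom_add[OF hom] in auto)
qed

text \<open>A minus sign can be absorbed into the left factor, so a plain list of pairs suffices and
  no integer coefficients have to be carried along.\<close>

lemma tensor_list_ex:
  assumes "t \<in> carrier T"
  shows "\<exists>l. set l \<subseteq> carrier U \<times> carrier V \<and> t = tsum T l tens"
  using assms
proof (induction rule: tensor_induct)
  case zero
  show ?case by (rule exI[of _ "[]"]) simp
next
  case (diff x y)
  then obtain l m where l: "set l \<subseteq> carrier U \<times> carrier V" "x = tsum T l tens"
    and m: "set m \<subseteq> carrier U \<times> carrier V" "y = tsum T m tens" by blast
  let ?m = "map (\<lambda>(u, v). (\<ominus>\<^bsub>U\<^esub> u, v)) m"
  have neg: "tens (\<ominus>\<^bsub>U\<^esub> u) v = \<ominus>\<^bsub>T\<^esub> tens u v" if "u \<in> carrier U" "v \<in> carrier V" for u v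
    using add_hom_a_inv[OF U.abelian_group_axioms abelian_group_tensor, of "\<lambda>u. tens u v" u]
      balanced_map_tens that by (simp add: balanced_map_def)
  have m': "set ?m \<subseteq> carrier U \<times> carrier V" using m by auto
  have cl: "tsum T k tens \<in> carrier T" if "set k \<subseteq> carrier U \<times> carrier V" for k
    using tsum_closed[OF abelian_group_tensor that] by simp
  have "\<ominus>\<^bsub>T\<^esub> tsum T m tens = tsum T m (\<lambda>u v. \<ominus>\<^bsub>T\<^esub> tens u v)"
    by (rule tsum_hom[OF abelian_group_tensor abelian_group_tensor _ m(1)])
      (simp_all add: add_hom_def T.minus_add)
  also have "\<dots> = tsum T ?m tens"
    using m(1) by (induction m) (auto simp: neg)
  finally have "x \<ominus>\<^bsub>T\<^esub> y = tsum T l tens \<oplus>\<^bsub>T\<^esub> tsum T ?m tens"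
    using l m by (simp add: a_minus_def)
  also have "\<dots> = tsum T (l @ ?m) tens"
    by (rule tsum_append[OF abelian_group_tensor l(1) m', symmetric]) simp
  finally have "x \<ominus>\<^bsub>T\<^esub> y = tsum T (l @ ?m) tens" .
  moreover have "set (l @ ?m) \<subseteq> carrier U \<times> carrier V" using l m' by simp
  ultimately show ?case by blast
next
  case (tens x y)
  then show ?case by (intro exI[of _ "[(x, y)]"]) simp
qed

lemma tensor_lift_tsum:
  assumes "abelian_group P" "balanced_map K U V P f" "set l \<subseteq> carrier U \<times> carrier V"
  shows "tensor_lift P (tsum T l tens) f = tsum P l f"
proof -
  note hom = tensor_lift_add_hom[OF assms(1,2)]
  have "tensor_lift P (tsum T l tens) f = tsum P l (\<lambda>u v. tensor_lift P (tens u v) f)"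
    using tsum_hom[OF abelian_group_tensor assms(1) hom assms(3) tens_closed] .
  also have "\<dots> = tsum P l f"
    by (rule tsum_cong[OF assms(3) tensor_lift_tens[OF assms(1,2)]])
  finally show ?thesis .
qed

end

section \<open>Sweedler sums\<close>

text \<open>A chosen expression of \<open>\<Delta> c\<close> as a sum of simple tensors turns Sweedler notation into honest
  finite sums, which commute with each other and with additive maps without linearity hypotheses.\<close>

definition comult_list :: "'k ring \<Rightarrow> ('k, 'c) bialgebra \<Rightarrow> 'c \<Rightarrow> ('c \<times> 'c) list" where
  "comult_list K C c =
    (let rep = \<lambda>l. set l \<subseteq> carrier C \<times> carrier C \<and>
       comult C c = tsum (tensor K C C) l (pure_tensor K C C)
     in if Ex rep then Eps rep else [])"

definition sweedler ::
  "'k ring \<Rightarrow> ('k, 'c) bialgebra \<Rightarrow> ('p, 'm) ring_scheme \<Rightarrow> 'c \<Rightarrow> ('c \<Rightarrow> 'c \<Rightarrow> 'p) \<Rightarrow> 'p" where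
  "sweedler K C P c f = tsum P (comult_list K C c) f"

text \<open>The default \<open>[]\<close> makes this true for every \<open>c\<close>, even outside
  the carrier and without any coalgebra axiom. The rules for rearranging Sweedler sums thereby get
  no side condition on the element that is comultiplied.\<close>

lemma comult_list_subset: "set (comult_list K C c) \<subseteq> carrier C \<times> carrier C"
proof -
  have "set (Eps (\<lambda>l. set l \<subseteq> carrier C \<times> carrier C \<and>
      comult C c = tsum (tensor K C C) l (pure_tensor K C C))) \<subseteq> carrier C \<times> carrier C"
    if "\<exists>l. set l \<subseteq> carrier C \<times> carrier C \<and> comult C c = tsum (tensor K C C) l (pure_tensor K C C)"
    using someI_ex[OF that] by blast
  then show ?thesis unfolding comult_list_def Let_def by auto
qed

text \<open>Rules for linearity in a single variable, applied backwards along the syntax of a term.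
  They discharge the linearity hypotheses that coassociativity and the counit laws put on nested
  Sweedler sums.\<close>

named_theorems linear_intros

text \<open>As a congruence rule it hands the simplifier the membership of both legs in the carrier,
  which most of the rewriting inside such sums requires.\<close>

lemma sweedler_cong [cong]:
  "(\<And>u v. u \<in> carrier C \<Longrightarrow> v \<in> carrier C \<Longrightarrow> f u v = g u v) \<Longrightarrow>
    sweedler K C P c f = sweedler K C P c g"
  unfolding sweedler_def by (rule tsum_cong[OF comult_list_subset])

lemma sweedler_closed:
  "abelian_group P \<Longrightarrow> (\<And>u v. u \<in> carrier C \<Longrightarrow> v \<in> carrier C \<Longrightarrow> f u v \<in> carrier P) \<Longrightarrow>
    sweedler K C P c f \<in> carrier P"
  unfolding sweedler_def by (rule tsum_closed[OF _ comult_list_subset])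

lemma sweedler_hom:
  "abelian_group P \<Longrightarrow> abelian_group Q \<Longrightarrow> h \<in> add_hom P Q \<Longrightarrow>
    (\<And>u v. u \<in> carrier C \<Longrightarrow> v \<in> carrier C \<Longrightarrow> f u v \<in> carrier P) \<Longrightarrow>
    h (sweedler K C P c f) = sweedler K C Q c (\<lambda>u v. h (f u v))"
  unfolding sweedler_def by (rule tsum_hom[OF _ _ _ comult_list_subset])

lemma sweedler_swap:
  assumes "abelian_group P"
    and "\<And>u v x y. u \<in> carrier C \<Longrightarrow> v \<in> carrier C \<Longrightarrow> x \<in> carrier D \<Longrightarrow> y \<in> carrier D \<Longrightarrow>
      f u v x y \<in> carrier P"
  shows "sweedler K C P c (\<lambda>u v. sweedler K D P d (\<lambda>x y. f u v x y)) =
    sweedler K D P d (\<lambda>x y. sweedler K C P c (\<lambda>u v. f u v x y))"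
  unfolding sweedler_def
  by (rule tsum_swap[OF assms(1) comult_list_subset comult_list_subset assms(2)])

text \<open>Here the variable occurs only in the summand and the list is fixed, so this is a finite
  sum of linear maps. Dependence on the comultiplied element is different in kind:
  \<open>lin_sweedler_outer\<close> needs bilinearity of the summand, since the chosen lists are not
  additive in that element.\<close>

lemma lin_sweedler_inner [linear_intros]:
  assumes P: "module K P"
    and g: "\<And>u v. u \<in> carrier C \<Longrightarrow> v \<in> carrier C \<Longrightarrow> (\<lambda>x. g x u v) \<in> module_hom K M P"
  shows "(\<lambda>x. sweedler K C P c (\<lambda>u v. g x u v)) \<in> module_hom K M P"
proof -
  interpret P: module K P by fact
  have gc: "g x u v \<in> carrier P" if "x \<in> carrier M" "u \<in> carrier C" "v \<in> carrier C" for x u v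
    using module_hom_in[OF g] that by auto
  show ?thesis
  proof (rule module_homI)
    fix x assume x: "x \<in> carrier M"
    then show "sweedler K C P c (\<lambda>u v. g x u v) \<in> carrier P"
      by (intro sweedler_closed P.abelian_group_axioms gc)
    fix r assume r: "r \<in> carrier K"
    have "r \<odot>\<^bsub>P\<^esub> sweedler K C P c (\<lambda>u v. g x u v) = sweedler K C P c (\<lambda>u v. r \<odot>\<^bsub>P\<^esub> g x u v)"
      using r x by (intro sweedler_hom P.abelian_group_axioms gc)
        (auto simp: add_hom_def P.smult_r_distr)
    also have "\<dots> = sweedler K C P c (\<lambda>u v. g (r \<odot>\<^bsub>M\<^esub> x) u v)"
      using g r x by (intro sweedler_cong) (simp add: module_hom_def)
    finally show "sweedler K C P c (\<lambda>u v. g (r \<odot>\<^bsub>M\<^esub> x) u v) =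
      r \<odot>\<^bsub>P\<^esub> sweedler K C P c (\<lambda>u v. g x u v)" by simp
  next
    fix x y assume x: "x \<in> carrier M" and y: "y \<in> carrier M"
    have "sweedler K C P c (\<lambda>u v. g (x \<oplus>\<^bsub>M\<^esub> y) u v) =
        sweedler K C P c (\<lambda>u v. g x u v \<oplus>\<^bsub>P\<^esub> g y u v)"
      using g x y by (intro sweedler_cong) (simp add: module_hom_def)
    also have "\<dots> = sweedler K C P c (\<lambda>u v. g x u v) \<oplus>\<^bsub>P\<^esub> sweedler K C P c (\<lambda>u v. g y u v)"
      unfolding sweedler_def
      by (rule tsum_add[OF P.abelian_group_axioms comult_list_subset gc[OF x] gc[OF y]])
    finally show "sweedler K C P c (\<lambda>u v. g (x \<oplus>\<^bsub>M\<^esub> y) u v) =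
      sweedler K C P c (\<lambda>u v. g x u v) \<oplus>\<^bsub>P\<^esub> sweedler K C P c (\<lambda>u v. g y u v)" .
  qed
qed

lemma lin_id [linear_intros]: "(\<lambda>x. x) \<in> module_hom K M M"
  by (simp add: module_hom_def)

lemma lin_pure_tensor_left [linear_intros]:
  fixes K :: "'k ring"
  assumes "module K U" "module K V" "F \<in> module_hom K M U" "v \<in> carrier V"
  shows "(\<lambda>x. pure_tensor K U V (F x) v) \<in> module_hom K M (tensor K U V)"
proof -
  interpret tensor_pair K U V using assms by (simp add: tensor_pair_def)
  show ?thesis by (rule bilinear_map_left[OF bilinear_map_tens assms(3,4)])
qed

lemma lin_pure_tensor_right [linear_intros]:
  fixes K :: "'k ring"
  assumes "module K U" "module K V" "F \<in> module_hom K M V" "u \<in> carrier U"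
  shows "(\<lambda>x. pure_tensor K U V u (F x)) \<in> module_hom K M (tensor K U V)"
proof -
  interpret tensor_pair K U V using assms by (simp add: tensor_pair_def)
  show ?thesis by (rule bilinear_map_right[OF bilinear_map_tens assms(4,3)])
qed

lemma lin_smult [linear_intros]:
  assumes "module K P" "F \<in> module_hom K M P" "r \<in> carrier K"
  shows "(\<lambda>x. r \<odot>\<^bsub>P\<^esub> F x) \<in> module_hom K M P"
proof -
  interpret P: module K P by fact
  show ?thesis using assms
    by (auto simp: module_hom_def Pi_iff P.smult_r_distr P.smult_assoc1[symmetric] P.R.m_comm)
qed

lemma lin_scalar [linear_intros]:
  assumes "module K P" "F \<in> module_hom K M (scalar_module K)" "p \<in> carrier P"
  shows "(\<lambda>x. F x \<odot>\<^bsub>P\<^esub> p) \<in> module_hom K M P"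
proof -
  interpret P: module K P by fact
  show ?thesis using assms
    by (auto simp: module_hom_def Pi_iff scalar_module_def P.smult_l_distr P.smult_assoc1)
qed

section \<open>Coassociativity and counit laws for Sweedler sums\<close>

context k_coalgebra begin

lemma module_C: "module K C"
  using vectorspace by (simp add: vectorspace_def)

lemma tensor_pair_C: "tensor_pair K C C"
  using module_C by (simp add: tensor_pair_def)

lemma comult_closed: "c \<in> carrier C \<Longrightarrow> comult C c \<in> carrier (tensor K C C)"
  using comult_linear by (rule module_hom_in)

lemma counit_closed [simp]: "c \<in> carrier C \<Longrightarrow> counit C c \<in> carrier K"
  using module_hom_in[OF counit_linear] by (simp add: scalar_module_def)

lemma lin_counit [linear_intros]: "F \<in> module_hom K M C \<Longrightarrow> (\<lambda>x. counit C (F x)) \<in> module_hom K M (scalar_module K)"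
  using counit_linear by (rule module_hom_compose[rotated])

lemma comult_eq:
  assumes "c \<in> carrier C"
  shows "comult C c = tsum (tensor K C C) (comult_list K C c) (pure_tensor K C C)"
proof -
  interpret tensor_pair K C C by (rule tensor_pair_C)
  have "\<exists>l. set l \<subseteq> carrier C \<times> carrier C \<and> comult C c = tsum (tensor K C C) l (pure_tensor K C C)"
    using tensor_list_ex[OF comult_closed[OF assms]] by auto
  from this someI_ex[OF this] show ?thesis by (simp add: comult_list_def)
qed

text \<open>The bridge between the definitions and the calculus with lists: on a balanced map both
  sides evaluate the same tensor, and the choice of its expression does not matter.\<close>

lemma tensor_lift_sweedler:
  assumes "abelian_group P" "balanced_map K C C P f" "c \<in> carrier C"
  shows "tensor_lift P (comult C c) f = sweedler K C P c f"
  unfolding comult_eq[OF assms(3)] sweedler_def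
  by (rule tensor_pair.tensor_lift_tsum[OF tensor_pair_C assms(1,2) comult_list_subset])

lemma tensor_lift_comult_hom:
  assumes "module K P" "bilinear_map K C C P f"
  shows "(\<lambda>c. tensor_lift P (comult C c) f) \<in> module_hom K C P"
  by (rule module_hom_compose[OF comult_linear tensor_pair.tensor_lift_hom[OF tensor_pair_C assms]])

lemma sweedler_linear:
  assumes P: "module K P" and f: "bilinear_map K C C P f"
  shows "(\<lambda>c. sweedler K C P c f) \<in> module_hom K C P"
proof -
  interpret P: module K P by fact
  interpret C: module K C by (rule module_C)
  show ?thesis using tensor_lift_comult_hom[OF P f]
    by (auto simp: module_hom_def Pi_iff bilinear_map_balanced[OF f]
      tensor_lift_sweedler[OF P.abelian_group_axioms])
qed

lemma lin_sweedler_outer [linear_intros]: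
  assumes "module K P" "F \<in> module_hom K M C"
    and "\<And>u. u \<in> carrier C \<Longrightarrow> (\<lambda>v. g u v) \<in> module_hom K C P"
    and "\<And>v. v \<in> carrier C \<Longrightarrow> (\<lambda>u. g u v) \<in> module_hom K C P"
  shows "(\<lambda>x. sweedler K C P (F x) (\<lambda>u v. g u v)) \<in> module_hom K M P"
  by (rule module_hom_compose[OF assms(2) sweedler_linear[OF assms(1) bilinear_mapI[OF assms(3,4)]]])

text \<open>The axiom is an equation in C \<otimes> (C \<otimes> C); applying to it the linear map
  induced by the trilinear \<open>f\<close> gives the statement in an arbitrary module.\<close>

lemma sweedler_coassoc:
  assumes P: "module K P"
    and f1: "\<And>v w. v \<in> carrier C \<Longrightarrow> w \<in> carrier C \<Longrightarrow> (\<lambda>u. f u v w) \<in> module_hom K C P"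
    and f2: "\<And>u w. u \<in> carrier C \<Longrightarrow> w \<in> carrier C \<Longrightarrow> (\<lambda>v. f u v w) \<in> module_hom K C P"
    and f3: "\<And>u v. u \<in> carrier C \<Longrightarrow> v \<in> carrier C \<Longrightarrow> (\<lambda>w. f u v w) \<in> module_hom K C P"
    and c: "c \<in> carrier C"
  shows "sweedler K C P c (\<lambda>x y. sweedler K C P x (\<lambda>u v. f u v y)) =
    sweedler K C P c (\<lambda>x y. sweedler K C P y (\<lambda>u v. f x u v))"
proof -
  interpret P: module K P by fact
  interpret C: module K C by (rule module_C)
  interpret T: tensor_pair K C C by (rule tensor_pair_C)
  interpret T3: tensor_pair K C "tensor K C C"
    using T.module_tensor C.module_axioms by (simp add: tensor_pair_def)
  \<comment> \<open>The linear map on the threefold tensor product induced by \<open>f\<close>,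
    lifted in two stages.\<close>
  define h where "h = (\<lambda>t. tensor_lift P t (\<lambda>x s. tensor_lift P s (\<lambda>y z. f x y z)))"
  have bil: "bilinear_map K C C P (\<lambda>y z. f x y z)" if "x \<in> carrier C" for x
    using that f2 f3 by (intro bilinear_mapI)
  \<comment> \<open>Linearity in a parameter is not visible through the choice hidden in
    \<open>tensor_lift\<close>. A list expressing \<open>s\<close>, the same for all
    \<open>x\<close>, turns the lift into a finite sum in which it is termwise.\<close>
  have "(\<lambda>x. tensor_lift P s (\<lambda>y z. f x y z)) \<in> module_hom K C P"
    if s: "s \<in> carrier (tensor K C C)" for s
  proof -
    obtain l where l: "set l \<subseteq> carrier C \<times> carrier C" "s = tsum (tensor K C C) l (pure_tensor K C C)"
      using T.tensor_list_ex[OF s] by blast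
    have "tensor_lift P s (\<lambda>y z. f x y z) = tsum P l (\<lambda>y z. f x y z)" if "x \<in> carrier C" for x
      unfolding l(2) using that bil l(1)
      by (intro T.tensor_lift_tsum P.abelian_group_axioms bilinear_map_balanced)
    moreover have "(\<lambda>x. tsum P l (\<lambda>y z. f x y z)) \<in> module_hom K C P"
      using l(1)
    proof (induction l)
      case (Cons p l)
      then show ?case using f1[of "fst p" "snd p"]
        by (cases p) (auto simp: module_hom_def Pi_iff P.smult_r_distr P.a_ac)
    qed (simp add: module_hom_def)
    ultimately show ?thesis by (simp add: module_hom_def Pi_iff)
  qed
  then have bil3: "bilinear_map K C (tensor K C C) P (\<lambda>x s. tensor_lift P s (\<lambda>y z. f x y z))"
    using bil T.tensor_lift_hom[OF P] by (simp add: bilinear_map_def)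
  have h: "h \<in> module_hom K (tensor K C (tensor K C C)) P"
    unfolding h_def by (rule T3.tensor_lift_hom[OF P bil3])
  note ah = module_hom_add_hom[OF h]
  have h_pure: "h (pure_tensor K C (tensor K C C) x s) = tensor_lift P s (\<lambda>y z. f x y z)"
    if "x \<in> carrier C" "s \<in> carrier (tensor K C C)" for x s
    unfolding h_def using that
    by (rule T3.tensor_lift_tens[OF P.abelian_group_axioms bilinear_map_balanced[OF bil3]])
  have h_pure3: "h (pure_tensor K C (tensor K C C) x (pure_tensor K C C y z)) = f x y z"
    if "x \<in> carrier C" "y \<in> carrier C" "z \<in> carrier C" for x y z
    using that bil h_pure
    by (simp add: T.tensor_lift_tens P.abelian_group_axioms bilinear_map_balanced)
  let ?T3 = "tensor K C (tensor K C C)"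
  note lins = linear_intros C.module_axioms T.module_tensor T3.module_tensor T.tens_closed
  have bil1: "bilinear_map K C C ?T3 (\<lambda>x\<^sub>1\<^sub>1 x\<^sub>1\<^sub>2.
      pure_tensor K C (tensor K C C) x\<^sub>1\<^sub>1 (pure_tensor K C C x\<^sub>1\<^sub>2 x\<^sub>2))" if "x\<^sub>2 \<in> carrier C" for x\<^sub>2
    using that by (intro bilinear_mapI) (intro lins | assumption)+
  have e1: "tensor_lift ?T3 (comult C x\<^sub>1) (\<lambda>x\<^sub>1\<^sub>1 x\<^sub>1\<^sub>2.
        pure_tensor K C (tensor K C C) x\<^sub>1\<^sub>1 (pure_tensor K C C x\<^sub>1\<^sub>2 x\<^sub>2)) =
      sweedler K C ?T3 x\<^sub>1 (\<lambda>x\<^sub>1\<^sub>1 x\<^sub>1\<^sub>2.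
        pure_tensor K C (tensor K C C) x\<^sub>1\<^sub>1 (pure_tensor K C C x\<^sub>1\<^sub>2 x\<^sub>2))"
    if "x\<^sub>1 \<in> carrier C" "x\<^sub>2 \<in> carrier C" for x\<^sub>1 x\<^sub>2
    using that by (intro tensor_lift_sweedler T3.abelian_group_tensor bilinear_map_balanced bil1)
  have bil2: "bilinear_map K C C ?T3 (\<lambda>x\<^sub>1 x\<^sub>2. sweedler K C ?T3 x\<^sub>1 (\<lambda>x\<^sub>1\<^sub>1 x\<^sub>1\<^sub>2.
        pure_tensor K C (tensor K C C) x\<^sub>1\<^sub>1 (pure_tensor K C C x\<^sub>1\<^sub>2 x\<^sub>2)))"
    by (intro bilinear_mapI) (intro lins | assumption)+
  \<comment> \<open>The axiom nests one lift in another, and the outer one can be converted only if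
    its integrand is bilinear. This is provable for the Sweedler form of the inner lift and is
    carried back along \<open>e1\<close>.\<close>
  have bil2': "bilinear_map K C C ?T3 (\<lambda>x\<^sub>1 x\<^sub>2. tensor_lift ?T3 (comult C x\<^sub>1) (\<lambda>x\<^sub>1\<^sub>1 x\<^sub>1\<^sub>2.
        pure_tensor K C (tensor K C C) x\<^sub>1\<^sub>1 (pure_tensor K C C x\<^sub>1\<^sub>2 x\<^sub>2)))"
    using bil2 by (simp add: bilinear_map_def module_hom_def Pi_iff e1)
  have "bilinear_map K C C ?T3 (\<lambda>x\<^sub>1 x\<^sub>2. pure_tensor K C (tensor K C C) x\<^sub>1 (comult C x\<^sub>2))"
    by (intro bilinear_mapI)
      (intro lins module_hom_compose[OF _ comult_linear] comult_closed | assumption)+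
  note eqs = tensor_lift_sweedler[OF T3.abelian_group_tensor bilinear_map_balanced[OF bil2'] c]
    tensor_lift_sweedler[OF T3.abelian_group_tensor bilinear_map_balanced[OF this] c]
  have "sweedler K C ?T3 c (\<lambda>x\<^sub>1 x\<^sub>2. tensor_lift ?T3 (comult C x\<^sub>1) (\<lambda>x\<^sub>1\<^sub>1 x\<^sub>1\<^sub>2.
        pure_tensor K C (tensor K C C) x\<^sub>1\<^sub>1 (pure_tensor K C C x\<^sub>1\<^sub>2 x\<^sub>2))) =
      sweedler K C ?T3 c (\<lambda>x\<^sub>1 x\<^sub>2. pure_tensor K C (tensor K C C) x\<^sub>1 (comult C x\<^sub>2))"
    using coassoc[OF c] unfolding eqs .
  then have "h (sweedler K C ?T3 c (\<lambda>x\<^sub>1 x\<^sub>2. sweedler K C ?T3 x\<^sub>1 (\<lambda>x\<^sub>1\<^sub>1 x\<^sub>1\<^sub>2.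
        pure_tensor K C (tensor K C C) x\<^sub>1\<^sub>1 (pure_tensor K C C x\<^sub>1\<^sub>2 x\<^sub>2)))) =
      h (sweedler K C ?T3 c (\<lambda>x\<^sub>1 x\<^sub>2. pure_tensor K C (tensor K C C) x\<^sub>1 (comult C x\<^sub>2)))"
    by (simp add: e1)
  moreover have "h (sweedler K C ?T3 c (\<lambda>x\<^sub>1 x\<^sub>2. sweedler K C ?T3 x\<^sub>1 (\<lambda>x\<^sub>1\<^sub>1 x\<^sub>1\<^sub>2.
        pure_tensor K C (tensor K C C) x\<^sub>1\<^sub>1 (pure_tensor K C C x\<^sub>1\<^sub>2 x\<^sub>2)))) =
      sweedler K C P c (\<lambda>x\<^sub>1 x\<^sub>2. h (sweedler K C ?T3 x\<^sub>1 (\<lambda>x\<^sub>1\<^sub>1 x\<^sub>1\<^sub>2.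
        pure_tensor K C (tensor K C C) x\<^sub>1\<^sub>1 (pure_tensor K C C x\<^sub>1\<^sub>2 x\<^sub>2))))"
    by (intro sweedler_hom[OF T3.abelian_group_tensor P.abelian_group_axioms ah] sweedler_closed
        T3.abelian_group_tensor T3.tens_closed T.tens_closed)
  moreover have "\<dots> = sweedler K C P c (\<lambda>x\<^sub>1 x\<^sub>2. sweedler K C P x\<^sub>1 (\<lambda>x\<^sub>1\<^sub>1 x\<^sub>1\<^sub>2.
        h (pure_tensor K C (tensor K C C) x\<^sub>1\<^sub>1 (pure_tensor K C C x\<^sub>1\<^sub>2 x\<^sub>2))))"
    by (intro sweedler_cong sweedler_hom[OF T3.abelian_group_tensor P.abelian_group_axioms ah]
        T3.tens_closed T.tens_closed)
  moreover have "\<dots> = sweedler K C P c (\<lambda>x y. sweedler K C P x (\<lambda>u v. f u v y))"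
    by (intro sweedler_cong) (rule h_pure3)
  moreover have "h (sweedler K C ?T3 c (\<lambda>x\<^sub>1 x\<^sub>2. pure_tensor K C (tensor K C C) x\<^sub>1 (comult C x\<^sub>2))) =
      sweedler K C P c (\<lambda>x\<^sub>1 x\<^sub>2. h (pure_tensor K C (tensor K C C) x\<^sub>1 (comult C x\<^sub>2)))"
    by (intro sweedler_hom[OF T3.abelian_group_tensor P.abelian_group_axioms ah]
        T3.tens_closed comult_closed)
  moreover have "\<dots> = sweedler K C P c (\<lambda>x y. sweedler K C P y (\<lambda>u v. f x u v))"
    by (intro sweedler_cong) (simp add: h_pure comult_closed bil
        tensor_lift_sweedler[OF P.abelian_group_axioms] bilinear_map_balanced)
  ultimately show ?thesis by simp
qed

text \<open>The axiom is the case of the identity map; apply \<open>f\<close> to both of its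
  sides.\<close>

lemma sweedler_counit_left:
  assumes P: "module K P" and f: "f \<in> module_hom K C P" and c: "c \<in> carrier C"
  shows "sweedler K C P c (\<lambda>x y. counit C x \<odot>\<^bsub>P\<^esub> f y) = f c"
proof -
  interpret P: module K P by fact
  interpret C: module K C by (rule module_C)
  have "bilinear_map K C C C (\<lambda>x\<^sub>1 x\<^sub>2. counit C x\<^sub>1 \<odot>\<^bsub>C\<^esub> x\<^sub>2)"
    by (intro bilinear_mapI) (intro linear_intros C.module_axioms counit_closed | assumption)+
  then have "c = sweedler K C C c (\<lambda>x\<^sub>1 x\<^sub>2. counit C x\<^sub>1 \<odot>\<^bsub>C\<^esub> x\<^sub>2)"
    using counit_left[OF c] c by (simp add: tensor_lift_sweedler[OF C.abelian_group_axioms] bilinear_map_balanced)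
  then have "f c = f (sweedler K C C c (\<lambda>x\<^sub>1 x\<^sub>2. counit C x\<^sub>1 \<odot>\<^bsub>C\<^esub> x\<^sub>2))" by simp
  also have "\<dots> = sweedler K C P c (\<lambda>x\<^sub>1 x\<^sub>2. f (counit C x\<^sub>1 \<odot>\<^bsub>C\<^esub> x\<^sub>2))"
    by (intro sweedler_hom C.abelian_group_axioms P.abelian_group_axioms module_hom_add_hom[OF f]) simp
  also have "\<dots> = sweedler K C P c (\<lambda>x y. counit C x \<odot>\<^bsub>P\<^esub> f y)"
    by (intro sweedler_cong) (simp add: module_hom_smult[OF f])
  finally show ?thesis by simp
qed

lemma sweedler_counit_right:
  assumes P: "module K P" and f: "f \<in> module_hom K C P" and c: "c \<in> carrier C"
  shows "sweedler K C P c (\<lambda>x y. counit C y \<odot>\<^bsub>P\<^esub> f x) = f c"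
proof -
  interpret P: module K P by fact
  interpret C: module K C by (rule module_C)
  have "bilinear_map K C C C (\<lambda>x\<^sub>1 x\<^sub>2. counit C x\<^sub>2 \<odot>\<^bsub>C\<^esub> x\<^sub>1)"
    by (intro bilinear_mapI) (intro linear_intros C.module_axioms counit_closed | assumption)+
  then have "c = sweedler K C C c (\<lambda>x\<^sub>1 x\<^sub>2. counit C x\<^sub>2 \<odot>\<^bsub>C\<^esub> x\<^sub>1)"
    using counit_right[OF c] c by (simp add: tensor_lift_sweedler[OF C.abelian_group_axioms] bilinear_map_balanced)
  then have "f c = f (sweedler K C C c (\<lambda>x\<^sub>1 x\<^sub>2. counit C x\<^sub>2 \<odot>\<^bsub>C\<^esub> x\<^sub>1))" by simp
  also have "\<dots> = sweedler K C P c (\<lambda>x\<^sub>1 x\<^sub>2. f (counit C x\<^sub>2 \<odot>\<^bsub>C\<^esub> x\<^sub>1))"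
    by (intro sweedler_hom C.abelian_group_axioms P.abelian_group_axioms module_hom_add_hom[OF f]) simp
  also have "\<dots> = sweedler K C P c (\<lambda>x y. counit C y \<odot>\<^bsub>P\<^esub> f x)"
    by (intro sweedler_cong) (simp add: module_hom_smult[OF f])
  finally show ?thesis by simp
qed

end

text \<open>Coassociativity of the coalgebra C \<otimes> D, whose legs are pairs. Interchanging sums
  brings the two coproducts of \<open>c\<close> together, then those of \<open>d\<close>, so that
  the two coassociativity laws apply one after the other.\<close>

lemma sweedler_joint_coassoc:
  assumes C: "k_coalgebra K C" and D: "k_coalgebra K D" and P: "module K P"
    and c: "c \<in> carrier C" and d: "d \<in> carrier D"
    and f1: "\<And>r q s t v. r \<in> carrier D \<Longrightarrow> q \<in> carrier C \<Longrightarrow> s \<in> carrier D \<Longrightarrow> t \<in> carrier C \<Longrightarrow> v \<in> carrier D \<Longrightarrow>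
      (\<lambda>p. f p r q s t v) \<in> module_hom K C P"
    and f2: "\<And>p q s t v. p \<in> carrier C \<Longrightarrow> q \<in> carrier C \<Longrightarrow> s \<in> carrier D \<Longrightarrow> t \<in> carrier C \<Longrightarrow> v \<in> carrier D \<Longrightarrow>
      (\<lambda>r. f p r q s t v) \<in> module_hom K D P"
    and f3: "\<And>p r s t v. p \<in> carrier C \<Longrightarrow> r \<in> carrier D \<Longrightarrow> s \<in> carrier D \<Longrightarrow> t \<in> carrier C \<Longrightarrow> v \<in> carrier D \<Longrightarrow>
      (\<lambda>q. f p r q s t v) \<in> module_hom K C P"
    and f4: "\<And>p r q t v. p \<in> carrier C \<Longrightarrow> r \<in> carrier D \<Longrightarrow> q \<in> carrier C \<Longrightarrow> t \<in> carrier C \<Longrightarrow> v \<in> carrier D \<Longrightarrow>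
      (\<lambda>s. f p r q s t v) \<in> module_hom K D P"
    and f5: "\<And>p r q s v. p \<in> carrier C \<Longrightarrow> r \<in> carrier D \<Longrightarrow> q \<in> carrier C \<Longrightarrow> s \<in> carrier D \<Longrightarrow> v \<in> carrier D \<Longrightarrow>
      (\<lambda>t. f p r q s t v) \<in> module_hom K C P"
    and f6: "\<And>p r q s t. p \<in> carrier C \<Longrightarrow> r \<in> carrier D \<Longrightarrow> q \<in> carrier C \<Longrightarrow> s \<in> carrier D \<Longrightarrow> t \<in> carrier C \<Longrightarrow>
      (\<lambda>v. f p r q s t v) \<in> module_hom K D P"
  shows "sweedler K C P c (\<lambda>x y. sweedler K D P d (\<lambda>x' y'.
      sweedler K C P x (\<lambda>u v. sweedler K D P x' (\<lambda>u' v'. f u u' v v' y y')))) =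
    sweedler K C P c (\<lambda>x y. sweedler K D P d (\<lambda>x' y'.
      sweedler K C P y (\<lambda>u v. sweedler K D P y' (\<lambda>u' v'. f x x' u u' v v'))))"
proof -
  interpret C: k_coalgebra K C by fact
  interpret D: k_coalgebra K D by fact
  interpret P: module K P by fact
  have fc: "f p r q s t v \<in> carrier P" if "p \<in> carrier C" "r \<in> carrier D" "q \<in> carrier C"
    "s \<in> carrier D" "t \<in> carrier C" "v \<in> carrier D" for p r q s t v
    using module_hom_in[OF f1] that by blast
  have "sweedler K C P c (\<lambda>x y. sweedler K D P d (\<lambda>x' y'.
      sweedler K C P x (\<lambda>u v. sweedler K D P x' (\<lambda>u' v'. f u u' v v' y y')))) =
    sweedler K C P c (\<lambda>x y. sweedler K C P x (\<lambda>u v. sweedler K D P d (\<lambda>x' y'.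
      sweedler K D P x' (\<lambda>u' v'. f u u' v v' y y'))))"
    by (intro sweedler_cong sweedler_swap P.abelian_group_axioms sweedler_closed fc)
  also have "\<dots> = sweedler K C P c (\<lambda>x y. sweedler K C P y (\<lambda>u v. sweedler K D P d (\<lambda>x' y'.
      sweedler K D P x' (\<lambda>u' v'. f x u' u v' v y'))))"
    by (rule C.sweedler_coassoc[OF P])
      (intro lin_sweedler_inner P f1 f3 f5 c | assumption)+
  also have "\<dots> = sweedler K C P c (\<lambda>x y. sweedler K C P y (\<lambda>u v. sweedler K D P d (\<lambda>x' y'.
      sweedler K D P y' (\<lambda>u' v'. f x x' u u' v v'))))"
    by (intro sweedler_cong D.sweedler_coassoc[OF P] f2 f4 f6 d)
  also have "\<dots> = sweedler K C P c (\<lambda>x y. sweedler K D P d (\<lambda>x' y'.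
      sweedler K C P y (\<lambda>u v. sweedler K D P y' (\<lambda>u' v'. f x x' u u' v v'))))"
    by (intro sweedler_cong sweedler_swap P.abelian_group_axioms sweedler_closed fc)
  finally show ?thesis .
qed

context k_algebra begin

lemma module_A: "module K A"
  using vectorspace by (simp add: vectorspace_def)

sublocale ring A by (rule ring)
sublocale VS: module K A by (rule module_A)

lemma lin_mult_left [linear_intros]:
  "F \<in> module_hom K M A \<Longrightarrow> a \<in> carrier A \<Longrightarrow> (\<lambda>x. F x \<otimes>\<^bsub>A\<^esub> a) \<in> module_hom K M A"
  by (rule bilinear_map_left[OF mult_bilinear])

lemma lin_mult_right [linear_intros]:
  "a \<in> carrier A \<Longrightarrow> F \<in> module_hom K M A \<Longrightarrow> (\<lambda>x. a \<otimes>\<^bsub>A\<^esub> F x) \<in> module_hom K M A"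
  by (rule bilinear_map_right[OF mult_bilinear])

lemma smult_mult_left:
  "r \<in> carrier K \<Longrightarrow> x \<in> carrier A \<Longrightarrow> y \<in> carrier A \<Longrightarrow> (r \<odot>\<^bsub>A\<^esub> x) \<otimes>\<^bsub>A\<^esub> y = r \<odot>\<^bsub>A\<^esub> (x \<otimes>\<^bsub>A\<^esub> y)"
  using bilinear_mapD(4)[OF mult_bilinear] .

lemma smult_mult_right:
  "r \<in> carrier K \<Longrightarrow> x \<in> carrier A \<Longrightarrow> y \<in> carrier A \<Longrightarrow> x \<otimes>\<^bsub>A\<^esub> (r \<odot>\<^bsub>A\<^esub> y) = r \<odot>\<^bsub>A\<^esub> (x \<otimes>\<^bsub>A\<^esub> y)"
  using bilinear_mapD(5)[OF mult_bilinear] .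

lemma add_hom_mult_left: "a \<in> carrier A \<Longrightarrow> (\<lambda>x. a \<otimes>\<^bsub>A\<^esub> x) \<in> add_hom A A"
  by (simp add: add_hom_def r_distr)

lemma add_hom_mult_right: "a \<in> carrier A \<Longrightarrow> (\<lambda>x. x \<otimes>\<^bsub>A\<^esub> a) \<in> add_hom A A"
  by (simp add: add_hom_def l_distr)

end

lemma sweedler_mult_left:
  assumes "k_algebra K H" "a \<in> carrier H"
    and "\<And>u v. u \<in> carrier C \<Longrightarrow> v \<in> carrier C \<Longrightarrow> f u v \<in> carrier H"
  shows "a \<otimes>\<^bsub>H\<^esub> sweedler K C H c (\<lambda>u v. f u v) = sweedler K C H c (\<lambda>u v. a \<otimes>\<^bsub>H\<^esub> f u v)"
proof -
  interpret H: k_algebra K H by fact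
  show ?thesis
    by (rule sweedler_hom[OF H.abelian_group_axioms H.abelian_group_axioms
          H.add_hom_mult_left[OF assms(2)] assms(3)])
qed

lemma sweedler_mult_right:
  assumes "k_algebra K H" "a \<in> carrier H"
    and "\<And>u v. u \<in> carrier C \<Longrightarrow> v \<in> carrier C \<Longrightarrow> f u v \<in> carrier H"
  shows "sweedler K C H c (\<lambda>u v. f u v) \<otimes>\<^bsub>H\<^esub> a = sweedler K C H c (\<lambda>u v. f u v \<otimes>\<^bsub>H\<^esub> a)"
proof -
  interpret H: k_algebra K H by fact
  show ?thesis
    by (rule sweedler_hom[OF H.abelian_group_axioms H.abelian_group_axioms
          H.add_hom_mult_right[OF assms(2)] assms(3)])
qed

lemma sweedler_module_hom:
  assumes "module K P" "module K Q" "h \<in> module_hom K P Q"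
    "\<And>u v. u \<in> carrier C \<Longrightarrow> v \<in> carrier C \<Longrightarrow> f u v \<in> carrier P"
  shows "h (sweedler K C P c (\<lambda>u v. f u v)) = sweedler K C Q c (\<lambda>u v. h (f u v))"
proof -
  interpret P: module K P by fact
  interpret Q: module K Q by fact
  show ?thesis
    by (rule sweedler_hom[OF P.abelian_group_axioms Q.abelian_group_axioms
          module_hom_add_hom[OF assms(3)] assms(4)])
qed

lemma sweedler_smult:
  assumes "module K P" "r \<in> carrier K"
    and "\<And>u v. u \<in> carrier C \<Longrightarrow> v \<in> carrier C \<Longrightarrow> f u v \<in> carrier P"
  shows "r \<odot>\<^bsub>P\<^esub> sweedler K C P c (\<lambda>u v. f u v) = sweedler K C P c (\<lambda>u v. r \<odot>\<^bsub>P\<^esub> f u v)"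
  using assms lin_smult[OF assms(1) lin_id assms(2)]
  by (intro sweedler_module_hom[where h = "\<lambda>x. r \<odot>\<^bsub>P\<^esub> x"])

text \<open>The inner lift is converted first, since bilinearity of the outer integrand can only be
  read off from its Sweedler form.\<close>

lemma tensor_lift_sweedler2:
  assumes C: "k_coalgebra K C" and D: "k_coalgebra K D" and P: "module K P"
    and c: "c \<in> carrier C" and d: "d \<in> carrier D"
    and f1: "\<And>v x y. v \<in> carrier C \<Longrightarrow> x \<in> carrier D \<Longrightarrow> y \<in> carrier D \<Longrightarrow> (\<lambda>u. f u v x y) \<in> module_hom K C P"
    and f2: "\<And>u x y. u \<in> carrier C \<Longrightarrow> x \<in> carrier D \<Longrightarrow> y \<in> carrier D \<Longrightarrow> (\<lambda>v. f u v x y) \<in> module_hom K C P"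
    and f3: "\<And>u v y. u \<in> carrier C \<Longrightarrow> v \<in> carrier C \<Longrightarrow> y \<in> carrier D \<Longrightarrow> (\<lambda>x. f u v x y) \<in> module_hom K D P"
    and f4: "\<And>u v x. u \<in> carrier C \<Longrightarrow> v \<in> carrier C \<Longrightarrow> x \<in> carrier D \<Longrightarrow> (\<lambda>y. f u v x y) \<in> module_hom K D P"
  shows "tensor_lift P (comult C c) (\<lambda>u v. tensor_lift P (comult D d) (\<lambda>x y. f u v x y)) =
    sweedler K C P c (\<lambda>u v. sweedler K D P d (\<lambda>x y. f u v x y))"
proof -
  interpret C: k_coalgebra K C by fact
  interpret D: k_coalgebra K D by fact
  interpret P: module K P by fact
  have e: "tensor_lift P (comult D d) (\<lambda>x y. f u v x y) = sweedler K D P d (\<lambda>x y. f u v x y)"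
    if "u \<in> carrier C" "v \<in> carrier C" for u v
    using that d
    by (intro D.tensor_lift_sweedler P.abelian_group_axioms bilinear_map_balanced bilinear_mapI f3 f4)
  have "bilinear_map K C C P (\<lambda>u v. sweedler K D P d (\<lambda>x y. f u v x y))"
    by (intro bilinear_mapI) (intro linear_intros P f1 f2 | assumption)+
  then have "bilinear_map K C C P (\<lambda>u v. tensor_lift P (comult D d) (\<lambda>x y. f u v x y))"
    by (rule bilinear_map_cong[OF C.module_C C.module_C, rotated]) (simp add: e)
  from C.tensor_lift_sweedler[OF P.abelian_group_axioms bilinear_map_balanced[OF this] c]
  show ?thesis by (simp add: e)
qed

text \<open>The hypothesis \<open>eq\<close> says that \<open>m\<close> respects comultiplication as
  a map on C \<otimes> D. The product of a bialgebra and the two actions of a matched pair are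
  instances, so one transfer argument serves all three.\<close>

lemma sweedler_comult_image:
  assumes C: "k_coalgebra K C" and D: "k_coalgebra K D" and E: "k_coalgebra K E" and P: "module K P"
    and m: "bilinear_map K C D E m" and \<phi>: "bilinear_map K E E P \<phi>"
    and c: "c \<in> carrier C" and d: "d \<in> carrier D"
    and eq: "comult E (m c d) = tensor_lift (tensor K E E) (comult C c) (\<lambda>c\<^sub>1 c\<^sub>2.
      tensor_lift (tensor K E E) (comult D d) (\<lambda>d\<^sub>1 d\<^sub>2. pure_tensor K E E (m c\<^sub>1 d\<^sub>1) (m c\<^sub>2 d\<^sub>2)))"
  shows "sweedler K E P (m c d) (\<lambda>u v. \<phi> u v) =
    sweedler K C P c (\<lambda>c\<^sub>1 c\<^sub>2. sweedler K D P d (\<lambda>d\<^sub>1 d\<^sub>2. \<phi> (m c\<^sub>1 d\<^sub>1) (m c\<^sub>2 d\<^sub>2)))"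
proof -
  interpret C: k_coalgebra K C by fact
  interpret D: k_coalgebra K D by fact
  interpret E: k_coalgebra K E by fact
  interpret P: module K P by fact
  interpret T: tensor_pair K E E by (rule E.tensor_pair_C)
  note m_closed = bilinear_mapD(1)[OF m]
  let ?T = "tensor K E E"
  have mc: "m c d \<in> carrier E" using m_closed c d .
  have tl: "(\<lambda>t. tensor_lift P t \<phi>) \<in> module_hom K ?T P"
    by (rule T.tensor_lift_hom[OF P \<phi>])
  have "comult E (m c d) = sweedler K C ?T c (\<lambda>c\<^sub>1 c\<^sub>2. sweedler K D ?T d (\<lambda>d\<^sub>1 d\<^sub>2.
      pure_tensor K E E (m c\<^sub>1 d\<^sub>1) (m c\<^sub>2 d\<^sub>2)))"
    unfolding eq
    by (rule tensor_lift_sweedler2[OF C D T.module_tensor c d])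
      (intro linear_intros E.module_C bilinear_map_left[OF m] bilinear_map_right[OF m] m_closed | assumption)+
  then have "sweedler K E P (m c d) \<phi> =
      tensor_lift P (sweedler K C ?T c (\<lambda>c\<^sub>1 c\<^sub>2. sweedler K D ?T d (\<lambda>d\<^sub>1 d\<^sub>2.
        pure_tensor K E E (m c\<^sub>1 d\<^sub>1) (m c\<^sub>2 d\<^sub>2)))) \<phi>"
    using E.tensor_lift_sweedler[OF P.abelian_group_axioms bilinear_map_balanced[OF \<phi>] mc] by simp
  also have "\<dots> = sweedler K C P c (\<lambda>c\<^sub>1 c\<^sub>2. tensor_lift P (sweedler K D ?T d (\<lambda>d\<^sub>1 d\<^sub>2.
        pure_tensor K E E (m c\<^sub>1 d\<^sub>1) (m c\<^sub>2 d\<^sub>2))) \<phi>)"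
    by (intro sweedler_module_hom[OF T.module_tensor P tl] sweedler_closed
        T.abelian_group_tensor T.tens_closed m_closed)
  also have "\<dots> = sweedler K C P c (\<lambda>c\<^sub>1 c\<^sub>2. sweedler K D P d (\<lambda>d\<^sub>1 d\<^sub>2. tensor_lift P (
        pure_tensor K E E (m c\<^sub>1 d\<^sub>1) (m c\<^sub>2 d\<^sub>2)) \<phi>))"
    by (intro sweedler_cong sweedler_module_hom[OF T.module_tensor P tl]
        T.abelian_group_tensor T.tens_closed m_closed)
  also have "\<dots> = sweedler K C P c (\<lambda>c\<^sub>1 c\<^sub>2. sweedler K D P d (\<lambda>d\<^sub>1 d\<^sub>2. \<phi> (m c\<^sub>1 d\<^sub>1) (m c\<^sub>2 d\<^sub>2)))"
    by (intro sweedler_cong sweedler_cong T.tensor_lift_tens P.abelian_group_axioms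
        bilinear_map_balanced \<phi> m_closed)
  finally show ?thesis .
qed

text \<open>The counit laws of C \<otimes> D: the two scalars are pulled out of one sum at a time,
  and each sum collapses by the law of its own coalgebra.\<close>

lemma
  assumes C: "k_coalgebra K C" and D: "k_coalgebra K D" and P: "module K P"
    and \<phi>: "bilinear_map K C D P \<phi>" and c: "c \<in> carrier C" and d: "d \<in> carrier D"
  shows sweedler_joint_counit_right:
    "sweedler K C P c (\<lambda>x y. sweedler K D P d (\<lambda>x' y'. counit C y \<odot>\<^bsub>P\<^esub> (counit D y' \<odot>\<^bsub>P\<^esub> \<phi> x x'))) = \<phi> c d"
  and sweedler_joint_counit_left:
    "sweedler K C P c (\<lambda>x y. sweedler K D P d (\<lambda>x' y'. counit C x \<odot>\<^bsub>P\<^esub> (counit D x' \<odot>\<^bsub>P\<^esub> \<phi> y y'))) = \<phi> c d"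
proof -
  interpret C: k_coalgebra K C by fact
  interpret D: k_coalgebra K D by fact
  interpret P: module K P by fact
  note \<phi>_closed = bilinear_mapD(1)[OF \<phi>]
  have \<phi>1: "(\<lambda>v. \<phi> u v) \<in> module_hom K D P" if "u \<in> carrier C" for u
    using \<phi> that by (simp add: bilinear_map_def)
  have \<phi>2: "(\<lambda>u. \<phi> u v) \<in> module_hom K C P" if "v \<in> carrier D" for v
    using \<phi> that by (simp add: bilinear_map_def)
  show "sweedler K C P c (\<lambda>x y. sweedler K D P d (\<lambda>x' y'. counit C y \<odot>\<^bsub>P\<^esub> (counit D y' \<odot>\<^bsub>P\<^esub> \<phi> x x'))) = \<phi> c d"
    using c d
    by (simp add: sweedler_smult[OF P, symmetric] \<phi>_closed D.sweedler_counit_right[OF P \<phi>1]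
        C.sweedler_counit_right[OF P \<phi>2])
  show "sweedler K C P c (\<lambda>x y. sweedler K D P d (\<lambda>x' y'. counit C x \<odot>\<^bsub>P\<^esub> (counit D x' \<odot>\<^bsub>P\<^esub> \<phi> y y'))) = \<phi> c d"
    using c d
    by (simp add: sweedler_smult[OF P, symmetric] \<phi>_closed D.sweedler_counit_left[OF P \<phi>1]
        C.sweedler_counit_left[OF P \<phi>2])
qed

lemma module_scalar:
  assumes "cring K"
  shows "module K (scalar_module K)"
proof -
  interpret cring K by fact
  have "abelian_group (scalar_module K)"
    by (rule abelian_groupI)
      (auto simp: scalar_module_def a_ac intro: bexI[of _ "\<ominus>\<^bsub>K\<^esub> x" for x] l_neg)
  then show ?thesis
    by (intro moduleI) (auto simp: scalar_module_def l_distr r_distr m_assoc is_cring)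
qed

section \<open>Convolution of bilinear maps\<close>

definition convolution ::
  "'k ring \<Rightarrow> ('k, 'c) bialgebra \<Rightarrow> ('k, 'd) bialgebra \<Rightarrow> ('k, 'h) bialgebra
    \<Rightarrow> ('c \<Rightarrow> 'd \<Rightarrow> 'h) \<Rightarrow> ('c \<Rightarrow> 'd \<Rightarrow> 'h) \<Rightarrow> 'c \<Rightarrow> 'd \<Rightarrow> 'h" where
  "convolution K C D H f g c d =
    sweedler K C H c (\<lambda>c\<^sub>1 c\<^sub>2. sweedler K D H d (\<lambda>d\<^sub>1 d\<^sub>2. f c\<^sub>1 d\<^sub>1 \<otimes>\<^bsub>H\<^esub> g c\<^sub>2 d\<^sub>2))"

lemma convolution_cong:
  assumes "\<And>c d. c \<in> carrier C \<Longrightarrow> d \<in> carrier D \<Longrightarrow> f c d = f' c d"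
    and "\<And>c d. c \<in> carrier C \<Longrightarrow> d \<in> carrier D \<Longrightarrow> g c d = g' c d"
  shows "convolution K C D H f g c d = convolution K C D H f' g' c d"
  unfolding convolution_def by (intro sweedler_cong) (simp add: assms)

text \<open>The convolution algebra of linear maps from C \<otimes> D to \<open>H\<close>, in
  curried form. Two coalgebras occur because the products x y in a Hopf algebra and b a in the
  double cross product are functions of two variables.\<close>

locale convolution_algebra =
  C: k_coalgebra K C + D: k_coalgebra K D + H: k_algebra K H
  for K :: "'k ring" and C :: "('k, 'c) bialgebra" and D :: "('k, 'd) bialgebra"
    and H :: "('k, 'h) bialgebra"
begin

abbreviation conv (infixl \<open>\<star>\<close> 70) where "f \<star> g \<equiv> convolution K C D H f g"
abbreviation conv_unit where "conv_unit \<equiv> \<lambda>c d. counit C c \<odot>\<^bsub>H\<^esub> (counit D d \<odot>\<^bsub>H\<^esub> \<one>\<^bsub>H\<^esub>)"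
abbreviation "bil \<equiv> bilinear_map K C D H"

lemma convolution_bilinear:
  assumes f: "bil f" and g: "bil g"
  shows "bil (f \<star> g)"
  unfolding convolution_def
  by (rule bilinear_mapI)
    (intro linear_intros bilinear_map_left[OF f] bilinear_map_right[OF f] bilinear_map_left[OF g]
      bilinear_map_right[OF g] bilinear_mapD(1)[OF f] bilinear_mapD(1)[OF g] H.module_A | assumption)+

lemma
  assumes f: "bil f" and c: "c \<in> carrier C" and d: "d \<in> carrier D"
  shows convolution_unit_right: "(f \<star> conv_unit) c d = f c d"
    and convolution_unit_left: "(conv_unit \<star> f) c d = f c d"
  using sweedler_joint_counit_right[OF C.k_coalgebra_axioms D.k_coalgebra_axioms H.module_A f c d]
    sweedler_joint_counit_left[OF C.k_coalgebra_axioms D.k_coalgebra_axioms H.module_A f c d]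
  by (simp_all add: convolution_def bilinear_mapD(1)[OF f] H.smult_mult_right H.smult_mult_left)

lemma convolution_assoc:
  assumes f: "bil f" and g: "bil g" and h: "bil h" and c: "c \<in> carrier C" and d: "d \<in> carrier D"
  shows "((f \<star> g) \<star> h) c d = (f \<star> (g \<star> h)) c d"
proof -
  note H = H.k_algebra_axioms
  note closed = bilinear_mapD(1)[OF f] bilinear_mapD(1)[OF g] bilinear_mapD(1)[OF h]
  note closed' = closed sweedler_closed H.abelian_group_axioms
  note lins = linear_intros bilinear_map_left[OF f] bilinear_map_right[OF f] bilinear_map_left[OF g]
    bilinear_map_right[OF g] bilinear_map_left[OF h] bilinear_map_right[OF h] closed H.m_closed
  have "((f \<star> g) \<star> h) c d = sweedler K C H c (\<lambda>x y. sweedler K D H d (\<lambda>x' y'.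
      sweedler K C H x (\<lambda>c\<^sub>1 c\<^sub>2. sweedler K D H x' (\<lambda>d\<^sub>1 d\<^sub>2. f c\<^sub>1 d\<^sub>1 \<otimes>\<^bsub>H\<^esub> g c\<^sub>2 d\<^sub>2 \<otimes>\<^bsub>H\<^esub> h y y'))))"
    by (simp add: convolution_def closed' sweedler_mult_right[OF H])
  also have "\<dots> = sweedler K C H c (\<lambda>x y. sweedler K D H d (\<lambda>x' y'.
      sweedler K C H y (\<lambda>c\<^sub>1 c\<^sub>2. sweedler K D H y' (\<lambda>d\<^sub>1 d\<^sub>2. f x x' \<otimes>\<^bsub>H\<^esub> g c\<^sub>1 d\<^sub>1 \<otimes>\<^bsub>H\<^esub> h c\<^sub>2 d\<^sub>2))))"
    by (rule sweedler_joint_coassoc[OF C.k_coalgebra_axioms D.k_coalgebra_axioms H.module_A c d])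
      (intro lins | assumption)+
  also have "\<dots> = (f \<star> (g \<star> h)) c d"
    by (simp add: convolution_def closed' sweedler_mult_left[OF H] H.m_assoc)
  finally show ?thesis .
qed

text \<open>A left inverse and a right inverse of \<open>g\<close> agree. Identities for antipodes
  are proved by recognising both sides as inverses of one product map.\<close>

lemma convolution_inverse_unique:
  assumes f: "bil f" and g: "bil g" and h: "bil h"
    and fg: "\<And>c d. c \<in> carrier C \<Longrightarrow> d \<in> carrier D \<Longrightarrow> (f \<star> g) c d = conv_unit c d"
    and gh: "\<And>c d. c \<in> carrier C \<Longrightarrow> d \<in> carrier D \<Longrightarrow> (g \<star> h) c d = conv_unit c d"
    and c: "c \<in> carrier C" and d: "d \<in> carrier D"
  shows "f c d = h c d"
proof -
  have "f c d = (f \<star> (g \<star> h)) c d"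
    using convolution_unit_right[OF f c d] by (simp add: gh cong: convolution_cong)
  also have "\<dots> = ((f \<star> g) \<star> h) c d" by (rule convolution_assoc[OF f g h c d, symmetric])
  also have "\<dots> = h c d"
    using convolution_unit_left[OF h c d] by (simp add: fg cong: convolution_cong)
  finally show ?thesis .
qed

end

context k_bialgebra begin

lemma coalgebra: "k_coalgebra K A" ..
lemma algebra: "k_algebra K A" ..

lemma sweedler_mult:
  assumes "module K P" "bilinear_map K A A P \<phi>" "x \<in> carrier A" "y \<in> carrier A"
  shows "sweedler K A P (x \<otimes>\<^bsub>A\<^esub> y) (\<lambda>u v. \<phi> u v) =
    sweedler K A P x (\<lambda>x\<^sub>1 x\<^sub>2. sweedler K A P y (\<lambda>y\<^sub>1 y\<^sub>2. \<phi> (x\<^sub>1 \<otimes>\<^bsub>A\<^esub> y\<^sub>1) (x\<^sub>2 \<otimes>\<^bsub>A\<^esub> y\<^sub>2)))"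
  by (rule sweedler_comult_image[OF coalgebra coalgebra coalgebra assms(1) mult_bilinear assms(2-4)
        comult_mult[OF assms(3,4)]])

lemma sweedler_one:
  assumes P: "module K P" and \<phi>: "bilinear_map K A A P \<phi>"
  shows "sweedler K A P \<one>\<^bsub>A\<^esub> (\<lambda>u v. \<phi> u v) = \<phi> \<one>\<^bsub>A\<^esub> \<one>\<^bsub>A\<^esub>"
proof -
  interpret P: module K P by fact
  interpret T: tensor_pair K A A by (rule tensor_pair_C)
  show ?thesis
    using tensor_lift_sweedler[OF P.abelian_group_axioms bilinear_map_balanced[OF \<phi>] one_closed]
      T.tensor_lift_tens[OF P.abelian_group_axioms bilinear_map_balanced[OF \<phi>] one_closed one_closed]
    by (simp add: comult_one)
qed

end

section \<open>The antipode of a Hopf algebra\<close>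

definition antipode :: "'k ring \<Rightarrow> ('k, 'a) bialgebra \<Rightarrow> 'a \<Rightarrow> 'a" where
  "antipode K A = (SOME S. S \<in> module_hom K A A \<and> (\<forall>x\<in>carrier A.
      sweedler K A A x (\<lambda>x\<^sub>1 x\<^sub>2. S x\<^sub>1 \<otimes>\<^bsub>A\<^esub> x\<^sub>2) = counit A x \<odot>\<^bsub>A\<^esub> \<one>\<^bsub>A\<^esub> \<and>
      sweedler K A A x (\<lambda>x\<^sub>1 x\<^sub>2. x\<^sub>1 \<otimes>\<^bsub>A\<^esub> S x\<^sub>2) = counit A x \<odot>\<^bsub>A\<^esub> \<one>\<^bsub>A\<^esub>))"

context hopf_algebra begin

abbreviation "S \<equiv> antipode K A"

text \<open>The existence axiom is phrased with lifts; linearity of a witness makes the two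
  integrands bilinear and turns its equations into the Sweedler form that the choice asks
  for.\<close>

lemma
  shows antipode_hom: "S \<in> module_hom K A A"
    and antipode_left: "x \<in> carrier A \<Longrightarrow>
      sweedler K A A x (\<lambda>x\<^sub>1 x\<^sub>2. S x\<^sub>1 \<otimes>\<^bsub>A\<^esub> x\<^sub>2) = counit A x \<odot>\<^bsub>A\<^esub> \<one>\<^bsub>A\<^esub>"
    and antipode_right: "x \<in> carrier A \<Longrightarrow>
      sweedler K A A x (\<lambda>x\<^sub>1 x\<^sub>2. x\<^sub>1 \<otimes>\<^bsub>A\<^esub> S x\<^sub>2) = counit A x \<odot>\<^bsub>A\<^esub> \<one>\<^bsub>A\<^esub>"
proof -
  obtain T where T: "T \<in> module_hom K A A"
    and eq: "\<And>x. x \<in> carrier A \<Longrightarrow>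
      tensor_lift A (comult A x) (\<lambda>x\<^sub>1 x\<^sub>2. T x\<^sub>1 \<otimes>\<^bsub>A\<^esub> x\<^sub>2) = counit A x \<odot>\<^bsub>A\<^esub> \<one>\<^bsub>A\<^esub>"
      "\<And>x. x \<in> carrier A \<Longrightarrow>
      tensor_lift A (comult A x) (\<lambda>x\<^sub>1 x\<^sub>2. x\<^sub>1 \<otimes>\<^bsub>A\<^esub> T x\<^sub>2) = counit A x \<odot>\<^bsub>A\<^esub> \<one>\<^bsub>A\<^esub>"
    using antipode_exists by blast
  have "bilinear_map K A A A (\<lambda>x\<^sub>1 x\<^sub>2. T x\<^sub>1 \<otimes>\<^bsub>A\<^esub> x\<^sub>2)"
    using T by (intro bilinear_mapI) (intro linear_intros module_hom_in[OF T] | simp)+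
  moreover have "bilinear_map K A A A (\<lambda>x\<^sub>1 x\<^sub>2. x\<^sub>1 \<otimes>\<^bsub>A\<^esub> T x\<^sub>2)"
    using T by (intro bilinear_mapI) (intro linear_intros module_hom_in[OF T] | simp)+
  ultimately have "balanced_map K A A A (\<lambda>x\<^sub>1 x\<^sub>2. T x\<^sub>1 \<otimes>\<^bsub>A\<^esub> x\<^sub>2)"
    "balanced_map K A A A (\<lambda>x\<^sub>1 x\<^sub>2. x\<^sub>1 \<otimes>\<^bsub>A\<^esub> T x\<^sub>2)"
    by (simp_all add: bilinear_map_balanced)
  note tensor_lift_sweedler[OF abelian_group_axioms this(1)] tensor_lift_sweedler[OF abelian_group_axioms this(2)]
  with T eq have "\<exists>T. T \<in> module_hom K A A \<and> (\<forall>x\<in>carrier A.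
      sweedler K A A x (\<lambda>x\<^sub>1 x\<^sub>2. T x\<^sub>1 \<otimes>\<^bsub>A\<^esub> x\<^sub>2) = counit A x \<odot>\<^bsub>A\<^esub> \<one>\<^bsub>A\<^esub> \<and>
      sweedler K A A x (\<lambda>x\<^sub>1 x\<^sub>2. x\<^sub>1 \<otimes>\<^bsub>A\<^esub> T x\<^sub>2) = counit A x \<odot>\<^bsub>A\<^esub> \<one>\<^bsub>A\<^esub>)"
    by (intro exI[of _ T]) simp
  from someI_ex[OF this, folded antipode_def]
  show "S \<in> module_hom K A A"
    and "x \<in> carrier A \<Longrightarrow>
      sweedler K A A x (\<lambda>x\<^sub>1 x\<^sub>2. S x\<^sub>1 \<otimes>\<^bsub>A\<^esub> x\<^sub>2) = counit A x \<odot>\<^bsub>A\<^esub> \<one>\<^bsub>A\<^esub>"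
    and "x \<in> carrier A \<Longrightarrow>
      sweedler K A A x (\<lambda>x\<^sub>1 x\<^sub>2. x\<^sub>1 \<otimes>\<^bsub>A\<^esub> S x\<^sub>2) = counit A x \<odot>\<^bsub>A\<^esub> \<one>\<^bsub>A\<^esub>"
    by blast+
qed

lemma antipode_closed [simp]: "x \<in> carrier A \<Longrightarrow> S x \<in> carrier A"
  by (rule module_hom_in[OF antipode_hom])

lemma lin_antipode [linear_intros]: "F \<in> module_hom K M A \<Longrightarrow> (\<lambda>x. S (F x)) \<in> module_hom K M A"
  using antipode_hom by (rule module_hom_compose[rotated])

lemma antipode_one: "S \<one>\<^bsub>A\<^esub> = \<one>\<^bsub>A\<^esub>"
proof -
  have "bilinear_map K A A A (\<lambda>x\<^sub>1 x\<^sub>2. S x\<^sub>1 \<otimes>\<^bsub>A\<^esub> x\<^sub>2)"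
    by (rule bilinear_mapI) (intro linear_intros antipode_closed | assumption)+
  from sweedler_one[OF module_A this] antipode_left[of "\<one>\<^bsub>A\<^esub>"]
  show ?thesis by (simp add: counit_one)
qed

text \<open>Both S(x y) and S(y) S(x) are convolution inverses of the multiplication: the first
  because \<Delta> is multiplicative, the second because x_1 y_1 S(y_2) S(x_2) collapses from the
  inside.\<close>

lemma antipode_mult:
  assumes "x \<in> carrier A" "y \<in> carrier A"
  shows "S (x \<otimes>\<^bsub>A\<^esub> y) = S y \<otimes>\<^bsub>A\<^esub> S x"
proof -
  interpret conv: convolution_algebra K A A A ..
  let ?f = "\<lambda>x y. S (x \<otimes>\<^bsub>A\<^esub> y)" and ?h = "\<lambda>x y. S y \<otimes>\<^bsub>A\<^esub> S x"
  have f: "bilinear_map K A A A ?f"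
    by (rule bilinear_mapI) (intro linear_intros antipode_closed | assumption)+
  have h: "bilinear_map K A A A ?h"
    by (rule bilinear_mapI) (intro linear_intros antipode_closed | assumption)+
  have b: "bilinear_map K A A A (\<lambda>x\<^sub>1 x\<^sub>2. S x\<^sub>1 \<otimes>\<^bsub>A\<^esub> x\<^sub>2)"
    by (rule bilinear_mapI) (intro linear_intros antipode_closed | assumption)+
  have fg: "convolution K A A A ?f (monoid.mult A) c d = counit A c \<odot>\<^bsub>A\<^esub> (counit A d \<odot>\<^bsub>A\<^esub> \<one>\<^bsub>A\<^esub>)"
    if c: "c \<in> carrier A" and d: "d \<in> carrier A" for c d
    unfolding convolution_def using sweedler_mult[OF module_A b c d] c d
    by (simp add: antipode_left counit_mult VS.smult_assoc1)
  have gh: "convolution K A A A (monoid.mult A) ?h c d = counit A c \<odot>\<^bsub>A\<^esub> (counit A d \<odot>\<^bsub>A\<^esub> \<one>\<^bsub>A\<^esub>)"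
    if c: "c \<in> carrier A" and d: "d \<in> carrier A" for c d
  proof -
    have "convolution K A A A (monoid.mult A) ?h c d =
        sweedler K A A c (\<lambda>c\<^sub>1 c\<^sub>2. sweedler K A A d (\<lambda>d\<^sub>1 d\<^sub>2. (c\<^sub>1 \<otimes>\<^bsub>A\<^esub> (d\<^sub>1 \<otimes>\<^bsub>A\<^esub> S d\<^sub>2)) \<otimes>\<^bsub>A\<^esub> S c\<^sub>2))"
      unfolding convolution_def by (simp add: m_assoc)
    also have "\<dots> = sweedler K A A c (\<lambda>c\<^sub>1 c\<^sub>2. (c\<^sub>1 \<otimes>\<^bsub>A\<^esub> (sweedler K A A d (\<lambda>d\<^sub>1 d\<^sub>2. d\<^sub>1 \<otimes>\<^bsub>A\<^esub> S d\<^sub>2))) \<otimes>\<^bsub>A\<^esub> S c\<^sub>2)"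
      by (simp add: sweedler_mult_left[OF algebra] sweedler_mult_right[OF algebra])
    also have "\<dots> = sweedler K A A c (\<lambda>c\<^sub>1 c\<^sub>2. counit A d \<odot>\<^bsub>A\<^esub> (c\<^sub>1 \<otimes>\<^bsub>A\<^esub> S c\<^sub>2))"
      using d by (simp add: antipode_right smult_mult_left smult_mult_right)
    also have "\<dots> = counit A d \<odot>\<^bsub>A\<^esub> (counit A c \<odot>\<^bsub>A\<^esub> \<one>\<^bsub>A\<^esub>)"
      using c d by (simp add: sweedler_smult[OF module_A, symmetric] antipode_right)
    also have "\<dots> = counit A c \<odot>\<^bsub>A\<^esub> (counit A d \<odot>\<^bsub>A\<^esub> \<one>\<^bsub>A\<^esub>)"
      using c d by (simp add: VS.smult_assoc1[symmetric] VS.R.m_comm)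
    finally show ?thesis .
  qed
  show ?thesis
    using conv.convolution_inverse_unique[OF f mult_bilinear h fg gh assms] .
qed

text \<open>Apply \<epsilon> to S(x_1) x_2 = \<epsilon>(x) 1; multiplicativity splits the factors
  and the counit law removes the second leg.\<close>

lemma counit_antipode:
  assumes "x \<in> carrier A"
  shows "counit A (S x) = counit A x"
proof -
  interpret K: module K "scalar_module K"
    by (rule module_scalar) (rule VS.R.is_cring)
  have "counit A x = counit A (sweedler K A A x (\<lambda>x\<^sub>1 x\<^sub>2. S x\<^sub>1 \<otimes>\<^bsub>A\<^esub> x\<^sub>2))"
    using assms module_hom_smult[OF counit_linear, of "counit A x" "\<one>\<^bsub>A\<^esub>"]
    by (simp add: antipode_left counit_one scalar_module_def)
  also have "\<dots> = sweedler K A (scalar_module K) x (\<lambda>x\<^sub>1 x\<^sub>2. counit A (S x\<^sub>1 \<otimes>\<^bsub>A\<^esub> x\<^sub>2))"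
    by (rule sweedler_module_hom[OF module_A K.module_axioms counit_linear]) simp
  also have "\<dots> = sweedler K A (scalar_module K) x
      (\<lambda>x\<^sub>1 x\<^sub>2. counit A x\<^sub>2 \<odot>\<^bsub>scalar_module K\<^esub> counit A (S x\<^sub>1))"
    by (simp add: counit_mult scalar_module_def VS.R.m_comm)
  also have "\<dots> = counit A (S x)"
    by (rule sweedler_counit_right[OF K.module_axioms _ assms])
      (intro linear_intros)
  finally show ?thesis by simp
qed

end

section \<open>The double cross product as a ring\<close>

text \<open>A fixed list expressing \<open>t\<close> replaces the choice inside the lift, after
  which linearity in the parameter is termwise.\<close>

lemma (in tensor_pair) lin_tensor_lift_inner:
  assumes P: "module K P" and t: "t \<in> carrier T"
    and g: "\<And>u v. u \<in> carrier U \<Longrightarrow> v \<in> carrier V \<Longrightarrow> (\<lambda>x. g x u v) \<in> module_hom K M P"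
    and bil: "\<And>x. x \<in> carrier M \<Longrightarrow> bilinear_map K U V P (g x)"
    and M: "module K M"
  shows "(\<lambda>x. tensor_lift P t (\<lambda>u v. g x u v)) \<in> module_hom K M P"
proof -
  interpret P: module K P by fact
  interpret M: module K M by fact
  obtain l where l: "set l \<subseteq> carrier U \<times> carrier V" "t = tsum T l tens"
    using tensor_list_ex[OF t] by blast
  have e: "tensor_lift P t (\<lambda>u v. g x u v) = tsum P l (\<lambda>u v. g x u v)" if "x \<in> carrier M" for x
    unfolding l(2) using that bil l(1)
    by (intro tensor_lift_tsum P.abelian_group_axioms bilinear_map_balanced)
  have "(\<lambda>x. tsum P l (\<lambda>u v. g x u v)) \<in> module_hom K M P"
    using l(1)
  proof (induction l)
    case (Cons p l)
    then show ?case using g[of "fst p" "snd p"]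
      by (cases p) (auto simp: module_hom_def Pi_iff P.smult_r_distr P.a_ac)
  qed (simp add: module_hom_def)
  then show ?thesis using e by (simp add: module_hom_def Pi_iff)
qed

section \<open>The two factors acting on the tensor product A \<otimes> B\<close>

context matched_pair begin

sublocale A: hopf_algebra K A by (rule hopf_A)
sublocale B: hopf_algebra K B by (rule hopf_B)
sublocale T: tensor_pair K A B
  using A.module_A B.module_A by (simp add: tensor_pair_def)
sublocale L: left_module_coalgebra K B A "(\<rhd>)" by (rule left_action)
sublocale R: right_module_coalgebra K A B "(\<lhd>\<^sub>r)" by (rule right_action)

abbreviation AB where "AB \<equiv> tensor K A B"
abbreviation bowtie (infixl \<open>\<bowtie>\<close> 65) where "a \<bowtie> b \<equiv> pure_tensor K A B a b"
abbreviation H where "H \<equiv> double_cross_product K A B (\<rhd>) (\<lhd>\<^sub>r)"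

lemma lact_closed [simp]: "b \<in> carrier B \<Longrightarrow> a \<in> carrier A \<Longrightarrow> b \<rhd> a \<in> carrier A"
  using bilinear_mapD(1)[OF L.act_bilinear] .

lemma ract_closed [simp]: "b \<in> carrier B \<Longrightarrow> a \<in> carrier A \<Longrightarrow> b \<lhd>\<^sub>r a \<in> carrier B"
  using bilinear_mapD(1)[OF R.act_bilinear] .

lemmas act_linear [linear_intros] =
  bilinear_map_left[OF L.act_bilinear] bilinear_map_right[OF L.act_bilinear]
  bilinear_map_left[OF R.act_bilinear] bilinear_map_right[OF R.act_bilinear]

lemmas mods [simp] = A.module_A B.module_A T.module_tensor
lemmas coalgs = A.coalgebra B.coalgebra

lemma sweedler_lact:
  assumes "module K P" "bilinear_map K A A P \<phi>" "b \<in> carrier B" "a \<in> carrier A"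
  shows "sweedler K A P (b \<rhd> a) (\<lambda>u v. \<phi> u v) =
    sweedler K B P b (\<lambda>b\<^sub>1 b\<^sub>2. sweedler K A P a (\<lambda>a\<^sub>1 a\<^sub>2. \<phi> (b\<^sub>1 \<rhd> a\<^sub>1) (b\<^sub>2 \<rhd> a\<^sub>2)))"
  by (rule sweedler_comult_image[OF B.coalgebra A.coalgebra A.coalgebra assms(1) L.act_bilinear assms(2-4)
        L.act_comult[OF assms(3,4)]])

lemma sweedler_ract:
  assumes "module K P" "bilinear_map K B B P \<phi>" "b \<in> carrier B" "a \<in> carrier A"
  shows "sweedler K B P (b \<lhd>\<^sub>r a) (\<lambda>u v. \<phi> u v) =
    sweedler K B P b (\<lambda>b\<^sub>1 b\<^sub>2. sweedler K A P a (\<lambda>a\<^sub>1 a\<^sub>2. \<phi> (b\<^sub>1 \<lhd>\<^sub>r a\<^sub>1) (b\<^sub>2 \<lhd>\<^sub>r a\<^sub>2)))"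
  by (rule sweedler_comult_image[OF B.coalgebra A.coalgebra B.coalgebra assms(1) R.act_bilinear assms(2-4)
        R.act_comult[OF assms(3,4)]])

lemma mult_ract':
  assumes "b \<in> carrier B" "d \<in> carrier B" "a \<in> carrier A"
  shows "(b \<otimes>\<^bsub>B\<^esub> d) \<lhd>\<^sub>r a = sweedler K B B d (\<lambda>d\<^sub>1 d\<^sub>2. sweedler K A B a (\<lambda>a\<^sub>1 a\<^sub>2.
    (b \<lhd>\<^sub>r (d\<^sub>1 \<rhd> a\<^sub>1)) \<otimes>\<^bsub>B\<^esub> (d\<^sub>2 \<lhd>\<^sub>r a\<^sub>2)))"
  unfolding mult_ract[OF assms]
  by (rule tensor_lift_sweedler2[OF B.coalgebra A.coalgebra B.module_A assms(2,3)])
    (use assms in \<open>intro linear_intros | simp\<close>)+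

lemma lact_mult':
  assumes "b \<in> carrier B" "a \<in> carrier A" "c \<in> carrier A"
  shows "b \<rhd> (a \<otimes>\<^bsub>A\<^esub> c) = sweedler K B A b (\<lambda>b\<^sub>1 b\<^sub>2. sweedler K A A a (\<lambda>a\<^sub>1 a\<^sub>2.
    (b\<^sub>1 \<rhd> a\<^sub>1) \<otimes>\<^bsub>A\<^esub> ((b\<^sub>2 \<lhd>\<^sub>r a\<^sub>2) \<rhd> c)))"
  unfolding lact_mult[OF assms]
  by (rule tensor_lift_sweedler2[OF B.coalgebra A.coalgebra A.module_A assms(1,2)])
    (use assms in \<open>intro linear_intros | simp\<close>)+

lemma sweedler_compatible:
  assumes P: "module K P" and \<phi>: "bilinear_map K B A P \<phi>" and b: "b \<in> carrier B" and a: "a \<in> carrier A"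
  shows "sweedler K B P b (\<lambda>b\<^sub>1 b\<^sub>2. sweedler K A P a (\<lambda>a\<^sub>1 a\<^sub>2. \<phi> (b\<^sub>1 \<lhd>\<^sub>r a\<^sub>1) (b\<^sub>2 \<rhd> a\<^sub>2))) =
    sweedler K B P b (\<lambda>b\<^sub>1 b\<^sub>2. sweedler K A P a (\<lambda>a\<^sub>1 a\<^sub>2. \<phi> (b\<^sub>2 \<lhd>\<^sub>r a\<^sub>2) (b\<^sub>1 \<rhd> a\<^sub>1)))"
proof -
  interpret P: module K P by fact
  interpret BA: tensor_pair K B A by (simp add: tensor_pair_def)
  let ?T = "tensor K B A"
  have tl: "(\<lambda>t. tensor_lift P t \<phi>) \<in> module_hom K ?T P"
    by (rule BA.tensor_lift_hom[OF P \<phi>])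
  have e: "tensor_lift P (pure_tensor K B A x y) \<phi> = \<phi> x y" if "x \<in> carrier B" "y \<in> carrier A" for x y
    using that by (rule BA.tensor_lift_tens[OF P.abelian_group_axioms bilinear_map_balanced[OF \<phi>]])
  have e1: "tensor_lift ?T (comult B b) (\<lambda>b\<^sub>1 b\<^sub>2. tensor_lift ?T (comult A a) (\<lambda>a\<^sub>1 a\<^sub>2.
      pure_tensor K B A (b\<^sub>1 \<lhd>\<^sub>r a\<^sub>1) (b\<^sub>2 \<rhd> a\<^sub>2))) =
    sweedler K B ?T b (\<lambda>b\<^sub>1 b\<^sub>2. sweedler K A ?T a (\<lambda>a\<^sub>1 a\<^sub>2. pure_tensor K B A (b\<^sub>1 \<lhd>\<^sub>r a\<^sub>1) (b\<^sub>2 \<rhd> a\<^sub>2)))"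
    by (rule tensor_lift_sweedler2[OF B.coalgebra A.coalgebra BA.module_tensor b a])
      (intro linear_intros | simp)+
  have e2: "tensor_lift ?T (comult B b) (\<lambda>b\<^sub>1 b\<^sub>2. tensor_lift ?T (comult A a) (\<lambda>a\<^sub>1 a\<^sub>2.
      pure_tensor K B A (b\<^sub>2 \<lhd>\<^sub>r a\<^sub>2) (b\<^sub>1 \<rhd> a\<^sub>1))) =
    sweedler K B ?T b (\<lambda>b\<^sub>1 b\<^sub>2. sweedler K A ?T a (\<lambda>a\<^sub>1 a\<^sub>2. pure_tensor K B A (b\<^sub>2 \<lhd>\<^sub>r a\<^sub>2) (b\<^sub>1 \<rhd> a\<^sub>1)))"
    by (rule tensor_lift_sweedler2[OF B.coalgebra A.coalgebra BA.module_tensor b a])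
      (intro linear_intros | simp)+
  have push: "tensor_lift P (sweedler K B ?T b (\<lambda>b\<^sub>1 b\<^sub>2. sweedler K A ?T a (\<lambda>a\<^sub>1 a\<^sub>2.
      pure_tensor K B A (f b\<^sub>1 b\<^sub>2 a\<^sub>1 a\<^sub>2) (g b\<^sub>1 b\<^sub>2 a\<^sub>1 a\<^sub>2)))) \<phi> =
    sweedler K B P b (\<lambda>b\<^sub>1 b\<^sub>2. sweedler K A P a (\<lambda>a\<^sub>1 a\<^sub>2. \<phi> (f b\<^sub>1 b\<^sub>2 a\<^sub>1 a\<^sub>2) (g b\<^sub>1 b\<^sub>2 a\<^sub>1 a\<^sub>2)))"
    if "\<And>b\<^sub>1 b\<^sub>2 a\<^sub>1 a\<^sub>2. b\<^sub>1 \<in> carrier B \<Longrightarrow> b\<^sub>2 \<in> carrier B \<Longrightarrow> a\<^sub>1 \<in> carrier A \<Longrightarrow> a\<^sub>2 \<in> carrier A \<Longrightarrow>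
      f b\<^sub>1 b\<^sub>2 a\<^sub>1 a\<^sub>2 \<in> carrier B \<and> g b\<^sub>1 b\<^sub>2 a\<^sub>1 a\<^sub>2 \<in> carrier A" for f g
  proof -
    have "tensor_lift P (sweedler K B ?T b (\<lambda>b\<^sub>1 b\<^sub>2. sweedler K A ?T a (\<lambda>a\<^sub>1 a\<^sub>2.
        pure_tensor K B A (f b\<^sub>1 b\<^sub>2 a\<^sub>1 a\<^sub>2) (g b\<^sub>1 b\<^sub>2 a\<^sub>1 a\<^sub>2)))) \<phi> =
      sweedler K B P b (\<lambda>b\<^sub>1 b\<^sub>2. tensor_lift P (sweedler K A ?T a (\<lambda>a\<^sub>1 a\<^sub>2.
        pure_tensor K B A (f b\<^sub>1 b\<^sub>2 a\<^sub>1 a\<^sub>2) (g b\<^sub>1 b\<^sub>2 a\<^sub>1 a\<^sub>2))) \<phi>)"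
      using that by (intro sweedler_module_hom[OF BA.module_tensor P tl] sweedler_closed BA.abelian_group_tensor) simp
    also have "\<dots> = sweedler K B P b (\<lambda>b\<^sub>1 b\<^sub>2. sweedler K A P a (\<lambda>a\<^sub>1 a\<^sub>2.
        tensor_lift P (pure_tensor K B A (f b\<^sub>1 b\<^sub>2 a\<^sub>1 a\<^sub>2) (g b\<^sub>1 b\<^sub>2 a\<^sub>1 a\<^sub>2)) \<phi>))"
      using that by (intro sweedler_cong sweedler_module_hom[OF BA.module_tensor P tl]) simp
    also have "\<dots> = sweedler K B P b (\<lambda>b\<^sub>1 b\<^sub>2. sweedler K A P a (\<lambda>a\<^sub>1 a\<^sub>2.
        \<phi> (f b\<^sub>1 b\<^sub>2 a\<^sub>1 a\<^sub>2) (g b\<^sub>1 b\<^sub>2 a\<^sub>1 a\<^sub>2)))"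
      using that by (intro sweedler_cong e) simp_all
    finally show ?thesis .
  qed
  have "tensor_lift P (sweedler K B ?T b (\<lambda>b\<^sub>1 b\<^sub>2. sweedler K A ?T a (\<lambda>a\<^sub>1 a\<^sub>2.
      pure_tensor K B A (b\<^sub>1 \<lhd>\<^sub>r a\<^sub>1) (b\<^sub>2 \<rhd> a\<^sub>2)))) \<phi> =
    tensor_lift P (sweedler K B ?T b (\<lambda>b\<^sub>1 b\<^sub>2. sweedler K A ?T a (\<lambda>a\<^sub>1 a\<^sub>2.
      pure_tensor K B A (b\<^sub>2 \<lhd>\<^sub>r a\<^sub>2) (b\<^sub>1 \<rhd> a\<^sub>1)))) \<phi>"
    using compatible[OF b a] unfolding e1 e2 by (rule arg_cong)
  then show ?thesis by (subst (asm) (1 2) push) simp_all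
qed

text \<open>\<open>left_op a\<close> and \<open>right_op b\<close> will be left multiplication by a
  \<bowtie> 1 and by 1 \<bowtie> b; the second is named after the tensor factor that
  \<open>b\<close> comes from. Splitting the product into these operators lets associativity be
  proved as a statement about modules.\<close>

definition left_op :: "'a \<Rightarrow> ('a \<times> 'b \<Rightarrow>\<^sub>0 int) set \<Rightarrow> ('a \<times> 'b \<Rightarrow>\<^sub>0 int) set" where
  "left_op a t = tensor_lift AB t (\<lambda>c e. (a \<otimes>\<^bsub>A\<^esub> c) \<bowtie> e)"

definition right_op :: "'b \<Rightarrow> ('a \<times> 'b \<Rightarrow>\<^sub>0 int) set \<Rightarrow> ('a \<times> 'b \<Rightarrow>\<^sub>0 int) set" where
  "right_op b t = tensor_lift AB t (\<lambda>c e.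
    sweedler K B AB b (\<lambda>b\<^sub>1 b\<^sub>2. sweedler K A AB c (\<lambda>c\<^sub>1 c\<^sub>2. (b\<^sub>1 \<rhd> c\<^sub>1) \<bowtie> ((b\<^sub>2 \<lhd>\<^sub>r c\<^sub>2) \<otimes>\<^bsub>B\<^esub> e))))"

lemma bilinear_left_op: "a \<in> carrier A \<Longrightarrow> bilinear_map K A B AB (\<lambda>c e. (a \<otimes>\<^bsub>A\<^esub> c) \<bowtie> e)"
  by (rule bilinear_mapI) (intro linear_intros | simp)+

lemma bilinear_right_op:
  assumes "b \<in> carrier B"
  shows "bilinear_map K A B AB (\<lambda>c e.
    sweedler K B AB b (\<lambda>b\<^sub>1 b\<^sub>2. sweedler K A AB c (\<lambda>c\<^sub>1 c\<^sub>2. (b\<^sub>1 \<rhd> c\<^sub>1) \<bowtie> ((b\<^sub>2 \<lhd>\<^sub>r c\<^sub>2) \<otimes>\<^bsub>B\<^esub> e))))"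
  by (rule bilinear_mapI) (intro linear_intros | simp add: assms)+

lemma
  assumes "a \<in> carrier A"
  shows left_op_hom: "left_op a \<in> module_hom K AB AB"
    and left_op_pure [simp]: "c \<in> carrier A \<Longrightarrow> e \<in> carrier B \<Longrightarrow> left_op a (c \<bowtie> e) = (a \<otimes>\<^bsub>A\<^esub> c) \<bowtie> e"
proof -
  show "left_op a \<in> module_hom K AB AB"
    using T.tensor_lift_hom[OF T.module_tensor bilinear_left_op[OF assms]] by (simp add: left_op_def[abs_def])
  show "c \<in> carrier A \<Longrightarrow> e \<in> carrier B \<Longrightarrow> left_op a (c \<bowtie> e) = (a \<otimes>\<^bsub>A\<^esub> c) \<bowtie> e"
    unfolding left_op_def
    by (rule T.tensor_lift_tens[OF T.abelian_group_tensor bilinear_map_balanced[OF bilinear_left_op[OF assms]]])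
qed

lemma
  assumes "b \<in> carrier B"
  shows right_op_hom: "right_op b \<in> module_hom K AB AB"
    and right_op_pure: "c \<in> carrier A \<Longrightarrow> e \<in> carrier B \<Longrightarrow> right_op b (c \<bowtie> e) =
      sweedler K B AB b (\<lambda>b\<^sub>1 b\<^sub>2. sweedler K A AB c (\<lambda>c\<^sub>1 c\<^sub>2. (b\<^sub>1 \<rhd> c\<^sub>1) \<bowtie> ((b\<^sub>2 \<lhd>\<^sub>r c\<^sub>2) \<otimes>\<^bsub>B\<^esub> e)))"
proof -
  show "right_op b \<in> module_hom K AB AB"
    using T.tensor_lift_hom[OF T.module_tensor bilinear_right_op[OF assms]] by (simp add: right_op_def[abs_def])
  show "c \<in> carrier A \<Longrightarrow> e \<in> carrier B \<Longrightarrow> right_op b (c \<bowtie> e) =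
      sweedler K B AB b (\<lambda>b\<^sub>1 b\<^sub>2. sweedler K A AB c (\<lambda>c\<^sub>1 c\<^sub>2. (b\<^sub>1 \<rhd> c\<^sub>1) \<bowtie> ((b\<^sub>2 \<lhd>\<^sub>r c\<^sub>2) \<otimes>\<^bsub>B\<^esub> e)))"
    unfolding right_op_def
    by (rule T.tensor_lift_tens[OF T.abelian_group_tensor bilinear_map_balanced[OF bilinear_right_op[OF assms]]])
qed

lemma left_op_closed [simp]: "a \<in> carrier A \<Longrightarrow> t \<in> carrier AB \<Longrightarrow> left_op a t \<in> carrier AB"
  by (rule module_hom_in[OF left_op_hom])

lemma right_op_closed [simp]: "b \<in> carrier B \<Longrightarrow> t \<in> carrier AB \<Longrightarrow> right_op b t \<in> carrier AB"
  by (rule module_hom_in[OF right_op_hom])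

lemma bilinear_map_left_op: "bilinear_map K A AB AB left_op"
proof (rule bilinear_mapI)
  show "(\<lambda>a. left_op a t) \<in> module_hom K A AB" if "t \<in> carrier AB" for t
    unfolding left_op_def
    by (rule T.lin_tensor_lift_inner[OF T.module_tensor that])
      (intro linear_intros | simp add: bilinear_left_op)+
qed (rule left_op_hom)

lemma bilinear_map_right_op: "bilinear_map K B AB AB right_op"
proof (rule bilinear_mapI)
  show "(\<lambda>b. right_op b t) \<in> module_hom K B AB" if "t \<in> carrier AB" for t
    unfolding right_op_def
    by (rule T.lin_tensor_lift_inner[OF T.module_tensor that])
      (intro linear_intros | simp add: bilinear_right_op)+
qed (rule right_op_hom)

lemmas op_linear [linear_intros] =
  bilinear_map_left[OF bilinear_map_left_op] bilinear_map_right[OF bilinear_map_left_op]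
  bilinear_map_left[OF bilinear_map_right_op] bilinear_map_right[OF bilinear_map_right_op]

lemma tensor_hom_eqI:
  assumes "module K P" "f \<in> module_hom K AB P" "g \<in> module_hom K AB P"
    and "\<And>x y. x \<in> carrier A \<Longrightarrow> y \<in> carrier B \<Longrightarrow> f (x \<bowtie> y) = g (x \<bowtie> y)"
    and "t \<in> carrier AB"
  shows "f t = g t"
proof -
  interpret P: module K P by fact
  show ?thesis
    using T.tensor_add_hom_eqI[OF P.abelian_group_axioms assms(2,3)[THEN module_hom_add_hom] assms(4,5)] .
qed

lemma left_op_mult:
  assumes "a \<in> carrier A" "c \<in> carrier A" "t \<in> carrier AB"
  shows "left_op (a \<otimes>\<^bsub>A\<^esub> c) t = left_op a (left_op c t)"
  by (rule tensor_hom_eqI[OF T.module_tensor _ _ _ assms(3)])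
    (use assms in \<open>intro linear_intros | simp add: A.m_assoc\<close>)+

text \<open>The tensor product is a left \<open>B\<close>-module. The axiom for (b d) \<lhd> c
  produces a further coproduct of the second legs, joint coassociativity moves it to the first legs,
  and there comultiplicativity of \<rhd> folds it into the coproduct of d_1 \<rhd> c_1.\<close>

lemma right_op_mult:
  assumes b: "b \<in> carrier B" and d: "d \<in> carrier B" and t: "t \<in> carrier AB"
  shows "right_op (b \<otimes>\<^bsub>B\<^esub> d) t = right_op b (right_op d t)"
proof (rule tensor_hom_eqI[OF T.module_tensor _ _ _ t])
  fix c e assume c: "c \<in> carrier A" and e: "e \<in> carrier B"
  have "right_op (b \<otimes>\<^bsub>B\<^esub> d) (c \<bowtie> e) =
    sweedler K B AB b (\<lambda>b\<^sub>1 b\<^sub>2. sweedler K B AB d (\<lambda>d\<^sub>1 d\<^sub>2. sweedler K A AB c (\<lambda>c\<^sub>1 c\<^sub>2.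
      ((b\<^sub>1 \<otimes>\<^bsub>B\<^esub> d\<^sub>1) \<rhd> c\<^sub>1) \<bowtie> (((b\<^sub>2 \<otimes>\<^bsub>B\<^esub> d\<^sub>2) \<lhd>\<^sub>r c\<^sub>2) \<otimes>\<^bsub>B\<^esub> e))))"
    unfolding right_op_pure[OF B.m_closed[OF b d] c e]
    by (rule B.sweedler_mult[OF T.module_tensor _ b d], rule bilinear_mapI)
      (intro linear_intros | simp add: c e)+
  also have "\<dots> = sweedler K B AB b (\<lambda>b\<^sub>1 b\<^sub>2. sweedler K B AB d (\<lambda>d\<^sub>1 d\<^sub>2. sweedler K A AB c (\<lambda>c\<^sub>1 c\<^sub>2.
      sweedler K B AB d\<^sub>2 (\<lambda>p q. sweedler K A AB c\<^sub>2 (\<lambda>r s.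
      (b\<^sub>1 \<rhd> (d\<^sub>1 \<rhd> c\<^sub>1)) \<bowtie> ((b\<^sub>2 \<lhd>\<^sub>r (p \<rhd> r)) \<otimes>\<^bsub>B\<^esub> (q \<lhd>\<^sub>r s) \<otimes>\<^bsub>B\<^esub> e))))))"
  proof (intro sweedler_cong)
    fix b\<^sub>1 b\<^sub>2 d\<^sub>1 d\<^sub>2 c\<^sub>1 c\<^sub>2 assume x: "b\<^sub>1 \<in> carrier B" "b\<^sub>2 \<in> carrier B" "d\<^sub>1 \<in> carrier B" "d\<^sub>2 \<in> carrier B"
      "c\<^sub>1 \<in> carrier A" "c\<^sub>2 \<in> carrier A"
    have "(\<lambda>z. (b\<^sub>1 \<rhd> (d\<^sub>1 \<rhd> c\<^sub>1)) \<bowtie> (z \<otimes>\<^bsub>B\<^esub> e)) \<in> module_hom K B AB"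
      using x e by (intro linear_intros) simp_all
    note push = sweedler_module_hom[OF B.module_A T.module_tensor this]
    show "((b\<^sub>1 \<otimes>\<^bsub>B\<^esub> d\<^sub>1) \<rhd> c\<^sub>1) \<bowtie> (((b\<^sub>2 \<otimes>\<^bsub>B\<^esub> d\<^sub>2) \<lhd>\<^sub>r c\<^sub>2) \<otimes>\<^bsub>B\<^esub> e) =
      sweedler K B AB d\<^sub>2 (\<lambda>p q. sweedler K A AB c\<^sub>2 (\<lambda>r s.
        (b\<^sub>1 \<rhd> (d\<^sub>1 \<rhd> c\<^sub>1)) \<bowtie> ((b\<^sub>2 \<lhd>\<^sub>r (p \<rhd> r)) \<otimes>\<^bsub>B\<^esub> (q \<lhd>\<^sub>r s) \<otimes>\<^bsub>B\<^esub> e)))"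
      using x e by (simp add: mult_ract' L.act_mult push sweedler_closed B.abelian_group_axioms)
  qed
  also have "\<dots> = sweedler K B AB b (\<lambda>b\<^sub>1 b\<^sub>2. sweedler K B AB d (\<lambda>d\<^sub>1 d\<^sub>2. sweedler K A AB c (\<lambda>c\<^sub>1 c\<^sub>2.
      sweedler K B AB d\<^sub>1 (\<lambda>p q. sweedler K A AB c\<^sub>1 (\<lambda>r s.
      (b\<^sub>1 \<rhd> (p \<rhd> r)) \<bowtie> ((b\<^sub>2 \<lhd>\<^sub>r (q \<rhd> s)) \<otimes>\<^bsub>B\<^esub> (d\<^sub>2 \<lhd>\<^sub>r c\<^sub>2) \<otimes>\<^bsub>B\<^esub> e))))))"
    by (rule sweedler_cong, rule sweedler_joint_coassoc[OF B.coalgebra A.coalgebra T.module_tensor d c, symmetric])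
      (intro linear_intros | simp add: e)+
  also have "\<dots> = sweedler K B AB d (\<lambda>d\<^sub>1 d\<^sub>2. sweedler K A AB c (\<lambda>c\<^sub>1 c\<^sub>2. sweedler K B AB b (\<lambda>b\<^sub>1 b\<^sub>2.
      sweedler K B AB d\<^sub>1 (\<lambda>p q. sweedler K A AB c\<^sub>1 (\<lambda>r s.
      (b\<^sub>1 \<rhd> (p \<rhd> r)) \<bowtie> ((b\<^sub>2 \<lhd>\<^sub>r (q \<rhd> s)) \<otimes>\<^bsub>B\<^esub> (d\<^sub>2 \<lhd>\<^sub>r c\<^sub>2) \<otimes>\<^bsub>B\<^esub> e))))))"
    by (subst sweedler_swap[of AB B B], use e in \<open>simp_all add: sweedler_closed T.abelian_group_tensor\<close>)
      (intro sweedler_cong sweedler_swap, simp_all add: sweedler_closed T.abelian_group_tensor e)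
  also have "\<dots> = sweedler K B AB d (\<lambda>d\<^sub>1 d\<^sub>2. sweedler K A AB c (\<lambda>c\<^sub>1 c\<^sub>2. sweedler K B AB b (\<lambda>b\<^sub>1 b\<^sub>2.
      sweedler K A AB (d\<^sub>1 \<rhd> c\<^sub>1) (\<lambda>r s.
      (b\<^sub>1 \<rhd> r) \<bowtie> ((b\<^sub>2 \<lhd>\<^sub>r s) \<otimes>\<^bsub>B\<^esub> ((d\<^sub>2 \<lhd>\<^sub>r c\<^sub>2) \<otimes>\<^bsub>B\<^esub> e))))))"
  proof (intro sweedler_cong)
    fix b\<^sub>1 b\<^sub>2 d\<^sub>1 d\<^sub>2 c\<^sub>1 c\<^sub>2 assume x: "b\<^sub>1 \<in> carrier B" "b\<^sub>2 \<in> carrier B" "d\<^sub>1 \<in> carrier B" "d\<^sub>2 \<in> carrier B"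
      "c\<^sub>1 \<in> carrier A" "c\<^sub>2 \<in> carrier A"
    have "bilinear_map K A A AB (\<lambda>r s. (b\<^sub>1 \<rhd> r) \<bowtie> ((b\<^sub>2 \<lhd>\<^sub>r s) \<otimes>\<^bsub>B\<^esub> ((d\<^sub>2 \<lhd>\<^sub>r c\<^sub>2) \<otimes>\<^bsub>B\<^esub> e)))"
      by (rule bilinear_mapI) (intro linear_intros | simp add: x e)+
    from sweedler_lact[OF T.module_tensor this x(3,5)] show
      "sweedler K B AB d\<^sub>1 (\<lambda>p q. sweedler K A AB c\<^sub>1 (\<lambda>r s.
        (b\<^sub>1 \<rhd> (p \<rhd> r)) \<bowtie> ((b\<^sub>2 \<lhd>\<^sub>r (q \<rhd> s)) \<otimes>\<^bsub>B\<^esub> (d\<^sub>2 \<lhd>\<^sub>r c\<^sub>2) \<otimes>\<^bsub>B\<^esub> e))) =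
      sweedler K A AB (d\<^sub>1 \<rhd> c\<^sub>1) (\<lambda>r s.
        (b\<^sub>1 \<rhd> r) \<bowtie> ((b\<^sub>2 \<lhd>\<^sub>r s) \<otimes>\<^bsub>B\<^esub> ((d\<^sub>2 \<lhd>\<^sub>r c\<^sub>2) \<otimes>\<^bsub>B\<^esub> e)))"
      using x e by (simp add: B.m_assoc)
  qed
  also have "\<dots> = right_op b (right_op d (c \<bowtie> e))"
    using b c d e
    by (simp add: right_op_pure sweedler_module_hom[OF T.module_tensor T.module_tensor right_op_hom[OF b]]
      sweedler_closed T.abelian_group_tensor)
  finally show "right_op (b \<otimes>\<^bsub>B\<^esub> d) (c \<bowtie> e) = right_op b (right_op d (c \<bowtie> e))" .
qed (use b d in \<open>intro linear_intros | simp\<close>)+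

text \<open>The straightening rule b c = \<Sum> (b_1 \<rhd> c_1)(b_2 \<lhd> c_2) as an identity of
  operators. The argument mirrors \<open>right_op_mult\<close>: the axiom for b \<rhd> (c e), joint
  coassociativity, then comultiplicativity of \<lhd>.\<close>

lemma right_left_op:
  assumes b: "b \<in> carrier B" and c: "c \<in> carrier A" and t: "t \<in> carrier AB"
  shows "right_op b (left_op c t) = sweedler K B AB b (\<lambda>b\<^sub>1 b\<^sub>2. sweedler K A AB c (\<lambda>c\<^sub>1 c\<^sub>2.
    left_op (b\<^sub>1 \<rhd> c\<^sub>1) (right_op (b\<^sub>2 \<lhd>\<^sub>r c\<^sub>2) t)))"
proof (rule tensor_hom_eqI[OF T.module_tensor _ _ _ t])
  fix e f assume e: "e \<in> carrier A" and f: "f \<in> carrier B"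
  have "right_op b (left_op c (e \<bowtie> f)) =
    sweedler K B AB b (\<lambda>b\<^sub>1 b\<^sub>2. sweedler K A AB c (\<lambda>c\<^sub>1 c\<^sub>2. sweedler K A AB e (\<lambda>e\<^sub>1 e\<^sub>2.
      (b\<^sub>1 \<rhd> (c\<^sub>1 \<otimes>\<^bsub>A\<^esub> e\<^sub>1)) \<bowtie> ((b\<^sub>2 \<lhd>\<^sub>r (c\<^sub>2 \<otimes>\<^bsub>A\<^esub> e\<^sub>2)) \<otimes>\<^bsub>B\<^esub> f))))"
    unfolding left_op_pure[OF c e f] right_op_pure[OF b A.m_closed[OF c e] f]
    by (intro sweedler_cong, rule A.sweedler_mult[OF T.module_tensor _ c e], rule bilinear_mapI)
      (intro linear_intros | simp add: f)+
  also have "\<dots> = sweedler K B AB b (\<lambda>b\<^sub>1 b\<^sub>2. sweedler K A AB c (\<lambda>c\<^sub>1 c\<^sub>2. sweedler K B AB b\<^sub>1 (\<lambda>p q.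
      sweedler K A AB c\<^sub>1 (\<lambda>r s. sweedler K A AB e (\<lambda>e\<^sub>1 e\<^sub>2.
      ((p \<rhd> r) \<otimes>\<^bsub>A\<^esub> ((q \<lhd>\<^sub>r s) \<rhd> e\<^sub>1)) \<bowtie> (((b\<^sub>2 \<lhd>\<^sub>r c\<^sub>2) \<lhd>\<^sub>r e\<^sub>2) \<otimes>\<^bsub>B\<^esub> f))))))"
  proof (intro sweedler_cong)
    fix b\<^sub>1 b\<^sub>2 c\<^sub>1 c\<^sub>2 assume x: "b\<^sub>1 \<in> carrier B" "b\<^sub>2 \<in> carrier B" "c\<^sub>1 \<in> carrier A" "c\<^sub>2 \<in> carrier A"
    have "(b\<^sub>1 \<rhd> (c\<^sub>1 \<otimes>\<^bsub>A\<^esub> e\<^sub>1)) \<bowtie> ((b\<^sub>2 \<lhd>\<^sub>r (c\<^sub>2 \<otimes>\<^bsub>A\<^esub> e\<^sub>2)) \<otimes>\<^bsub>B\<^esub> f) =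
      sweedler K B AB b\<^sub>1 (\<lambda>p q. sweedler K A AB c\<^sub>1 (\<lambda>r s.
        ((p \<rhd> r) \<otimes>\<^bsub>A\<^esub> ((q \<lhd>\<^sub>r s) \<rhd> e\<^sub>1)) \<bowtie> (((b\<^sub>2 \<lhd>\<^sub>r c\<^sub>2) \<lhd>\<^sub>r e\<^sub>2) \<otimes>\<^bsub>B\<^esub> f)))"
      if e': "e\<^sub>1 \<in> carrier A" "e\<^sub>2 \<in> carrier A" for e\<^sub>1 e\<^sub>2
    proof -
      have "(\<lambda>z. z \<bowtie> (((b\<^sub>2 \<lhd>\<^sub>r c\<^sub>2) \<lhd>\<^sub>r e\<^sub>2) \<otimes>\<^bsub>B\<^esub> f)) \<in> module_hom K A AB"
        using x f e' by (intro linear_intros) simp_all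
      note push = sweedler_module_hom[OF A.module_A T.module_tensor this]
      show ?thesis
        using x e' e by (simp add: lact_mult' R.act_mult push sweedler_closed A.abelian_group_axioms)
    qed
    then have "sweedler K A AB e (\<lambda>e\<^sub>1 e\<^sub>2.
        (b\<^sub>1 \<rhd> (c\<^sub>1 \<otimes>\<^bsub>A\<^esub> e\<^sub>1)) \<bowtie> ((b\<^sub>2 \<lhd>\<^sub>r (c\<^sub>2 \<otimes>\<^bsub>A\<^esub> e\<^sub>2)) \<otimes>\<^bsub>B\<^esub> f)) =
      sweedler K A AB e (\<lambda>e\<^sub>1 e\<^sub>2. sweedler K B AB b\<^sub>1 (\<lambda>p q. sweedler K A AB c\<^sub>1 (\<lambda>r s.
        ((p \<rhd> r) \<otimes>\<^bsub>A\<^esub> ((q \<lhd>\<^sub>r s) \<rhd> e\<^sub>1)) \<bowtie> (((b\<^sub>2 \<lhd>\<^sub>r c\<^sub>2) \<lhd>\<^sub>r e\<^sub>2) \<otimes>\<^bsub>B\<^esub> f))))"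
      by (intro sweedler_cong)
    also have "\<dots> = sweedler K B AB b\<^sub>1 (\<lambda>p q. sweedler K A AB e (\<lambda>e\<^sub>1 e\<^sub>2. sweedler K A AB c\<^sub>1 (\<lambda>r s.
        ((p \<rhd> r) \<otimes>\<^bsub>A\<^esub> ((q \<lhd>\<^sub>r s) \<rhd> e\<^sub>1)) \<bowtie> (((b\<^sub>2 \<lhd>\<^sub>r c\<^sub>2) \<lhd>\<^sub>r e\<^sub>2) \<otimes>\<^bsub>B\<^esub> f))))"
      using x f by (intro sweedler_swap sweedler_closed T.abelian_group_tensor) simp_all
    also have "\<dots> = sweedler K B AB b\<^sub>1 (\<lambda>p q. sweedler K A AB c\<^sub>1 (\<lambda>r s. sweedler K A AB e (\<lambda>e\<^sub>1 e\<^sub>2.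
        ((p \<rhd> r) \<otimes>\<^bsub>A\<^esub> ((q \<lhd>\<^sub>r s) \<rhd> e\<^sub>1)) \<bowtie> (((b\<^sub>2 \<lhd>\<^sub>r c\<^sub>2) \<lhd>\<^sub>r e\<^sub>2) \<otimes>\<^bsub>B\<^esub> f))))"
      using x f by (intro sweedler_cong sweedler_swap T.abelian_group_tensor) simp_all
    finally show "sweedler K A AB e (\<lambda>e\<^sub>1 e\<^sub>2.
        (b\<^sub>1 \<rhd> (c\<^sub>1 \<otimes>\<^bsub>A\<^esub> e\<^sub>1)) \<bowtie> ((b\<^sub>2 \<lhd>\<^sub>r (c\<^sub>2 \<otimes>\<^bsub>A\<^esub> e\<^sub>2)) \<otimes>\<^bsub>B\<^esub> f)) =
      sweedler K B AB b\<^sub>1 (\<lambda>p q. sweedler K A AB c\<^sub>1 (\<lambda>r s. sweedler K A AB e (\<lambda>e\<^sub>1 e\<^sub>2.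
        ((p \<rhd> r) \<otimes>\<^bsub>A\<^esub> ((q \<lhd>\<^sub>r s) \<rhd> e\<^sub>1)) \<bowtie> (((b\<^sub>2 \<lhd>\<^sub>r c\<^sub>2) \<lhd>\<^sub>r e\<^sub>2) \<otimes>\<^bsub>B\<^esub> f))))" .
  qed
  also have "\<dots> = sweedler K B AB b (\<lambda>b\<^sub>1 b\<^sub>2. sweedler K A AB c (\<lambda>c\<^sub>1 c\<^sub>2. sweedler K B AB b\<^sub>2 (\<lambda>p q.
      sweedler K A AB c\<^sub>2 (\<lambda>r s. sweedler K A AB e (\<lambda>e\<^sub>1 e\<^sub>2.
      ((b\<^sub>1 \<rhd> c\<^sub>1) \<otimes>\<^bsub>A\<^esub> ((p \<lhd>\<^sub>r r) \<rhd> e\<^sub>1)) \<bowtie> (((q \<lhd>\<^sub>r s) \<lhd>\<^sub>r e\<^sub>2) \<otimes>\<^bsub>B\<^esub> f))))))"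
    by (rule sweedler_joint_coassoc[OF B.coalgebra A.coalgebra T.module_tensor b c])
      (intro linear_intros | simp add: e f)+
  also have "\<dots> = sweedler K B AB b (\<lambda>b\<^sub>1 b\<^sub>2. sweedler K A AB c (\<lambda>c\<^sub>1 c\<^sub>2.
      sweedler K B AB (b\<^sub>2 \<lhd>\<^sub>r c\<^sub>2) (\<lambda>u v. sweedler K A AB e (\<lambda>e\<^sub>1 e\<^sub>2.
      ((b\<^sub>1 \<rhd> c\<^sub>1) \<otimes>\<^bsub>A\<^esub> (u \<rhd> e\<^sub>1)) \<bowtie> ((v \<lhd>\<^sub>r e\<^sub>2) \<otimes>\<^bsub>B\<^esub> f)))))"
  proof (intro sweedler_cong sweedler_ract[symmetric] T.module_tensor)
    fix b\<^sub>1 b\<^sub>2 c\<^sub>1 c\<^sub>2 assume x: "b\<^sub>1 \<in> carrier B" "b\<^sub>2 \<in> carrier B" "c\<^sub>1 \<in> carrier A" "c\<^sub>2 \<in> carrier A"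
    show "bilinear_map K B B AB (\<lambda>u v. sweedler K A AB e (\<lambda>e\<^sub>1 e\<^sub>2.
      ((b\<^sub>1 \<rhd> c\<^sub>1) \<otimes>\<^bsub>A\<^esub> (u \<rhd> e\<^sub>1)) \<bowtie> ((v \<lhd>\<^sub>r e\<^sub>2) \<otimes>\<^bsub>B\<^esub> f)))"
      by (rule bilinear_mapI) (intro linear_intros | simp add: x e f)+
  qed simp_all
  also have "\<dots> = sweedler K B AB b (\<lambda>b\<^sub>1 b\<^sub>2. sweedler K A AB c (\<lambda>c\<^sub>1 c\<^sub>2.
    left_op (b\<^sub>1 \<rhd> c\<^sub>1) (right_op (b\<^sub>2 \<lhd>\<^sub>r c\<^sub>2) (e \<bowtie> f))))"
    using e f
    by (simp add: right_op_pure sweedler_module_hom[OF T.module_tensor T.module_tensor left_op_hom]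
      sweedler_closed T.abelian_group_tensor)
  finally show "right_op b (left_op c (e \<bowtie> f)) = sweedler K B AB b (\<lambda>b\<^sub>1 b\<^sub>2. sweedler K A AB c (\<lambda>c\<^sub>1 c\<^sub>2.
    left_op (b\<^sub>1 \<rhd> c\<^sub>1) (right_op (b\<^sub>2 \<lhd>\<^sub>r c\<^sub>2) (e \<bowtie> f))))" .
qed (use b c in \<open>intro linear_intros | simp\<close>)+

end

section \<open>The double cross product is an algebra\<close>

context matched_pair begin

lemma H_simps [simp]:
  "carrier H = carrier AB" "\<zero>\<^bsub>H\<^esub> = \<zero>\<^bsub>AB\<^esub>" "x \<oplus>\<^bsub>H\<^esub> y = x \<oplus>\<^bsub>AB\<^esub> y" "\<one>\<^bsub>H\<^esub> = \<one>\<^bsub>A\<^esub> \<bowtie> \<one>\<^bsub>B\<^esub>"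
  "r \<odot>\<^bsub>H\<^esub> x = r \<odot>\<^bsub>AB\<^esub> x"
  by (simp_all add: double_cross_product_def Let_def)

lemma module_hom_H: "module_hom K M H = module_hom K M AB" "module_hom K H P = module_hom K AB P"
  by (simp_all add: module_hom_def)

lemma sweedler_H: "sweedler K C H c f = sweedler K C AB c f"
  by (simp add: sweedler_def tsum_def)

lemma bilinear_ops:
  assumes "t \<in> carrier AB"
  shows "bilinear_map K A B AB (\<lambda>a b. left_op a (right_op b t))"
  by (rule bilinear_mapI) (intro linear_intros | simp add: assms)+

text \<open>Rewrites the four nested lifts of the definition by the two operators. The inner pair is
  evaluated on simple tensors of the second factor; lifting a linear map from its values on simple
  tensors then returns that map.\<close>

lemma mult_eq:
  assumes s: "s \<in> carrier AB" and t: "t \<in> carrier AB"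
  shows "s \<otimes>\<^bsub>H\<^esub> t = tensor_lift AB s (\<lambda>a b. left_op a (right_op b t))"
proof -
  let ?F = "\<lambda>a b c d. tensor_lift AB (comult B b) (\<lambda>b\<^sub>1 b\<^sub>2. tensor_lift AB (comult A c) (\<lambda>c\<^sub>1 c\<^sub>2.
    (a \<otimes>\<^bsub>A\<^esub> (b\<^sub>1 \<rhd> c\<^sub>1)) \<bowtie> ((b\<^sub>2 \<lhd>\<^sub>r c\<^sub>2) \<otimes>\<^bsub>B\<^esub> d)))"
  have F: "left_op a (right_op b (c \<bowtie> d)) = ?F a b c d"
    if x: "a \<in> carrier A" "b \<in> carrier B" "c \<in> carrier A" "d \<in> carrier B" for a b c d
  proof -
    have "?F a b c d = sweedler K B AB b (\<lambda>b\<^sub>1 b\<^sub>2. sweedler K A AB c (\<lambda>c\<^sub>1 c\<^sub>2.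
        (a \<otimes>\<^bsub>A\<^esub> (b\<^sub>1 \<rhd> c\<^sub>1)) \<bowtie> ((b\<^sub>2 \<lhd>\<^sub>r c\<^sub>2) \<otimes>\<^bsub>B\<^esub> d)))"
      by (rule tensor_lift_sweedler2[OF B.coalgebra A.coalgebra T.module_tensor x(2,3)])
        (intro linear_intros | simp add: x)+
    also have "\<dots> = left_op a (right_op b (c \<bowtie> d))"
      using x by (simp add: right_op_pure sweedler_closed T.abelian_group_tensor
        sweedler_module_hom[OF T.module_tensor T.module_tensor left_op_hom])
    finally show ?thesis by simp
  qed
  have "tensor_lift AB t (\<lambda>c d. ?F a b c d) = left_op a (right_op b t)"
    if x: "a \<in> carrier A" "b \<in> carrier B" for a b
  proof -
    have bil: "bilinear_map K A B AB (\<lambda>c d. left_op a (right_op b (c \<bowtie> d)))"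
      by (rule bilinear_mapI) (intro linear_intros | simp add: x)+
    have "tensor_lift AB t (\<lambda>c d. ?F a b c d) = tensor_lift AB t (\<lambda>c d. left_op a (right_op b (c \<bowtie> d)))"
      by (rule T.tensor_lift_cong[OF T.abelian_group_tensor bilinear_map_balanced[OF bil] t F[OF x], symmetric])
    also have "\<dots> = left_op a (right_op b t)"
      by (rule tensor_hom_eqI[OF T.module_tensor T.tensor_lift_hom[OF T.module_tensor bil] _ _ t])
        (intro linear_intros | simp add: x T.tensor_lift_tens[OF T.abelian_group_tensor bilinear_map_balanced[OF bil]])+
    finally show ?thesis .
  qed
  then have "tensor_lift AB s (\<lambda>a b. left_op a (right_op b t)) =
      tensor_lift AB s (\<lambda>a b. tensor_lift AB t (\<lambda>c d. ?F a b c d))"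
    by (intro T.tensor_lift_cong[OF T.abelian_group_tensor bilinear_map_balanced[OF bilinear_ops[OF t]] s]) simp
  then show ?thesis by (simp add: double_cross_product_def Let_def)
qed

lemma pure_mult:
  "a \<in> carrier A \<Longrightarrow> b \<in> carrier B \<Longrightarrow> t \<in> carrier AB \<Longrightarrow> (a \<bowtie> b) \<otimes>\<^bsub>H\<^esub> t = left_op a (right_op b t)"
  by (simp add: mult_eq T.tensor_lift_tens[OF T.abelian_group_tensor bilinear_map_balanced[OF bilinear_ops]])

lemma mult_closed: "s \<in> carrier AB \<Longrightarrow> t \<in> carrier AB \<Longrightarrow> s \<otimes>\<^bsub>H\<^esub> t \<in> carrier AB"
  using module_hom_in[OF T.tensor_lift_hom[OF T.module_tensor bilinear_ops]] by (simp add: mult_eq)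

lemma bilinear_mult: "bilinear_map K AB AB AB (monoid.mult H)"
proof (rule bilinear_map_cong[OF T.module_tensor T.module_tensor mult_eq[symmetric]], assumption+, rule bilinear_mapI)
  show "(\<lambda>t. tensor_lift AB s (\<lambda>a b. left_op a (right_op b t))) \<in> module_hom K AB AB"
    if "s \<in> carrier AB" for s
    by (rule T.lin_tensor_lift_inner[OF T.module_tensor that])
      (intro linear_intros | simp add: bilinear_ops)+
  show "(\<lambda>s. tensor_lift AB s (\<lambda>a b. left_op a (right_op b t))) \<in> module_hom K AB AB"
    if "t \<in> carrier AB" for t
    by (rule T.tensor_lift_hom[OF T.module_tensor bilinear_ops[OF that]])
qed

lemmas mult_linear = bilinear_map_left[OF bilinear_mult] bilinear_map_right[OF bilinear_mult]

lemma left_op_mult_H: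
  assumes "a \<in> carrier A" "s \<in> carrier AB" "t \<in> carrier AB"
  shows "left_op a s \<otimes>\<^bsub>H\<^esub> t = left_op a (s \<otimes>\<^bsub>H\<^esub> t)"
  by (rule tensor_hom_eqI[OF T.module_tensor _ _ _ assms(2)])
    (use assms in \<open>intro linear_intros mult_linear | simp add: pure_mult left_op_mult mult_closed\<close>)+

text \<open>Only \<open>x\<close> and \<open>y\<close> are reduced to simple tensors;
  \<open>z\<close> stays an arbitrary vector on which the operators act. What remains is
  \<open>right_op_mult\<close> together with the straightening rule.\<close>

lemma mult_assoc:
  assumes x: "x \<in> carrier AB" and y: "y \<in> carrier AB" and z: "z \<in> carrier AB"
  shows "(x \<otimes>\<^bsub>H\<^esub> y) \<otimes>\<^bsub>H\<^esub> z = x \<otimes>\<^bsub>H\<^esub> (y \<otimes>\<^bsub>H\<^esub> z)"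
proof (rule tensor_hom_eqI[OF T.module_tensor _ _ _ x])
  fix a b assume a: "a \<in> carrier A" and b: "b \<in> carrier B"
  have "(left_op a (right_op b y)) \<otimes>\<^bsub>H\<^esub> z = left_op a (right_op b (y \<otimes>\<^bsub>H\<^esub> z))"
  proof (rule tensor_hom_eqI[OF T.module_tensor _ _ _ y])
    fix c d assume c: "c \<in> carrier A" and d: "d \<in> carrier B"
    note pushz = sweedler_module_hom[OF T.module_tensor T.module_tensor bilinear_map_left[OF bilinear_mult lin_id z]]
    have "right_op b (c \<bowtie> d) \<otimes>\<^bsub>H\<^esub> z =
      sweedler K B AB b (\<lambda>b\<^sub>1 b\<^sub>2. sweedler K A AB c (\<lambda>c\<^sub>1 c\<^sub>2.
        left_op (b\<^sub>1 \<rhd> c\<^sub>1) (right_op (b\<^sub>2 \<lhd>\<^sub>r c\<^sub>2) (right_op d z))))"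
      using b c d z
      by (simp add: right_op_pure pushz pure_mult right_op_mult sweedler_closed T.abelian_group_tensor)
    also have "\<dots> = right_op b (left_op c (right_op d z))"
      using b c d z by (simp add: right_left_op)
    finally show "left_op a (right_op b (c \<bowtie> d)) \<otimes>\<^bsub>H\<^esub> z = left_op a (right_op b ((c \<bowtie> d) \<otimes>\<^bsub>H\<^esub> z))"
      using a b c d z by (simp add: left_op_mult_H pure_mult)
  qed (use a b z in \<open>intro linear_intros mult_linear | simp\<close>)+
  then show "((a \<bowtie> b) \<otimes>\<^bsub>H\<^esub> y) \<otimes>\<^bsub>H\<^esub> z = (a \<bowtie> b) \<otimes>\<^bsub>H\<^esub> (y \<otimes>\<^bsub>H\<^esub> z)"
    using a b y z by (simp add: pure_mult mult_closed)
qed (use y z in \<open>intro linear_intros mult_linear | simp add: mult_closed\<close>)+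

lemma left_op_one: "t \<in> carrier AB \<Longrightarrow> left_op \<one>\<^bsub>A\<^esub> t = t"
  by (rule tensor_hom_eqI[OF T.module_tensor]) (intro linear_intros | simp)+

lemma right_op_one: 
  assumes t: "t \<in> carrier AB"
  shows "right_op \<one>\<^bsub>B\<^esub> t = t"
proof (rule tensor_hom_eqI[OF T.module_tensor _ _ _ t])
  fix c e assume c: "c \<in> carrier A" and e: "e \<in> carrier B"
  have bil: "bilinear_map K B B AB (\<lambda>b\<^sub>1 b\<^sub>2. sweedler K A AB c (\<lambda>c\<^sub>1 c\<^sub>2. (b\<^sub>1 \<rhd> c\<^sub>1) \<bowtie> ((b\<^sub>2 \<lhd>\<^sub>r c\<^sub>2) \<otimes>\<^bsub>B\<^esub> e)))"
    by (rule bilinear_mapI) (intro linear_intros | simp add: c e)+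
  have "right_op \<one>\<^bsub>B\<^esub> (c \<bowtie> e) =
      sweedler K A AB c (\<lambda>c\<^sub>1 c\<^sub>2. (\<one>\<^bsub>B\<^esub> \<rhd> c\<^sub>1) \<bowtie> ((\<one>\<^bsub>B\<^esub> \<lhd>\<^sub>r c\<^sub>2) \<otimes>\<^bsub>B\<^esub> e))"
    unfolding right_op_pure[OF B.one_closed c e] by (rule B.sweedler_one[OF T.module_tensor bil])
  also have "\<dots> = sweedler K A AB c (\<lambda>c\<^sub>1 c\<^sub>2. counit A c\<^sub>2 \<odot>\<^bsub>AB\<^esub> (c\<^sub>1 \<bowtie> e))"
    using e by (simp add: L.act_one one_ract B.smult_mult_left T.smult_tens T.tens_smult_swap)
  also have "\<dots> = c \<bowtie> e"
    by (rule A.sweedler_counit_right[OF T.module_tensor _ c]) (intro linear_intros | simp add: e)+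
  finally show "right_op \<one>\<^bsub>B\<^esub> (c \<bowtie> e) = c \<bowtie> e" .
qed (intro linear_intros | simp)+

lemma right_op_one_pure:
  assumes b: "b \<in> carrier B" and e: "e \<in> carrier B"
  shows "right_op b (\<one>\<^bsub>A\<^esub> \<bowtie> e) = \<one>\<^bsub>A\<^esub> \<bowtie> (b \<otimes>\<^bsub>B\<^esub> e)"
proof -
  have bil: "bilinear_map K A A AB (\<lambda>c\<^sub>1 c\<^sub>2. (b\<^sub>1 \<rhd> c\<^sub>1) \<bowtie> ((b\<^sub>2 \<lhd>\<^sub>r c\<^sub>2) \<otimes>\<^bsub>B\<^esub> e))"
    if "b\<^sub>1 \<in> carrier B" "b\<^sub>2 \<in> carrier B" for b\<^sub>1 b\<^sub>2
    by (rule bilinear_mapI) (intro linear_intros | simp add: that e)+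
  have "right_op b (\<one>\<^bsub>A\<^esub> \<bowtie> e) = sweedler K B AB b (\<lambda>b\<^sub>1 b\<^sub>2. counit B b\<^sub>1 \<odot>\<^bsub>AB\<^esub> (\<one>\<^bsub>A\<^esub> \<bowtie> (b\<^sub>2 \<otimes>\<^bsub>B\<^esub> e)))"
    unfolding right_op_pure[OF b A.one_closed e]
    using e by (intro sweedler_cong) (simp add: A.sweedler_one[OF T.module_tensor bil] R.act_one lact_one T.smult_tens)
  also have "\<dots> = \<one>\<^bsub>A\<^esub> \<bowtie> (b \<otimes>\<^bsub>B\<^esub> e)"
    by (rule B.sweedler_counit_left[OF T.module_tensor _ b]) (intro linear_intros | simp add: e)+
  finally show ?thesis .
qed

lemma mult_one: 
  assumes t: "t \<in> carrier AB"
  shows "t \<otimes>\<^bsub>H\<^esub> (\<one>\<^bsub>A\<^esub> \<bowtie> \<one>\<^bsub>B\<^esub>) = t"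
  by (rule tensor_hom_eqI[OF T.module_tensor _ _ _ t])
    (intro linear_intros mult_linear | simp add: pure_mult right_op_one_pure)+

lemma algebra_H: "k_algebra K H"
proof -
  have ab: "abelian_group H"
    by (rule abelian_groupI) (auto simp: T.T.a_ac intro: T.T.l_neg T.T.a_inv_closed)
  have m: "Module.module K H"
    by (intro moduleI A.VS.R.is_cring ab)
      (simp_all add: T.T.smult_l_distr T.T.smult_r_distr T.T.smult_assoc1)
  show ?thesis
  proof (rule k_algebra.intro)
    show "vectorspace K H"
      using A.vectorspace m by (simp add: vectorspace_def)
    have "Group.monoid H"
      by (rule Group.monoidI)
        (simp_all add: mult_closed mult_assoc pure_mult left_op_one right_op_one mult_one)
    then show "Ring.ring H"
      by (intro ringI ab)
        (simp_all add: bilinear_mapD(2,3)[OF bilinear_mult])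
    show "bilinear_map K H H H (monoid.mult H)"
      using bilinear_mult by (simp add: bilinear_map_def module_hom_H)
  qed
qed

end

section \<open>Bimodules and direct summands of powers\<close>

lemma add_hom_finsum_pointwise:
  assumes M: "abelian_group M" and N: "abelian_group N" and f: "\<And>i. i \<in> I \<Longrightarrow> f i \<in> add_hom M N"
  shows "(\<lambda>x. \<Oplus>\<^bsub>N\<^esub>i\<in>I. f i x) \<in> add_hom M N"
proof -
  interpret M: abelian_group M by fact
  interpret N: abelian_group N by fact
  note cl = add_hom_closed[OF f]
  show ?thesis
  proof (rule add_homI)
    fix x y assume x: "x \<in> carrier M" and y: "y \<in> carrier M"
    have "(\<Oplus>\<^bsub>N\<^esub>i\<in>I. f i (x \<oplus>\<^bsub>M\<^esub> y)) = (\<Oplus>\<^bsub>N\<^esub>i\<in>I. f i x \<oplus>\<^bsub>N\<^esub> f i y)"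
      using x y cl add_hom_add[OF f] by (intro N.add.finprod_cong') auto
    also have "\<dots> = (\<Oplus>\<^bsub>N\<^esub>i\<in>I. f i x) \<oplus>\<^bsub>N\<^esub> (\<Oplus>\<^bsub>N\<^esub>i\<in>I. f i y)"
      using x y cl by (intro N.finsum_addf) auto
    finally show "(\<Oplus>\<^bsub>N\<^esub>i\<in>I. f i (x \<oplus>\<^bsub>M\<^esub> y)) = (\<Oplus>\<^bsub>N\<^esub>i\<in>I. f i x) \<oplus>\<^bsub>N\<^esub> (\<Oplus>\<^bsub>N\<^esub>i\<in>I. f i y)" .
  qed (use cl in \<open>auto intro!: N.finsum_closed\<close>)
qed

text \<open>The sets \<open>L\<close> and \<open>S\<close> are arbitrary, so the same record can be
  viewed over the whole ring or over the subring on either side. Additivity of each scalar is what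
  makes kernels, images and finite sums compatible with the actions.\<close>

definition biadditive :: "'l set \<Rightarrow> 's set \<Rightarrow> ('l, 's, 'm) bimodule \<Rightarrow> bool" where
  "biadditive L S M \<longleftrightarrow> abelian_group M \<and> (\<forall>l\<in>L. left_smult M l \<in> add_hom M M) \<and>
    (\<forall>s\<in>S. (\<lambda>x. right_smult M x s) \<in> add_hom M M)"

definition bimodule_hom ::
  "'l set \<Rightarrow> 's set \<Rightarrow> ('l, 's, 'm) bimodule \<Rightarrow> ('l, 's, 'n) bimodule \<Rightarrow> ('m \<Rightarrow> 'n) set" where
  "bimodule_hom L S M N = {h \<in> add_hom M N.
    (\<forall>l\<in>L. \<forall>x\<in>carrier M. h (left_smult M l x) = left_smult N l (h x)) \<and>
    (\<forall>s\<in>S. \<forall>x\<in>carrier M. h (right_smult M x s) = right_smult N (h x) s)}"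

lemma bimodule_homD:
  assumes "h \<in> bimodule_hom L S M N"
  shows "h \<in> add_hom M N"
    and "l \<in> L \<Longrightarrow> x \<in> carrier M \<Longrightarrow> h (left_smult M l x) = left_smult N l (h x)"
    and "s \<in> S \<Longrightarrow> x \<in> carrier M \<Longrightarrow> h (right_smult M x s) = right_smult N (h x) s"
  using assms by (auto simp: bimodule_hom_def)

lemma power_simps:
  "carrier (bimodule_power N p) = {..<p} \<rightarrow>\<^sub>E carrier N"
  "\<zero>\<^bsub>bimodule_power N p\<^esub> = (\<lambda>i\<in>{..<p}. \<zero>\<^bsub>N\<^esub>)"
  "f \<oplus>\<^bsub>bimodule_power N p\<^esub> g = (\<lambda>i\<in>{..<p}. f i \<oplus>\<^bsub>N\<^esub> g i)"
  "left_smult (bimodule_power N p) l f = (\<lambda>i\<in>{..<p}. left_smult N l (f i))"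
  "right_smult (bimodule_power N p) f s = (\<lambda>i\<in>{..<p}. right_smult N (f i) s)"
  by (simp_all add: bimodule_power_def)

lemma abelian_group_power:
  assumes "abelian_group N"
  shows "abelian_group (bimodule_power N p)"
proof -
  interpret N: abelian_group N by fact
  show ?thesis
  proof (rule abelian_groupI)
    fix x assume x: "x \<in> carrier (bimodule_power N p)"
    then have "(\<lambda>i\<in>{..<p}. \<ominus>\<^bsub>N\<^esub> x i) \<in> carrier (bimodule_power N p)"
      "(\<lambda>i\<in>{..<p}. \<ominus>\<^bsub>N\<^esub> x i) \<oplus>\<^bsub>bimodule_power N p\<^esub> x = \<zero>\<^bsub>bimodule_power N p\<^esub>"
      by (auto simp: power_simps PiE_iff N.l_neg intro!: restrict_ext)
    then show "\<exists>y\<in>carrier (bimodule_power N p). y \<oplus>\<^bsub>bimodule_power N p\<^esub> x = \<zero>\<^bsub>bimodule_power N p\<^esub>"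
      by blast
  qed (auto simp: power_simps PiE_iff N.a_ac fun_eq_iff extensional_def)
qed

lemma biadditive_power:
  assumes "biadditive L S N"
  shows "biadditive L S (bimodule_power N p)"
  using assms abelian_group_power[of N p]
  by (auto simp: biadditive_def add_hom_def power_simps PiE_iff Pi_iff fun_eq_iff)

lemma sub_bimodule_kernel:
  assumes M: "biadditive L S M" and N: "biadditive L S N" and h: "h \<in> bimodule_hom L S M N"
  shows "sub_bimodule L S {x \<in> carrier M. h x = \<zero>\<^bsub>N\<^esub>} M"
proof -
  interpret M: abelian_group M using M by (simp add: biadditive_def)
  interpret N: abelian_group N using N by (simp add: biadditive_def)
  note ah = bimodule_homD(1)[OF h]
  have z: "left_smult N l \<zero>\<^bsub>N\<^esub> = \<zero>\<^bsub>N\<^esub>" if "l \<in> L" for l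
    using N that add_hom_zero[OF N.abelian_group_axioms N.abelian_group_axioms] by (simp add: biadditive_def)
  have z': "right_smult N \<zero>\<^bsub>N\<^esub> s = \<zero>\<^bsub>N\<^esub>" if "s \<in> S" for s
    using N that add_hom_zero[OF N.abelian_group_axioms N.abelian_group_axioms, of "\<lambda>x. right_smult N x s"]
    by (simp add: biadditive_def)
  have "additive_subgroup {x \<in> carrier M. h x = \<zero>\<^bsub>N\<^esub>} M"
    using abelian_group_hom.additive_subgroup_a_kernel[OF add_hom_group_hom[OF M.abelian_group_axioms N.abelian_group_axioms ah]]
    by (simp add: a_kernel_def')
  then show ?thesis
    using M bimodule_homD(2,3)[OF h] z z'
    by (auto simp: sub_bimodule_def biadditive_def add_hom_def Pi_iff)
qed

lemma sub_bimodule_image: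
  assumes M: "biadditive L S M" and N: "biadditive L S N" and h: "h \<in> bimodule_hom L S M N"
  shows "sub_bimodule L S (h ` carrier M) N"
proof -
  interpret M: abelian_group M using M by (simp add: biadditive_def)
  interpret N: abelian_group N using N by (simp add: biadditive_def)
  note ah = bimodule_homD(1)[OF h]
  have "additive_subgroup (h ` carrier M) N"
  proof (rule additive_subgroup.intro, rule N.add.subgroupI)
    show "h ` carrier M \<subseteq> carrier N" using add_hom_closed[OF ah] by auto
    show "h ` carrier M \<noteq> {}" using M.zero_closed by auto
    show "\<ominus>\<^bsub>N\<^esub> a \<in> h ` carrier M" if "a \<in> h ` carrier M" for a
      using that add_hom_a_inv[OF M.abelian_group_axioms N.abelian_group_axioms ah]
      by (metis (no_types, lifting) M.a_inv_closed image_iff)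
    show "a \<oplus>\<^bsub>N\<^esub> b \<in> h ` carrier M" if ab: "a \<in> h ` carrier M" "b \<in> h ` carrier M" for a b
    proof -
      obtain x y where "a = h x" "b = h y" "x \<in> carrier M" "y \<in> carrier M" using ab by blast
      then show ?thesis using add_hom_add[OF ah, of x y] by (auto intro!: image_eqI[of _ _ "x \<oplus>\<^bsub>M\<^esub> y"])
    qed
  qed
  moreover have "left_smult N l (h x) \<in> h ` carrier M" if "l \<in> L" "x \<in> carrier M" for l x
    using bimodule_homD(2)[OF h that, symmetric] M that by (auto simp: biadditive_def add_hom_def Pi_iff)
  moreover have "right_smult N (h x) s \<in> h ` carrier M" if "s \<in> S" "x \<in> carrier M" for s x
    using bimodule_homD(3)[OF h that, symmetric] M that by (auto simp: biadditive_def add_hom_def Pi_iff)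
  ultimately show ?thesis by (auto simp: sub_bimodule_def)
qed

text \<open>A map \<open>F\<close> with retraction \<open>G\<close> splits its target into the image
  of \<open>F\<close> and the kernel of \<open>G\<close>: every x is F(G x) plus a remainder that
  \<open>G\<close> kills.\<close>

lemma iso_to_direct_summandI:
  assumes M: "biadditive L S M" and N: "biadditive L S N"
    and F: "F \<in> bimodule_hom L S M N" and G: "G \<in> bimodule_hom L S N M"
    and GF: "\<And>m. m \<in> carrier M \<Longrightarrow> G (F m) = m"
  shows "iso_to_direct_summand L S M N"
proof -
  interpret M: abelian_group M using M by (simp add: biadditive_def)
  interpret N: abelian_group N using N by (simp add: biadditive_def)
  note aF = bimodule_homD(1)[OF F] note aG = bimodule_homD(1)[OF G]
  note Fc = add_hom_closed[OF aF] note Gc = add_hom_closed[OF aG]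
  let ?V = "{x \<in> carrier N. G x = \<zero>\<^bsub>M\<^esub>}"
  have "F ` carrier M <+>\<^bsub>N\<^esub> ?V = carrier N"
  proof
    show "F ` carrier M <+>\<^bsub>N\<^esub> ?V \<subseteq> carrier N" using Fc by (auto simp: set_add_def')
    show "carrier N \<subseteq> F ` carrier M <+>\<^bsub>N\<^esub> ?V"
    proof
      fix x assume x: "x \<in> carrier N"
      have "x \<ominus>\<^bsub>N\<^esub> F (G x) \<in> ?V"
        using x Fc Gc GF
        by (simp add: a_minus_def add_hom_add[OF aG] add_hom_a_inv[OF N.abelian_group_axioms M.abelian_group_axioms aG] M.r_neg)
      moreover have "x = F (G x) \<oplus>\<^bsub>N\<^esub> (x \<ominus>\<^bsub>N\<^esub> F (G x))"
        using x Fc Gc by (metis N.a_comm N.add.inv_closed N.add.inv_solve_right' N.add.m_closed N.minus_eq)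
      ultimately show "x \<in> F ` carrier M <+>\<^bsub>N\<^esub> ?V" using Gc[OF x] unfolding set_add_def' by blast
    qed
  qed
  moreover have "F ` carrier M \<inter> ?V = {\<zero>\<^bsub>N\<^esub>}"
    using GF add_hom_zero[OF M.abelian_group_axioms N.abelian_group_axioms aF]
      add_hom_zero[OF N.abelian_group_axioms M.abelian_group_axioms aG]
    by (auto intro!: image_eqI[of _ _ "\<zero>\<^bsub>M\<^esub>"])
  ultimately have "direct_summand L S (F ` carrier M) N"
    unfolding direct_summand_def
    using sub_bimodule_image[OF M N F] sub_bimodule_kernel[OF N M G] by blast
  moreover have "bimodule_iso L S M (N\<lparr>carrier := F ` carrier M\<rparr>) F"
    using bimodule_homD(2,3)[OF F] add_hom_add[OF aF] inj_on_inverseI[of "carrier M" G F] GF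
    by (auto simp: bimodule_iso_def bij_betw_def)
  ultimately show ?thesis unfolding iso_to_direct_summand_def by blast
qed

lemma (in abelian_group) minus_eq_minusI:
  assumes "x \<oplus> y = z \<oplus> w" and [simp]: "x \<in> carrier G" "y \<in> carrier G" "z \<in> carrier G" "w \<in> carrier G"
  shows "x \<ominus> z = w \<ominus> y"
proof -
  have "x \<ominus> z = (x \<oplus> y) \<oplus> (\<ominus> y \<oplus> \<ominus> z)"
    by (simp add: a_minus_def a_assoc r_neg2)
  also have "\<dots> = (w \<oplus> z) \<oplus> (\<ominus> z \<oplus> \<ominus> y)"
    by (simp add: assms(1) a_comm)
  also have "\<dots> = w \<ominus> y"
    by (simp add: a_minus_def a_assoc r_neg2)
  finally show ?thesis .
qed

text \<open>The retraction is the projection onto \<open>U\<close> along \<open>V\<close> followed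
  by the inverse of \<open>h\<close>. It is obtained by unique description from the decomposition of
  an element, so its compatibility with sums and scalars follows by exhibiting a
  decomposition.\<close>

lemma iso_to_direct_summandE:
  assumes M: "biadditive L S M" and N: "biadditive L S N" and iso: "iso_to_direct_summand L S M N"
  obtains F G where "F \<in> bimodule_hom L S M N" "G \<in> bimodule_hom L S N M"
    "\<And>m. m \<in> carrier M \<Longrightarrow> G (F m) = m"
proof -
  interpret M: abelian_group M using M by (simp add: biadditive_def)
  interpret N: abelian_group N using N by (simp add: biadditive_def)
  obtain U V h where U: "sub_bimodule L S U N" and V: "sub_bimodule L S V N"
    and UV: "U <+>\<^bsub>N\<^esub> V = carrier N" "U \<inter> V = {\<zero>\<^bsub>N\<^esub>}"
    and h: "bimodule_iso L S M (N\<lparr>carrier := U\<rparr>) h"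
    using iso by (auto simp: iso_to_direct_summand_def direct_summand_def)
  interpret U: additive_subgroup U N using U by (simp add: sub_bimodule_def)
  interpret V: additive_subgroup V N using V by (simp add: sub_bimodule_def)
  have hb: "bij_betw h (carrier M) U" using h by (simp add: bimodule_iso_def)
  have hU: "h m \<in> U" if "m \<in> carrier M" for m using hb that by (auto simp: bij_betw_def)
  have hF: "h \<in> bimodule_hom L S M N"
    using h hU U.a_subset by (auto simp: bimodule_iso_def bimodule_hom_def add_hom_def)
  define P where "P x m \<longleftrightarrow> m \<in> carrier M \<and> (\<exists>v\<in>V. x = h m \<oplus>\<^bsub>N\<^esub> v)" for x m
  have ex: "\<exists>m. P x m" if "x \<in> carrier N" for x
  proof -
    have "x \<in> U <+>\<^bsub>N\<^esub> V" using that UV(1) by blast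
    then obtain u v where uv: "u \<in> U" "v \<in> V" "x = u \<oplus>\<^bsub>N\<^esub> v"
      unfolding set_add_def' by blast
    moreover obtain m where "m \<in> carrier M" "u = h m" using hb uv(1) by (auto simp: bij_betw_def)
    ultimately show ?thesis by (auto simp: P_def)
  qed
  have uniq: "m = m'" if Pm: "P x m" "P x m'" for x m m'
  proof -
    obtain v where v1: "m \<in> carrier M" "v \<in> V" "x = h m \<oplus>\<^bsub>N\<^esub> v"
      using Pm(1) by (auto simp: P_def)
    obtain v' where v2: "m' \<in> carrier M" "v' \<in> V" "x = h m' \<oplus>\<^bsub>N\<^esub> v'"
      using Pm(2) by (auto simp: P_def)
    have v: "m \<in> carrier M" "m' \<in> carrier M" "v \<in> V" "v' \<in> V" "h m \<oplus>\<^bsub>N\<^esub> v = h m' \<oplus>\<^bsub>N\<^esub> v'"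
      using v1 v2 by auto
    note c = hU[OF v(1)] hU[OF v(2)] v(3,4)
    note cc = subsetD[OF U.a_subset c(1)] subsetD[OF U.a_subset c(2)]
      subsetD[OF V.a_subset c(3)] subsetD[OF V.a_subset c(4)]
    have "h m \<ominus>\<^bsub>N\<^esub> h m' = v' \<ominus>\<^bsub>N\<^esub> v"
      using N.minus_eq_minusI[OF v(5) cc(1) cc(3) cc(2) cc(4)] .
    moreover have "h m \<ominus>\<^bsub>N\<^esub> h m' \<in> U" using c(1,2) by (simp add: a_minus_def)
    moreover have "v' \<ominus>\<^bsub>N\<^esub> v \<in> V" using c(3,4) by (simp add: a_minus_def)
    ultimately have "h m \<ominus>\<^bsub>N\<^esub> h m' = \<zero>\<^bsub>N\<^esub>" using UV(2) by (metis IntI singletonD)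
    then have "h m = h m'" using N.minus_eq_zeroD cc by blast
    then show ?thesis using hb v by (auto simp: bij_betw_def inj_on_def)
  qed
  define G where "G x = (THE m. P x m)" for x
  have GP: "P x (G x)" if "x \<in> carrier N" for x
    unfolding G_def using ex[OF that] uniq by (metis theI)
  have GI: "G x = m" if "P x m" "x \<in> carrier N" for x m using uniq[OF GP[OF that(2)] that(1)] .
  have Ph: "P (h m) m" if "m \<in> carrier M" for m
    using that V.zero_closed hU[OF that] U.a_subset by (auto simp: P_def intro!: bexI[of _ "\<zero>\<^bsub>N\<^esub>"])
  have Gc: "G x \<in> carrier M" if "x \<in> carrier N" for x using GP[OF that] by (simp add: P_def)
  have "G \<in> add_hom N M"
  proof (rule add_homI[OF Gc])
    fix x y assume x: "x \<in> carrier N" and y: "y \<in> carrier N"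
    obtain v w where vw: "v \<in> V" "w \<in> V" "x = h (G x) \<oplus>\<^bsub>N\<^esub> v" "y = h (G y) \<oplus>\<^bsub>N\<^esub> w"
      using GP[OF x] GP[OF y] by (auto simp: P_def)
    note cc = subsetD[OF V.a_subset vw(1)] subsetD[OF V.a_subset vw(2)]
      add_hom_closed[OF bimodule_homD(1)[OF hF] Gc[OF x]] add_hom_closed[OF bimodule_homD(1)[OF hF] Gc[OF y]]
    have "x \<oplus>\<^bsub>N\<^esub> y = (h (G x) \<oplus>\<^bsub>N\<^esub> v) \<oplus>\<^bsub>N\<^esub> (h (G y) \<oplus>\<^bsub>N\<^esub> w)"
      using vw(3,4) by simp
    also have "\<dots> = h (G x \<oplus>\<^bsub>M\<^esub> G y) \<oplus>\<^bsub>N\<^esub> (v \<oplus>\<^bsub>N\<^esub> w)"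
      using cc add_hom_add[OF bimodule_homD(1)[OF hF] Gc[OF x] Gc[OF y]] by (simp add: N.a_ac)
    finally have "P (x \<oplus>\<^bsub>N\<^esub> y) (G x \<oplus>\<^bsub>M\<^esub> G y)"
      unfolding P_def using vw Gc[OF x] Gc[OF y] by blast
    then show "G (x \<oplus>\<^bsub>N\<^esub> y) = G x \<oplus>\<^bsub>M\<^esub> G y" using GI x y by simp
  qed
  moreover have "G (left_smult N l x) = left_smult M l (G x)" if l: "l \<in> L" and x: "x \<in> carrier N" for l x
  proof -
    obtain v where v: "v \<in> V" "x = h (G x) \<oplus>\<^bsub>N\<^esub> v" using GP[OF x] by (auto simp: P_def)
    have lN: "left_smult N l \<in> add_hom N N" and lM: "left_smult M l \<in> add_hom M M"
      using M N l by (auto simp: biadditive_def)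
    have "left_smult N l x = left_smult N l (h (G x)) \<oplus>\<^bsub>N\<^esub> left_smult N l v"
      using add_hom_add[OF lN add_hom_closed[OF bimodule_homD(1)[OF hF] Gc[OF x]] subsetD[OF V.a_subset v(1)]] v(2)
      by simp
    also have "left_smult N l (h (G x)) = h (left_smult M l (G x))"
      using bimodule_homD(2)[OF hF l Gc[OF x]] by simp
    finally have "P (left_smult N l x) (left_smult M l (G x))"
      unfolding P_def using V l v(1) add_hom_closed[OF lM Gc[OF x]] by (auto simp: sub_bimodule_def)
    then show ?thesis using GI add_hom_closed[OF lN x] by simp
  qed
  moreover have "G (right_smult N x s) = right_smult M (G x) s" if s: "s \<in> S" and x: "x \<in> carrier N" for s x
  proof -
    obtain v where v: "v \<in> V" "x = h (G x) \<oplus>\<^bsub>N\<^esub> v" using GP[OF x] by (auto simp: P_def)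
    have rN: "(\<lambda>x. right_smult N x s) \<in> add_hom N N" and rM: "(\<lambda>x. right_smult M x s) \<in> add_hom M M"
      using M N s by (auto simp: biadditive_def)
    have "right_smult N x s = right_smult N (h (G x)) s \<oplus>\<^bsub>N\<^esub> right_smult N v s"
      using add_hom_add[OF rN add_hom_closed[OF bimodule_homD(1)[OF hF] Gc[OF x]] subsetD[OF V.a_subset v(1)]] v(2)
      by simp
    also have "right_smult N (h (G x)) s = h (right_smult M (G x) s)"
      using bimodule_homD(3)[OF hF s Gc[OF x]] by simp
    finally have "P (right_smult N x s) (right_smult M (G x) s)"
      unfolding P_def using V s v(1) add_hom_closed[OF rM Gc[OF x]] by (auto simp: sub_bimodule_def)
    then show ?thesis using GI add_hom_closed[OF rN x] by simp
  qed
  ultimately have G: "G \<in> bimodule_hom L S N M" by (simp add: bimodule_hom_def)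
  have Gh: "G (h m) = m" if "m \<in> carrier M" for m
    using GI[OF Ph[OF that]] that hF by (simp add: bimodule_hom_def add_hom_def Pi_iff)
  show thesis by (rule that[OF hF G Gh])
qed

text \<open>A split embedding into a power amounts to finitely many pairs of maps with \<Sum> g_i
  f_i = id. In this form a depth two quasi-basis can be inserted directly.\<close>

lemma iso_to_direct_summand_powerI:
  fixes p :: nat
  assumes M: "biadditive L S M" and N: "biadditive L S N"
    and f: "\<And>i. i < p \<Longrightarrow> f i \<in> bimodule_hom L S M N"
    and g: "\<And>i. i < p \<Longrightarrow> g i \<in> bimodule_hom L S N M"
    and gf: "\<And>m. m \<in> carrier M \<Longrightarrow> (\<Oplus>\<^bsub>M\<^esub>i\<in>{..<p}. g i (f i m)) = m"
  shows "iso_to_direct_summand L S M (bimodule_power N p)"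
proof -
  interpret M: abelian_group M using M by (simp add: biadditive_def)
  interpret N: abelian_group N using N by (simp add: biadditive_def)
  let ?F = "\<lambda>m. \<lambda>i\<in>{..<p}. f i m" and ?G = "\<lambda>x. \<Oplus>\<^bsub>M\<^esub>i\<in>{..<p}. g i (x i)"
  note fa = bimodule_homD(1)[OF f] note ga = bimodule_homD(1)[OF g]
  have gc: "g i (x i) \<in> carrier M" if "x \<in> {..<p} \<rightarrow>\<^sub>E carrier N" "i < p" for x i
    using add_hom_closed[OF ga[OF that(2)]] that by auto
  have F: "?F \<in> bimodule_hom L S M (bimodule_power N p)"
    using bimodule_homD[OF f]
    by (auto simp: bimodule_hom_def add_hom_def power_simps PiE_iff Pi_iff fun_eq_iff)
  have "?G \<in> add_hom (bimodule_power N p) M"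
  proof (rule add_homI)
    fix x y assume x: "x \<in> carrier (bimodule_power N p)" and y: "y \<in> carrier (bimodule_power N p)"
    have "?G (x \<oplus>\<^bsub>bimodule_power N p\<^esub> y) = (\<Oplus>\<^bsub>M\<^esub>i\<in>{..<p}. g i (x i) \<oplus>\<^bsub>M\<^esub> g i (y i))"
      using x y gc add_hom_add[OF ga] by (intro M.add.finprod_cong') (auto simp: power_simps PiE_iff)
    also have "\<dots> = ?G x \<oplus>\<^bsub>M\<^esub> ?G y"
      using x y gc by (intro M.finsum_addf) (auto simp: power_simps)
    finally show "?G (x \<oplus>\<^bsub>bimodule_power N p\<^esub> y) = ?G x \<oplus>\<^bsub>M\<^esub> ?G y" .
  qed (use gc in \<open>auto simp: power_simps intro!: M.finsum_closed\<close>)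
  moreover have "?G (left_smult (bimodule_power N p) l x) = left_smult M l (?G x)"
    if l: "l \<in> L" and x: "x \<in> carrier (bimodule_power N p)" for l x
  proof -
    have "left_smult M l (?G x) = (\<Oplus>\<^bsub>M\<^esub>i\<in>{..<p}. left_smult M l (g i (x i)))"
      using M l x gc by (intro add_hom_finsum[OF M.abelian_group_axioms M.abelian_group_axioms])
        (auto simp: biadditive_def power_simps)
    also have "\<dots> = ?G (left_smult (bimodule_power N p) l x)"
      using M N l x bimodule_homD(2)[OF g] gc
      by (intro M.add.finprod_cong')
        (auto simp: power_simps PiE_iff biadditive_def add_hom_def Pi_iff)
    finally show ?thesis by simp
  qed
  moreover have "?G (right_smult (bimodule_power N p) x s) = right_smult M (?G x) s"
    if s: "s \<in> S" and x: "x \<in> carrier (bimodule_power N p)" for s x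
  proof -
    have "right_smult M (?G x) s = (\<Oplus>\<^bsub>M\<^esub>i\<in>{..<p}. right_smult M (g i (x i)) s)"
      using M s x gc by (intro add_hom_finsum[OF M.abelian_group_axioms M.abelian_group_axioms,
          where f = "\<lambda>x. right_smult M x s"])
        (auto simp: biadditive_def power_simps)
    also have "\<dots> = ?G (right_smult (bimodule_power N p) x s)"
      using M N s x bimodule_homD(3)[OF g] gc
      by (intro M.add.finprod_cong')
        (auto simp: power_simps PiE_iff biadditive_def add_hom_def Pi_iff)
    finally show ?thesis by simp
  qed
  ultimately have G: "?G \<in> bimodule_hom L S (bimodule_power N p) M" by (simp add: bimodule_hom_def)
  have "?G (?F m) = m" if m: "m \<in> carrier M" for m
  proof -
    have "?G (?F m) = (\<Oplus>\<^bsub>M\<^esub>i\<in>{..<p}. g i (f i m))"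
      using add_hom_closed[OF ga] add_hom_closed[OF fa] m by (intro M.add.finprod_cong') auto
    then show ?thesis using gf[OF m] by simp
  qed
  then show ?thesis by (rule iso_to_direct_summandI[OF M biadditive_power[OF N] F G])
qed

text \<open>Extracts the spanning of \<open>M\<close> by images of bimodule maps from
  \<open>N\<close>: identities of additive maps on \<open>M\<close> can then be tested on the
  images.\<close>

lemma iso_to_direct_summand_powerE:
  fixes p :: nat
  assumes M: "biadditive L S M" and N: "biadditive L S N"
    and iso: "iso_to_direct_summand L S M (bimodule_power N p)"
  obtains g where "\<And>i. i < p \<Longrightarrow> g i \<in> bimodule_hom L S N M"
    and "\<And>m. m \<in> carrier M \<Longrightarrow> \<exists>n \<in> {..<p} \<rightarrow> carrier N. m = (\<Oplus>\<^bsub>M\<^esub>i\<in>{..<p}. g i (n i))"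
proof -
  interpret M: abelian_group M using M by (simp add: biadditive_def)
  interpret N: abelian_group N using N by (simp add: biadditive_def)
  let ?N = "bimodule_power N p"
  interpret NP: abelian_group ?N by (rule abelian_group_power) (rule N.abelian_group_axioms)
  obtain F G where F: "F \<in> bimodule_hom L S M ?N" and G: "G \<in> bimodule_hom L S ?N M"
    and GF: "\<And>m. m \<in> carrier M \<Longrightarrow> G (F m) = m"
    by (rule iso_to_direct_summandE[OF M biadditive_power[OF N] iso]) (rule that)
  define \<iota> where "\<iota> i n = (\<lambda>j\<in>{..<p}. if j = i then n else \<zero>\<^bsub>N\<^esub>)" for i n
  have z: "left_smult N l \<zero>\<^bsub>N\<^esub> = \<zero>\<^bsub>N\<^esub>" if "l \<in> L" for l
    using N that add_hom_zero[OF N.abelian_group_axioms N.abelian_group_axioms] by (simp add: biadditive_def)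
  have z': "right_smult N \<zero>\<^bsub>N\<^esub> s = \<zero>\<^bsub>N\<^esub>" if "s \<in> S" for s
    using N that add_hom_zero[OF N.abelian_group_axioms N.abelian_group_axioms, of "\<lambda>x. right_smult N x s"]
    by (simp add: biadditive_def)
  have \<iota>: "\<iota> i \<in> bimodule_hom L S N ?N" for i
    using N z z'
    by (auto simp: \<iota>_def bimodule_hom_def add_hom_def power_simps PiE_iff Pi_iff fun_eq_iff biadditive_def)
  have \<iota>c: "\<iota> i n \<in> carrier ?N" if "n \<in> carrier N" for i n
    using add_hom_closed[OF bimodule_homD(1)[OF \<iota>] that] .
  have sum: "(\<Oplus>\<^bsub>?N\<^esub>i\<in>{..<p}. \<iota> i (x i)) = x" if x: "x \<in> carrier ?N" for x
  proof -
    have xc: "x i \<in> carrier N" if "i < p" for i using x that by (auto simp: power_simps)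
    have "(\<Oplus>\<^bsub>?N\<^esub>i\<in>{..<p}. \<iota> i (x i)) \<in> carrier ?N"
      using xc \<iota>c by (intro NP.finsum_closed) auto
    moreover have "(\<Oplus>\<^bsub>?N\<^esub>i\<in>{..<p}. \<iota> i (x i)) j = x j" if j: "j < p" for j
    proof -
      have "(\<lambda>y. y j) \<in> add_hom ?N N" using j by (auto simp: add_hom_def power_simps)
      from add_hom_finsum[OF NP.abelian_group_axioms N.abelian_group_axioms this, of "{..<p}" "\<lambda>i. \<iota> i (x i)"]
      have "(\<Oplus>\<^bsub>?N\<^esub>i\<in>{..<p}. \<iota> i (x i)) j = (\<Oplus>\<^bsub>N\<^esub>i\<in>{..<p}. \<iota> i (x i) j)"
        using xc \<iota>c by auto
      also have "\<dots> = (\<Oplus>\<^bsub>N\<^esub>i\<in>{..<p}. if j = i then x i else \<zero>\<^bsub>N\<^esub>)"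
        using xc j by (intro N.add.finprod_cong') (auto simp: \<iota>_def)
      also have "\<dots> = x j"
        using xc j by (intro N.add.finprod_singleton) auto
      finally show ?thesis .
    qed
    ultimately show ?thesis
      using x by (intro PiE_ext[of _ "{..<p}" "\<lambda>i. carrier N"]) (auto simp: power_simps)
  qed
  define g where "g i n = G (\<iota> i n)" for i n
  have g: "g i \<in> bimodule_hom L S N M" for i
    using \<iota>[of i] G \<iota>c
    by (auto simp: bimodule_hom_def g_def add_hom_def Pi_iff)
  have "\<exists>n \<in> {..<p} \<rightarrow> carrier N. m = (\<Oplus>\<^bsub>M\<^esub>i\<in>{..<p}. g i (n i))" if m: "m \<in> carrier M" for m
  proof (rule bexI)
    have Fm: "F m \<in> carrier ?N" using add_hom_closed[OF bimodule_homD(1)[OF F] m] .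
    show "F m \<in> {..<p} \<rightarrow> carrier N" using Fm by (auto simp: power_simps)
    then have "G (\<Oplus>\<^bsub>?N\<^esub>i\<in>{..<p}. \<iota> i (F m i)) = (\<Oplus>\<^bsub>M\<^esub>i\<in>{..<p}. g i (F m i))"
      unfolding g_def using \<iota>c
      by (intro add_hom_finsum[OF NP.abelian_group_axioms M.abelian_group_axioms bimodule_homD(1)[OF G]]) auto
    then show "m = (\<Oplus>\<^bsub>M\<^esub>i\<in>{..<p}. g i (F m i))" using sum[OF Fm] GF[OF m] by simp
  qed
  then show thesis by (rule that[OF g])
qed

section \<open>Depth two of a ring extension\<close>

locale ring_extension = ring H for R and H :: "('h, 'm) ring_scheme" (structure) +
  assumes subring: "subring R H"
begin

lemma R_subset: "R \<subseteq> carrier H"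
  using subring by (rule subringE(1))

lemma R_in: "r \<in> R \<Longrightarrow> r \<in> carrier H"
  using R_subset by auto

lemma presentation_tensor_power: "presentation (tensor_power_words H n) (tensor_power_rels R H n)"
proof
  fix \<rho> assume "\<rho> \<in> tensor_power_rels R H n"
  then consider
      xs x y ys where "\<rho> = frag_of (xs @ (x \<oplus> y) # ys) - frag_of (xs @ x # ys) - frag_of (xs @ y # ys)"
        "set xs \<union> set ys \<union> {x, y} \<subseteq> carrier H" "length xs + length ys + 1 = n"
    | xs x r y ys where "\<rho> = frag_of (xs @ (x \<otimes> r) # y # ys) - frag_of (xs @ x # (r \<otimes> y) # ys)"
        "set xs \<union> set ys \<union> {x, y} \<subseteq> carrier H" "r \<in> R" "length xs + length ys + 2 = n"
    unfolding tensor_power_rels_def by blast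
  then show "Poly_Mapping.keys \<rho> \<subseteq> tensor_power_words H n"
    using R_in
    by cases (auto simp: tensor_power_words_def dest!: subsetD[OF keys_diff] split: if_splits)
qed

sublocale T1: presentation "tensor_power_words H (Suc 0)" "tensor_power_rels R H (Suc 0)"
  by (rule presentation_tensor_power)
sublocale T2: presentation "tensor_power_words H 2" "tensor_power_rels R H 2"
  by (rule presentation_tensor_power)

text \<open>Bimodules isomorphic to H and to the tensor square of H over \<open>R\<close>, whose
  generators are words of length one and two. The index is \<open>Suc 0\<close> because the
  simplifier rewrites \<open>1\<close> to it.\<close>

abbreviation "M\<^sub>1 \<equiv> tensor_power R H (Suc 0)"
abbreviation "M\<^sub>2 \<equiv> tensor_power R H 2"
abbreviation "e\<^sub>1 x \<equiv> T1.cls [x]"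
abbreviation "e\<^sub>2 x y \<equiv> T2.cls [x, y]"

lemma word1_in_iff [simp]: "[x] \<in> tensor_power_words H (Suc 0) \<longleftrightarrow> x \<in> carrier H"
  by (simp add: tensor_power_words_def)

lemma word2_in_iff [simp]: "[x, y] \<in> tensor_power_words H 2 \<longleftrightarrow> x \<in> carrier H \<and> y \<in> carrier H"
  by (simp add: tensor_power_words_def)

lemma words1E:
  assumes "xs \<in> tensor_power_words H (Suc 0)"
  obtains x where "x \<in> carrier H" "xs = [x]"
  using assms by (cases xs) (auto simp: tensor_power_words_def)

lemma words2E:
  assumes "xs \<in> tensor_power_words H 2"
  obtains x y where "x \<in> carrier H" "y \<in> carrier H" "xs = [x, y]"
proof -
  have "length xs = Suc (Suc 0)" using assms by (simp add: tensor_power_words_def)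
  then obtain x y where "xs = [x, y]" by (auto simp: length_Suc_conv)
  with assms show thesis by (intro that[of x y]) simp_all
qed

lemma rels1E:
  assumes "\<rho> \<in> tensor_power_rels R H (Suc 0)"
  obtains x y where "x \<in> carrier H" "y \<in> carrier H" "\<rho> = frag_of [x \<oplus> y] - frag_of [x] - frag_of [y]"
  using assms by (auto simp: tensor_power_rels_def)

lemma rel1_in: "x \<in> carrier H \<Longrightarrow> y \<in> carrier H \<Longrightarrow>
    frag_of [x \<oplus> y] - frag_of [x] - frag_of [y] \<in> tensor_power_rels R H (Suc 0)"
  unfolding tensor_power_rels_def
  by (intro UnI1 CollectI exI[of _ "[]"] exI[of _ x] exI[of _ y]) simp

lemma rels2E:
  assumes "\<rho> \<in> tensor_power_rels R H 2"
  obtains (left) x y z where "x \<in> carrier H" "y \<in> carrier H" "z \<in> carrier H"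
      "\<rho> = frag_of [x \<oplus> y, z] - frag_of [x, z] - frag_of [y, z]"
    | (right) x y z where "x \<in> carrier H" "y \<in> carrier H" "z \<in> carrier H"
      "\<rho> = frag_of [z, x \<oplus> y] - frag_of [z, x] - frag_of [z, y]"
    | (middle) x r y where "x \<in> carrier H" "r \<in> R" "y \<in> carrier H"
      "\<rho> = frag_of [x \<otimes> r, y] - frag_of [x, r \<otimes> y]"
proof -
  from assms show thesis
    unfolding tensor_power_rels_def
  proof (elim UnE CollectE exE conjE)
    fix xs x y ys
    assume a: "\<rho> = frag_of (xs @ (x \<oplus> y) # ys) - frag_of (xs @ x # ys) - frag_of (xs @ y # ys)"
      "set xs \<union> set ys \<union> {x, y} \<subseteq> carrier H" "length xs + length ys + 1 = 2"
    show thesis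
    proof (cases xs)
      case Nil
      with a(3) obtain z where "ys = [z]" by (auto simp: length_Suc_conv)
      with a Nil show thesis by (intro left[of x y z]) simp_all
    next
      case (Cons z zs)
      with a(3) have "xs = [z]" "ys = []" by simp_all
      with a show thesis by (intro right[of x y z]) simp_all
    qed
  next
    fix xs x r y ys
    assume a: "\<rho> = frag_of (xs @ (x \<otimes> r) # y # ys) - frag_of (xs @ x # (r \<otimes> y) # ys)"
      "set xs \<union> set ys \<union> {x, y} \<subseteq> carrier H" "r \<in> R" "length xs + length ys + 2 = 2"
    then have "xs = []" "ys = []" by simp_all
    with a show thesis by (intro middle[of x r y]) simp_all
  qed
qed

lemma rel2_in:
  shows "x \<in> carrier H \<Longrightarrow> y \<in> carrier H \<Longrightarrow> z \<in> carrier H \<Longrightarrow>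
      frag_of [x \<oplus> y, z] - frag_of [x, z] - frag_of [y, z] \<in> tensor_power_rels R H 2"
    and "x \<in> carrier H \<Longrightarrow> y \<in> carrier H \<Longrightarrow> z \<in> carrier H \<Longrightarrow>
      frag_of [z, x \<oplus> y] - frag_of [z, x] - frag_of [z, y] \<in> tensor_power_rels R H 2"
    and "x \<in> carrier H \<Longrightarrow> r \<in> R \<Longrightarrow> y \<in> carrier H \<Longrightarrow>
      frag_of [x \<otimes> r, y] - frag_of [x, r \<otimes> y] \<in> tensor_power_rels R H 2"
  unfolding tensor_power_rels_def
  subgoal by (intro UnI1 CollectI exI[of _ "[]"] exI[of _ x] exI[of _ y] exI[of _ "[z]"]) simp
  subgoal by (intro UnI1 CollectI exI[of _ "[z]"] exI[of _ x] exI[of _ y] exI[of _ "[]"]) simp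
  subgoal by (intro UnI2 CollectI exI[of _ "[]"] exI[of _ x] exI[of _ r] exI[of _ y]) simp
  done

lemma tensor_power_simps:
  "carrier M\<^sub>1 = carrier T1.Q" "x \<oplus>\<^bsub>M\<^sub>1\<^esub> y = x \<oplus>\<^bsub>T1.Q\<^esub> y" "\<zero>\<^bsub>M\<^sub>1\<^esub> = \<zero>\<^bsub>T1.Q\<^esub>"
  "carrier M\<^sub>2 = carrier T2.Q" "s \<oplus>\<^bsub>M\<^sub>2\<^esub> t = s \<oplus>\<^bsub>T2.Q\<^esub> t" "\<zero>\<^bsub>M\<^sub>2\<^esub> = \<zero>\<^bsub>T2.Q\<^esub>"
  by (simp_all add: tensor_power_def Let_def)

lemma add_hom_M:
  "add_hom M\<^sub>1 P = add_hom T1.Q P" "add_hom P' M\<^sub>1 = add_hom P' T1.Q"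
  "add_hom M\<^sub>2 P'' = add_hom T2.Q P''" "add_hom P''' M\<^sub>2 = add_hom P''' T2.Q"
  by (simp_all add: add_hom_def tensor_power_simps)

lemma abelian_groups: "abelian_group M\<^sub>1" "abelian_group M\<^sub>2"
proof -
  interpret Q1: abelian_group T1.Q by (rule T1.abelian_group_presented_group)
  interpret Q2: abelian_group T2.Q by (rule T2.abelian_group_presented_group)
  show "abelian_group M\<^sub>1"
    by (rule abelian_groupI)
      (simp_all add: tensor_power_simps Q1.a_assoc, auto simp: Q1.a_comm intro: Q1.l_neg Q1.a_inv_closed)
  show "abelian_group M\<^sub>2"
    by (rule abelian_groupI)
      (simp_all add: tensor_power_simps Q2.a_assoc, auto simp: Q2.a_comm intro: Q2.l_neg Q2.a_inv_closed)
qed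

sublocale M1: abelian_group M\<^sub>1 by (rule abelian_groups)
sublocale M2: abelian_group M\<^sub>2 by (rule abelian_groups)

lemma frag_sum_rel3:
  assumes P: "abelian_group P" and f: "f b \<in> carrier P" "f c \<in> carrier P"
    and eq: "f a = f b \<oplus>\<^bsub>P\<^esub> f c"
  shows "frag_sum P f (frag_of a - frag_of b - frag_of c) = \<zero>\<^bsub>P\<^esub>"
proof -
  interpret P: abelian_group P by fact
  have k: "Poly_Mapping.keys (frag_of a - frag_of b) \<subseteq> {a, b, c}"
    by (auto dest!: subsetD[OF keys_diff] split: if_splits)
  have fa: "f a \<in> carrier P" using f eq by simp
  have fc: "f \<in> {a, b, c} \<rightarrow> carrier P" using f fa by auto
  show ?thesis
    using P.frag_sum_diff[OF fc k, of "frag_of c"] P.frag_sum_diff[OF fc, of "frag_of a" "frag_of b"]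
      f fa P.add_minus_minus[OF f]
    by (simp add: P.frag_sum_of eq)
qed

lemma frag_sum_rel2:
  assumes P: "abelian_group P" and f: "f a \<in> carrier P" "f b \<in> carrier P" and eq: "f a = f b"
  shows "frag_sum P f (frag_of a - frag_of b) = \<zero>\<^bsub>P\<^esub>"
proof -
  interpret P: abelian_group P by fact
  have fc: "f \<in> {a, b} \<rightarrow> carrier P" using f by auto
  show ?thesis
    using P.frag_sum_diff[OF fc, of "frag_of a" "frag_of b"] f
    by (simp add: P.frag_sum_of eq a_minus_def P.r_neg)
qed

definition lift\<^sub>1 :: "('p, 'q) ring_scheme \<Rightarrow> ('h \<Rightarrow> 'p) \<Rightarrow> ('h list \<Rightarrow>\<^sub>0 int) set \<Rightarrow> 'p" where
  "lift\<^sub>1 P f t = presented_lift P t (\<lambda>xs. f (hd xs))"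

definition lift\<^sub>2 :: "('p, 'q) ring_scheme \<Rightarrow> ('h \<Rightarrow> 'h \<Rightarrow> 'p) \<Rightarrow> ('h list \<Rightarrow>\<^sub>0 int) set \<Rightarrow> 'p" where
  "lift\<^sub>2 P f t = presented_lift P t (\<lambda>xs. f (hd xs) (hd (tl xs)))"

definition balanced :: "('p, 'q) ring_scheme \<Rightarrow> ('h \<Rightarrow> 'h \<Rightarrow> 'p) \<Rightarrow> bool" where
  "balanced P f \<longleftrightarrow> (\<forall>x\<in>carrier H. f x \<in> add_hom H P) \<and> (\<forall>y\<in>carrier H. (\<lambda>x. f x y) \<in> add_hom H P) \<and>
    (\<forall>r\<in>R. \<forall>x\<in>carrier H. \<forall>y\<in>carrier H. f (x \<otimes> r) y = f x (r \<otimes> y))"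

lemma
  assumes P: "abelian_group P" and f: "f \<in> add_hom H P"
  shows lift\<^sub>1_hom: "lift\<^sub>1 P f \<in> add_hom M\<^sub>1 P"
    and lift\<^sub>1_e [simp]: "x \<in> carrier H \<Longrightarrow> lift\<^sub>1 P f (e\<^sub>1 x) = f x"
proof -
  have fc: "(\<lambda>xs. f (hd xs)) \<in> tensor_power_words H (Suc 0) \<rightarrow> carrier P"
    using add_hom_closed[OF f] by (auto elim: words1E)
  have kill: "frag_sum P (\<lambda>xs. f (hd xs)) \<rho> = \<zero>\<^bsub>P\<^esub>" if "\<rho> \<in> tensor_power_rels R H (Suc 0)" for \<rho>
    using that by (rule rels1E)
      (simp add: frag_sum_rel3[OF P] add_hom_closed[OF f] add_hom_add[OF f])
  show "lift\<^sub>1 P f \<in> add_hom M\<^sub>1 P"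
    using T1.presented_lift_add_hom[OF P fc kill] by (simp add: add_hom_M lift\<^sub>1_def[abs_def])
  show "x \<in> carrier H \<Longrightarrow> lift\<^sub>1 P f (e\<^sub>1 x) = f x"
    unfolding lift\<^sub>1_def using T1.presented_lift_cls[OF P fc kill, of "[x]"] by simp
qed

lemma
  assumes P: "abelian_group P" and f: "balanced P f"
  shows lift\<^sub>2_hom: "lift\<^sub>2 P f \<in> add_hom M\<^sub>2 P"
    and lift\<^sub>2_e [simp]: "x \<in> carrier H \<Longrightarrow> y \<in> carrier H \<Longrightarrow> lift\<^sub>2 P f (e\<^sub>2 x y) = f x y"
proof -
  have cl: "f x y \<in> carrier P" if "x \<in> carrier H" "y \<in> carrier H" for x y
    using f that by (auto simp: balanced_def add_hom_def Pi_iff)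
  have fc: "(\<lambda>xs. f (hd xs) (hd (tl xs))) \<in> tensor_power_words H 2 \<rightarrow> carrier P"
    using cl by (auto elim: words2E)
  have add: "f (x \<oplus> y) z = f x z \<oplus>\<^bsub>P\<^esub> f y z" "f z (x \<oplus> y) = f z x \<oplus>\<^bsub>P\<^esub> f z y"
    if "x \<in> carrier H" "y \<in> carrier H" "z \<in> carrier H" for x y z
    using f that by (auto simp: balanced_def add_hom_def)
  have bal: "f (x \<otimes> r) y = f x (r \<otimes> y)" if "x \<in> carrier H" "r \<in> R" "y \<in> carrier H" for x r y
    using f that by (auto simp: balanced_def)
  have kill: "frag_sum P (\<lambda>xs. f (hd xs) (hd (tl xs))) \<rho> = \<zero>\<^bsub>P\<^esub>" if "\<rho> \<in> tensor_power_rels R H 2" for \<rho>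
    using that
    by (rule rels2E) (simp_all add: frag_sum_rel3[OF P] frag_sum_rel2[OF P] cl add bal R_in)
  show "lift\<^sub>2 P f \<in> add_hom M\<^sub>2 P"
    using T2.presented_lift_add_hom[OF P fc kill] by (simp add: add_hom_M lift\<^sub>2_def[abs_def])
  show "x \<in> carrier H \<Longrightarrow> y \<in> carrier H \<Longrightarrow> lift\<^sub>2 P f (e\<^sub>2 x y) = f x y"
    unfolding lift\<^sub>2_def using T2.presented_lift_cls[OF P fc kill, of "[x, y]"] by simp
qed

lemma e\<^sub>1_hom: "T1.cls [x] \<in> carrier M\<^sub>1" if "x \<in> carrier H" for x
  using T1.cls_closed[of "[x]"] that by (simp add: tensor_power_simps)

lemma e\<^sub>2_closed: "x \<in> carrier H \<Longrightarrow> y \<in> carrier H \<Longrightarrow> e\<^sub>2 x y \<in> carrier M\<^sub>2"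
  using T2.cls_closed[of "[x, y]"] by (simp add: tensor_power_simps)

lemma coset_rel3:
  assumes "presentation gens Rel" "a \<in> gens" "b \<in> gens" "c \<in> gens" "frag_of a - frag_of b - frag_of c \<in> Rel"
  shows "presented_class gens Rel a =
    presented_class gens Rel b \<oplus>\<^bsub>presented_group gens Rel\<^esub> presented_class gens Rel c"
proof -
  interpret presentation gens Rel by fact
  interpret Q: abelian_group Q by (rule abelian_group_presented_group)
  have "Poly_Mapping.keys (frag_of a - frag_of b) \<subseteq> gens"
    using assms by (auto dest!: subsetD[OF keys_diff] split: if_splits)
  then have "coset (frag_of a) \<ominus>\<^bsub>Q\<^esub> coset (frag_of b) \<ominus>\<^bsub>Q\<^esub> coset (frag_of c) = \<zero>\<^bsub>Q\<^esub>"
    using coset_rel[OF assms(5)] assms by (simp add: coset_diff)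
  note eq = this
  have cl: "coset (frag_of a) \<in> carrier Q" "coset (frag_of b) \<in> carrier Q" "coset (frag_of c) \<in> carrier Q"
    using assms by (simp_all add: coset_closed)
  from eq have "coset (frag_of a) \<ominus>\<^bsub>Q\<^esub> coset (frag_of b) = coset (frag_of c)"
    by (rule Q.minus_eq_zeroD) (use cl in simp_all)
  moreover have "coset (frag_of b) \<oplus>\<^bsub>Q\<^esub> (coset (frag_of a) \<ominus>\<^bsub>Q\<^esub> coset (frag_of b)) = coset (frag_of a)"
    unfolding a_minus_def Q.a_comm[OF cl(1) Q.a_inv_closed[OF cl(2)]] by (rule Q.r_neg2[OF cl(2,1)])
  ultimately show ?thesis by (simp add: cls_eq)
qed

lemma coset_rel2:
  assumes "presentation gens Rel" "a \<in> gens" "b \<in> gens" "frag_of a - frag_of b \<in> Rel"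
  shows "presented_class gens Rel a = presented_class gens Rel b"
proof -
  interpret presentation gens Rel by fact
  interpret Q: abelian_group Q by (rule abelian_group_presented_group)
  have "coset (frag_of a) \<ominus>\<^bsub>Q\<^esub> coset (frag_of b) = \<zero>\<^bsub>Q\<^esub>"
    using coset_rel[OF assms(4)] assms by (simp add: coset_diff)
  then have "coset (frag_of a) = coset (frag_of b)"
    by (rule Q.minus_eq_zeroD) (use assms in \<open>simp_all add: coset_closed\<close>)
  then show ?thesis by (simp add: cls_eq)
qed

lemma e\<^sub>1_add_hom: "(\<lambda>x. e\<^sub>1 x) \<in> add_hom H M\<^sub>1"
proof (rule add_homI[OF e\<^sub>1_hom])
  fix x y assume "x \<in> carrier H" "y \<in> carrier H"
  then show "e\<^sub>1 (x \<oplus> y) = e\<^sub>1 x \<oplus>\<^bsub>M\<^sub>1\<^esub> e\<^sub>1 y"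
    using coset_rel3[OF presentation_tensor_power, of "[x \<oplus> y]" "Suc 0" "[x]" "[y]"]
    by (simp add: tensor_power_simps rel1_in)
qed

lemma balanced_e\<^sub>2: "balanced M\<^sub>2 e\<^sub>2"
proof -
  have "e\<^sub>2 (x \<oplus> y) z = e\<^sub>2 x z \<oplus>\<^bsub>M\<^sub>2\<^esub> e\<^sub>2 y z" "e\<^sub>2 z (x \<oplus> y) = e\<^sub>2 z x \<oplus>\<^bsub>M\<^sub>2\<^esub> e\<^sub>2 z y"
    if "x \<in> carrier H" "y \<in> carrier H" "z \<in> carrier H" for x y z
    using that coset_rel3[OF presentation_tensor_power, of "[x \<oplus> y, z]" 2 "[x, z]" "[y, z]"]
      coset_rel3[OF presentation_tensor_power, of "[z, x \<oplus> y]" 2 "[z, x]" "[z, y]"]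
    by (simp_all add: tensor_power_simps rel2_in)
  moreover have "e\<^sub>2 (x \<otimes> r) y = e\<^sub>2 x (r \<otimes> y)" if "x \<in> carrier H" "r \<in> R" "y \<in> carrier H" for x r y
    using that R_in coset_rel2[OF presentation_tensor_power, of "[x \<otimes> r, y]" 2 "[x, r \<otimes> y]"]
    by (simp add: rel2_in)
  ultimately show ?thesis by (auto simp: balanced_def add_hom_def e\<^sub>2_closed)
qed

text \<open>The additivity relation merges any integer combination of words of length one into a
  single word. Elements of \<open>M\<^sub>2\<close> have no such normal form, and for them
  \<open>M\<^sub>2_eqI\<close> compares additive maps on simple tensors.\<close>

lemma M\<^sub>1_cases:
  assumes "t \<in> carrier M\<^sub>1"
  obtains x where "x \<in> carrier H" "t = e\<^sub>1 x"
proof -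
  have "t \<in> carrier T1.Q" using assms by (simp add: tensor_power_simps)
  then have "\<exists>x\<in>carrier H. t = e\<^sub>1 x"
  proof (induction rule: T1.presented_group_induct)
    case zero
    show ?case
      using add_hom_zero[OF abelian_group_axioms abelian_groups(1) e\<^sub>1_add_hom]
      by (intro bexI[of _ \<zero>]) (simp_all add: tensor_power_simps)
  next
    case (diff x y)
    then obtain u v where uv: "u \<in> carrier H" "v \<in> carrier H" "x = e\<^sub>1 u" "y = e\<^sub>1 v" by blast
    have "x \<ominus>\<^bsub>T1.Q\<^esub> y = x \<ominus>\<^bsub>M\<^sub>1\<^esub> y"
      by (simp add: a_minus_def tensor_power_simps a_inv_def m_inv_def)
    also have "\<dots> = e\<^sub>1 (u \<ominus> v)"
      using uv add_hom_add[OF e\<^sub>1_add_hom, of u "\<ominus> v"]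
        add_hom_a_inv[OF abelian_group_axioms abelian_groups(1) e\<^sub>1_add_hom]
      by (simp add: a_minus_def)
    finally show ?case using uv by blast
  next
    case (cls x)
    then show ?case by (auto elim: words1E)
  qed
  then show thesis by (elim bexE) (rule that)
qed

lemma M\<^sub>2_eqI:
  assumes P: "abelian_group P" and "f \<in> add_hom M\<^sub>2 P" "g \<in> add_hom M\<^sub>2 P"
    and "\<And>x y. x \<in> carrier H \<Longrightarrow> y \<in> carrier H \<Longrightarrow> f (e\<^sub>2 x y) = g (e\<^sub>2 x y)"
    and "t \<in> carrier M\<^sub>2"
  shows "f t = g t"
  by (rule T2.add_hom_eqI[OF P, of f g]) (use assms in \<open>auto simp: add_hom_M tensor_power_simps elim: words2E\<close>)

text \<open>The general definition manipulates heads and tails of lists of any length; on words of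
  length one it is plain multiplication. The two formulas agree only on generators, which is all
  that \<open>presented_lift_cong\<close> asks for. The three companions below rest on the same
  comparison.\<close>

lemma smult_M\<^sub>1:
  "left_smult M\<^sub>1 h t = lift\<^sub>1 T1.Q (\<lambda>x. e\<^sub>1 (h \<otimes> x)) t"
  if "t \<in> carrier M\<^sub>1" "h \<in> carrier H" for h t
proof -
  have "presented_lift T1.Q t (\<lambda>xs. T1.cls ((h \<otimes> hd xs) # tl xs)) = presented_lift T1.Q t (\<lambda>xs. e\<^sub>1 (h \<otimes> hd xs))"
    by (rule T1.presented_lift_cong[OF T1.abelian_group_presented_group])
      (use that e\<^sub>1_hom in \<open>auto simp: tensor_power_simps elim!: words1E\<close>)
  then show ?thesis by (simp add: tensor_power_def Let_def lift\<^sub>1_def)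
qed

lemma right_smult_M\<^sub>1:
  "right_smult M\<^sub>1 t h = lift\<^sub>1 T1.Q (\<lambda>x. e\<^sub>1 (x \<otimes> h)) t"
  if "t \<in> carrier M\<^sub>1" "h \<in> carrier H" for h t
proof -
  have "presented_lift T1.Q t (\<lambda>xs. T1.cls (butlast xs @ [last xs \<otimes> h])) = presented_lift T1.Q t (\<lambda>xs. e\<^sub>1 (hd xs \<otimes> h))"
    by (rule T1.presented_lift_cong[OF T1.abelian_group_presented_group])
      (use that e\<^sub>1_hom in \<open>auto simp: tensor_power_simps elim!: words1E\<close>)
  then show ?thesis by (simp add: tensor_power_def Let_def lift\<^sub>1_def)
qed

lemma left_smult_M\<^sub>2:
  "left_smult M\<^sub>2 h t = lift\<^sub>2 T2.Q (\<lambda>x y. e\<^sub>2 (h \<otimes> x) y) t"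
  if "t \<in> carrier M\<^sub>2" "h \<in> carrier H" for h t
proof -
  have "presented_lift T2.Q t (\<lambda>xs. T2.cls ((h \<otimes> hd xs) # tl xs)) = presented_lift T2.Q t (\<lambda>xs. e\<^sub>2 (h \<otimes> hd xs) (hd (tl xs)))"
    by (rule T2.presented_lift_cong[OF T2.abelian_group_presented_group])
      (use that e\<^sub>2_closed in \<open>auto simp: tensor_power_simps elim!: words2E\<close>)
  then show ?thesis by (simp add: tensor_power_def Let_def lift\<^sub>2_def)
qed

lemma right_smult_M\<^sub>2:
  "right_smult M\<^sub>2 t h = lift\<^sub>2 T2.Q (\<lambda>x y. e\<^sub>2 x (y \<otimes> h)) t"
  if "t \<in> carrier M\<^sub>2" "h \<in> carrier H" for h t
proof -
  have "presented_lift T2.Q t (\<lambda>xs. T2.cls (butlast xs @ [last xs \<otimes> h])) = presented_lift T2.Q t (\<lambda>xs. e\<^sub>2 (hd xs) (hd (tl xs) \<otimes> h))"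
    by (rule T2.presented_lift_cong[OF T2.abelian_group_presented_group])
      (use that e\<^sub>2_closed in \<open>auto simp: tensor_power_simps elim!: words2E\<close>)
  then show ?thesis by (simp add: tensor_power_def Let_def lift\<^sub>2_def)
qed

end

lemma biadditive_mono: "biadditive L S M \<Longrightarrow> L' \<subseteq> L \<Longrightarrow> S' \<subseteq> S \<Longrightarrow> biadditive L' S' M"
  by (auto simp: biadditive_def)

context ring_extension begin

lemma add_hom_id_mult:
  "h \<in> carrier H \<Longrightarrow> (\<lambda>x. h \<otimes> x) \<in> add_hom H H" "h \<in> carrier H \<Longrightarrow> (\<lambda>x. x \<otimes> h) \<in> add_hom H H"
  by (auto simp: add_hom_def r_distr l_distr)

lemma balanced_add_hom_left: "balanced P f \<Longrightarrow> y \<in> carrier H \<Longrightarrow> (\<lambda>x. f x y) \<in> add_hom H P"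
  and balanced_add_hom_right: "balanced P f \<Longrightarrow> x \<in> carrier H \<Longrightarrow> (\<lambda>y. f x y) \<in> add_hom H P"
  and balanced_middle: "balanced P f \<Longrightarrow> x \<in> carrier H \<Longrightarrow> r \<in> R \<Longrightarrow> y \<in> carrier H \<Longrightarrow>
    f (x \<otimes> r) y = f x (r \<otimes> y)"
  by (simp_all add: balanced_def)

lemma balanced_mult:
  assumes f: "balanced P f" and h: "h \<in> carrier H"
  shows "balanced P (\<lambda>x y. f (h \<otimes> x) y)" "balanced P (\<lambda>x y. f x (y \<otimes> h))"
  using add_hom_compose[OF add_hom_id_mult(1)[OF h] balanced_add_hom_left[OF f]]
    add_hom_compose[OF add_hom_id_mult(2)[OF h] balanced_add_hom_right[OF f]]
    balanced_add_hom_left[OF f] balanced_add_hom_right[OF f] balanced_middle[OF f] h R_in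
  by (simp_all add: balanced_def m_assoc[symmetric])

lemma add_hom_e\<^sub>1_mult:
  assumes "h \<in> carrier H"
  shows "(\<lambda>x. e\<^sub>1 (h \<otimes> x)) \<in> add_hom H M\<^sub>1" "(\<lambda>x. e\<^sub>1 (x \<otimes> h)) \<in> add_hom H M\<^sub>1"
  using add_hom_compose[OF add_hom_id_mult(1)[OF assms] e\<^sub>1_add_hom]
    add_hom_compose[OF add_hom_id_mult(2)[OF assms] e\<^sub>1_add_hom] by simp_all

lemma balanced_Q: "balanced T2.Q f \<longleftrightarrow> balanced M\<^sub>2 f"
  by (simp add: balanced_def add_hom_M)

lemma
  assumes h: "h \<in> carrier H"
  shows left_smult_M\<^sub>1_hom: "left_smult M\<^sub>1 h \<in> add_hom M\<^sub>1 M\<^sub>1"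
    and left_smult_e\<^sub>1 [simp]: "x \<in> carrier H \<Longrightarrow> left_smult M\<^sub>1 h (e\<^sub>1 x) = e\<^sub>1 (h \<otimes> x)"
    and right_smult_M\<^sub>1_hom: "(\<lambda>t. right_smult M\<^sub>1 t h) \<in> add_hom M\<^sub>1 M\<^sub>1"
    and right_smult_e\<^sub>1 [simp]: "x \<in> carrier H \<Longrightarrow> right_smult M\<^sub>1 (e\<^sub>1 x) h = e\<^sub>1 (x \<otimes> h)"
proof -
  note hom = add_hom_e\<^sub>1_mult[OF h, unfolded add_hom_M(2)]
  note ab = T1.abelian_group_presented_group
  note lift = lift\<^sub>1_hom[OF ab hom(1)] lift\<^sub>1_hom[OF ab hom(2)]
  show "left_smult M\<^sub>1 h \<in> add_hom M\<^sub>1 M\<^sub>1" "(\<lambda>t. right_smult M\<^sub>1 t h) \<in> add_hom M\<^sub>1 M\<^sub>1"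
    using lift h M1.a_closed
    by (auto simp: add_hom_def smult_M\<^sub>1 right_smult_M\<^sub>1 tensor_power_simps Pi_iff)
  show "x \<in> carrier H \<Longrightarrow> left_smult M\<^sub>1 h (e\<^sub>1 x) = e\<^sub>1 (h \<otimes> x)"
    "x \<in> carrier H \<Longrightarrow> right_smult M\<^sub>1 (e\<^sub>1 x) h = e\<^sub>1 (x \<otimes> h)"
    using h by (simp_all add: smult_M\<^sub>1 right_smult_M\<^sub>1 e\<^sub>1_hom lift\<^sub>1_e[OF ab hom(1)] lift\<^sub>1_e[OF ab hom(2)])
qed

lemma
  assumes h: "h \<in> carrier H"
  shows left_smult_M\<^sub>2_hom: "left_smult M\<^sub>2 h \<in> add_hom M\<^sub>2 M\<^sub>2"
    and left_smult_e\<^sub>2 [simp]: "x \<in> carrier H \<Longrightarrow> y \<in> carrier H \<Longrightarrow> left_smult M\<^sub>2 h (e\<^sub>2 x y) = e\<^sub>2 (h \<otimes> x) y"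
    and right_smult_M\<^sub>2_hom: "(\<lambda>t. right_smult M\<^sub>2 t h) \<in> add_hom M\<^sub>2 M\<^sub>2"
    and right_smult_e\<^sub>2 [simp]: "x \<in> carrier H \<Longrightarrow> y \<in> carrier H \<Longrightarrow> right_smult M\<^sub>2 (e\<^sub>2 x y) h = e\<^sub>2 x (y \<otimes> h)"
proof -
  note bal = balanced_mult[OF balanced_e\<^sub>2 h, folded balanced_Q]
  note ab = T2.abelian_group_presented_group
  note lift = lift\<^sub>2_hom[OF ab bal(1)] lift\<^sub>2_hom[OF ab bal(2)]
  show "left_smult M\<^sub>2 h \<in> add_hom M\<^sub>2 M\<^sub>2" "(\<lambda>t. right_smult M\<^sub>2 t h) \<in> add_hom M\<^sub>2 M\<^sub>2"
    using lift h M2.a_closed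
    by (auto simp: add_hom_def left_smult_M\<^sub>2 right_smult_M\<^sub>2 tensor_power_simps Pi_iff)
  show "x \<in> carrier H \<Longrightarrow> y \<in> carrier H \<Longrightarrow> left_smult M\<^sub>2 h (e\<^sub>2 x y) = e\<^sub>2 (h \<otimes> x) y"
    "x \<in> carrier H \<Longrightarrow> y \<in> carrier H \<Longrightarrow> right_smult M\<^sub>2 (e\<^sub>2 x y) h = e\<^sub>2 x (y \<otimes> h)"
    using h by (simp_all add: left_smult_M\<^sub>2 right_smult_M\<^sub>2 e\<^sub>2_closed lift\<^sub>2_e[OF ab bal(1)] lift\<^sub>2_e[OF ab bal(2)])
qed

lemma biadditive_M:
  assumes "L \<subseteq> carrier H" "S \<subseteq> carrier H"
  shows "biadditive L S M\<^sub>1" "biadditive L S M\<^sub>2"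
  using assms abelian_groups left_smult_M\<^sub>1_hom right_smult_M\<^sub>1_hom left_smult_M\<^sub>2_hom right_smult_M\<^sub>2_hom
  by (auto simp: biadditive_def)

lemma bimodule_hom_M\<^sub>1I:
  assumes P: "biadditive L S P" and L: "L \<subseteq> carrier H" and S: "S \<subseteq> carrier H"
    and f: "f \<in> add_hom M\<^sub>1 P"
    and l: "\<And>h x. h \<in> L \<Longrightarrow> x \<in> carrier H \<Longrightarrow> f (e\<^sub>1 (h \<otimes> x)) = left_smult P h (f (e\<^sub>1 x))"
    and r: "\<And>h x. h \<in> S \<Longrightarrow> x \<in> carrier H \<Longrightarrow> f (e\<^sub>1 (x \<otimes> h)) = right_smult P (f (e\<^sub>1 x)) h"
  shows "f \<in> bimodule_hom L S M\<^sub>1 P"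
  unfolding bimodule_hom_def using f l r L S
  by (auto elim!: M\<^sub>1_cases)

lemma bimodule_hom_M\<^sub>2I:
  assumes P: "biadditive L S P" and L: "L \<subseteq> carrier H" and S: "S \<subseteq> carrier H"
    and f: "f \<in> add_hom M\<^sub>2 P"
    and l: "\<And>h x y. h \<in> L \<Longrightarrow> x \<in> carrier H \<Longrightarrow> y \<in> carrier H \<Longrightarrow>
      f (e\<^sub>2 (h \<otimes> x) y) = left_smult P h (f (e\<^sub>2 x y))"
    and r: "\<And>h x y. h \<in> S \<Longrightarrow> x \<in> carrier H \<Longrightarrow> y \<in> carrier H \<Longrightarrow>
      f (e\<^sub>2 x (y \<otimes> h)) = right_smult P (f (e\<^sub>2 x y)) h"
  shows "f \<in> bimodule_hom L S M\<^sub>2 P"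
proof -
  have ab: "abelian_group P" using P by (simp add: biadditive_def)
  have "f (left_smult M\<^sub>2 h t) = left_smult P h (f t)" if h: "h \<in> L" and t: "t \<in> carrier M\<^sub>2" for h t
  proof (rule M\<^sub>2_eqI[OF ab _ _ _ t])
    have hH: "h \<in> carrier H" using h L by auto
    show "(\<lambda>t. f (left_smult M\<^sub>2 h t)) \<in> add_hom M\<^sub>2 P"
      by (rule add_hom_compose[OF left_smult_M\<^sub>2_hom[OF hH] f])
    show "(\<lambda>t. left_smult P h (f t)) \<in> add_hom M\<^sub>2 P"
      using P h by (intro add_hom_compose[OF f]) (simp add: biadditive_def)
  qed (use h L l in auto)
  moreover have "f (right_smult M\<^sub>2 t h) = right_smult P (f t) h" if h: "h \<in> S" and t: "t \<in> carrier M\<^sub>2" for h t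
  proof (rule M\<^sub>2_eqI[OF ab _ _ _ t])
    have hH: "h \<in> carrier H" using h S by auto
    show "(\<lambda>t. f (right_smult M\<^sub>2 t h)) \<in> add_hom M\<^sub>2 P"
      by (rule add_hom_compose[OF right_smult_M\<^sub>2_hom[OF hH] f])
    show "(\<lambda>t. right_smult P (f t) h) \<in> add_hom M\<^sub>2 P"
      using P h by (intro add_hom_compose[OF f]) (simp add: biadditive_def)
  qed (use h S r in auto)
  ultimately show ?thesis using f by (simp add: bimodule_hom_def)
qed

lemma M\<^sub>2_smult_assoc:
  assumes "h \<in> carrier H" "h' \<in> carrier H" "t \<in> carrier M\<^sub>2"
  shows "left_smult M\<^sub>2 (h \<otimes> h') t = left_smult M\<^sub>2 h (left_smult M\<^sub>2 h' t)"
    and "right_smult M\<^sub>2 t (h \<otimes> h') = right_smult M\<^sub>2 (right_smult M\<^sub>2 t h) h'"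
    and "left_smult M\<^sub>2 h (right_smult M\<^sub>2 t h') = right_smult M\<^sub>2 (left_smult M\<^sub>2 h t) h'"
proof -
  note homs = left_smult_M\<^sub>2_hom right_smult_M\<^sub>2_hom add_hom_compose[OF left_smult_M\<^sub>2_hom left_smult_M\<^sub>2_hom]
    add_hom_compose[OF right_smult_M\<^sub>2_hom right_smult_M\<^sub>2_hom]
    add_hom_compose[OF right_smult_M\<^sub>2_hom left_smult_M\<^sub>2_hom] add_hom_compose[OF left_smult_M\<^sub>2_hom right_smult_M\<^sub>2_hom]
  show "left_smult M\<^sub>2 (h \<otimes> h') t = left_smult M\<^sub>2 h (left_smult M\<^sub>2 h' t)"
    by (rule M\<^sub>2_eqI[OF abelian_groups(2) _ _ _ assms(3), of "left_smult M\<^sub>2 (h \<otimes> h')" "\<lambda>t. left_smult M\<^sub>2 h (left_smult M\<^sub>2 h' t)"])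
      (use assms homs in \<open>simp_all add: m_assoc\<close>)
  show "right_smult M\<^sub>2 t (h \<otimes> h') = right_smult M\<^sub>2 (right_smult M\<^sub>2 t h) h'"
    by (rule M\<^sub>2_eqI[OF abelian_groups(2) _ _ _ assms(3), of "\<lambda>t. right_smult M\<^sub>2 t (h \<otimes> h')" "\<lambda>t. right_smult M\<^sub>2 (right_smult M\<^sub>2 t h) h'"])
      (use assms homs in \<open>simp_all add: m_assoc\<close>)
  show "left_smult M\<^sub>2 h (right_smult M\<^sub>2 t h') = right_smult M\<^sub>2 (left_smult M\<^sub>2 h t) h'"
    by (rule M\<^sub>2_eqI[OF abelian_groups(2) _ _ _ assms(3), of "\<lambda>t. left_smult M\<^sub>2 h (right_smult M\<^sub>2 t h')" "\<lambda>t. right_smult M\<^sub>2 (left_smult M\<^sub>2 h t) h'"])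
      (use assms homs in simp_all)
qed

text \<open>Additivity in the ring element instead of the module element. It allows h \<mapsto> h t,
  and likewise h \<mapsto> t h, to be extended by \<open>lift\<^sub>1\<close>.\<close>

lemma smult_M\<^sub>2_add_hom:
  assumes t: "t \<in> carrier M\<^sub>2"
  shows "(\<lambda>h. left_smult M\<^sub>2 h t) \<in> add_hom H M\<^sub>2" "(\<lambda>h. right_smult M\<^sub>2 t h) \<in> add_hom H M\<^sub>2"
proof -
  have add: "(\<lambda>t. f t \<oplus>\<^bsub>M\<^sub>2\<^esub> g t) \<in> add_hom M\<^sub>2 M\<^sub>2" if "f \<in> add_hom M\<^sub>2 M\<^sub>2" "g \<in> add_hom M\<^sub>2 M\<^sub>2" for f g
    using that by (auto simp: add_hom_def Pi_iff M2.a_ac)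
  show "(\<lambda>h. left_smult M\<^sub>2 h t) \<in> add_hom H M\<^sub>2"
  proof (rule add_homI)
    show "left_smult M\<^sub>2 h t \<in> carrier M\<^sub>2" if "h \<in> carrier H" for h
      using add_hom_closed[OF left_smult_M\<^sub>2_hom[OF that] t] .
    show "left_smult M\<^sub>2 (h \<oplus> h') t = left_smult M\<^sub>2 h t \<oplus>\<^bsub>M\<^sub>2\<^esub> left_smult M\<^sub>2 h' t"
      if "h \<in> carrier H" "h' \<in> carrier H" for h h'
      by (rule M\<^sub>2_eqI[OF abelian_groups(2) _ _ _ t, of "left_smult M\<^sub>2 (h \<oplus> h')" "\<lambda>t. left_smult M\<^sub>2 h t \<oplus>\<^bsub>M\<^sub>2\<^esub> left_smult M\<^sub>2 h' t"])
        (use that add left_smult_M\<^sub>2_hom add_hom_add[OF balanced_add_hom_left[OF balanced_e\<^sub>2]] in \<open>simp_all add: l_distr\<close>)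
  qed
  show "(\<lambda>h. right_smult M\<^sub>2 t h) \<in> add_hom H M\<^sub>2"
  proof (rule add_homI)
    show "right_smult M\<^sub>2 t h \<in> carrier M\<^sub>2" if "h \<in> carrier H" for h
      using add_hom_closed[OF right_smult_M\<^sub>2_hom[OF that] t] .
    show "right_smult M\<^sub>2 t (h \<oplus> h') = right_smult M\<^sub>2 t h \<oplus>\<^bsub>M\<^sub>2\<^esub> right_smult M\<^sub>2 t h'"
      if "h \<in> carrier H" "h' \<in> carrier H" for h h'
      by (rule M\<^sub>2_eqI[OF abelian_groups(2) _ _ _ t, of "\<lambda>t. right_smult M\<^sub>2 t (h \<oplus> h')" "\<lambda>t. right_smult M\<^sub>2 t h \<oplus>\<^bsub>M\<^sub>2\<^esub> right_smult M\<^sub>2 t h'"])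
        (use that add right_smult_M\<^sub>2_hom add_hom_add[OF balanced_add_hom_right[OF balanced_e\<^sub>2]] in \<open>simp_all add: r_distr\<close>)
  qed
qed

lemma carrier_subset: "carrier H \<subseteq> carrier H" by simp

text \<open>Multiplication retracts x \<mapsto> x \<otimes> 1 and y \<mapsto> 1 \<otimes> y. The
  first is linear over H on the left and, as x r \<otimes> 1 = x \<otimes> r, over \<open>R\<close>
  on the right; the second is its mirror. One half of the similarity for depth two thus holds in
  every extension.\<close>

lemma M\<^sub>1_direct_summand:
  "iso_to_direct_summand (carrier H) R M\<^sub>1 (bimodule_power M\<^sub>2 1)"
  "iso_to_direct_summand R (carrier H) M\<^sub>1 (bimodule_power M\<^sub>2 1)"
proof -
  have mult: "balanced M\<^sub>1 (\<lambda>x y. e\<^sub>1 (x \<otimes> y))"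
    using R_in add_hom_e\<^sub>1_mult by (auto simp: balanced_def m_assoc)
  note ml = lift\<^sub>2_hom[OF abelian_groups(1) mult] lift\<^sub>2_e[OF abelian_groups(1) mult]
  let ?g = "lift\<^sub>2 M\<^sub>1 (\<lambda>x y. e\<^sub>1 (x \<otimes> y))"
  have g: "?g \<in> bimodule_hom L S M\<^sub>2 M\<^sub>1" if "L \<subseteq> carrier H" "S \<subseteq> carrier H" for L S
    by (rule bimodule_hom_M\<^sub>2I[OF biadditive_M(1)[OF that] that])
      (use that ml in \<open>auto simp: m_assoc\<close>)
  have gf: "(\<Oplus>\<^bsub>M\<^sub>1\<^esub>i\<in>{..<1::nat}. ?g (f m)) = m"
    if "f = lift\<^sub>1 M\<^sub>2 (\<lambda>x. e\<^sub>2 x \<one>) \<or> f = lift\<^sub>1 M\<^sub>2 (\<lambda>y. e\<^sub>2 \<one> y)" and m: "m \<in> carrier M\<^sub>1" for f m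
  proof -
    have "?g (f m) = m"
      using m that(1) balanced_add_hom_left[OF balanced_e\<^sub>2, of \<one>] balanced_add_hom_right[OF balanced_e\<^sub>2, of \<one>]
      by (auto elim!: M\<^sub>1_cases simp: lift\<^sub>1_e[OF abelian_groups(2)] ml)
    then show ?thesis using m by (simp add: lessThan_Suc)
  qed
  have f1: "lift\<^sub>1 M\<^sub>2 (\<lambda>x. e\<^sub>2 x \<one>) \<in> bimodule_hom (carrier H) R M\<^sub>1 M\<^sub>2"
    using balanced_add_hom_left[OF balanced_e\<^sub>2, of \<one>] balanced_middle[OF balanced_e\<^sub>2, of _ _ \<one>] R_in
    by (intro bimodule_hom_M\<^sub>1I[OF biadditive_M(2)[OF carrier_subset R_subset] carrier_subset R_subset])
      (simp_all add: lift\<^sub>1_hom[OF abelian_groups(2)] lift\<^sub>1_e[OF abelian_groups(2)])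
  have f2: "lift\<^sub>1 M\<^sub>2 (\<lambda>y. e\<^sub>2 \<one> y) \<in> bimodule_hom R (carrier H) M\<^sub>1 M\<^sub>2"
    using balanced_add_hom_right[OF balanced_e\<^sub>2, of \<one>] balanced_middle[OF balanced_e\<^sub>2, of \<one>] R_in
    by (intro bimodule_hom_M\<^sub>1I[OF biadditive_M(2)[OF R_subset carrier_subset] R_subset carrier_subset])
      (simp_all add: lift\<^sub>1_hom[OF abelian_groups(2)] lift\<^sub>1_e[OF abelian_groups(2)])
  show "iso_to_direct_summand (carrier H) R M\<^sub>1 (bimodule_power M\<^sub>2 1)"
    by (rule iso_to_direct_summand_powerI[OF biadditive_M[OF carrier_subset R_subset] f1 g[OF carrier_subset R_subset]])
      (use gf in auto)
  show "iso_to_direct_summand R (carrier H) M\<^sub>1 (bimodule_power M\<^sub>2 1)"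
    by (rule iso_to_direct_summand_powerI[OF biadditive_M[OF R_subset carrier_subset] f2 g[OF R_subset carrier_subset]])
      (use gf in auto)
qed

end

section \<open>Sufficient and necessary conditions for depth at most two\<close>

context ring_extension begin

text \<open>The elements \<open>u i\<close> and the maps \<open>\<gamma> i\<close> form a depth two quasi-basis.\<close>

lemma depth_two_leftI:
  fixes n :: nat
  assumes n: "n > 0"
    and \<gamma>: "\<And>i. i < n \<Longrightarrow> \<gamma> i \<in> add_hom H H"
    and \<gamma>l: "\<And>i r y. i < n \<Longrightarrow> r \<in> R \<Longrightarrow> y \<in> carrier H \<Longrightarrow> \<gamma> i (r \<otimes> y) = r \<otimes> \<gamma> i y"
    and \<gamma>r: "\<And>i r y. i < n \<Longrightarrow> r \<in> R \<Longrightarrow> y \<in> carrier H \<Longrightarrow> \<gamma> i (y \<otimes> r) = \<gamma> i y \<otimes> r"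
    and u: "\<And>i. i < n \<Longrightarrow> u i \<in> carrier M\<^sub>2"
    and ur: "\<And>i r. i < n \<Longrightarrow> r \<in> R \<Longrightarrow> left_smult M\<^sub>2 r (u i) = right_smult M\<^sub>2 (u i) r"
    and sum: "\<And>y. y \<in> carrier H \<Longrightarrow> (\<Oplus>\<^bsub>M\<^sub>2\<^esub>i\<in>{..<n}. left_smult M\<^sub>2 (\<gamma> i y) (u i)) = e\<^sub>2 \<one> y"
  shows "has_depth R H 2"
proof -
  note bi = biadditive_M[OF carrier_subset R_subset]
  note \<gamma>c = add_hom_closed[OF \<gamma>]
  \<comment> \<open>The embedding sends x \<otimes> y to the family x \<gamma>_i(y), and the
    retraction sends (h_i) to \<Sum> h_i u_i. Left linearity of \<gamma>_i makes the first balanced;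
    its right linearity and the commutation of u_i with \<open>R\<close> give right linearity of
    both. \<open>sum\<close> says that the composite fixes 1 \<otimes> y, hence x \<otimes>
    y.\<close>
  let ?f = "\<lambda>i. lift\<^sub>2 M\<^sub>1 (\<lambda>x y. e\<^sub>1 (x \<otimes> \<gamma> i y))"
  let ?g = "\<lambda>i. lift\<^sub>1 M\<^sub>2 (\<lambda>h. left_smult M\<^sub>2 h (u i))"
  have bal: "balanced M\<^sub>1 (\<lambda>x y. e\<^sub>1 (x \<otimes> \<gamma> i y))" if i: "i < n" for i
  proof -
    have "(\<lambda>y. e\<^sub>1 (x \<otimes> \<gamma> i y)) \<in> add_hom H M\<^sub>1" if "x \<in> carrier H" for x
      using add_hom_compose[OF \<gamma>[OF i] add_hom_e\<^sub>1_mult(1)[OF that]] .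
    moreover have "(\<lambda>x. e\<^sub>1 (x \<otimes> \<gamma> i y)) \<in> add_hom H M\<^sub>1" if "y \<in> carrier H" for y
      using add_hom_e\<^sub>1_mult(2)[OF \<gamma>c[OF i that]] .
    ultimately show ?thesis using i \<gamma>c \<gamma>l R_in by (simp add: balanced_def m_assoc)
  qed
  note f = lift\<^sub>2_hom[OF abelian_groups(1) bal] lift\<^sub>2_e[OF abelian_groups(1) bal]
  note g = lift\<^sub>1_hom[OF abelian_groups(2) smult_M\<^sub>2_add_hom(1)[OF u]]
    lift\<^sub>1_e[OF abelian_groups(2) smult_M\<^sub>2_add_hom(1)[OF u]]
  have f_hom: "?f i \<in> bimodule_hom (carrier H) R M\<^sub>2 M\<^sub>1" if i: "i < n" for i
    by (rule bimodule_hom_M\<^sub>2I[OF bi(1) carrier_subset R_subset f(1)[OF i]])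
      (use i \<gamma>c \<gamma>r R_in f(2) in \<open>simp_all add: m_assoc\<close>)
  have g_hom: "?g i \<in> bimodule_hom (carrier H) R M\<^sub>1 M\<^sub>2" if i: "i < n" for i
    by (rule bimodule_hom_M\<^sub>1I[OF bi(2) carrier_subset R_subset g(1)[OF i]])
      (use i u[OF i] ur[OF i] R_in g(2) in \<open>simp_all add: M\<^sub>2_smult_assoc\<close>)
  have "iso_to_direct_summand (carrier H) R M\<^sub>2 (bimodule_power M\<^sub>1 n)"
  proof (rule iso_to_direct_summand_powerI[OF bi(2,1) f_hom g_hom])
    fix m assume m: "m \<in> carrier M\<^sub>2"
    show "(\<Oplus>\<^bsub>M\<^sub>2\<^esub>i\<in>{..<n}. ?g i (?f i m)) = m"
    proof (rule M\<^sub>2_eqI[OF abelian_groups(2) _ _ _ m, of "\<lambda>m. \<Oplus>\<^bsub>M\<^sub>2\<^esub>i\<in>{..<n}. ?g i (?f i m)" "\<lambda>m. m"])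
      have gf: "(\<lambda>m. ?g i (?f i m)) \<in> add_hom M\<^sub>2 M\<^sub>2" if "i < n" for i
        using add_hom_compose[OF f(1)[OF that] g(1)[OF that]] .
      show "(\<lambda>m. \<Oplus>\<^bsub>M\<^sub>2\<^esub>i\<in>{..<n}. ?g i (?f i m)) \<in> add_hom M\<^sub>2 M\<^sub>2"
        by (rule add_hom_finsum_pointwise[OF abelian_groups(2) abelian_groups(2) gf]) simp
      fix x y assume x: "x \<in> carrier H" and y: "y \<in> carrier H"
      have cl: "left_smult M\<^sub>2 (\<gamma> i y) (u i) \<in> carrier M\<^sub>2" if "i < n" for i
        using add_hom_closed[OF left_smult_M\<^sub>2_hom[OF \<gamma>c[OF that y]] u[OF that]] .
      have "(\<Oplus>\<^bsub>M\<^sub>2\<^esub>i\<in>{..<n}. ?g i (?f i (e\<^sub>2 x y))) =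
          (\<Oplus>\<^bsub>M\<^sub>2\<^esub>i\<in>{..<n}. left_smult M\<^sub>2 x (left_smult M\<^sub>2 (\<gamma> i y) (u i)))"
        using x y \<gamma>c u f(2) g(2) cl add_hom_closed[OF left_smult_M\<^sub>2_hom[OF x]]
        by (intro M2.add.finprod_cong') (auto simp: M\<^sub>2_smult_assoc)
      also have "\<dots> = left_smult M\<^sub>2 x (e\<^sub>2 \<one> y)"
        using cl by (subst sum[OF y, symmetric], intro add_hom_finsum[symmetric] abelian_groups left_smult_M\<^sub>2_hom x) simp
      also have "\<dots> = e\<^sub>2 x y" using x y by simp
      finally show "(\<Oplus>\<^bsub>M\<^sub>2\<^esub>i\<in>{..<n}. ?g i (?f i (e\<^sub>2 x y))) = e\<^sub>2 x y" .
    qed (simp add: add_hom_def)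
  qed
  then have "bimodule_similar (carrier H) R M\<^sub>2 M\<^sub>1"
    unfolding bimodule_similar_def using n M\<^sub>1_direct_summand(1)
    by (intro conjI exI[of _ n] exI[of _ "1::nat"]) simp_all
  then have "bimodule_similar (carrier H) R (tensor_power R H (1 + 1)) (tensor_power R H 1)"
    by (simp add: numeral_2_eq_2)
  then show ?thesis unfolding has_depth_def by (intro disjI2 exI[of _ 1]) simp
qed

text \<open>The mirror version: \<gamma>_i is applied to the left leg, x \<otimes> y \<mapsto>
  \<gamma>_i(x) y, and the family is recombined as \<Sum> u_i h_i. This splits the tensor square as
  an \<open>R\<close>-H-bimodule.\<close>

lemma depth_two_rightI:
  fixes n :: nat
  assumes n: "n > 0"
    and \<gamma>: "\<And>i. i < n \<Longrightarrow> \<gamma> i \<in> add_hom H H"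
    and \<gamma>l: "\<And>i r y. i < n \<Longrightarrow> r \<in> R \<Longrightarrow> y \<in> carrier H \<Longrightarrow> \<gamma> i (r \<otimes> y) = r \<otimes> \<gamma> i y"
    and \<gamma>r: "\<And>i r y. i < n \<Longrightarrow> r \<in> R \<Longrightarrow> y \<in> carrier H \<Longrightarrow> \<gamma> i (y \<otimes> r) = \<gamma> i y \<otimes> r"
    and u: "\<And>i. i < n \<Longrightarrow> u i \<in> carrier M\<^sub>2"
    and ur: "\<And>i r. i < n \<Longrightarrow> r \<in> R \<Longrightarrow> left_smult M\<^sub>2 r (u i) = right_smult M\<^sub>2 (u i) r"
    and sum: "\<And>y. y \<in> carrier H \<Longrightarrow> (\<Oplus>\<^bsub>M\<^sub>2\<^esub>i\<in>{..<n}. right_smult M\<^sub>2 (u i) (\<gamma> i y)) = e\<^sub>2 y \<one>"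
  shows "has_depth R H 2"
proof -
  note bi = biadditive_M[OF R_subset carrier_subset]
  note \<gamma>c = add_hom_closed[OF \<gamma>]
  let ?f = "\<lambda>i. lift\<^sub>2 M\<^sub>1 (\<lambda>x y. e\<^sub>1 (\<gamma> i x \<otimes> y))"
  let ?g = "\<lambda>i. lift\<^sub>1 M\<^sub>2 (\<lambda>h. right_smult M\<^sub>2 (u i) h)"
  have bal: "balanced M\<^sub>1 (\<lambda>x y. e\<^sub>1 (\<gamma> i x \<otimes> y))" if i: "i < n" for i
  proof -
    have "(\<lambda>x. e\<^sub>1 (\<gamma> i x \<otimes> y)) \<in> add_hom H M\<^sub>1" if "y \<in> carrier H" for y
      using add_hom_compose[OF \<gamma>[OF i] add_hom_e\<^sub>1_mult(2)[OF that]] .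
    moreover have "(\<lambda>y. e\<^sub>1 (\<gamma> i x \<otimes> y)) \<in> add_hom H M\<^sub>1" if "x \<in> carrier H" for x
      using add_hom_e\<^sub>1_mult(1)[OF \<gamma>c[OF i that]] .
    ultimately show ?thesis using i \<gamma>c \<gamma>r R_in by (simp add: balanced_def m_assoc)
  qed
  note f = lift\<^sub>2_hom[OF abelian_groups(1) bal] lift\<^sub>2_e[OF abelian_groups(1) bal]
  note g = lift\<^sub>1_hom[OF abelian_groups(2) smult_M\<^sub>2_add_hom(2)[OF u]]
    lift\<^sub>1_e[OF abelian_groups(2) smult_M\<^sub>2_add_hom(2)[OF u]]
  have f_hom: "?f i \<in> bimodule_hom R (carrier H) M\<^sub>2 M\<^sub>1" if i: "i < n" for i
    by (rule bimodule_hom_M\<^sub>2I[OF bi(1) R_subset carrier_subset f(1)[OF i]])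
      (use i \<gamma>c \<gamma>l R_in f(2) in \<open>simp_all add: m_assoc\<close>)
  have g_hom: "?g i \<in> bimodule_hom R (carrier H) M\<^sub>1 M\<^sub>2" if i: "i < n" for i
    by (rule bimodule_hom_M\<^sub>1I[OF bi(2) R_subset carrier_subset g(1)[OF i]])
      (use i u[OF i] ur[OF i, symmetric] R_in g(2) in \<open>simp_all add: M\<^sub>2_smult_assoc\<close>)
  have "iso_to_direct_summand R (carrier H) M\<^sub>2 (bimodule_power M\<^sub>1 n)"
  proof (rule iso_to_direct_summand_powerI[OF bi(2,1) f_hom g_hom])
    fix m assume m: "m \<in> carrier M\<^sub>2"
    show "(\<Oplus>\<^bsub>M\<^sub>2\<^esub>i\<in>{..<n}. ?g i (?f i m)) = m"
    proof (rule M\<^sub>2_eqI[OF abelian_groups(2) _ _ _ m, of "\<lambda>m. \<Oplus>\<^bsub>M\<^sub>2\<^esub>i\<in>{..<n}. ?g i (?f i m)" "\<lambda>m. m"])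
      have gf: "(\<lambda>m. ?g i (?f i m)) \<in> add_hom M\<^sub>2 M\<^sub>2" if "i < n" for i
        using add_hom_compose[OF f(1)[OF that] g(1)[OF that]] .
      show "(\<lambda>m. \<Oplus>\<^bsub>M\<^sub>2\<^esub>i\<in>{..<n}. ?g i (?f i m)) \<in> add_hom M\<^sub>2 M\<^sub>2"
        by (rule add_hom_finsum_pointwise[OF abelian_groups(2) abelian_groups(2) gf]) simp
      fix x y assume x: "x \<in> carrier H" and y: "y \<in> carrier H"
      have cl: "right_smult M\<^sub>2 (u i) (\<gamma> i x) \<in> carrier M\<^sub>2" if "i < n" for i
        using add_hom_closed[OF right_smult_M\<^sub>2_hom[OF \<gamma>c[OF that x]] u[OF that]] .
      have "(\<Oplus>\<^bsub>M\<^sub>2\<^esub>i\<in>{..<n}. ?g i (?f i (e\<^sub>2 x y))) =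
          (\<Oplus>\<^bsub>M\<^sub>2\<^esub>i\<in>{..<n}. right_smult M\<^sub>2 (right_smult M\<^sub>2 (u i) (\<gamma> i x)) y)"
        using x y \<gamma>c u f(2) g(2) cl add_hom_closed[OF right_smult_M\<^sub>2_hom[OF y]]
        by (intro M2.add.finprod_cong') (auto simp: M\<^sub>2_smult_assoc)
      also have "\<dots> = right_smult M\<^sub>2 (e\<^sub>2 x \<one>) y"
        using cl by (subst sum[OF x, symmetric],
            intro add_hom_finsum[symmetric, of _ _ "\<lambda>t. right_smult M\<^sub>2 t y"] abelian_groups right_smult_M\<^sub>2_hom y) simp
      also have "\<dots> = e\<^sub>2 x y" using x y by simp
      finally show "(\<Oplus>\<^bsub>M\<^sub>2\<^esub>i\<in>{..<n}. ?g i (?f i (e\<^sub>2 x y))) = e\<^sub>2 x y" .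
    qed (simp add: add_hom_def)
  qed
  then have "bimodule_similar R (carrier H) M\<^sub>2 M\<^sub>1"
    unfolding bimodule_similar_def using n M\<^sub>1_direct_summand(2)
    by (intro conjI exI[of _ n] exI[of _ "1::nat"]) simp_all
  then have "bimodule_similar R (carrier H) (tensor_power R H (1 + 1)) (tensor_power R H 1)"
    by (simp add: numeral_2_eq_2)
  then show ?thesis unfolding has_depth_def by (intro disjI2 exI[of _ 1]) simp
qed

lemma has_depth_two_cases:
  assumes "has_depth R H 2"
  shows "bimodule_similar R (carrier H) M\<^sub>2 M\<^sub>1 \<or> bimodule_similar (carrier H) R M\<^sub>2 M\<^sub>1"
proof -
  obtain n :: nat where n: "n \<ge> 1" "2 = 2 * n"
    "bimodule_similar R (carrier H) (tensor_power R H (n + 1)) (tensor_power R H n) \<or>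
     bimodule_similar (carrier H) R (tensor_power R H (n + 1)) (tensor_power R H n)"
  proof -
    \<comment> \<open>Parity rules out the odd clause of \<open>has_depth\<close>; in the even
      clause the exponent must then be one.\<close>
    have "\<not> (2 = 2 * n + 1)" for n :: nat by presburger
    with assms show thesis using that unfolding has_depth_def by auto
  qed
  then have "n = 1" by simp
  with n(3) show ?thesis by (simp add: numeral_2_eq_2)
qed

lemma has_depth_one_cases:
  assumes "has_depth R H 1"
  shows "bimodule_similar R R M\<^sub>1 (base_bimodule R H)"
proof -
  have "1 \<noteq> 2 * n" for n :: nat by presburger
  with assms show ?thesis unfolding has_depth_def by auto
qed

lemma min_depth_le_two_iff: "min_depth R H \<le> 2 \<longleftrightarrow> has_depth R H 1 \<or> has_depth R H 2"
proof
  let ?D = "{enat m | m. m > 0 \<and> has_depth R H m}"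
  assume le: "min_depth R H \<le> 2"
  have "?D \<noteq> {}"
  proof
    assume e: "?D = {}"
    have "min_depth R H = \<infinity>" unfolding min_depth_def e by (simp add: top_enat_def)
    with le show False by simp
  qed
  then obtain k where "k \<in> ?D" by blast
  \<comment> \<open>On a nonempty set the infimum in \<open>enat\<close> is a least element, hence
    attained. The empty set was excluded because its infimum is infinite.\<close>
  then have "Inf ?D \<in> ?D" unfolding Inf_enat_def using \<open>?D \<noteq> {}\<close> by (simp only: if_False) (rule LeastI)
  then obtain m where "min_depth R H = enat m" "m > 0" "has_depth R H m" by (auto simp: min_depth_def)
  with le have "m \<le> 2" by (simp add: numeral_eq_enat)
  then have "m = 1 \<or> m = 2" using \<open>m > 0\<close> by auto
  then show "has_depth R H 1 \<or> has_depth R H 2" using \<open>has_depth R H m\<close> by auto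
next
  have le: "min_depth R H \<le> enat m" if "m > 0" "has_depth R H m" for m
    unfolding min_depth_def using that by (intro Inf_lower) auto
  have 12: "enat 1 \<le> 2" "enat 2 \<le> 2" by (simp_all add: numeral_eq_enat)
  assume "has_depth R H 1 \<or> has_depth R H 2"
  then show "min_depth R H \<le> 2"
    by (elim disjE) (rule order_trans[OF le 12(1)] order_trans[OF le 12(2)]; simp)+
qed

lemma biadditive_base: "biadditive R R (base_bimodule R H)"
proof -
  note sub = subringE[OF subring]
  have ab: "abelian_group (base_bimodule R H)"
  proof (rule abelian_groupI)
    show "\<exists>y\<in>carrier (base_bimodule R H). y \<oplus>\<^bsub>base_bimodule R H\<^esub> x = \<zero>\<^bsub>base_bimodule R H\<^esub>"
      if "x \<in> carrier (base_bimodule R H)" for x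
      using that sub(5)[of x] R_in by (intro bexI[of _ "\<ominus> x"]) (simp_all add: base_bimodule_def l_neg)
    show "x \<oplus>\<^bsub>base_bimodule R H\<^esub> y = y \<oplus>\<^bsub>base_bimodule R H\<^esub> x"
      if "x \<in> carrier (base_bimodule R H)" "y \<in> carrier (base_bimodule R H)" for x y
      using that R_in a_comm by (simp add: base_bimodule_def)
  qed (use sub(2,7) R_in in \<open>simp_all add: base_bimodule_def a_assoc\<close>)
  moreover have "left_smult (base_bimodule R H) l \<in> add_hom (base_bimodule R H) (base_bimodule R H)"
    "(\<lambda>x. right_smult (base_bimodule R H) x l) \<in> add_hom (base_bimodule R H) (base_bimodule R H)" if "l \<in> R" for l
    using that sub(6) R_in by (simp_all add: add_hom_def base_bimodule_def r_distr l_distr)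
  ultimately show ?thesis by (simp add: biadditive_def)
qed

text \<open>An augmentation \<epsilon> of H with values in \<open>K\<close>, and a module
  \<open>V\<close> receiving the test maps. Keeping both abstract allows the same lemmas to serve
  for the projections to A and B and for their composites with the antipode.\<close>

context
  fixes K :: "'k ring" and V :: "('k, 'v, 'o) module_scheme" and \<epsilon> :: "'h \<Rightarrow> 'k"
  assumes V: "Module.module K V"
    and \<epsilon>_closed: "\<And>x. x \<in> carrier H \<Longrightarrow> \<epsilon> x \<in> carrier K"
    and \<epsilon>_add: "\<And>x y. x \<in> carrier H \<Longrightarrow> y \<in> carrier H \<Longrightarrow> \<epsilon> (x \<oplus> y) = \<epsilon> x \<oplus>\<^bsub>K\<^esub> \<epsilon> y"
    and \<epsilon>_mult: "\<And>x y. x \<in> carrier H \<Longrightarrow> y \<in> carrier H \<Longrightarrow> \<epsilon> (x \<otimes> y) = \<epsilon> x \<otimes>\<^bsub>K\<^esub> \<epsilon> y"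
    and \<epsilon>_one: "\<epsilon> \<one> = \<one>\<^bsub>K\<^esub>"
begin

interpretation V: Module.module K V by (rule V)

lemma smult_add_hom: "c \<in> carrier K \<Longrightarrow> (\<lambda>v. c \<odot>\<^bsub>V\<^esub> v) \<in> add_hom V V"
  by (simp add: add_hom_def V.smult_r_distr)

lemma eps_add_hom: "v \<in> carrier V \<Longrightarrow> (\<lambda>x. \<epsilon> x \<odot>\<^bsub>V\<^esub> v) \<in> add_hom H V"
  by (simp add: add_hom_def \<epsilon>_closed \<epsilon>_add V.smult_l_distr)

text \<open>A family of maps \<open>g i\<close> whose images span is tested on the images only.\<close>

lemma smult_eq_on_span:
  fixes M :: "('x, 'y) ring_scheme" and p :: nat
  assumes M: "abelian_group M" and \<theta>: "\<theta> \<in> add_hom M V" and \<pi>: "\<pi> \<in> add_hom M V" and c: "c \<in> carrier K"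
    and g: "\<And>i n. i < p \<Longrightarrow> n \<in> N \<Longrightarrow> g i n \<in> carrier M"
    and eq: "\<And>i n. i < p \<Longrightarrow> n \<in> N \<Longrightarrow> \<theta> (g i n) = c \<odot>\<^bsub>V\<^esub> \<pi> (g i n)"
    and m: "n \<in> {..<p} \<rightarrow> N" "m = (\<Oplus>\<^bsub>M\<^esub>i\<in>{..<p}. g i (n i))"
  shows "\<theta> m = c \<odot>\<^bsub>V\<^esub> \<pi> m"
proof -
  have n: "n i \<in> N" if "i < p" for i using m(1) that by auto
  have "\<theta> m = (\<Oplus>\<^bsub>V\<^esub>i\<in>{..<p}. \<theta> (g i (n i)))"
    unfolding m(2) using g n by (intro add_hom_finsum[OF M V.abelian_group_axioms \<theta>]) auto
  also have "\<dots> = (\<Oplus>\<^bsub>V\<^esub>i\<in>{..<p}. c \<odot>\<^bsub>V\<^esub> \<pi> (g i (n i)))"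
    using n g eq c add_hom_closed[OF \<pi>] by (intro V.add.finprod_cong') auto
  also have "\<dots> = c \<odot>\<^bsub>V\<^esub> \<pi> m"
    unfolding m(2) using g n
    by (intro add_hom_finsum[OF M V.abelian_group_axioms add_hom_compose[OF \<pi> smult_add_hom[OF c]], symmetric]) auto
  finally show ?thesis .
qed

text \<open>The map x \<otimes> y \<mapsto> \<epsilon>(x) \<phi>(y) turns left multiplication by any
  h into the scalar \<epsilon>(h). On the images of H this determines it up to the constant
  \<pi>(g_i(1)), and right multiplication by \<open>r\<close> only changes \<epsilon>(y) into
  \<epsilon>(y r).\<close>

lemma depth_two_left_necessary:
  assumes sim: "bimodule_similar (carrier H) R M\<^sub>2 M\<^sub>1"
    and \<phi>: "\<phi> \<in> add_hom H V"
    and \<phi>R: "\<And>r x. r \<in> R \<Longrightarrow> x \<in> carrier H \<Longrightarrow> \<phi> (r \<otimes> x) = \<epsilon> r \<odot>\<^bsub>V\<^esub> \<phi> x"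
    and r: "r \<in> R" and x: "x \<in> carrier H"
  shows "\<phi> (x \<otimes> r) = \<epsilon> r \<odot>\<^bsub>V\<^esub> \<phi> x"
proof -
  note bi = biadditive_M[OF carrier_subset R_subset]
  note \<phi>c = add_hom_closed[OF \<phi>]
  obtain p where "iso_to_direct_summand (carrier H) R M\<^sub>2 (bimodule_power M\<^sub>1 p)"
    using sim by (auto simp: bimodule_similar_def)
  then obtain g where g: "\<And>i. i < p \<Longrightarrow> g i \<in> bimodule_hom (carrier H) R M\<^sub>1 M\<^sub>2"
    and span: "\<And>m. m \<in> carrier M\<^sub>2 \<Longrightarrow> \<exists>n \<in> {..<p} \<rightarrow> carrier M\<^sub>1. m = (\<Oplus>\<^bsub>M\<^sub>2\<^esub>i\<in>{..<p}. g i (n i))"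
    by (rule iso_to_direct_summand_powerE[OF bi(2,1)]) (rule that)
  \<comment> \<open>Here the hypothesis on \<phi> is used: \<epsilon>(x r) \<phi>(y) = \<epsilon>(x)
    \<phi>(r y).\<close>
  have bal: "balanced V (\<lambda>x y. \<epsilon> x \<odot>\<^bsub>V\<^esub> \<phi> y)"
    using add_hom_compose[OF \<phi> smult_add_hom] eps_add_hom \<phi>c \<phi>R \<epsilon>_closed \<epsilon>_mult R_in
    by (simp add: balanced_def V.smult_assoc1)
  let ?\<pi> = "lift\<^sub>2 V (\<lambda>x y. \<epsilon> x \<odot>\<^bsub>V\<^esub> \<phi> y)"
  note \<pi> = lift\<^sub>2_hom[OF V.abelian_group_axioms bal] lift\<^sub>2_e[OF V.abelian_group_axioms bal]
  have \<pi>l: "?\<pi> (left_smult M\<^sub>2 h t) = \<epsilon> h \<odot>\<^bsub>V\<^esub> ?\<pi> t" if h: "h \<in> carrier H" and t: "t \<in> carrier M\<^sub>2" for h t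
    by (rule M\<^sub>2_eqI[OF V.abelian_group_axioms add_hom_compose[OF left_smult_M\<^sub>2_hom[OF h] \<pi>(1)]
          add_hom_compose[OF \<pi>(1) smult_add_hom[OF \<epsilon>_closed[OF h]]] _ t])
      (simp add: \<pi>(2) h \<epsilon>_mult \<epsilon>_closed \<phi>c V.smult_assoc1)
  have rH: "r \<in> carrier H" using R_in r .
  obtain n where n: "n \<in> {..<p} \<rightarrow> carrier M\<^sub>1" "e\<^sub>2 \<one> x = (\<Oplus>\<^bsub>M\<^sub>2\<^esub>i\<in>{..<p}. g i (n i))"
    using span[OF e\<^sub>2_closed[OF one_closed x]] by blast
  have gc: "g i t \<in> carrier M\<^sub>2" if "i < p" "t \<in> carrier M\<^sub>1" for i t
    using add_hom_closed[OF bimodule_homD(1)[OF g[OF that(1)]] that(2)] .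
  \<comment> \<open>As \<open>e\<^sub>1 y\<close> is y times \<open>e\<^sub>1 \<one>\<close> and
    \<open>g i\<close> is left linear over all of H, the value at y is governed by the value at
    one.\<close>
  have ge: "?\<pi> (g i (e\<^sub>1 y)) = \<epsilon> y \<odot>\<^bsub>V\<^esub> ?\<pi> (g i (e\<^sub>1 \<one>))" if i: "i < p" and y: "y \<in> carrier H" for i y
    using bimodule_homD(2)[OF g[OF i] y e\<^sub>1_hom[OF one_closed]] y \<pi>l[OF y gc[OF i e\<^sub>1_hom[OF one_closed]]] by simp
  have "?\<pi> (right_smult M\<^sub>2 (e\<^sub>2 \<one> x) r) = \<epsilon> r \<odot>\<^bsub>V\<^esub> ?\<pi> (e\<^sub>2 \<one> x)"
  proof (rule smult_eq_on_span[where g = g and n = n and p = p and \<theta> = "\<lambda>t. ?\<pi> (right_smult M\<^sub>2 t r)" and \<pi> = ?\<pi>,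
          OF abelian_groups(2) add_hom_compose[OF right_smult_M\<^sub>2_hom[OF rH] \<pi>(1)] \<pi>(1)
        \<epsilon>_closed[OF rH] gc _ n])
    fix i t assume i: "i < p" and t: "t \<in> carrier M\<^sub>1"
    obtain y where y: "y \<in> carrier H" "t = e\<^sub>1 y" using t by (rule M\<^sub>1_cases)
    have c: "?\<pi> (g i (e\<^sub>1 \<one>)) \<in> carrier V"
      using add_hom_closed[OF \<pi>(1) gc[OF i e\<^sub>1_hom[OF one_closed]]] .
    have "?\<pi> (right_smult M\<^sub>2 (g i t) r) = ?\<pi> (g i (e\<^sub>1 (y \<otimes> r)))"
      using bimodule_homD(3)[OF g[OF i] r t] y rH by simp
    also have "\<dots> = (\<epsilon> y \<otimes>\<^bsub>K\<^esub> \<epsilon> r) \<odot>\<^bsub>V\<^esub> ?\<pi> (g i (e\<^sub>1 \<one>))"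
      using ge[OF i, of "y \<otimes> r"] y(1) rH by (simp add: \<epsilon>_mult)
    also have "\<dots> = \<epsilon> r \<odot>\<^bsub>V\<^esub> ?\<pi> (g i t)"
      using ge[OF i y(1)] c y rH \<epsilon>_closed by (simp add: V.R.m_comm V.smult_assoc1)
    finally show "?\<pi> (right_smult M\<^sub>2 (g i t) r) = \<epsilon> r \<odot>\<^bsub>V\<^esub> ?\<pi> (g i t)" .
  qed
  \<comment> \<open>At 1 \<otimes> x and 1 \<otimes> x r the functional returns the values of
    \<phi>, because \<epsilon> is one at the unit.\<close>
  then show ?thesis using x rH \<pi>(2) \<phi>c by (simp add: \<epsilon>_one)
qed

text \<open>The mirror argument, with the functional x \<otimes> y \<mapsto> \<epsilon>(y) \<phi>(x)
  and right linearity of \<open>g i\<close> over H; here \<phi> is read off at x \<otimes>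
  1.\<close>

lemma depth_two_right_necessary:
  assumes sim: "bimodule_similar R (carrier H) M\<^sub>2 M\<^sub>1"
    and \<phi>: "\<phi> \<in> add_hom H V"
    and \<phi>R: "\<And>r x. r \<in> R \<Longrightarrow> x \<in> carrier H \<Longrightarrow> \<phi> (x \<otimes> r) = \<epsilon> r \<odot>\<^bsub>V\<^esub> \<phi> x"
    and r: "r \<in> R" and x: "x \<in> carrier H"
  shows "\<phi> (r \<otimes> x) = \<epsilon> r \<odot>\<^bsub>V\<^esub> \<phi> x"
proof -
  note bi = biadditive_M[OF R_subset carrier_subset]
  note \<phi>c = add_hom_closed[OF \<phi>]
  obtain p where "iso_to_direct_summand R (carrier H) M\<^sub>2 (bimodule_power M\<^sub>1 p)"
    using sim by (auto simp: bimodule_similar_def)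
  then obtain g where g: "\<And>i. i < p \<Longrightarrow> g i \<in> bimodule_hom R (carrier H) M\<^sub>1 M\<^sub>2"
    and span: "\<And>m. m \<in> carrier M\<^sub>2 \<Longrightarrow> \<exists>n \<in> {..<p} \<rightarrow> carrier M\<^sub>1. m = (\<Oplus>\<^bsub>M\<^sub>2\<^esub>i\<in>{..<p}. g i (n i))"
    by (rule iso_to_direct_summand_powerE[OF bi(2,1)]) (rule that)
  have bal: "balanced V (\<lambda>x y. \<epsilon> y \<odot>\<^bsub>V\<^esub> \<phi> x)"
    using add_hom_compose[OF \<phi> smult_add_hom] eps_add_hom \<phi>c \<phi>R \<epsilon>_closed \<epsilon>_mult R_in
    by (simp add: balanced_def V.smult_assoc1[symmetric] V.R.m_comm)
  let ?\<pi> = "lift\<^sub>2 V (\<lambda>x y. \<epsilon> y \<odot>\<^bsub>V\<^esub> \<phi> x)"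
  note \<pi> = lift\<^sub>2_hom[OF V.abelian_group_axioms bal] lift\<^sub>2_e[OF V.abelian_group_axioms bal]
  have \<pi>r: "?\<pi> (right_smult M\<^sub>2 t h) = \<epsilon> h \<odot>\<^bsub>V\<^esub> ?\<pi> t" if h: "h \<in> carrier H" and t: "t \<in> carrier M\<^sub>2" for h t
    by (rule M\<^sub>2_eqI[OF V.abelian_group_axioms add_hom_compose[OF right_smult_M\<^sub>2_hom[OF h] \<pi>(1)]
          add_hom_compose[OF \<pi>(1) smult_add_hom[OF \<epsilon>_closed[OF h]]] _ t])
      (simp add: \<pi>(2) h \<epsilon>_mult \<epsilon>_closed \<phi>c V.smult_assoc1[symmetric] V.R.m_comm)
  have rH: "r \<in> carrier H" using R_in r .
  obtain n where n: "n \<in> {..<p} \<rightarrow> carrier M\<^sub>1" "e\<^sub>2 x \<one> = (\<Oplus>\<^bsub>M\<^sub>2\<^esub>i\<in>{..<p}. g i (n i))"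
    using span[OF e\<^sub>2_closed[OF x one_closed]] by blast
  have gc: "g i t \<in> carrier M\<^sub>2" if "i < p" "t \<in> carrier M\<^sub>1" for i t
    using add_hom_closed[OF bimodule_homD(1)[OF g[OF that(1)]] that(2)] .
  have ge: "?\<pi> (g i (e\<^sub>1 y)) = \<epsilon> y \<odot>\<^bsub>V\<^esub> ?\<pi> (g i (e\<^sub>1 \<one>))" if i: "i < p" and y: "y \<in> carrier H" for i y
    using bimodule_homD(3)[OF g[OF i] y e\<^sub>1_hom[OF one_closed]] y \<pi>r[OF y gc[OF i e\<^sub>1_hom[OF one_closed]]] by simp
  have "?\<pi> (left_smult M\<^sub>2 r (e\<^sub>2 x \<one>)) = \<epsilon> r \<odot>\<^bsub>V\<^esub> ?\<pi> (e\<^sub>2 x \<one>)"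
  proof (rule smult_eq_on_span[where g = g and n = n and p = p and \<theta> = "\<lambda>t. ?\<pi> (left_smult M\<^sub>2 r t)" and \<pi> = ?\<pi>,
          OF abelian_groups(2) add_hom_compose[OF left_smult_M\<^sub>2_hom[OF rH] \<pi>(1)] \<pi>(1)
        \<epsilon>_closed[OF rH] gc _ n])
    fix i t assume i: "i < p" and t: "t \<in> carrier M\<^sub>1"
    obtain y where y: "y \<in> carrier H" "t = e\<^sub>1 y" using t by (rule M\<^sub>1_cases)
    have c: "?\<pi> (g i (e\<^sub>1 \<one>)) \<in> carrier V"
      using add_hom_closed[OF \<pi>(1) gc[OF i e\<^sub>1_hom[OF one_closed]]] .
    have "?\<pi> (left_smult M\<^sub>2 r (g i t)) = ?\<pi> (g i (e\<^sub>1 (r \<otimes> y)))"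
      using bimodule_homD(2)[OF g[OF i] r t] y rH by simp
    also have "\<dots> = \<epsilon> r \<odot>\<^bsub>V\<^esub> ?\<pi> (g i t)"
      using ge[OF i, of "r \<otimes> y"] ge[OF i y(1)] c y rH \<epsilon>_closed by (simp add: \<epsilon>_mult V.smult_assoc1)
    finally show "?\<pi> (left_smult M\<^sub>2 r (g i t)) = \<epsilon> r \<odot>\<^bsub>V\<^esub> ?\<pi> (g i t)" .
  qed
  then show ?thesis using x rH \<pi>(2) \<phi>c by (simp add: \<epsilon>_one)
qed

context
  fixes \<phi> r x
  assumes sim: "bimodule_similar R R M\<^sub>1 (base_bimodule R H)" and \<phi>: "\<phi> \<in> add_hom H V"
    and r: "r \<in> R" and x: "x \<in> carrier H"
begin

text \<open>Depth one expresses H through the elements \<open>g i \<one>\<close> with coefficients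
  in \<open>R\<close>, and bimodule linearity makes these elements commute with \<open>R\<close>.
  Left and right forms are both recorded, since the two criteria below need opposite ones.\<close>

lemma depth_one_span:
  obtains g p n where
    "\<And>i s. i < p \<Longrightarrow> s \<in> R \<Longrightarrow> g i s \<in> carrier M\<^sub>1"
    "\<And>i s. i < p \<Longrightarrow> s \<in> R \<Longrightarrow> g i s = left_smult M\<^sub>1 s (g i \<one>)"
    "\<And>i s. i < p \<Longrightarrow> s \<in> R \<Longrightarrow> g i s = right_smult M\<^sub>1 (g i \<one>) s"
    "\<And>i s. i < p \<Longrightarrow> s \<in> R \<Longrightarrow> g i (r \<otimes> s) = left_smult M\<^sub>1 r (g i s)"
    "\<And>i s. i < p \<Longrightarrow> s \<in> R \<Longrightarrow> g i (s \<otimes> r) = right_smult M\<^sub>1 (g i s) r"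
    "n \<in> {..<p::nat} \<rightarrow> R" "e\<^sub>1 x = (\<Oplus>\<^bsub>M\<^sub>1\<^esub>i\<in>{..<p}. g i (n i))"
proof -
  let ?N = "base_bimodule R H"
  have Rc: "carrier ?N = R" by (simp add: base_bimodule_def)
  obtain p where "iso_to_direct_summand R R M\<^sub>1 (bimodule_power ?N p)"
    using sim by (auto simp: bimodule_similar_def)
  then obtain g where g: "\<And>i. i < p \<Longrightarrow> g i \<in> bimodule_hom R R ?N M\<^sub>1"
    and span: "\<And>m. m \<in> carrier M\<^sub>1 \<Longrightarrow> \<exists>n \<in> {..<p} \<rightarrow> carrier ?N. m = (\<Oplus>\<^bsub>M\<^sub>1\<^esub>i\<in>{..<p}. g i (n i))"
    by (rule iso_to_direct_summand_powerE[OF biadditive_M(1)[OF R_subset R_subset] biadditive_base]) (rule that)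
  have oneR: "\<one> \<in> R" using subringE(3)[OF subring] .
  obtain n where n: "n \<in> {..<p} \<rightarrow> R" "e\<^sub>1 x = (\<Oplus>\<^bsub>M\<^sub>1\<^esub>i\<in>{..<p}. g i (n i))"
    using span[OF e\<^sub>1_hom[OF x]] unfolding Rc by blast
  have gc: "g i t \<in> carrier M\<^sub>1" if "i < p" "t \<in> R" for i t
    using add_hom_closed[OF bimodule_homD(1)[OF g[OF that(1)]]] that(2) Rc by simp
  have gl: "g i s = left_smult M\<^sub>1 s (g i \<one>)" "g i s = right_smult M\<^sub>1 (g i \<one>) s"
      "g i (r \<otimes> s) = left_smult M\<^sub>1 r (g i s)" "g i (s \<otimes> r) = right_smult M\<^sub>1 (g i s) r"
    if "i < p" "s \<in> R" for i s
    using bimodule_homD(2,3)[OF g[OF that(1)] that(2), of \<one>] bimodule_homD(2,3)[OF g[OF that(1)] r, of s]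
      oneR R_in[OF that(2)] that by (simp_all add: base_bimodule_def)
  show thesis by (rule that[OF gc gl n])
qed

text \<open>Write x = \<Sum> n_i c_i with n_i in \<open>R\<close> and c_i = g_i(1) commuting with
  \<open>R\<close>. Then n_i c_i r = (n_i r) c_i, and the hypothesis evaluates \<phi> there as
  \<epsilon>(n_i) \<epsilon>(r) \<phi>(c_i).\<close>

lemma depth_one_necessary_left:
  assumes \<phi>R: "\<And>r x. r \<in> R \<Longrightarrow> x \<in> carrier H \<Longrightarrow> \<phi> (r \<otimes> x) = \<epsilon> r \<odot>\<^bsub>V\<^esub> \<phi> x"
  shows "\<phi> (x \<otimes> r) = \<epsilon> r \<odot>\<^bsub>V\<^esub> \<phi> x"
proof (rule depth_one_span)
  fix g p n
  assume gc: "\<And>i s. i < p \<Longrightarrow> s \<in> R \<Longrightarrow> g i s \<in> carrier M\<^sub>1"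
    and gl: "\<And>i s. i < p \<Longrightarrow> s \<in> R \<Longrightarrow> g i s = left_smult M\<^sub>1 s (g i \<one>)"
    and gr: "\<And>i s. i < p \<Longrightarrow> s \<in> R \<Longrightarrow> g i (s \<otimes> r) = right_smult M\<^sub>1 (g i s) r"
    and n: "n \<in> {..<p::nat} \<rightarrow> R" "e\<^sub>1 x = (\<Oplus>\<^bsub>M\<^sub>1\<^esub>i\<in>{..<p}. g i (n i))"
  let ?\<pi> = "lift\<^sub>1 V \<phi>"
  note \<pi> = lift\<^sub>1_hom[OF V.abelian_group_axioms \<phi>] lift\<^sub>1_e[OF V.abelian_group_axioms \<phi>]
  have rH: "r \<in> carrier H" using R_in r .
  have oneR: "\<one> \<in> R" using subringE(3)[OF subring] .
  have \<pi>l: "?\<pi> (left_smult M\<^sub>1 h t) = \<epsilon> h \<odot>\<^bsub>V\<^esub> ?\<pi> t" if "h \<in> R" "t \<in> carrier M\<^sub>1" for h t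
    using that \<phi>R R_in by (auto elim!: M\<^sub>1_cases simp: \<pi>(2))
  have "?\<pi> (right_smult M\<^sub>1 (e\<^sub>1 x) r) = \<epsilon> r \<odot>\<^bsub>V\<^esub> ?\<pi> (e\<^sub>1 x)"
  proof (rule smult_eq_on_span[where g = g and n = n and p = p and \<theta> = "\<lambda>t. ?\<pi> (right_smult M\<^sub>1 t r)" and \<pi> = ?\<pi>,
        OF abelian_groups(1) add_hom_compose[OF right_smult_M\<^sub>1_hom[OF rH] \<pi>(1)] \<pi>(1) \<epsilon>_closed[OF rH] gc _ n])
    fix i s assume i: "i < p" and s: "s \<in> R"
    have c: "?\<pi> (g i \<one>) \<in> carrier V" using add_hom_closed[OF \<pi>(1) gc[OF i oneR]] .
    have sr: "s \<otimes> r \<in> R" using subringE(6)[OF subring s r] .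
    have "?\<pi> (right_smult M\<^sub>1 (g i s) r) = ?\<pi> (left_smult M\<^sub>1 (s \<otimes> r) (g i \<one>))"
      using gr[OF i s] gl[OF i sr] by simp
    also have "\<dots> = (\<epsilon> s \<otimes>\<^bsub>K\<^esub> \<epsilon> r) \<odot>\<^bsub>V\<^esub> ?\<pi> (g i \<one>)"
      using \<pi>l[OF sr gc[OF i oneR]] \<epsilon>_mult R_in s r by simp
    also have "\<dots> = \<epsilon> r \<odot>\<^bsub>V\<^esub> (\<epsilon> s \<odot>\<^bsub>V\<^esub> ?\<pi> (g i \<one>))"
      using c s r R_in \<epsilon>_closed by (simp add: V.R.m_comm V.smult_assoc1)
    also have "\<epsilon> s \<odot>\<^bsub>V\<^esub> ?\<pi> (g i \<one>) = ?\<pi> (g i s)"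
      unfolding gl[OF i s] by (rule \<pi>l[OF s gc[OF i oneR], symmetric])
    finally show "?\<pi> (right_smult M\<^sub>1 (g i s) r) = \<epsilon> r \<odot>\<^bsub>V\<^esub> ?\<pi> (g i s)" .
  qed
  then show "\<phi> (x \<otimes> r) = \<epsilon> r \<odot>\<^bsub>V\<^esub> \<phi> x" using x rH by (simp add: \<pi>(2))
qed

text \<open>The same expansion with coefficients on the right: r c_i n_i = c_i (r n_i).\<close>

lemma depth_one_necessary_right:
  assumes \<phi>R: "\<And>r x. r \<in> R \<Longrightarrow> x \<in> carrier H \<Longrightarrow> \<phi> (x \<otimes> r) = \<epsilon> r \<odot>\<^bsub>V\<^esub> \<phi> x"
  shows "\<phi> (r \<otimes> x) = \<epsilon> r \<odot>\<^bsub>V\<^esub> \<phi> x"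
proof (rule depth_one_span)
  fix g p n
  assume gc: "\<And>i s. i < p \<Longrightarrow> s \<in> R \<Longrightarrow> g i s \<in> carrier M\<^sub>1"
    and gr: "\<And>i s. i < p \<Longrightarrow> s \<in> R \<Longrightarrow> g i s = right_smult M\<^sub>1 (g i \<one>) s"
    and gl: "\<And>i s. i < p \<Longrightarrow> s \<in> R \<Longrightarrow> g i (r \<otimes> s) = left_smult M\<^sub>1 r (g i s)"
    and n: "n \<in> {..<p::nat} \<rightarrow> R" "e\<^sub>1 x = (\<Oplus>\<^bsub>M\<^sub>1\<^esub>i\<in>{..<p}. g i (n i))"
  let ?\<pi> = "lift\<^sub>1 V \<phi>"
  note \<pi> = lift\<^sub>1_hom[OF V.abelian_group_axioms \<phi>] lift\<^sub>1_e[OF V.abelian_group_axioms \<phi>]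
  have rH: "r \<in> carrier H" using R_in r .
  have oneR: "\<one> \<in> R" using subringE(3)[OF subring] .
  have \<pi>r: "?\<pi> (right_smult M\<^sub>1 t h) = \<epsilon> h \<odot>\<^bsub>V\<^esub> ?\<pi> t" if "h \<in> R" "t \<in> carrier M\<^sub>1" for h t
    using that \<phi>R R_in by (auto elim!: M\<^sub>1_cases simp: \<pi>(2))
  have "?\<pi> (left_smult M\<^sub>1 r (e\<^sub>1 x)) = \<epsilon> r \<odot>\<^bsub>V\<^esub> ?\<pi> (e\<^sub>1 x)"
  proof (rule smult_eq_on_span[where g = g and n = n and p = p and \<theta> = "\<lambda>t. ?\<pi> (left_smult M\<^sub>1 r t)" and \<pi> = ?\<pi>,
        OF abelian_groups(1) add_hom_compose[OF left_smult_M\<^sub>1_hom[OF rH] \<pi>(1)] \<pi>(1) \<epsilon>_closed[OF rH] gc _ n])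
    fix i s assume i: "i < p" and s: "s \<in> R"
    have c: "?\<pi> (g i \<one>) \<in> carrier V" using add_hom_closed[OF \<pi>(1) gc[OF i oneR]] .
    have rs: "r \<otimes> s \<in> R" using subringE(6)[OF subring r s] .
    have "?\<pi> (left_smult M\<^sub>1 r (g i s)) = ?\<pi> (right_smult M\<^sub>1 (g i \<one>) (r \<otimes> s))"
      using gl[OF i s] gr[OF i rs] by simp
    also have "\<dots> = \<epsilon> r \<odot>\<^bsub>V\<^esub> (\<epsilon> s \<odot>\<^bsub>V\<^esub> ?\<pi> (g i \<one>))"
      using \<pi>r[OF rs gc[OF i oneR]] c s r R_in \<epsilon>_closed \<epsilon>_mult by (simp add: V.smult_assoc1)
    also have "\<epsilon> s \<odot>\<^bsub>V\<^esub> ?\<pi> (g i \<one>) = ?\<pi> (g i s)"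
      unfolding gr[OF i s] by (rule \<pi>r[OF s gc[OF i oneR], symmetric])
    finally show "?\<pi> (left_smult M\<^sub>1 r (g i s)) = \<epsilon> r \<odot>\<^bsub>V\<^esub> ?\<pi> (g i s)" .
  qed
  then show "\<phi> (r \<otimes> x) = \<epsilon> r \<odot>\<^bsub>V\<^esub> \<phi> x" using x rH by (simp add: \<pi>(2))
qed

end

end

end

section \<open>Projections and the antipode of the double cross product\<close>

context matched_pair begin

text \<open>From here on H is handled through its ring laws and the two embeddings. Rewriting its
  carrier and unit into those of the tensor product would keep these laws from applying.\<close>

declare H_simps [simp del]

sublocale H: k_algebra K H by (rule algebra_H)

definition \<alpha> :: "'a \<Rightarrow> ('a \<times> 'b \<Rightarrow>\<^sub>0 int) set" where "\<alpha> a = a \<bowtie> \<one>\<^bsub>B\<^esub>"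
definition \<beta> :: "'b \<Rightarrow> ('a \<times> 'b \<Rightarrow>\<^sub>0 int) set" where "\<beta> b = \<one>\<^bsub>A\<^esub> \<bowtie> b"

lemma lin_\<alpha> [linear_intros]: "F \<in> module_hom K M A \<Longrightarrow> (\<lambda>x. \<alpha> (F x)) \<in> module_hom K M H"
  unfolding module_hom_H \<alpha>_def by (intro linear_intros) simp_all

lemma lin_\<beta> [linear_intros]: "F \<in> module_hom K M B \<Longrightarrow> (\<lambda>x. \<beta> (F x)) \<in> module_hom K M H"
  unfolding module_hom_H \<beta>_def by (intro linear_intros) simp_all

lemmas \<alpha>_hom = lin_\<alpha>[OF lin_id]
lemmas \<beta>_hom = lin_\<beta>[OF lin_id]

lemma \<alpha>_closed [simp]: "a \<in> carrier A \<Longrightarrow> \<alpha> a \<in> carrier H"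
  by (rule module_hom_in[OF \<alpha>_hom])

lemma \<beta>_closed [simp]: "b \<in> carrier B \<Longrightarrow> \<beta> b \<in> carrier H"
  by (rule module_hom_in[OF \<beta>_hom])

lemma \<alpha>_mult: "a \<in> carrier A \<Longrightarrow> a' \<in> carrier A \<Longrightarrow> \<alpha> (a \<otimes>\<^bsub>A\<^esub> a') = \<alpha> a \<otimes>\<^bsub>H\<^esub> \<alpha> a'"
  by (simp add: \<alpha>_def pure_mult right_op_one)

lemma \<beta>_mult: "b \<in> carrier B \<Longrightarrow> b' \<in> carrier B \<Longrightarrow> \<beta> (b \<otimes>\<^bsub>B\<^esub> b') = \<beta> b \<otimes>\<^bsub>H\<^esub> \<beta> b'"
  by (simp add: \<beta>_def pure_mult left_op_one right_op_one_pure)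

lemma \<alpha>_one: "\<alpha> \<one>\<^bsub>A\<^esub> = \<one>\<^bsub>H\<^esub>" and \<beta>_one: "\<beta> \<one>\<^bsub>B\<^esub> = \<one>\<^bsub>H\<^esub>"
  by (simp_all add: \<alpha>_def \<beta>_def H_simps)

lemma \<alpha>\<beta>: "a \<in> carrier A \<Longrightarrow> b \<in> carrier B \<Longrightarrow> \<alpha> a \<otimes>\<^bsub>H\<^esub> \<beta> b = a \<bowtie> b"
  by (simp add: \<alpha>_def \<beta>_def pure_mult right_op_one)

text \<open>The straightening rule inside H. Together with \<open>\<alpha>\<beta>\<close> it
  replaces a product in the order b a by products in the order a b, on which linear maps out of H
  are defined.\<close>

lemma \<beta>\<alpha>:
  assumes "a \<in> carrier A" "b \<in> carrier B"
  shows "\<beta> b \<otimes>\<^bsub>H\<^esub> \<alpha> a =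
    sweedler K B H b (\<lambda>b\<^sub>1 b\<^sub>2. sweedler K A H a (\<lambda>a\<^sub>1 a\<^sub>2. \<alpha> (b\<^sub>1 \<rhd> a\<^sub>1) \<otimes>\<^bsub>H\<^esub> \<beta> (b\<^sub>2 \<lhd>\<^sub>r a\<^sub>2)))"
proof -
  have "\<beta> b \<otimes>\<^bsub>H\<^esub> \<alpha> a = right_op b (a \<bowtie> \<one>\<^bsub>B\<^esub>)"
    using assms by (simp add: \<alpha>_def \<beta>_def pure_mult left_op_one)
  also have "\<dots> = sweedler K B AB b (\<lambda>b\<^sub>1 b\<^sub>2. sweedler K A AB a (\<lambda>a\<^sub>1 a\<^sub>2. (b\<^sub>1 \<rhd> a\<^sub>1) \<bowtie> (b\<^sub>2 \<lhd>\<^sub>r a\<^sub>2)))"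
    using assms by (simp add: right_op_pure)
  finally show ?thesis unfolding sweedler_H by (simp add: \<alpha>\<beta>)
qed

lemma H_hom_eqI:
  assumes "module K P" "f \<in> module_hom K H P" "g \<in> module_hom K H P"
    and "\<And>a b. a \<in> carrier A \<Longrightarrow> b \<in> carrier B \<Longrightarrow> f (\<alpha> a \<otimes>\<^bsub>H\<^esub> \<beta> b) = g (\<alpha> a \<otimes>\<^bsub>H\<^esub> \<beta> b)"
    and "x \<in> carrier H"
  shows "f x = g x"
proof (rule tensor_hom_eqI[OF assms(1)])
  show "f \<in> module_hom K AB P" "g \<in> module_hom K AB P"
    using assms(2,3) by (simp_all only: module_hom_H)
  show "f (a \<bowtie> b) = g (a \<bowtie> b)" if "a \<in> carrier A" "b \<in> carrier B" for a b
    using assms(4)[OF that] unfolding \<alpha>\<beta>[OF that] .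
  show "x \<in> carrier AB" using assms(5) by (simp only: H_simps)
qed

lemma
  assumes P: "module K P" and \<phi>: "bilinear_map K A B P \<phi>"
  shows H_lift_hom: "(\<lambda>x. tensor_lift P x \<phi>) \<in> module_hom K H P"
    and H_lift_pure: "a \<in> carrier A \<Longrightarrow> b \<in> carrier B \<Longrightarrow> tensor_lift P (\<alpha> a \<otimes>\<^bsub>H\<^esub> \<beta> b) \<phi> = \<phi> a b"
proof -
  interpret P: module K P by fact
  show "(\<lambda>x. tensor_lift P x \<phi>) \<in> module_hom K H P"
    unfolding module_hom_H by (rule T.tensor_lift_hom[OF P \<phi>])
  show "a \<in> carrier A \<Longrightarrow> b \<in> carrier B \<Longrightarrow> tensor_lift P (\<alpha> a \<otimes>\<^bsub>H\<^esub> \<beta> b) \<phi> = \<phi> a b"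
    by (simp add: \<alpha>\<beta> T.tensor_lift_tens[OF P.abelian_group_axioms bilinear_map_balanced[OF \<phi>]])
qed

lemmas push_H = sweedler_module_hom[OF H.module_A]
text \<open>\<open>pA\<close> and \<open>pB\<close> apply the counit to the other tensor factor.
  \<open>SH\<close> is the only candidate for an antipode of H: on a product a b it takes the value
  S(b) S(a) that reversal of products forces.\<close>

definition pA where "pA x = tensor_lift A x (\<lambda>a b. counit B b \<odot>\<^bsub>A\<^esub> a)"
definition pB where "pB x = tensor_lift B x (\<lambda>a b. counit A a \<odot>\<^bsub>B\<^esub> b)"
definition SH where "SH x = tensor_lift H x (\<lambda>a b. \<beta> (B.S b) \<otimes>\<^bsub>H\<^esub> \<alpha> (A.S a))"

lemma bilinear_pA: "bilinear_map K A B A (\<lambda>a b. counit B b \<odot>\<^bsub>A\<^esub> a)"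
  by (rule bilinear_mapI) (intro linear_intros A.module_A B.counit_closed | assumption)+

lemma bilinear_pB: "bilinear_map K A B B (\<lambda>a b. counit A a \<odot>\<^bsub>B\<^esub> b)"
  by (rule bilinear_mapI) (intro linear_intros B.module_A A.counit_closed | assumption)+

lemma bilinear_SH: "bilinear_map K A B H (\<lambda>a b. \<beta> (B.S b) \<otimes>\<^bsub>H\<^esub> \<alpha> (A.S a))"
  by (rule bilinear_mapI) (intro linear_intros | simp)+

lemma pA_hom: "pA \<in> module_hom K H A" and pB_hom: "pB \<in> module_hom K H B"
  and SH_hom: "SH \<in> module_hom K H H"
  using H_lift_hom[OF _ bilinear_pA] H_lift_hom[OF _ bilinear_pB] H_lift_hom[OF H.module_A bilinear_SH]
  by (simp_all add: pA_def[abs_def] pB_def[abs_def] SH_def[abs_def])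

lemma projections_pure:
  assumes "a \<in> carrier A" "b \<in> carrier B"
  shows "pA (\<alpha> a \<otimes>\<^bsub>H\<^esub> \<beta> b) = counit B b \<odot>\<^bsub>A\<^esub> a"
    and "pB (\<alpha> a \<otimes>\<^bsub>H\<^esub> \<beta> b) = counit A a \<odot>\<^bsub>B\<^esub> b"
    and "SH (\<alpha> a \<otimes>\<^bsub>H\<^esub> \<beta> b) = \<beta> (B.S b) \<otimes>\<^bsub>H\<^esub> \<alpha> (A.S a)"
  using assms by (simp_all add: pA_def pB_def SH_def H_lift_pure[OF _ bilinear_pA]
      H_lift_pure[OF _ bilinear_pB] H_lift_pure[OF H.module_A bilinear_SH])

lemma lin_projections [linear_intros]:
  "F \<in> module_hom K M H \<Longrightarrow> (\<lambda>x. pA (F x)) \<in> module_hom K M A"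
  "F \<in> module_hom K M H \<Longrightarrow> (\<lambda>x. pB (F x)) \<in> module_hom K M B"
  "F \<in> module_hom K M H \<Longrightarrow> (\<lambda>x. SH (F x)) \<in> module_hom K M H"
  by (rule module_hom_compose[OF _ pA_hom] module_hom_compose[OF _ pB_hom] module_hom_compose[OF _ SH_hom]; assumption)+

lemma projections_closed [simp]:
  assumes "x \<in> carrier H"
  shows "pA x \<in> carrier A" "pB x \<in> carrier B" "SH x \<in> carrier H"
  using assms by (simp_all add: module_hom_in[OF pA_hom] module_hom_in[OF pB_hom] module_hom_in[OF SH_hom])

lemma counit_one_simps [simp]: "counit A \<one>\<^bsub>A\<^esub> = \<one>\<^bsub>K\<^esub>" "counit B \<one>\<^bsub>B\<^esub> = \<one>\<^bsub>K\<^esub>"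
  by (rule A.counit_one B.counit_one)+

lemma projections_emb:
  "a \<in> carrier A \<Longrightarrow> pA (\<alpha> a) = a" "b \<in> carrier B \<Longrightarrow> pA (\<beta> b) = counit B b \<odot>\<^bsub>A\<^esub> \<one>\<^bsub>A\<^esub>"
  "a \<in> carrier A \<Longrightarrow> pB (\<alpha> a) = counit A a \<odot>\<^bsub>B\<^esub> \<one>\<^bsub>B\<^esub>" "b \<in> carrier B \<Longrightarrow> pB (\<beta> b) = b"
  "a \<in> carrier A \<Longrightarrow> SH (\<alpha> a) = \<alpha> (A.S a)" "b \<in> carrier B \<Longrightarrow> SH (\<beta> b) = \<beta> (B.S b)"
  using projections_pure[of a "\<one>\<^bsub>B\<^esub>"] projections_pure[of "\<one>\<^bsub>A\<^esub>" b]
  by (simp_all add: \<alpha>_one \<beta>_one A.antipode_one B.antipode_one)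

lemma counit_simps [simp]: "a \<in> carrier A \<Longrightarrow> counit A a \<in> carrier K" "b \<in> carrier B \<Longrightarrow> counit B b \<in> carrier K"
  by (rule A.counit_closed B.counit_closed; assumption)+

text \<open>All six rules multiply by A from the left or by B from the right, where the order a b is
  preserved and no straightening occurs. The other sides are harder: they bring in the
  actions.\<close>

lemma
  assumes a: "a \<in> carrier A" and b: "b \<in> carrier B" and x: "x \<in> carrier H"
  shows pB_\<alpha>_mult: "pB (\<alpha> a \<otimes>\<^bsub>H\<^esub> x) = counit A a \<odot>\<^bsub>B\<^esub> pB x"
    and pB_mult_\<beta>: "pB (x \<otimes>\<^bsub>H\<^esub> \<beta> b) = pB x \<otimes>\<^bsub>B\<^esub> b"
    and pA_\<alpha>_mult: "pA (\<alpha> a \<otimes>\<^bsub>H\<^esub> x) = a \<otimes>\<^bsub>A\<^esub> pA x"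
    and pA_mult_\<beta>: "pA (x \<otimes>\<^bsub>H\<^esub> \<beta> b) = counit B b \<odot>\<^bsub>A\<^esub> pA x"
    and SH_\<alpha>_mult: "SH (\<alpha> a \<otimes>\<^bsub>H\<^esub> x) = SH x \<otimes>\<^bsub>H\<^esub> \<alpha> (A.S a)"
    and SH_mult_\<beta>: "SH (x \<otimes>\<^bsub>H\<^esub> \<beta> b) = \<beta> (B.S b) \<otimes>\<^bsub>H\<^esub> SH x"
proof -
  have l: "\<alpha> a \<otimes>\<^bsub>H\<^esub> (\<alpha> c \<otimes>\<^bsub>H\<^esub> \<beta> d) = \<alpha> (a \<otimes>\<^bsub>A\<^esub> c) \<otimes>\<^bsub>H\<^esub> \<beta> d"
    if "c \<in> carrier A" "d \<in> carrier B" for c d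
    using that a by (simp add: \<alpha>_mult H.m_assoc)
  have r: "(\<alpha> c \<otimes>\<^bsub>H\<^esub> \<beta> d) \<otimes>\<^bsub>H\<^esub> \<beta> b = \<alpha> c \<otimes>\<^bsub>H\<^esub> \<beta> (d \<otimes>\<^bsub>B\<^esub> b)"
    if "c \<in> carrier A" "d \<in> carrier B" for c d
    using that b by (simp add: \<beta>_mult H.m_assoc)
  show "pB (\<alpha> a \<otimes>\<^bsub>H\<^esub> x) = counit A a \<odot>\<^bsub>B\<^esub> pB x"
    by (rule H_hom_eqI[OF B.module_A _ _ _ x])
      (intro linear_intros | simp add: a l projections_pure A.counit_mult B.VS.smult_assoc1)+
  show "pB (x \<otimes>\<^bsub>H\<^esub> \<beta> b) = pB x \<otimes>\<^bsub>B\<^esub> b"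
    by (rule H_hom_eqI[OF B.module_A _ _ _ x])
      (intro linear_intros | simp add: b r projections_pure B.smult_mult_left)+
  show "pA (\<alpha> a \<otimes>\<^bsub>H\<^esub> x) = a \<otimes>\<^bsub>A\<^esub> pA x"
    by (rule H_hom_eqI[OF A.module_A _ _ _ x])
      (intro linear_intros | simp add: a l projections_pure A.smult_mult_right)+
  show "pA (x \<otimes>\<^bsub>H\<^esub> \<beta> b) = counit B b \<odot>\<^bsub>A\<^esub> pA x"
  proof (rule H_hom_eqI[OF A.module_A _ _ _ x])
    fix c d assume c: "c \<in> carrier A" and d: "d \<in> carrier B"
    have "pA ((\<alpha> c \<otimes>\<^bsub>H\<^esub> \<beta> d) \<otimes>\<^bsub>H\<^esub> \<beta> b) = (counit B b \<otimes>\<^bsub>K\<^esub> counit B d) \<odot>\<^bsub>A\<^esub> c"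
      using b c d by (simp add: r projections_pure B.counit_mult A.VS.R.m_comm)
    then show "pA ((\<alpha> c \<otimes>\<^bsub>H\<^esub> \<beta> d) \<otimes>\<^bsub>H\<^esub> \<beta> b) = counit B b \<odot>\<^bsub>A\<^esub> pA (\<alpha> c \<otimes>\<^bsub>H\<^esub> \<beta> d)"
      using b c d by (simp add: projections_pure A.VS.smult_assoc1)
  qed (intro linear_intros | simp add: b)+
  show "SH (\<alpha> a \<otimes>\<^bsub>H\<^esub> x) = SH x \<otimes>\<^bsub>H\<^esub> \<alpha> (A.S a)"
  proof (rule H_hom_eqI[OF H.module_A _ _ _ x])
    fix c d assume c: "c \<in> carrier A" and d: "d \<in> carrier B"
    have "SH (\<alpha> a \<otimes>\<^bsub>H\<^esub> (\<alpha> c \<otimes>\<^bsub>H\<^esub> \<beta> d)) = \<beta> (B.S d) \<otimes>\<^bsub>H\<^esub> \<alpha> (A.S c \<otimes>\<^bsub>A\<^esub> A.S a)"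
      using a c d by (simp add: l projections_pure A.antipode_mult)
    also have "\<dots> = SH (\<alpha> c \<otimes>\<^bsub>H\<^esub> \<beta> d) \<otimes>\<^bsub>H\<^esub> \<alpha> (A.S a)"
      using a c d by (simp add: projections_pure \<alpha>_mult H.m_assoc)
    finally show "SH (\<alpha> a \<otimes>\<^bsub>H\<^esub> (\<alpha> c \<otimes>\<^bsub>H\<^esub> \<beta> d)) = SH (\<alpha> c \<otimes>\<^bsub>H\<^esub> \<beta> d) \<otimes>\<^bsub>H\<^esub> \<alpha> (A.S a)" .
  qed (intro linear_intros | simp add: a)+
  show "SH (x \<otimes>\<^bsub>H\<^esub> \<beta> b) = \<beta> (B.S b) \<otimes>\<^bsub>H\<^esub> SH x"
  proof (rule H_hom_eqI[OF H.module_A _ _ _ x])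
    fix c d assume c: "c \<in> carrier A" and d: "d \<in> carrier B"
    have "SH ((\<alpha> c \<otimes>\<^bsub>H\<^esub> \<beta> d) \<otimes>\<^bsub>H\<^esub> \<beta> b) = \<beta> (B.S b \<otimes>\<^bsub>B\<^esub> B.S d) \<otimes>\<^bsub>H\<^esub> \<alpha> (A.S c)"
      using b c d by (simp add: r projections_pure B.antipode_mult)
    also have "\<dots> = \<beta> (B.S b) \<otimes>\<^bsub>H\<^esub> SH (\<alpha> c \<otimes>\<^bsub>H\<^esub> \<beta> d)"
      using b c d by (simp add: projections_pure \<beta>_mult H.m_assoc)
    finally show "SH ((\<alpha> c \<otimes>\<^bsub>H\<^esub> \<beta> d) \<otimes>\<^bsub>H\<^esub> \<beta> b) = \<beta> (B.S b) \<otimes>\<^bsub>H\<^esub> SH (\<alpha> c \<otimes>\<^bsub>H\<^esub> \<beta> d)" .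
  qed (intro linear_intros | simp add: b)+
qed

lemma hom_\<beta>\<alpha>:
  assumes "module K P" "h \<in> module_hom K H P" and a: "a \<in> carrier A" and b: "b \<in> carrier B"
  shows "h (\<beta> b \<otimes>\<^bsub>H\<^esub> \<alpha> a) = sweedler K B P b (\<lambda>b\<^sub>1 b\<^sub>2. sweedler K A P a (\<lambda>a\<^sub>1 a\<^sub>2.
      h (\<alpha> (b\<^sub>1 \<rhd> a\<^sub>1) \<otimes>\<^bsub>H\<^esub> \<beta> (b\<^sub>2 \<lhd>\<^sub>r a\<^sub>2))))"
proof -
  have "h (\<beta> b \<otimes>\<^bsub>H\<^esub> \<alpha> a) = sweedler K B P b (\<lambda>b\<^sub>1 b\<^sub>2. h (sweedler K A H a (\<lambda>a\<^sub>1 a\<^sub>2.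
      \<alpha> (b\<^sub>1 \<rhd> a\<^sub>1) \<otimes>\<^bsub>H\<^esub> \<beta> (b\<^sub>2 \<lhd>\<^sub>r a\<^sub>2))))"
    unfolding \<beta>\<alpha>[OF a b]
    by (intro push_H assms(1,2) sweedler_closed H.abelian_group_axioms) simp
  also have "\<dots> = sweedler K B P b (\<lambda>b\<^sub>1 b\<^sub>2. sweedler K A P a (\<lambda>a\<^sub>1 a\<^sub>2.
      h (\<alpha> (b\<^sub>1 \<rhd> a\<^sub>1) \<otimes>\<^bsub>H\<^esub> \<beta> (b\<^sub>2 \<lhd>\<^sub>r a\<^sub>2))))"
    by (intro sweedler_cong push_H assms(1,2)) simp
  finally show ?thesis .
qed

text \<open>After straightening b a, each projection meets a counit of an acted-on element. The
  actions preserve counits, so two of the four legs collapse. This is how the actions are recovered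
  from products in H.\<close>

lemma
  assumes a: "a \<in> carrier A" and b: "b \<in> carrier B"
  shows pB_\<beta>\<alpha>: "pB (\<beta> b \<otimes>\<^bsub>H\<^esub> \<alpha> a) = b \<lhd>\<^sub>r a" and pA_\<beta>\<alpha>: "pA (\<beta> b \<otimes>\<^bsub>H\<^esub> \<alpha> a) = b \<rhd> a"
proof -
  have "pB (\<beta> b \<otimes>\<^bsub>H\<^esub> \<alpha> a) = sweedler K B B b (\<lambda>b\<^sub>1 b\<^sub>2. sweedler K A B a (\<lambda>a\<^sub>1 a\<^sub>2.
      counit B b\<^sub>1 \<odot>\<^bsub>B\<^esub> (counit A a\<^sub>1 \<odot>\<^bsub>B\<^esub> (b\<^sub>2 \<lhd>\<^sub>r a\<^sub>2))))"
    unfolding hom_\<beta>\<alpha>[OF B.module_A pB_hom a b]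
    by (intro sweedler_cong) (simp add: projections_pure L.act_counit B.VS.smult_assoc1)
  then show "pB (\<beta> b \<otimes>\<^bsub>H\<^esub> \<alpha> a) = b \<lhd>\<^sub>r a"
    unfolding sweedler_joint_counit_left[OF B.coalgebra A.coalgebra B.module_A R.act_bilinear b a] .
  have "pA (\<beta> b \<otimes>\<^bsub>H\<^esub> \<alpha> a) = sweedler K B A b (\<lambda>b\<^sub>1 b\<^sub>2. sweedler K A A a (\<lambda>a\<^sub>1 a\<^sub>2.
      counit B b\<^sub>2 \<odot>\<^bsub>A\<^esub> (counit A a\<^sub>2 \<odot>\<^bsub>A\<^esub> (b\<^sub>1 \<rhd> a\<^sub>1))))"
    unfolding hom_\<beta>\<alpha>[OF A.module_A pA_hom a b]
    by (intro sweedler_cong) (simp add: projections_pure R.act_counit A.VS.smult_assoc1)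
  then show "pA (\<beta> b \<otimes>\<^bsub>H\<^esub> \<alpha> a) = b \<rhd> a"
    unfolding sweedler_joint_counit_right[OF B.coalgebra A.coalgebra A.module_A L.act_bilinear b a] .
qed

text \<open>The counit of H, written through \<open>pA\<close> so that its linearity is inherited
  from the projection and the counit of A.\<close>

definition eH where "eH x = counit A (pA x)"

lemma lin_eH [linear_intros]: "F \<in> module_hom K M H \<Longrightarrow> (\<lambda>x. eH (F x)) \<in> module_hom K M (scalar_module K)"
  unfolding eH_def by (intro linear_intros)

lemma eH_closed [simp]: "x \<in> carrier H \<Longrightarrow> eH x \<in> carrier K"
  by (simp add: eH_def)

lemma module_scalar_K: "module K (scalar_module K)"
  by (rule module_scalar) (rule A.VS.R.is_cring)

lemma counit_smult:
  "r \<in> carrier K \<Longrightarrow> a \<in> carrier A \<Longrightarrow> counit A (r \<odot>\<^bsub>A\<^esub> a) = r \<otimes>\<^bsub>K\<^esub> counit A a"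
  using module_hom_smult[OF A.counit_linear] by (simp add: scalar_module_def)

lemma eH_emb: "a \<in> carrier A \<Longrightarrow> eH (\<alpha> a) = counit A a" "b \<in> carrier B \<Longrightarrow> eH (\<beta> b) = counit B b"
  by (simp_all add: eH_def projections_emb counit_smult)

lemma eH_add: "x \<in> carrier H \<Longrightarrow> y \<in> carrier H \<Longrightarrow> eH (x \<oplus>\<^bsub>H\<^esub> y) = eH x \<oplus>\<^bsub>K\<^esub> eH y"
  using lin_eH[OF lin_id] by (simp add: module_hom_def scalar_module_def)

text \<open>It is enough to multiply from the left by elements of A and of B separately. For A this
  is visible through \<open>pA\<close>; for B the product b c d reduces by \<open>pA\<close> to b
  \<rhd> c, and \<rhd> preserves counits.\<close>

lemma eH_mult:
  assumes x: "x \<in> carrier H" and y: "y \<in> carrier H"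
  shows "eH (x \<otimes>\<^bsub>H\<^esub> y) = eH x \<otimes>\<^bsub>K\<^esub> eH y"
proof -
  have smult: "r \<odot>\<^bsub>scalar_module K\<^esub> s = r \<otimes>\<^bsub>K\<^esub> s" "carrier (scalar_module K) = carrier K" for r s
    by (simp_all add: scalar_module_def)
  have l: "eH (\<alpha> a \<otimes>\<^bsub>H\<^esub> z) = counit A a \<otimes>\<^bsub>K\<^esub> eH z" if "a \<in> carrier A" "z \<in> carrier H" for a z
    using that by (simp add: eH_def pA_\<alpha>_mult[OF _ B.one_closed] A.counit_mult)
  have r: "eH (\<beta> b \<otimes>\<^bsub>H\<^esub> z) = counit B b \<otimes>\<^bsub>K\<^esub> eH z" if b: "b \<in> carrier B" and z: "z \<in> carrier H" for b z
  proof -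
    have "eH (\<beta> b \<otimes>\<^bsub>H\<^esub> z) = counit B b \<odot>\<^bsub>scalar_module K\<^esub> eH z"
    proof (rule H_hom_eqI[OF module_scalar_K _ _ _ z])
      fix c d assume c: "c \<in> carrier A" and d: "d \<in> carrier B"
      have "pA (\<beta> b \<otimes>\<^bsub>H\<^esub> (\<alpha> c \<otimes>\<^bsub>H\<^esub> \<beta> d)) = pA ((\<beta> b \<otimes>\<^bsub>H\<^esub> \<alpha> c) \<otimes>\<^bsub>H\<^esub> \<beta> d)"
        using b c d by (simp add: H.m_assoc)
      also have "\<dots> = counit B d \<odot>\<^bsub>A\<^esub> (b \<rhd> c)"
        using b c d by (simp add: pA_mult_\<beta>[OF A.one_closed] pA_\<beta>\<alpha>)
      finally have "eH (\<beta> b \<otimes>\<^bsub>H\<^esub> (\<alpha> c \<otimes>\<^bsub>H\<^esub> \<beta> d)) =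
          counit B d \<otimes>\<^bsub>K\<^esub> (counit B b \<otimes>\<^bsub>K\<^esub> counit A c)"
        using b c d by (simp add: eH_def counit_smult L.act_counit)
      also have "\<dots> = counit B b \<otimes>\<^bsub>K\<^esub> (counit B d \<otimes>\<^bsub>K\<^esub> counit A c)"
        using b c d by (intro A.VS.R.m_lcomm) simp_all
      finally show "eH (\<beta> b \<otimes>\<^bsub>H\<^esub> (\<alpha> c \<otimes>\<^bsub>H\<^esub> \<beta> d)) =
          counit B b \<odot>\<^bsub>scalar_module K\<^esub> eH (\<alpha> c \<otimes>\<^bsub>H\<^esub> \<beta> d)"
        using c d by (simp add: eH_def projections_pure counit_smult smult(1))
    qed (intro linear_intros module_scalar_K | simp add: b smult(2))+
    then show ?thesis by (simp add: smult(1))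
  qed
  have "eH (x \<otimes>\<^bsub>H\<^esub> y) = eH x \<odot>\<^bsub>scalar_module K\<^esub> eH y"
  proof (rule H_hom_eqI[OF module_scalar_K _ _ _ x])
    fix a b assume a: "a \<in> carrier A" and b: "b \<in> carrier B"
    have "eH ((\<alpha> a \<otimes>\<^bsub>H\<^esub> \<beta> b) \<otimes>\<^bsub>H\<^esub> y) = counit A a \<otimes>\<^bsub>K\<^esub> (counit B b \<otimes>\<^bsub>K\<^esub> eH y)"
      using a b y by (simp add: H.m_assoc l r)
    also have "\<dots> = (counit A a \<otimes>\<^bsub>K\<^esub> counit B b) \<otimes>\<^bsub>K\<^esub> eH y"
      using a b y by (intro A.VS.R.m_assoc[symmetric]) simp_all
    finally show "eH ((\<alpha> a \<otimes>\<^bsub>H\<^esub> \<beta> b) \<otimes>\<^bsub>H\<^esub> y) = eH (\<alpha> a \<otimes>\<^bsub>H\<^esub> \<beta> b) \<odot>\<^bsub>scalar_module K\<^esub> eH y"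
      using a b by (simp add: l eH_emb smult(1))
  qed (intro linear_intros module_scalar_K | simp add: y smult(2))+
  then show ?thesis by (simp add: smult(1))
qed

end

section \<open>The antipode of the double cross product reverses products\<close>

context matched_pair begin

lemma convolution_algebra_BAH: "convolution_algebra K B A H"
  by (intro convolution_algebra.intro B.coalgebra A.coalgebra algebra_H)

text \<open>Since \<open>SH\<close> is prescribed on products a b, reversal of b a is a theorem.
  Both sides are convolution inverses of (b, a) \<mapsto> b a. Straightening writes this map as
  \<open>?k \<star> ?l\<close>, so its left inverse is \<open>?l' \<star> ?k'\<close>; a right
  inverse is S(a) S(b).\<close>

lemma SH_\<beta>\<alpha>:
  assumes a: "a \<in> carrier A" and b: "b \<in> carrier B"
  shows "SH (\<beta> b \<otimes>\<^bsub>H\<^esub> \<alpha> a) = \<alpha> (A.S a) \<otimes>\<^bsub>H\<^esub> \<beta> (B.S b)"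
proof -
  interpret C: convolution_algebra K B A H by (rule convolution_algebra_BAH)
  let ?k = "\<lambda>b a. \<alpha> (b \<rhd> a)" and ?l = "\<lambda>b a. \<beta> (b \<lhd>\<^sub>r a)" and ?g = "\<lambda>b a. \<beta> b \<otimes>\<^bsub>H\<^esub> \<alpha> a"
    and ?k' = "\<lambda>b a. \<alpha> (A.S (b \<rhd> a))" and ?l' = "\<lambda>b a. \<beta> (B.S (b \<lhd>\<^sub>r a))"
    and ?h = "\<lambda>b a. \<alpha> (A.S a) \<otimes>\<^bsub>H\<^esub> \<beta> (B.S b)"
  have bil: "C.bil ?k" "C.bil ?l" "C.bil ?g" "C.bil ?k'" "C.bil ?l'" "C.bil ?h"
    by (rule bilinear_mapI; (intro linear_intros | simp)+)+
  have unit: "\<alpha> (counit A (b \<rhd> a) \<odot>\<^bsub>A\<^esub> \<one>\<^bsub>A\<^esub>) = C.conv_unit b a"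
    "\<beta> (counit B (b \<lhd>\<^sub>r a) \<odot>\<^bsub>B\<^esub> \<one>\<^bsub>B\<^esub>) = C.conv_unit b a"
    if "b \<in> carrier B" "a \<in> carrier A" for b a
    using that by (simp_all add: module_hom_smult[OF \<alpha>_hom] module_hom_smult[OF \<beta>_hom] \<alpha>_one \<beta>_one
        L.act_counit R.act_counit H.VS.smult_assoc1)
  \<comment> \<open>Composing the antipode with a coalgebra map gives a convolution inverse of that
    map. For \<rhd> this is the antipode law of A taken at b \<rhd> a; \<open>ll\<close> is the same
    law of B at b \<lhd> a.\<close>
  have kk: "C.conv ?k' ?k b a = C.conv_unit b a" if x: "b \<in> carrier B" "a \<in> carrier A" for b a
  proof -
    have "C.conv ?k' ?k b a = sweedler K A H (b \<rhd> a) (\<lambda>u v. \<alpha> (A.S u \<otimes>\<^bsub>A\<^esub> v))"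
      unfolding convolution_def by (subst sweedler_lact[OF H.module_A _ x])
        (rule bilinear_mapI, (intro linear_intros | simp add: \<alpha>_mult)+)
    also have "\<dots> = C.conv_unit b a"
      using x by (simp add: sweedler_module_hom[OF A.module_A H.module_A \<alpha>_hom, symmetric] A.antipode_left unit)
    finally show ?thesis .
  qed
  have ll: "C.conv ?l' ?l b a = C.conv_unit b a" if x: "b \<in> carrier B" "a \<in> carrier A" for b a
  proof -
    have "C.conv ?l' ?l b a = sweedler K B H (b \<lhd>\<^sub>r a) (\<lambda>u v. \<beta> (B.S u \<otimes>\<^bsub>B\<^esub> v))"
      unfolding convolution_def by (subst sweedler_ract[OF H.module_A _ x])
        (rule bilinear_mapI, (intro linear_intros | simp add: \<beta>_mult)+)
    also have "\<dots> = C.conv_unit b a"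
      using x by (simp add: sweedler_module_hom[OF B.module_A H.module_A \<beta>_hom, symmetric] B.antipode_left unit)
    finally show ?thesis .
  qed
  have g: "?g b a = C.conv ?k ?l b a" if "b \<in> carrier B" "a \<in> carrier A" for b a
    using \<beta>\<alpha>[OF that(2,1)] by (simp add: convolution_def)
  \<comment> \<open>Cancellation from the inside: \<open>?k'\<close> removes the left factor of
    \<open>?g\<close>, leaving \<open>?l\<close>, which \<open>?l'\<close> then removes.\<close>
  have inv: "C.conv (C.conv ?l' ?k') ?g b a = C.conv_unit b a" if x: "b \<in> carrier B" "a \<in> carrier A" for b a
  proof -
    have "C.conv ?k' ?g b a = ?l b a" if x: "b \<in> carrier B" "a \<in> carrier A" for b a
    proof -
      have "C.conv ?k' ?g b a = C.conv ?k' (C.conv ?k ?l) b a"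
        by (rule convolution_cong) (simp_all only: g)
      also have "\<dots> = C.conv (C.conv ?k' ?k) ?l b a"
        by (rule C.convolution_assoc[OF bil(4,1,2) x, symmetric])
      also have "\<dots> = C.conv C.conv_unit ?l b a"
        by (rule convolution_cong) (simp_all only: kk)
      also have "\<dots> = ?l b a"
        by (rule C.convolution_unit_left[OF bil(2) x])
      finally show ?thesis .
    qed
    then have "C.conv ?l' (C.conv ?k' ?g) b a = C.conv ?l' ?l b a"
      by (intro convolution_cong) simp_all
    then show ?thesis unfolding C.convolution_assoc[OF bil(5,4,3) x] ll[OF x] .
  qed
  \<comment> \<open>Here b_1 a_1 S(a_2) S(b_2) collapses from the inside by the two antipode laws
    alone; no straightening is involved.\<close>
  have gh: "C.conv ?g ?h b a = C.conv_unit b a" if x: "b \<in> carrier B" "a \<in> carrier A" for b a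
  proof -
    have "C.conv ?g ?h b a = sweedler K B H b (\<lambda>b\<^sub>1 b\<^sub>2. sweedler K A H a (\<lambda>a\<^sub>1 a\<^sub>2.
        \<beta> b\<^sub>1 \<otimes>\<^bsub>H\<^esub> \<alpha> (a\<^sub>1 \<otimes>\<^bsub>A\<^esub> A.S a\<^sub>2) \<otimes>\<^bsub>H\<^esub> \<beta> (B.S b\<^sub>2)))"
      unfolding convolution_def by (intro sweedler_cong) (simp add: \<alpha>_mult H.m_assoc)
    also have "\<dots> = sweedler K B H b (\<lambda>b\<^sub>1 b\<^sub>2. counit A a \<odot>\<^bsub>H\<^esub> \<beta> (b\<^sub>1 \<otimes>\<^bsub>B\<^esub> B.S b\<^sub>2))"
    proof (rule sweedler_cong)
      fix b\<^sub>1 b\<^sub>2 assume y: "b\<^sub>1 \<in> carrier B" "b\<^sub>2 \<in> carrier B"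
      have "(\<lambda>z. \<beta> b\<^sub>1 \<otimes>\<^bsub>H\<^esub> \<alpha> z \<otimes>\<^bsub>H\<^esub> \<beta> (B.S b\<^sub>2)) \<in> module_hom K A H"
        by (intro linear_intros | simp add: y)+
      note push = sweedler_module_hom[OF A.module_A H.module_A this, symmetric]
      show "sweedler K A H a (\<lambda>a\<^sub>1 a\<^sub>2. \<beta> b\<^sub>1 \<otimes>\<^bsub>H\<^esub> \<alpha> (a\<^sub>1 \<otimes>\<^bsub>A\<^esub> A.S a\<^sub>2) \<otimes>\<^bsub>H\<^esub> \<beta> (B.S b\<^sub>2)) =
          counit A a \<odot>\<^bsub>H\<^esub> \<beta> (b\<^sub>1 \<otimes>\<^bsub>B\<^esub> B.S b\<^sub>2)"
        using x y by (subst push) (simp_all add: A.antipode_right module_hom_smult[OF \<alpha>_hom] \<alpha>_one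
            H.smult_mult_left H.smult_mult_right \<beta>_mult)
    qed
    also have "\<dots> = counit A a \<odot>\<^bsub>H\<^esub> \<beta> (sweedler K B B b (\<lambda>b\<^sub>1 b\<^sub>2. b\<^sub>1 \<otimes>\<^bsub>B\<^esub> B.S b\<^sub>2))"
      using x by (simp add: sweedler_smult[OF H.module_A, symmetric] sweedler_module_hom[OF B.module_A H.module_A \<beta>_hom])
    also have "\<dots> = C.conv_unit b a"
      using x by (simp add: B.antipode_right module_hom_smult[OF \<beta>_hom] \<beta>_one H.VS.smult_assoc1[symmetric] A.VS.R.m_comm)
    finally show ?thesis .
  qed
  have "SH (\<beta> b \<otimes>\<^bsub>H\<^esub> \<alpha> a) = sweedler K B H b (\<lambda>b\<^sub>1 b\<^sub>2. sweedler K A H a (\<lambda>a\<^sub>1 a\<^sub>2.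
      \<beta> (B.S (b\<^sub>2 \<lhd>\<^sub>r a\<^sub>2)) \<otimes>\<^bsub>H\<^esub> \<alpha> (A.S (b\<^sub>1 \<rhd> a\<^sub>1))))"
    unfolding hom_\<beta>\<alpha>[OF H.module_A SH_hom a b] by (intro sweedler_cong) (simp add: projections_pure)
  \<comment> \<open>\<open>SH\<close> reverses each straightened product, leaving the legs in the
    crossed order S(b_2 \<lhd> a_2) S(b_1 \<rhd> a_1). The compatibility condition uncrosses
    them.\<close>
  also have "\<dots> = C.conv ?l' ?k' b a"
    unfolding convolution_def
    by (rule sweedler_compatible[OF H.module_A _ b a, where \<phi> = "\<lambda>b a. \<beta> (B.S b) \<otimes>\<^bsub>H\<^esub> \<alpha> (A.S a)", symmetric],
        rule bilinear_mapI) (intro linear_intros | simp)+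
  also have "\<dots> = ?h b a"
    by (rule C.convolution_inverse_unique[OF C.convolution_bilinear[OF bil(5,4)] bil(3,6) inv gh b a])
  finally show ?thesis .
qed

lemma SH_mult_\<alpha>:
  assumes a: "a \<in> carrier A" and x: "x \<in> carrier H"
  shows "SH (x \<otimes>\<^bsub>H\<^esub> \<alpha> a) = \<alpha> (A.S a) \<otimes>\<^bsub>H\<^esub> SH x"
proof (rule H_hom_eqI[OF H.module_A _ _ _ x])
  fix c d assume c: "c \<in> carrier A" and d: "d \<in> carrier B"
  have "SH (\<alpha> c \<otimes>\<^bsub>H\<^esub> \<beta> d \<otimes>\<^bsub>H\<^esub> \<alpha> a) = \<alpha> (A.S a) \<otimes>\<^bsub>H\<^esub> \<beta> (B.S d) \<otimes>\<^bsub>H\<^esub> \<alpha> (A.S c)"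
    using a c d by (simp add: H.m_assoc SH_\<alpha>_mult[OF _ B.one_closed] SH_\<beta>\<alpha>)
  then show "SH (\<alpha> c \<otimes>\<^bsub>H\<^esub> \<beta> d \<otimes>\<^bsub>H\<^esub> \<alpha> a) = \<alpha> (A.S a) \<otimes>\<^bsub>H\<^esub> SH (\<alpha> c \<otimes>\<^bsub>H\<^esub> \<beta> d)"
    using a c d by (simp add: projections_pure H.m_assoc)
qed (intro linear_intros | simp add: a)+

lemma SH_\<beta>_mult:
  assumes b: "b \<in> carrier B" and x: "x \<in> carrier H"
  shows "SH (\<beta> b \<otimes>\<^bsub>H\<^esub> x) = SH x \<otimes>\<^bsub>H\<^esub> \<beta> (B.S b)"
proof (rule H_hom_eqI[OF H.module_A _ _ _ x])
  fix c d assume c: "c \<in> carrier A" and d: "d \<in> carrier B"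
  have "SH (\<beta> b \<otimes>\<^bsub>H\<^esub> (\<alpha> c \<otimes>\<^bsub>H\<^esub> \<beta> d)) = SH ((\<beta> b \<otimes>\<^bsub>H\<^esub> \<alpha> c) \<otimes>\<^bsub>H\<^esub> \<beta> d)"
    using b c d by (simp add: H.m_assoc)
  also have "\<dots> = \<beta> (B.S d) \<otimes>\<^bsub>H\<^esub> (\<alpha> (A.S c) \<otimes>\<^bsub>H\<^esub> \<beta> (B.S b))"
    using b c d by (simp add: SH_mult_\<beta>[OF A.one_closed] SH_\<beta>\<alpha>)
  finally show "SH (\<beta> b \<otimes>\<^bsub>H\<^esub> (\<alpha> c \<otimes>\<^bsub>H\<^esub> \<beta> d)) = SH (\<alpha> c \<otimes>\<^bsub>H\<^esub> \<beta> d) \<otimes>\<^bsub>H\<^esub> \<beta> (B.S b)"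
    using b c d by (simp add: projections_pure H.m_assoc)
qed (intro linear_intros | simp add: b)+

end

lemma (in ring) subring_image:
  assumes "ring A" "h \<in> ring_hom A R"
  shows "subring (h ` carrier A) R"
proof -
  interpret h: ring_hom_ring A R h
    by (intro ring_hom_ringI2 assms ring_axioms)
  show ?thesis
  proof (rule subringI)
    show "h ` carrier A \<subseteq> carrier R" by auto
    show "\<one> \<in> h ` carrier A" using h.hom_one by (metis h.R.one_closed image_eqI)
    show "\<ominus> x \<in> h ` carrier A" if "x \<in> h ` carrier A" for x
      using that by (auto simp flip: h.hom_a_inv)
    show "x \<otimes> y \<in> h ` carrier A" "x \<oplus> y \<in> h ` carrier A" if "x \<in> h ` carrier A" "y \<in> h ` carrier A" for x y
      using that by (auto simp flip: h.hom_mult h.hom_add)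
  qed
qed

section \<open>The factors as subrings, and cancellation of their antipodes\<close>

context matched_pair begin

lemma ring_extensions: "ring_extension (left_factor K A B) H" "ring_extension (right_factor K A B) H"
proof -
  have "\<alpha> \<in> ring_hom A H" "\<beta> \<in> ring_hom B H"
    using \<alpha>_hom \<beta>_hom by (auto simp: ring_hom_def module_hom_def \<alpha>_mult \<beta>_mult \<alpha>_one \<beta>_one)
  then have "subring (\<alpha> ` carrier A) H" "subring (\<beta> ` carrier B) H"
    using H.subring_image A.ring_axioms B.ring_axioms by auto
  then show "ring_extension (left_factor K A B) H" "ring_extension (right_factor K A B) H"
    using H.ring_axioms
    by (simp_all add: ring_extension_def ring_extension_axioms_def left_factor_def right_factor_def \<alpha>_def[abs_def] \<beta>_def[abs_def])
qed

lemma left_factor_eq: "left_factor K A B = \<alpha> ` carrier A"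
  and right_factor_eq: "right_factor K A B = \<beta> ` carrier B"
  by (simp_all add: left_factor_def right_factor_def \<alpha>_def[abs_def] \<beta>_def[abs_def])

text \<open>Expand b \<lhd> a as \<Sum> (b_1 \<lhd> a) S(b_2) b_3. The first two factors are
  \<epsilon>(a) \<epsilon>(b_1) by \<open>cancel\<close>, which leaves \<epsilon>(a) b.\<close>

lemma ract_trivialI:
  assumes a: "a \<in> carrier A" and b: "b \<in> carrier B"
    and S: "\<And>a b. a \<in> carrier A \<Longrightarrow> b \<in> carrier B \<Longrightarrow> B.S (b \<lhd>\<^sub>r a) = counit A a \<odot>\<^bsub>B\<^esub> B.S b"
  shows "b \<lhd>\<^sub>r a = counit A a \<odot>\<^bsub>B\<^esub> b"
proof -
  have bil: "bilinear_map K B B B (\<lambda>u v. u \<otimes>\<^bsub>B\<^esub> B.S v)"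
    by (rule bilinear_mapI) (intro linear_intros | simp)+
  \<comment> \<open>The antipode law at x \<lhd> a reads \<Sum> (x_1 \<lhd> a_1) S(x_2 \<lhd> a_2) =
    \<epsilon>(x) \<epsilon>(a). The hypothesis makes the second factor \<epsilon>(a_2) S(x_2), so
    that all of a moves to the first.\<close>
  have cancel: "sweedler K B B x (\<lambda>u v. (u \<lhd>\<^sub>r a) \<otimes>\<^bsub>B\<^esub> B.S v) = counit B x \<odot>\<^bsub>B\<^esub> (counit A a \<odot>\<^bsub>B\<^esub> \<one>\<^bsub>B\<^esub>)"
    if x: "x \<in> carrier B" for x
  proof -
    have "counit B x \<odot>\<^bsub>B\<^esub> (counit A a \<odot>\<^bsub>B\<^esub> \<one>\<^bsub>B\<^esub>) = sweedler K B B (x \<lhd>\<^sub>r a) (\<lambda>u v. u \<otimes>\<^bsub>B\<^esub> B.S v)"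
      using x a by (simp add: B.antipode_right R.act_counit B.VS.smult_assoc1)
    also have "\<dots> = sweedler K B B x (\<lambda>u v. sweedler K A B a (\<lambda>a\<^sub>1 a\<^sub>2. (u \<lhd>\<^sub>r a\<^sub>1) \<otimes>\<^bsub>B\<^esub> B.S (v \<lhd>\<^sub>r a\<^sub>2)))"
      by (rule sweedler_ract[OF B.module_A bil x a])
    also have "\<dots> = sweedler K B B x (\<lambda>u v. (u \<lhd>\<^sub>r a) \<otimes>\<^bsub>B\<^esub> B.S v)"
    proof (rule sweedler_cong)
      fix u v assume y: "u \<in> carrier B" "v \<in> carrier B"
      have "sweedler K A B a (\<lambda>a\<^sub>1 a\<^sub>2. counit A a\<^sub>2 \<odot>\<^bsub>B\<^esub> ((u \<lhd>\<^sub>r a\<^sub>1) \<otimes>\<^bsub>B\<^esub> B.S v)) = (u \<lhd>\<^sub>r a) \<otimes>\<^bsub>B\<^esub> B.S v"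
        by (rule A.sweedler_counit_right[OF B.module_A _ a]) (intro linear_intros | simp add: y)+
      then show "sweedler K A B a (\<lambda>a\<^sub>1 a\<^sub>2. (u \<lhd>\<^sub>r a\<^sub>1) \<otimes>\<^bsub>B\<^esub> B.S (v \<lhd>\<^sub>r a\<^sub>2)) = (u \<lhd>\<^sub>r a) \<otimes>\<^bsub>B\<^esub> B.S v"
        using y by (simp add: S B.smult_mult_right)
    qed
    finally show ?thesis by simp
  qed
  have "b \<lhd>\<^sub>r a = sweedler K B B b (\<lambda>x y. counit B y \<odot>\<^bsub>B\<^esub> (x \<lhd>\<^sub>r a))"
    by (rule B.sweedler_counit_right[OF B.module_A _ b, symmetric]) (intro linear_intros | simp add: a)+
  also have "\<dots> = sweedler K B B b (\<lambda>x y. sweedler K B B y (\<lambda>u v. (x \<lhd>\<^sub>r a) \<otimes>\<^bsub>B\<^esub> B.S u \<otimes>\<^bsub>B\<^esub> v))"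
  proof (rule sweedler_cong)
    fix x y assume y: "x \<in> carrier B" "y \<in> carrier B"
    have "counit B y \<odot>\<^bsub>B\<^esub> (x \<lhd>\<^sub>r a) = (x \<lhd>\<^sub>r a) \<otimes>\<^bsub>B\<^esub> sweedler K B B y (\<lambda>u v. B.S u \<otimes>\<^bsub>B\<^esub> v)"
      using y a by (simp add: B.antipode_left B.smult_mult_right)
    also have "\<dots> = sweedler K B B y (\<lambda>u v. (x \<lhd>\<^sub>r a) \<otimes>\<^bsub>B\<^esub> B.S u \<otimes>\<^bsub>B\<^esub> v)"
      using y a by (simp add: sweedler_mult_left[OF B.algebra] B.m_assoc)
    finally show "counit B y \<odot>\<^bsub>B\<^esub> (x \<lhd>\<^sub>r a) = sweedler K B B y (\<lambda>u v. (x \<lhd>\<^sub>r a) \<otimes>\<^bsub>B\<^esub> B.S u \<otimes>\<^bsub>B\<^esub> v)" .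
  qed
  also have "\<dots> = sweedler K B B b (\<lambda>x y. sweedler K B B x (\<lambda>u v. (u \<lhd>\<^sub>r a) \<otimes>\<^bsub>B\<^esub> B.S v \<otimes>\<^bsub>B\<^esub> y))"
    by (rule B.sweedler_coassoc[OF B.module_A, symmetric]) (intro linear_intros | simp add: a b)+
  also have "\<dots> = sweedler K B B b (\<lambda>x y. counit B x \<odot>\<^bsub>B\<^esub> (counit A a \<odot>\<^bsub>B\<^esub> y))"
    using a by (intro sweedler_cong)
      (simp add: sweedler_mult_right[OF B.algebra, symmetric] cancel B.smult_mult_left)
  also have "\<dots> = counit A a \<odot>\<^bsub>B\<^esub> b"
    by (rule B.sweedler_counit_left[OF B.module_A _ b]) (intro linear_intros | simp add: a)+
  finally show ?thesis .
qed

text \<open>The mirror computation in A: b \<rhd> a = \<Sum> a_1 S(a_2) (b \<rhd> a_3), where the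
  last two factors collapse to \<epsilon>(b) \<epsilon>(a_2).\<close>

lemma lact_trivialI:
  assumes a: "a \<in> carrier A" and b: "b \<in> carrier B"
    and S: "\<And>a b. a \<in> carrier A \<Longrightarrow> b \<in> carrier B \<Longrightarrow> A.S (b \<rhd> a) = counit B b \<odot>\<^bsub>A\<^esub> A.S a"
  shows "b \<rhd> a = counit B b \<odot>\<^bsub>A\<^esub> a"
proof -
  have bil: "bilinear_map K A A A (\<lambda>u v. A.S u \<otimes>\<^bsub>A\<^esub> v)"
    by (rule bilinear_mapI) (intro linear_intros | simp)+
  have cancel: "sweedler K A A x (\<lambda>u v. A.S u \<otimes>\<^bsub>A\<^esub> (b \<rhd> v)) = counit A x \<odot>\<^bsub>A\<^esub> (counit B b \<odot>\<^bsub>A\<^esub> \<one>\<^bsub>A\<^esub>)"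
    if x: "x \<in> carrier A" for x
  proof -
    have "counit A x \<odot>\<^bsub>A\<^esub> (counit B b \<odot>\<^bsub>A\<^esub> \<one>\<^bsub>A\<^esub>) = sweedler K A A (b \<rhd> x) (\<lambda>u v. A.S u \<otimes>\<^bsub>A\<^esub> v)"
      using x b by (simp add: A.antipode_left L.act_counit A.VS.smult_assoc1[symmetric] A.VS.R.m_comm)
    also have "\<dots> = sweedler K B A b (\<lambda>b\<^sub>1 b\<^sub>2. sweedler K A A x (\<lambda>u v. A.S (b\<^sub>1 \<rhd> u) \<otimes>\<^bsub>A\<^esub> (b\<^sub>2 \<rhd> v)))"
      by (rule sweedler_lact[OF A.module_A bil b x])
    also have "\<dots> = sweedler K B A b (\<lambda>b\<^sub>1 b\<^sub>2. counit B b\<^sub>1 \<odot>\<^bsub>A\<^esub> sweedler K A A x (\<lambda>u v. A.S u \<otimes>\<^bsub>A\<^esub> (b\<^sub>2 \<rhd> v)))"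
      by (intro sweedler_cong) (simp add: S A.smult_mult_left sweedler_smult[OF A.module_A])
    also have "\<dots> = sweedler K A A x (\<lambda>u v. A.S u \<otimes>\<^bsub>A\<^esub> (b \<rhd> v))"
      by (rule B.sweedler_counit_left[OF A.module_A _ b]) (intro linear_intros | simp add: x)+
    finally show ?thesis by simp
  qed
  have "b \<rhd> a = sweedler K A A a (\<lambda>x y. counit A x \<odot>\<^bsub>A\<^esub> (b \<rhd> y))"
    by (rule A.sweedler_counit_left[OF A.module_A _ a, symmetric]) (intro linear_intros | simp add: b)+
  also have "\<dots> = sweedler K A A a (\<lambda>x y. sweedler K A A x (\<lambda>u v. u \<otimes>\<^bsub>A\<^esub> (A.S v \<otimes>\<^bsub>A\<^esub> (b \<rhd> y))))"
  proof (rule sweedler_cong)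
    fix x y assume y: "x \<in> carrier A" "y \<in> carrier A"
    have "counit A x \<odot>\<^bsub>A\<^esub> (b \<rhd> y) = sweedler K A A x (\<lambda>u v. u \<otimes>\<^bsub>A\<^esub> A.S v) \<otimes>\<^bsub>A\<^esub> (b \<rhd> y)"
      using y b by (simp add: A.antipode_right A.smult_mult_left)
    also have "\<dots> = sweedler K A A x (\<lambda>u v. u \<otimes>\<^bsub>A\<^esub> (A.S v \<otimes>\<^bsub>A\<^esub> (b \<rhd> y)))"
      using y b by (simp add: sweedler_mult_right[OF A.algebra] A.m_assoc)
    finally show "counit A x \<odot>\<^bsub>A\<^esub> (b \<rhd> y) =
      sweedler K A A x (\<lambda>u v. u \<otimes>\<^bsub>A\<^esub> (A.S v \<otimes>\<^bsub>A\<^esub> (b \<rhd> y)))" .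
  qed
  also have "\<dots> = sweedler K A A a (\<lambda>x y. sweedler K A A y (\<lambda>u v. x \<otimes>\<^bsub>A\<^esub> (A.S u \<otimes>\<^bsub>A\<^esub> (b \<rhd> v))))"
    by (rule A.sweedler_coassoc[OF A.module_A]) (intro linear_intros | simp add: a b)+
  also have "\<dots> = sweedler K A A a (\<lambda>x y. counit A y \<odot>\<^bsub>A\<^esub> (counit B b \<odot>\<^bsub>A\<^esub> x))"
    using b by (intro sweedler_cong)
      (simp add: sweedler_mult_left[OF A.algebra, symmetric] cancel A.smult_mult_right)
  also have "\<dots> = counit B b \<odot>\<^bsub>A\<^esub> a"
    by (rule A.sweedler_counit_right[OF A.module_A _ a]) (intro linear_intros | simp add: b)+
  finally show ?thesis .
qed

end

section \<open>Minimal depth at most two forces a trivial action\<close>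

context matched_pair begin

lemma left_factor_necessary:
  assumes depth: "min_depth (left_factor K A B) H \<le> 2" and a: "a \<in> carrier A" and b: "b \<in> carrier B"
  shows "b \<lhd>\<^sub>r a = counit A a \<odot>\<^bsub>B\<^esub> b"
proof -
  interpret E: ring_extension "left_factor K A B" H by (rule ring_extensions)
  note eH = eH_closed eH_add eH_mult
  have eH1: "eH \<one>\<^bsub>H\<^esub> = \<one>\<^bsub>K\<^esub>" using eH_emb(1)[OF A.one_closed] by (simp add: \<alpha>_one)
  have \<alpha>_in: "\<alpha> a \<in> left_factor K A B" if "a \<in> carrier A" for a
    using that by (simp add: left_factor_eq)
  have l: "pB (r \<otimes>\<^bsub>H\<^esub> x) = eH r \<odot>\<^bsub>B\<^esub> pB x" if "r \<in> left_factor K A B" "x \<in> carrier H" for r x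
    using that pB_\<alpha>_mult[OF _ B.one_closed] by (auto simp: left_factor_eq eH_emb)
  \<comment> \<open>As \<open>SH\<close> reverses products, composing it with \<open>pB\<close>
    gives a test map on which A acts trivially from the right, as the A-H-bimodule criterion
    demands.\<close>
  have r: "pB (SH (x \<otimes>\<^bsub>H\<^esub> r)) = eH r \<odot>\<^bsub>B\<^esub> pB (SH x)" if "r \<in> left_factor K A B" "x \<in> carrier H" for r x
    using that pB_\<alpha>_mult[OF _ B.one_closed]
    by (auto simp: left_factor_eq eH_emb SH_mult_\<alpha> A.counit_antipode)
  have lin: "pB \<in> add_hom H B" "(\<lambda>x. pB (SH x)) \<in> add_hom H B"
    by (rule module_hom_add_hom[OF pB_hom] module_hom_add_hom[OF lin_projections(2)[OF SH_hom]])+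
  consider (one) "bimodule_similar (left_factor K A B) (left_factor K A B) E.M\<^sub>1 (base_bimodule (left_factor K A B) H)"
    | (left) "bimodule_similar (carrier H) (left_factor K A B) E.M\<^sub>2 E.M\<^sub>1"
    | (right) "bimodule_similar (left_factor K A B) (carrier H) E.M\<^sub>2 E.M\<^sub>1"
    using depth E.min_depth_le_two_iff E.has_depth_one_cases E.has_depth_two_cases by blast
  then show ?thesis
  proof cases
    case one
    \<comment> \<open>The criterion is evaluated at x = \<beta> b, where \<open>pB\<close> of b a is
      b \<lhd> a.\<close>
    from E.depth_one_necessary_left[OF B.module_A eH eH1 this lin(1) \<alpha>_in[OF a] \<beta>_closed[OF b] l]
    show ?thesis using a b by (simp add: pB_\<beta>\<alpha> projections_emb eH_emb)
  next
    case left
    from E.depth_two_left_necessary[OF B.module_A eH eH1 this lin(1) l \<alpha>_in[OF a] \<beta>_closed[OF b]]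
    show ?thesis using a b by (simp add: pB_\<beta>\<alpha> projections_emb eH_emb)
  next
    case right
    have key: "pB (SH (\<alpha> a \<otimes>\<^bsub>H\<^esub> x)) = counit A a \<odot>\<^bsub>B\<^esub> pB (SH x)" if "a \<in> carrier A" "x \<in> carrier H" for a x
      using E.depth_two_right_necessary[OF B.module_A eH eH1 right lin(2) r \<alpha>_in[OF that(1)] that(2)] that
      by (simp add: eH_emb)
    show ?thesis
    proof (rule ract_trivialI[OF a b])
      fix a b assume a: "a \<in> carrier A" and b: "b \<in> carrier B"
      \<comment> \<open>The inserted counits stand for the factors \<alpha> (b_1 \<rhd> a_1) of the
        straightened product b a, which \<open>key\<close> turns into scalars. Evaluating
        \<open>SH\<close> on b a directly gives S(a) S(b) instead, and comparing the two results
        yields the claim.\<close>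
      have "B.S (b \<lhd>\<^sub>r a) = sweedler K B B b (\<lambda>b\<^sub>1 b\<^sub>2. sweedler K A B a (\<lambda>a\<^sub>1 a\<^sub>2.
          counit B b\<^sub>1 \<odot>\<^bsub>B\<^esub> (counit A a\<^sub>1 \<odot>\<^bsub>B\<^esub> B.S (b\<^sub>2 \<lhd>\<^sub>r a\<^sub>2))))"
        by (rule sweedler_joint_counit_left[OF B.coalgebra A.coalgebra B.module_A _ b a, symmetric],
            rule bilinear_mapI) (intro linear_intros | simp)+
      also have "\<dots> = pB (SH (\<beta> b \<otimes>\<^bsub>H\<^esub> \<alpha> a))"
        unfolding hom_\<beta>\<alpha>[OF B.module_A lin_projections(2)[OF SH_hom] a b]
        by (intro sweedler_cong) (simp add: key projections_emb L.act_counit B.VS.smult_assoc1)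
      also have "\<dots> = counit A a \<odot>\<^bsub>B\<^esub> B.S b"
        using a b by (simp add: SH_\<beta>\<alpha> projections_pure A.counit_antipode)
      finally show "B.S (b \<lhd>\<^sub>r a) = counit A a \<odot>\<^bsub>B\<^esub> B.S b" .
    qed
  qed
qed

text \<open>Sides are exchanged: \<open>pA\<close> trivialises right multiplication by B. Hence
  B-H-bimodules are the direct case, and H-B-bimodules are the one that calls for the
  antipode.\<close>

lemma right_factor_necessary:
  assumes depth: "min_depth (right_factor K A B) H \<le> 2" and a: "a \<in> carrier A" and b: "b \<in> carrier B"
  shows "b \<rhd> a = counit B b \<odot>\<^bsub>A\<^esub> a"
proof -
  interpret E: ring_extension "right_factor K A B" H by (rule ring_extensions)
  note eH = eH_closed eH_add eH_mult
  have eH1: "eH \<one>\<^bsub>H\<^esub> = \<one>\<^bsub>K\<^esub>" using eH_emb(1)[OF A.one_closed] by (simp add: \<alpha>_one)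
  have \<beta>_in: "\<beta> b \<in> right_factor K A B" if "b \<in> carrier B" for b
    using that by (simp add: right_factor_eq)
  have r: "pA (x \<otimes>\<^bsub>H\<^esub> r) = eH r \<odot>\<^bsub>A\<^esub> pA x" if "r \<in> right_factor K A B" "x \<in> carrier H" for r x
    using that pA_mult_\<beta>[OF A.one_closed] by (auto simp: right_factor_eq eH_emb)
  have l: "pA (SH (r \<otimes>\<^bsub>H\<^esub> x)) = eH r \<odot>\<^bsub>A\<^esub> pA (SH x)" if "r \<in> right_factor K A B" "x \<in> carrier H" for r x
    using that pA_mult_\<beta>[OF A.one_closed]
    by (auto simp: right_factor_eq eH_emb SH_\<beta>_mult B.counit_antipode)
  have lin: "pA \<in> add_hom H A" "(\<lambda>x. pA (SH x)) \<in> add_hom H A"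
    by (rule module_hom_add_hom[OF pA_hom] module_hom_add_hom[OF lin_projections(1)[OF SH_hom]])+
  consider (one) "bimodule_similar (right_factor K A B) (right_factor K A B) E.M\<^sub>1 (base_bimodule (right_factor K A B) H)"
    | (left) "bimodule_similar (carrier H) (right_factor K A B) E.M\<^sub>2 E.M\<^sub>1"
    | (right) "bimodule_similar (right_factor K A B) (carrier H) E.M\<^sub>2 E.M\<^sub>1"
    using depth E.min_depth_le_two_iff E.has_depth_one_cases E.has_depth_two_cases by blast
  then show ?thesis
  proof cases
    case one
    from E.depth_one_necessary_right[OF A.module_A eH eH1 this lin(1) \<beta>_in[OF b] \<alpha>_closed[OF a] r]
    show ?thesis using a b by (simp add: pA_\<beta>\<alpha> projections_emb eH_emb)
  next
    case right
    from E.depth_two_right_necessary[OF A.module_A eH eH1 this lin(1) r \<beta>_in[OF b] \<alpha>_closed[OF a]]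
    show ?thesis using a b by (simp add: pA_\<beta>\<alpha> projections_emb eH_emb)
  next
    case left
    have key: "pA (SH (x \<otimes>\<^bsub>H\<^esub> \<beta> b)) = counit B b \<odot>\<^bsub>A\<^esub> pA (SH x)" if "b \<in> carrier B" "x \<in> carrier H" for b x
      using E.depth_two_left_necessary[OF A.module_A eH eH1 left lin(2) l \<beta>_in[OF that(1)] that(2)] that
      by (simp add: eH_emb)
    show ?thesis
    proof (rule lact_trivialI[OF a b])
      fix a b assume a: "a \<in> carrier A" and b: "b \<in> carrier B"
      \<comment> \<open>This time the second legs are straightened into factors \<beta> (b_2 \<lhd>
        a_2) on the right, and it is their counits that are inserted.\<close>
      have "A.S (b \<rhd> a) = sweedler K B A b (\<lambda>b\<^sub>1 b\<^sub>2. sweedler K A A a (\<lambda>a\<^sub>1 a\<^sub>2.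
          counit B b\<^sub>2 \<odot>\<^bsub>A\<^esub> (counit A a\<^sub>2 \<odot>\<^bsub>A\<^esub> A.S (b\<^sub>1 \<rhd> a\<^sub>1))))"
        by (rule sweedler_joint_counit_right[OF B.coalgebra A.coalgebra A.module_A _ b a, symmetric],
            rule bilinear_mapI) (intro linear_intros | simp)+
      also have "\<dots> = pA (SH (\<beta> b \<otimes>\<^bsub>H\<^esub> \<alpha> a))"
        unfolding hom_\<beta>\<alpha>[OF A.module_A lin_projections(1)[OF SH_hom] a b]
        by (intro sweedler_cong) (simp add: key projections_emb R.act_counit A.VS.smult_assoc1)
      also have "\<dots> = counit B b \<odot>\<^bsub>A\<^esub> A.S a"
        using a b by (simp add: SH_\<beta>\<alpha> projections_pure B.counit_antipode)
      finally show "A.S (b \<rhd> a) = counit B b \<odot>\<^bsub>A\<^esub> A.S a" .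
    qed
  qed
qed

end

section \<open>The converse\<close>

text \<open>That scalar multiples of one belong to \<open>R\<close> lets them cross the tensor sign
  of the tensor square over \<open>R\<close>; the ground field then acts unambiguously on
  it.\<close>

locale algebra_extension = k_algebra K H + ring_extension R H
  for K :: "'k ring" and H :: "('k, 'h) bialgebra" and R +
  assumes scalars: "r \<in> carrier K \<Longrightarrow> r \<odot>\<^bsub>H\<^esub> \<one>\<^bsub>H\<^esub> \<in> R"
begin

text \<open>The tensor square is defined from additive relations and has no scalars of its own,
  whereas coassociativity and counit laws for Sweedler sums expect a module over \<open>K\<close> as
  target. The action is left multiplication by scalar multiples of one.\<close>

definition M\<^sub>2_module :: "('k, ('h list \<Rightarrow>\<^sub>0 int) set) module" where
  "M\<^sub>2_module = \<lparr>carrier = carrier M\<^sub>2, monoid.mult = undefined, monoid.one = undefined,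
     ring.zero = \<zero>\<^bsub>M\<^sub>2\<^esub>, ring.add = ring.add M\<^sub>2, smult = (\<lambda>r. left_smult M\<^sub>2 (r \<odot>\<^bsub>H\<^esub> \<one>\<^bsub>H\<^esub>))\<rparr>"

lemma M\<^sub>2_module_simps:
  "carrier M\<^sub>2_module = carrier M\<^sub>2" "\<zero>\<^bsub>M\<^sub>2_module\<^esub> = \<zero>\<^bsub>M\<^sub>2\<^esub>" "x \<oplus>\<^bsub>M\<^sub>2_module\<^esub> y = x \<oplus>\<^bsub>M\<^sub>2\<^esub> y"
  "r \<odot>\<^bsub>M\<^sub>2_module\<^esub> x = left_smult M\<^sub>2 (r \<odot>\<^bsub>H\<^esub> \<one>\<^bsub>H\<^esub>) x"
  by (simp_all add: M\<^sub>2_module_def)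

lemma scalar_mult:
  "r \<in> carrier K \<Longrightarrow> x \<in> carrier H \<Longrightarrow> (r \<odot>\<^bsub>H\<^esub> \<one>\<^bsub>H\<^esub>) \<otimes>\<^bsub>H\<^esub> x = r \<odot>\<^bsub>H\<^esub> x"
  "r \<in> carrier K \<Longrightarrow> x \<in> carrier H \<Longrightarrow> x \<otimes>\<^bsub>H\<^esub> (r \<odot>\<^bsub>H\<^esub> \<one>\<^bsub>H\<^esub>) = r \<odot>\<^bsub>H\<^esub> x"
  by (simp_all add: smult_mult_left smult_mult_right)

text \<open>The second equation needs \<open>scalars\<close>: the multiple of one lies in
  \<open>R\<close> and therefore passes from the right leg to the left one.\<close>

lemma e\<^sub>2_smult:
  assumes "r \<in> carrier K" "x \<in> carrier H" "y \<in> carrier H"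
  shows "e\<^sub>2 (r \<odot>\<^bsub>H\<^esub> x) y = r \<odot>\<^bsub>M\<^sub>2_module\<^esub> e\<^sub>2 x y" "e\<^sub>2 x (r \<odot>\<^bsub>H\<^esub> y) = r \<odot>\<^bsub>M\<^sub>2_module\<^esub> e\<^sub>2 x y"
proof -
  show "e\<^sub>2 (r \<odot>\<^bsub>H\<^esub> x) y = r \<odot>\<^bsub>M\<^sub>2_module\<^esub> e\<^sub>2 x y"
    using assms by (simp add: M\<^sub>2_module_simps scalar_mult)
  with balanced_middle[OF balanced_e\<^sub>2 assms(2) scalars[OF assms(1)] assms(3)]
  show "e\<^sub>2 x (r \<odot>\<^bsub>H\<^esub> y) = r \<odot>\<^bsub>M\<^sub>2_module\<^esub> e\<^sub>2 x y"
    using assms by (simp add: scalar_mult)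
qed

lemma smult_M\<^sub>2_right:
  assumes r: "r \<in> carrier K" and t: "t \<in> carrier M\<^sub>2"
  shows "right_smult M\<^sub>2 t (r \<odot>\<^bsub>H\<^esub> \<one>\<^bsub>H\<^esub>) = r \<odot>\<^bsub>M\<^sub>2_module\<^esub> t"
proof -
  have r1: "r \<odot>\<^bsub>H\<^esub> \<one>\<^bsub>H\<^esub> \<in> carrier H" using r by simp
  show ?thesis unfolding M\<^sub>2_module_simps
    by (rule M\<^sub>2_eqI[OF abelian_groups(2) right_smult_M\<^sub>2_hom[OF r1] left_smult_M\<^sub>2_hom[OF r1] _ t])
      (use r e\<^sub>2_smult in \<open>simp add: scalar_mult\<close>)
qed

lemma module_M\<^sub>2: "module K M\<^sub>2_module"
proof (rule moduleI)
  note M2 = add_hom_closed[OF left_smult_M\<^sub>2_hom]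
  show "abelian_group M\<^sub>2_module"
    by (rule abelian_groupI)
      (simp_all add: M\<^sub>2_module_simps M2.a_assoc, auto simp: M2.a_comm intro: M2.l_neg M2.a_inv_closed)
  show "\<one>\<^bsub>K\<^esub> \<odot>\<^bsub>M\<^sub>2_module\<^esub> t = t" if "t \<in> carrier M\<^sub>2_module" for t
    unfolding M\<^sub>2_module_simps
    by (rule M\<^sub>2_eqI[OF abelian_groups(2) left_smult_M\<^sub>2_hom, of _ "\<lambda>t. t"])
      (use that in \<open>simp_all add: M\<^sub>2_module_simps add_hom_def\<close>)
  show "(r \<oplus>\<^bsub>K\<^esub> s) \<odot>\<^bsub>M\<^sub>2_module\<^esub> t = r \<odot>\<^bsub>M\<^sub>2_module\<^esub> t \<oplus>\<^bsub>M\<^sub>2_module\<^esub> s \<odot>\<^bsub>M\<^sub>2_module\<^esub> t"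
    if "r \<in> carrier K" "s \<in> carrier K" "t \<in> carrier M\<^sub>2_module" for r s t
    using that add_hom_add[OF smult_M\<^sub>2_add_hom(1), of t] by (simp add: M\<^sub>2_module_simps VS.smult_l_distr)
  show "(r \<otimes>\<^bsub>K\<^esub> s) \<odot>\<^bsub>M\<^sub>2_module\<^esub> t = r \<odot>\<^bsub>M\<^sub>2_module\<^esub> (s \<odot>\<^bsub>M\<^sub>2_module\<^esub> t)"
    if "r \<in> carrier K" "s \<in> carrier K" "t \<in> carrier M\<^sub>2_module" for r s t
    using that M\<^sub>2_smult_assoc(1)[of "r \<odot>\<^bsub>H\<^esub> \<one>\<^bsub>H\<^esub>" "s \<odot>\<^bsub>H\<^esub> \<one>\<^bsub>H\<^esub>" t]
    by (simp add: M\<^sub>2_module_simps scalar_mult(1) VS.smult_assoc1)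
qed (use add_hom_closed[OF left_smult_M\<^sub>2_hom] add_hom_add[OF left_smult_M\<^sub>2_hom] VS.R.is_cring
    in \<open>simp_all add: M\<^sub>2_module_simps\<close>)

lemma bilinear_e\<^sub>2: "bilinear_map K H H M\<^sub>2_module e\<^sub>2"
  using add_hom_add[OF balanced_add_hom_left[OF balanced_e\<^sub>2]] add_hom_add[OF balanced_add_hom_right[OF balanced_e\<^sub>2]]
  by (intro bilinear_mapI) (simp_all add: module_hom_def e\<^sub>2_smult Pi_iff, simp_all add: M\<^sub>2_module_simps e\<^sub>2_closed)

lemmas lin_e\<^sub>2 [linear_intros] = bilinear_map_left[OF bilinear_e\<^sub>2] bilinear_map_right[OF bilinear_e\<^sub>2]

lemma sweedler_M\<^sub>2: "sweedler K C M\<^sub>2_module c f = sweedler K C M\<^sub>2 c f"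
  by (simp add: sweedler_def tsum_def M\<^sub>2_module_simps)

lemma smult_M\<^sub>2_scalar:
  assumes r: "r \<in> carrier K" and z: "z \<in> carrier H" and t: "t \<in> carrier M\<^sub>2"
  shows "left_smult M\<^sub>2 (r \<odot>\<^bsub>H\<^esub> z) t = left_smult M\<^sub>2 z (r \<odot>\<^bsub>M\<^sub>2_module\<^esub> t)"
    and "right_smult M\<^sub>2 t (r \<odot>\<^bsub>H\<^esub> z) = right_smult M\<^sub>2 (r \<odot>\<^bsub>M\<^sub>2_module\<^esub> t) z"
  using assms M\<^sub>2_smult_assoc(1)[of z "r \<odot>\<^bsub>H\<^esub> \<one>\<^bsub>H\<^esub>" t] M\<^sub>2_smult_assoc(2)[of "r \<odot>\<^bsub>H\<^esub> \<one>\<^bsub>H\<^esub>" z t]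
  by (simp_all add: scalar_mult M\<^sub>2_module_simps(4) smult_M\<^sub>2_right[unfolded M\<^sub>2_module_simps(4)])

end

lemma finsum_sweedler:
  assumes P: "abelian_group P" and "finite I"
    and g: "\<And>i u v. i \<in> I \<Longrightarrow> u \<in> carrier C \<Longrightarrow> v \<in> carrier C \<Longrightarrow> g i u v \<in> carrier P"
  shows "(\<Oplus>\<^bsub>P\<^esub>i\<in>I. sweedler K C P c (\<lambda>u v. g i u v)) = sweedler K C P c (\<lambda>u v. \<Oplus>\<^bsub>P\<^esub>i\<in>I. g i u v)"
  using assms(2,3)
proof (induction I)
  interpret P: abelian_group P by fact
  case empty
  show ?case by (simp add: sweedler_def tsum_zero[OF P])
next
  interpret P: abelian_group P by fact
  case (insert i I)
  have "(\<Oplus>\<^bsub>P\<^esub>j\<in>insert i I. sweedler K C P c (\<lambda>u v. g j u v)) =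
      sweedler K C P c (\<lambda>u v. g i u v) \<oplus>\<^bsub>P\<^esub> sweedler K C P c (\<lambda>u v. \<Oplus>\<^bsub>P\<^esub>j\<in>I. g j u v)"
    using insert by (subst P.finsum_insert) (auto intro!: sweedler_closed P)
  also have "\<dots> = sweedler K C P c (\<lambda>u v. g i u v \<oplus>\<^bsub>P\<^esub> (\<Oplus>\<^bsub>P\<^esub>j\<in>I. g j u v))"
    unfolding sweedler_def using insert.prems
    by (intro tsum_add[OF P comult_list_subset, symmetric] P.finsum_closed) auto
  also have "\<dots> = sweedler K C P c (\<lambda>u v. \<Oplus>\<^bsub>P\<^esub>j\<in>insert i I. g j u v)"
    using insert by (intro sweedler_cong) (subst P.finsum_insert, auto)
  finally show ?case .
qed

text \<open>Coordinates with respect to a finite basis. The index set is an initial segment of the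
  naturals because powers of a bimodule are indexed that way.\<close>

lemma dual_basis:
  fixes K :: "'k ring" and V :: "('k, 'v, 'o) module_scheme"
  assumes V: "vectorspace K V" and fin: "vectorspace.fin_dim K V"
  obtains n :: nat and v f where "\<And>i. i < n \<Longrightarrow> v i \<in> carrier V"
    and "\<And>i. i < n \<Longrightarrow> f i \<in> module_hom K V (scalar_module K)"
    and "\<And>x. x \<in> carrier V \<Longrightarrow> (\<Oplus>\<^bsub>V\<^esub>i\<in>{..<n}. f i x \<odot>\<^bsub>V\<^esub> v i) = x"
proof -
  interpret V: vectorspace K V by fact
  obtain B where B: "finite B" "V.basis B" using V.finite_basis_exists[OF fin] by blast
  then have BV: "B \<subseteq> carrier V" by (simp add: V.basis_def)
  have ex1: "\<exists>!c. c \<in> B \<rightarrow>\<^sub>E carrier K \<and> V.lincomb c B = x" if "x \<in> carrier V" for x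
    using V.basis_criterion[OF B(1) BV] B(2) that by blast
  define c where "c x = (THE c. c \<in> B \<rightarrow>\<^sub>E carrier K \<and> V.lincomb c B = x)" for x
  have c: "c x \<in> B \<rightarrow>\<^sub>E carrier K" "V.lincomb (c x) B = x" if "x \<in> carrier V" for x
    using theI'[OF ex1[OF that]] by (simp_all add: c_def)
  have cB: "c x b \<in> carrier K" if "x \<in> carrier V" "b \<in> B" for x b
    using c(1)[OF that(1)] that(2) by auto
  \<comment> \<open>Uniqueness of coordinates: linearity of the coordinate functions follows by
    exhibiting one valid coordinate family for a sum or a multiple. Since \<open>c x\<close> is a
    restricted function, a competing family is restricted before it is compared.\<close>
  have c_eq: "c x b = d b"
    if x: "x \<in> carrier V" and d: "\<And>b. b \<in> B \<Longrightarrow> d b \<in> carrier K" and dx: "V.lincomb d B = x" and b: "b \<in> B" for x d b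
  proof -
    have "V.lincomb (restrict d B) B = V.lincomb d B"
      unfolding V.lincomb_def using d BV by (intro V.add.finprod_cong') auto
    then have "restrict d B \<in> B \<rightarrow>\<^sub>E carrier K \<and> V.lincomb (restrict d B) B = x"
      using d dx by auto
    then have "c x = restrict d B"
      unfolding c_def by (rule the1_equality[OF ex1[OF x]])
    then show ?thesis using b by simp
  qed
  have c_smult: "c (r \<odot>\<^bsub>V\<^esub> x) b = r \<otimes>\<^bsub>K\<^esub> c x b" if x: "x \<in> carrier V" and r: "r \<in> carrier K" and b: "b \<in> B" for x r b
  proof (rule c_eq[OF _ _ _ b])
    have "c x \<in> B \<rightarrow> carrier K" using cB[OF x] by auto
    from V.lincomb_smult[OF BV this r] show "V.lincomb (\<lambda>b. r \<otimes>\<^bsub>K\<^esub> c x b) B = r \<odot>\<^bsub>V\<^esub> x"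
      unfolding c(2)[OF x] .
  qed (use x r cB in auto)
  have c_add: "c (x \<oplus>\<^bsub>V\<^esub> y) b = c x b \<oplus>\<^bsub>K\<^esub> c y b" if x: "x \<in> carrier V" and y: "y \<in> carrier V" and b: "b \<in> B" for x y b
  proof (rule c_eq[OF _ _ _ b])
    have "c x \<in> B \<rightarrow> carrier K" "c y \<in> B \<rightarrow> carrier K" using cB[OF x] cB[OF y] by auto
    from V.lincomb_sum[OF B(1) BV this] show "V.lincomb (\<lambda>b. c x b \<oplus>\<^bsub>K\<^esub> c y b) B = x \<oplus>\<^bsub>V\<^esub> y"
      unfolding c(2)[OF x] c(2)[OF y] .
  qed (use x y cB in auto)
  have lin: "(\<lambda>x. c x b) \<in> module_hom K V (scalar_module K)" if b: "b \<in> B" for b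
    using cB[OF _ b] c_smult[OF _ _ b] c_add[OF _ _ b] by (simp add: module_hom_def scalar_module_def)
  obtain h where h: "bij_betw h {..<card B} B"
    using ex_bij_betw_nat_finite[OF B(1)] by (auto simp: atLeast0LessThan)
  then have hB: "h i \<in> B" if "i < card B" for i using that by (auto simp: bij_betw_def)
  show thesis
  proof (rule that)
    show "h i \<in> carrier V" if "i < card B" for i using hB[OF that] BV by auto
    show "(\<lambda>x. c x (h i)) \<in> module_hom K V (scalar_module K)" if "i < card B" for i
      by (rule lin[OF hB[OF that]])
    show "(\<Oplus>\<^bsub>V\<^esub>i\<in>{..<card B}. c x (h i) \<odot>\<^bsub>V\<^esub> h i) = x" if x: "x \<in> carrier V" for x
    proof -
      have "(\<Oplus>\<^bsub>V\<^esub>b\<in>h ` {..<card B}. c x b \<odot>\<^bsub>V\<^esub> b) = (\<Oplus>\<^bsub>V\<^esub>i\<in>{..<card B}. c x (h i) \<odot>\<^bsub>V\<^esub> h i)"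
        using h BV cB[OF x] by (intro V.finsum_reindex) (auto simp: bij_betw_def)
      then show ?thesis using c(2)[OF x] bij_betw_imp_surj_on[OF h] unfolding V.lincomb_def by simp
    qed
  qed
qed

text \<open>The antipode laws transported along an algebra map \<open>j\<close>, next to an extra
  factor \<open>z\<close>. The embeddings of both factors into H are the instances.\<close>

lemma (in hopf_algebra)
  assumes H: "k_algebra K H" and j: "j \<in> module_hom K A H"
    and mult: "\<And>x y. x \<in> carrier A \<Longrightarrow> y \<in> carrier A \<Longrightarrow> j (x \<otimes>\<^bsub>A\<^esub> y) = j x \<otimes>\<^bsub>H\<^esub> j y"
    and one: "j \<one>\<^bsub>A\<^esub> = \<one>\<^bsub>H\<^esub>" and z: "z \<in> carrier H" and x: "x \<in> carrier A"
  shows sweedler_cancel_right: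
      "sweedler K A H x (\<lambda>u v. (z \<otimes>\<^bsub>H\<^esub> j u) \<otimes>\<^bsub>H\<^esub> j (S v)) = counit A x \<odot>\<^bsub>H\<^esub> z"
    and sweedler_cancel_left:
      "sweedler K A H x (\<lambda>u v. j (S u) \<otimes>\<^bsub>H\<^esub> (j v \<otimes>\<^bsub>H\<^esub> z)) = counit A x \<odot>\<^bsub>H\<^esub> z"
proof -
  interpret H: k_algebra K H by (rule H)
  have jc: "j u \<in> carrier H" if "u \<in> carrier A" for u by (rule module_hom_in[OF j that])
  have jr: "(\<lambda>w. z \<otimes>\<^bsub>H\<^esub> j w) \<in> module_hom K A H" by (rule H.lin_mult_right[OF z j])
  have jl: "(\<lambda>w. j w \<otimes>\<^bsub>H\<^esub> z) \<in> module_hom K A H" by (rule H.lin_mult_left[OF j z])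
  have "sweedler K A H x (\<lambda>u v. (z \<otimes>\<^bsub>H\<^esub> j u) \<otimes>\<^bsub>H\<^esub> j (S v)) = sweedler K A H x (\<lambda>u v. z \<otimes>\<^bsub>H\<^esub> j (u \<otimes>\<^bsub>A\<^esub> S v))"
    by (intro sweedler_cong) (simp add: jc z mult H.m_assoc)
  also have "\<dots> = z \<otimes>\<^bsub>H\<^esub> j (sweedler K A A x (\<lambda>u v. u \<otimes>\<^bsub>A\<^esub> S v))"
    by (rule sweedler_module_hom[OF module_A H.module_A jr, symmetric]) simp
  finally show "sweedler K A H x (\<lambda>u v. (z \<otimes>\<^bsub>H\<^esub> j u) \<otimes>\<^bsub>H\<^esub> j (S v)) = counit A x \<odot>\<^bsub>H\<^esub> z"
    using x z by (simp add: antipode_right module_hom_smult[OF j] counit_closed one H.smult_mult_right)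
  have "sweedler K A H x (\<lambda>u v. j (S u) \<otimes>\<^bsub>H\<^esub> (j v \<otimes>\<^bsub>H\<^esub> z)) = sweedler K A H x (\<lambda>u v. j (S u \<otimes>\<^bsub>A\<^esub> v) \<otimes>\<^bsub>H\<^esub> z)"
    by (intro sweedler_cong) (simp add: jc z mult H.m_assoc)
  also have "\<dots> = j (sweedler K A A x (\<lambda>u v. S u \<otimes>\<^bsub>A\<^esub> v)) \<otimes>\<^bsub>H\<^esub> z"
    by (rule sweedler_module_hom[OF module_A H.module_A jl, symmetric]) simp
  finally show "sweedler K A H x (\<lambda>u v. j (S u) \<otimes>\<^bsub>H\<^esub> (j v \<otimes>\<^bsub>H\<^esub> z)) = counit A x \<odot>\<^bsub>H\<^esub> z"
    using x z by (simp add: antipode_left module_hom_smult[OF j] counit_closed one H.smult_mult_left)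
qed

section \<open>Trivial right action: a quasi-basis over A\<close>

context matched_pair begin

lemma H_add_hom_eqI:
  assumes "abelian_group P" "f \<in> add_hom H P" "g \<in> add_hom H P"
    and "\<And>a b. a \<in> carrier A \<Longrightarrow> b \<in> carrier B \<Longrightarrow> f (\<alpha> a \<otimes>\<^bsub>H\<^esub> \<beta> b) = g (\<alpha> a \<otimes>\<^bsub>H\<^esub> \<beta> b)"
    and "x \<in> carrier H"
  shows "f x = g x"
proof (rule T.tensor_add_hom_eqI[OF assms(1), of f g])
  show "f \<in> add_hom AB P" "g \<in> add_hom AB P"
    using assms(2,3) by (simp_all only: add_hom_def H_simps)
  show "f (a \<bowtie> b) = g (a \<bowtie> b)" if "a \<in> carrier A" "b \<in> carrier B" for a b
    using assms(4)[OF that] unfolding \<alpha>\<beta>[OF that] .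
  show "x \<in> carrier AB" using assms(5) by (simp only: H_simps)
qed

lemma algebra_extensions:
  "algebra_extension K H (left_factor K A B)" "algebra_extension K H (right_factor K A B)"
proof -
  have "r \<odot>\<^bsub>H\<^esub> \<one>\<^bsub>H\<^esub> = \<alpha> (r \<odot>\<^bsub>A\<^esub> \<one>\<^bsub>A\<^esub>)" "r \<odot>\<^bsub>H\<^esub> \<one>\<^bsub>H\<^esub> = \<beta> (r \<odot>\<^bsub>B\<^esub> \<one>\<^bsub>B\<^esub>)" if "r \<in> carrier K" for r
    using that by (simp_all add: module_hom_smult[OF \<alpha>_hom] module_hom_smult[OF \<beta>_hom] \<alpha>_one \<beta>_one)
  then have "r \<odot>\<^bsub>H\<^esub> \<one>\<^bsub>H\<^esub> \<in> left_factor K A B" "r \<odot>\<^bsub>H\<^esub> \<one>\<^bsub>H\<^esub> \<in> right_factor K A B" if "r \<in> carrier K" for r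
    using that by (auto simp: left_factor_eq right_factor_eq)
  then show "algebra_extension K H (left_factor K A B)" "algebra_extension K H (right_factor K A B)"
    using ring_extensions algebra_H by (simp_all add: algebra_extension_def algebra_extension_axioms_def)
qed

lemmas \<alpha>_cancel = A.sweedler_cancel_left[OF algebra_H \<alpha>_hom \<alpha>_mult \<alpha>_one] A.sweedler_cancel_right[OF algebra_H \<alpha>_hom \<alpha>_mult \<alpha>_one]
lemmas \<beta>_cancel = B.sweedler_cancel_left[OF algebra_H \<beta>_hom \<beta>_mult \<beta>_one] B.sweedler_cancel_right[OF algebra_H \<beta>_hom \<beta>_mult \<beta>_one]
lemmas hoist_left = sweedler_mult_left[OF algebra_H] and hoist_right = sweedler_mult_right[OF algebra_H]

context
  assumes triv: "\<forall>a\<in>carrier A. \<forall>b\<in>carrier B. b \<lhd>\<^sub>r a = counit A a \<odot>\<^bsub>B\<^esub> b"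
begin

text \<open>The coproduct of a meets a counit in its second leg, and multiplication becomes that of
  a smash product, b a = \<Sum> (b_1 \<rhd> a) b_2.\<close>

lemma \<beta>\<alpha>_trivial_ract:
  assumes a: "a \<in> carrier A" and b: "b \<in> carrier B"
  shows "\<beta> b \<otimes>\<^bsub>H\<^esub> \<alpha> a = sweedler K B H b (\<lambda>u v. \<alpha> (u \<rhd> a) \<otimes>\<^bsub>H\<^esub> \<beta> v)"
  unfolding \<beta>\<alpha>[OF a b]
proof (rule sweedler_cong)
  fix u v assume y: "u \<in> carrier B" "v \<in> carrier B"
  have "sweedler K A H a (\<lambda>p q. \<alpha> (u \<rhd> p) \<otimes>\<^bsub>H\<^esub> \<beta> (v \<lhd>\<^sub>r q)) =
      sweedler K A H a (\<lambda>p q. counit A q \<odot>\<^bsub>H\<^esub> (\<alpha> (u \<rhd> p) \<otimes>\<^bsub>H\<^esub> \<beta> v))"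
    using y by (intro sweedler_cong) (simp add: triv module_hom_smult[OF \<beta>_hom] H.smult_mult_right)
  also have "\<dots> = \<alpha> (u \<rhd> a) \<otimes>\<^bsub>H\<^esub> \<beta> v"
    by (rule A.sweedler_counit_right[OF H.module_A _ a]) (intro linear_intros | simp add: y)+
  finally show "sweedler K A H a (\<lambda>p q. \<alpha> (u \<rhd> p) \<otimes>\<^bsub>H\<^esub> \<beta> (v \<lhd>\<^sub>r q)) = \<alpha> (u \<rhd> a) \<otimes>\<^bsub>H\<^esub> \<beta> v" .
qed

text \<open>In a smash product the action is the adjoint one: straightening b_1 a turns b_1 a S(b_2)
  into (b_1 \<rhd> a) b_2 S(b_3), and the antipode law applies.\<close>

lemma lact_adjoint:
  assumes a: "a \<in> carrier A" and b: "b \<in> carrier B"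
  shows "\<alpha> (b \<rhd> a) = sweedler K B H b (\<lambda>u v. \<beta> u \<otimes>\<^bsub>H\<^esub> \<alpha> a \<otimes>\<^bsub>H\<^esub> \<beta> (B.S v))"
proof -
  have "sweedler K B H b (\<lambda>u v. \<beta> u \<otimes>\<^bsub>H\<^esub> \<alpha> a \<otimes>\<^bsub>H\<^esub> \<beta> (B.S v)) =
      sweedler K B H b (\<lambda>u v. sweedler K B H u (\<lambda>p q. \<alpha> (p \<rhd> a) \<otimes>\<^bsub>H\<^esub> \<beta> q \<otimes>\<^bsub>H\<^esub> \<beta> (B.S v)))"
    using a by (intro sweedler_cong) (simp add: \<beta>\<alpha>_trivial_ract hoist_right)
  also have "\<dots> = sweedler K B H b (\<lambda>u v. sweedler K B H v (\<lambda>p q. \<alpha> (u \<rhd> a) \<otimes>\<^bsub>H\<^esub> \<beta> p \<otimes>\<^bsub>H\<^esub> \<beta> (B.S q)))"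
    by (rule B.sweedler_coassoc[OF H.module_A]) (intro linear_intros | simp add: a b)+
  also have "\<dots> = sweedler K B H b (\<lambda>u v. counit B v \<odot>\<^bsub>H\<^esub> \<alpha> (u \<rhd> a))"
    using a by (intro sweedler_cong \<beta>_cancel(2)) simp_all
  also have "\<dots> = \<alpha> (b \<rhd> a)"
    by (rule B.sweedler_counit_right[OF H.module_A _ b]) (intro linear_intros | simp add: a)+
  finally show ?thesis by simp
qed

text \<open>Moves a past an antipode. By the adjoint formula the sum is S(b_1) b_2 a S(b_3), whose
  first two factors cancel. It serves to show that the quasi-basis elements commute with A.\<close>

lemma antipode_lact:
  assumes a: "a \<in> carrier A" and b: "b \<in> carrier B"
  shows "sweedler K B H b (\<lambda>u v. \<beta> (B.S u) \<otimes>\<^bsub>H\<^esub> \<alpha> (v \<rhd> a)) = \<alpha> a \<otimes>\<^bsub>H\<^esub> \<beta> (B.S b)"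
proof -
  have "sweedler K B H b (\<lambda>u v. \<beta> (B.S u) \<otimes>\<^bsub>H\<^esub> \<alpha> (v \<rhd> a)) =
      sweedler K B H b (\<lambda>u v. sweedler K B H v (\<lambda>p q. \<beta> (B.S u) \<otimes>\<^bsub>H\<^esub> (\<beta> p \<otimes>\<^bsub>H\<^esub> (\<alpha> a \<otimes>\<^bsub>H\<^esub> \<beta> (B.S q)))))"
    using a by (intro sweedler_cong) (simp add: lact_adjoint hoist_left H.m_assoc)
  also have "\<dots> = sweedler K B H b (\<lambda>u v. sweedler K B H u (\<lambda>p q. \<beta> (B.S p) \<otimes>\<^bsub>H\<^esub> (\<beta> q \<otimes>\<^bsub>H\<^esub> (\<alpha> a \<otimes>\<^bsub>H\<^esub> \<beta> (B.S v)))))"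
    by (rule B.sweedler_coassoc[OF H.module_A, symmetric]) (intro linear_intros | simp add: a b)+
  also have "\<dots> = sweedler K B H b (\<lambda>u v. counit B u \<odot>\<^bsub>H\<^esub> (\<alpha> a \<otimes>\<^bsub>H\<^esub> \<beta> (B.S v)))"
    using a by (intro sweedler_cong \<beta>_cancel(1)) simp_all
  also have "\<dots> = \<alpha> a \<otimes>\<^bsub>H\<^esub> \<beta> (B.S b)"
    by (rule B.sweedler_counit_left[OF H.module_A _ b]) (intro linear_intros | simp add: a)+
  finally show ?thesis .
qed

interpretation E: algebra_extension K H "left_factor K A B" by (rule algebra_extensions)

text \<open>\<open>U c\<close> is the preimage of 1 \<otimes> c under the Galois map of H over A.
  Linearity in c lets a dual basis of B be inserted later; the last equation is the computation a
  b_1 S(b_2) \<otimes> b_3 = a \<otimes> b.\<close>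

lemma left_factor_quasi_basis:
  assumes a: "a \<in> carrier A"
  defines "U \<equiv> \<lambda>c. sweedler K B E.M\<^sub>2_module c (\<lambda>x y. E.e\<^sub>2 (\<beta> (B.S x)) (\<beta> y))"
  shows "U \<in> module_hom K B E.M\<^sub>2_module"
    and "c \<in> carrier B \<Longrightarrow> left_smult E.M\<^sub>2 (\<alpha> a) (U c) = right_smult E.M\<^sub>2 (U c) (\<alpha> a)"
    and "b \<in> carrier B \<Longrightarrow> sweedler K B E.M\<^sub>2 b (\<lambda>p q. left_smult E.M\<^sub>2 (\<alpha> a \<otimes>\<^bsub>H\<^esub> \<beta> p) (U q)) = E.e\<^sub>2 \<one>\<^bsub>H\<^esub> (\<alpha> a \<otimes>\<^bsub>H\<^esub> \<beta> b)"
proof -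
  note push_l = sweedler_module_hom[OF H.module_A E.module_M\<^sub>2 E.lin_e\<^sub>2(1)[OF lin_id]]
  note push_r = sweedler_module_hom[OF H.module_A E.module_M\<^sub>2 E.lin_e\<^sub>2(2)[OF _ lin_id]]
  note ag = E.abelian_groups(2)
  have \<alpha>_in: "\<alpha> r \<in> left_factor K A B" if "r \<in> carrier A" for r using that by (simp add: left_factor_eq)
  have pull_l: "left_smult E.M\<^sub>2 h (U c) = sweedler K B E.M\<^sub>2_module c (\<lambda>x y. E.e\<^sub>2 (h \<otimes>\<^bsub>H\<^esub> \<beta> (B.S x)) (\<beta> y))"
    and pull_r: "right_smult E.M\<^sub>2 (U c) h = sweedler K B E.M\<^sub>2_module c (\<lambda>x y. E.e\<^sub>2 (\<beta> (B.S x)) (\<beta> y \<otimes>\<^bsub>H\<^esub> h))"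
    if "h \<in> carrier H" for h c
    unfolding U_def E.sweedler_M\<^sub>2
    using sweedler_hom[OF ag ag E.left_smult_M\<^sub>2_hom[OF that], of B "\<lambda>x y. E.e\<^sub>2 (\<beta> (B.S x)) (\<beta> y)"]
      sweedler_hom[OF ag ag E.right_smult_M\<^sub>2_hom[OF that], of B "\<lambda>x y. E.e\<^sub>2 (\<beta> (B.S x)) (\<beta> y)"] that
    by (simp_all add: E.e\<^sub>2_closed)
  show "U \<in> module_hom K B E.M\<^sub>2_module"
    unfolding U_def by (intro linear_intros E.module_M\<^sub>2 E.lin_e\<^sub>2 | simp)+
  show "left_smult E.M\<^sub>2 (\<alpha> a) (U c) = right_smult E.M\<^sub>2 (U c) (\<alpha> a)" if c: "c \<in> carrier B"
  proof -
    \<comment> \<open>The chain is a S(c_1) \<otimes> c_2 = S(c_1) (c_2 \<rhd> a) \<otimes> c_3 =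
      S(c_1) \<otimes> (c_2 \<rhd> a) c_3 = S(c_1) \<otimes> c_2 a. The middle equality holds
      because c_2 \<rhd> a lies in A, over which the tensor product is taken.\<close>
    have "left_smult E.M\<^sub>2 (\<alpha> a) (U c) = sweedler K B E.M\<^sub>2_module c (\<lambda>x y. sweedler K B E.M\<^sub>2_module x (\<lambda>u v.
        E.e\<^sub>2 (\<beta> (B.S u) \<otimes>\<^bsub>H\<^esub> \<alpha> (v \<rhd> a)) (\<beta> y)))"
      unfolding pull_l[OF \<alpha>_closed[OF a]] using a
      by (intro sweedler_cong) (simp add: push_l[symmetric] antipode_lact)
    also have "\<dots> = sweedler K B E.M\<^sub>2_module c (\<lambda>x y. sweedler K B E.M\<^sub>2_module y (\<lambda>u v.
        E.e\<^sub>2 (\<beta> (B.S x) \<otimes>\<^bsub>H\<^esub> \<alpha> (u \<rhd> a)) (\<beta> v)))"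
      by (rule B.sweedler_coassoc[OF E.module_M\<^sub>2]) (intro linear_intros E.lin_e\<^sub>2 | simp add: a c)+
    also have "\<dots> = sweedler K B E.M\<^sub>2_module c (\<lambda>x y. sweedler K B E.M\<^sub>2_module y (\<lambda>u v.
        E.e\<^sub>2 (\<beta> (B.S x)) (\<alpha> (u \<rhd> a) \<otimes>\<^bsub>H\<^esub> \<beta> v)))"
      using a by (intro sweedler_cong E.balanced_middle[OF E.balanced_e\<^sub>2] \<alpha>_in) simp_all
    also have "\<dots> = right_smult E.M\<^sub>2 (U c) (\<alpha> a)"
      unfolding pull_r[OF \<alpha>_closed[OF a]] using a
      by (intro sweedler_cong) (simp add: push_r[symmetric] \<beta>\<alpha>_trivial_ract)
    finally show ?thesis .
  qed
  show "sweedler K B E.M\<^sub>2 b (\<lambda>p q. left_smult E.M\<^sub>2 (\<alpha> a \<otimes>\<^bsub>H\<^esub> \<beta> p) (U q)) = E.e\<^sub>2 \<one>\<^bsub>H\<^esub> (\<alpha> a \<otimes>\<^bsub>H\<^esub> \<beta> b)"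
    if b: "b \<in> carrier B"
  proof -
    have "sweedler K B E.M\<^sub>2_module b (\<lambda>p q. left_smult E.M\<^sub>2 (\<alpha> a \<otimes>\<^bsub>H\<^esub> \<beta> p) (U q)) =
        sweedler K B E.M\<^sub>2_module b (\<lambda>p q. sweedler K B E.M\<^sub>2_module q (\<lambda>x y.
          E.e\<^sub>2 (\<alpha> a \<otimes>\<^bsub>H\<^esub> \<beta> p \<otimes>\<^bsub>H\<^esub> \<beta> (B.S x)) (\<beta> y)))"
      using a by (intro sweedler_cong pull_l) simp
    also have "\<dots> = sweedler K B E.M\<^sub>2_module b (\<lambda>p q. sweedler K B E.M\<^sub>2_module p (\<lambda>x y.
          E.e\<^sub>2 (\<alpha> a \<otimes>\<^bsub>H\<^esub> \<beta> x \<otimes>\<^bsub>H\<^esub> \<beta> (B.S y)) (\<beta> q)))"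
      by (rule B.sweedler_coassoc[OF E.module_M\<^sub>2, symmetric]) (intro linear_intros E.lin_e\<^sub>2 | simp add: a b)+
    also have "\<dots> = sweedler K B E.M\<^sub>2_module b (\<lambda>p q. counit B p \<odot>\<^bsub>E.M\<^sub>2_module\<^esub> E.e\<^sub>2 (\<alpha> a) (\<beta> q))"
      using a by (intro sweedler_cong) (simp add: push_l[symmetric] \<beta>_cancel(2) E.e\<^sub>2_smult)
    also have "\<dots> = E.e\<^sub>2 (\<alpha> a) (\<beta> b)"
      by (rule B.sweedler_counit_left[OF E.module_M\<^sub>2 _ b]) (intro linear_intros E.lin_e\<^sub>2 | simp add: a)+
    also have "\<dots> = E.e\<^sub>2 \<one>\<^bsub>H\<^esub> (\<alpha> a \<otimes>\<^bsub>H\<^esub> \<beta> b)"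
      using a E.balanced_middle[OF E.balanced_e\<^sub>2 H.one_closed \<alpha>_in \<beta>_closed[OF b], of a] by simp
    finally show ?thesis unfolding E.sweedler_M\<^sub>2 .
  qed
qed

end

end

text \<open>The counit maps one to one in the field. Hence a dual basis is nonempty, as the positive
  exponent in the definition of similarity requires.\<close>

lemma (in k_bialgebra) one_not_zero: "\<one>\<^bsub>A\<^esub> \<noteq> \<zero>\<^bsub>A\<^esub>"
proof
  interpret K: field K using k_algebra.vectorspace[OF algebra] by (simp add: vectorspace_def)
  assume "\<one>\<^bsub>A\<^esub> = \<zero>\<^bsub>A\<^esub>"
  then have "\<one>\<^bsub>K\<^esub> = counit A (\<zero>\<^bsub>K\<^esub> \<odot>\<^bsub>A\<^esub> \<one>\<^bsub>A\<^esub>)" using counit_one by simp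
  also have "\<dots> = \<zero>\<^bsub>K\<^esub>"
    using module_hom_smult[OF counit_linear, of "\<zero>\<^bsub>K\<^esub>" "\<one>\<^bsub>A\<^esub>"] counit_one by (simp add: scalar_module_def)
  finally show False by simp
qed

context matched_pair begin

lemma left_factor_sufficient:
  assumes fin: "vectorspace.fin_dim K B"
    and triv: "\<forall>a\<in>carrier A. \<forall>b\<in>carrier B. b \<lhd>\<^sub>r a = counit A a \<odot>\<^bsub>B\<^esub> b"
  shows "has_depth (left_factor K A B) H 2"
proof -
  interpret E: algebra_extension K H "left_factor K A B" by (rule algebra_extensions)
  obtain n :: nat and v f where v: "\<And>i. i < n \<Longrightarrow> v i \<in> carrier B"
    and f: "\<And>i. i < n \<Longrightarrow> f i \<in> module_hom K B (scalar_module K)"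
    and dual: "\<And>x. x \<in> carrier B \<Longrightarrow> (\<Oplus>\<^bsub>B\<^esub>i\<in>{..<n}. f i x \<odot>\<^bsub>B\<^esub> v i) = x"
    by (rule dual_basis[OF B.vectorspace fin]) (rule that)
  define U where "U c = sweedler K B E.M\<^sub>2_module c (\<lambda>x y. E.e\<^sub>2 (\<beta> (B.S x)) (\<beta> y))" for c
  note U = left_factor_quasi_basis[OF triv, folded U_def]
  note U_hom = U(1)[OF A.one_closed]
  \<comment> \<open>In Galois terms this is y \<mapsto> \<Sum> f_i(y_1) y_0 for the coaction of B on
    H. The A-part is untouched, so left A-linearity is immediate.\<close>
  define \<gamma> where "\<gamma> i x = tensor_lift H x (\<lambda>a b. sweedler K B H b (\<lambda>p q. f i q \<odot>\<^bsub>H\<^esub> (\<alpha> a \<otimes>\<^bsub>H\<^esub> \<beta> p)))" for i x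
  have fc: "f i x \<in> carrier K" if "i < n" "x \<in> carrier B" for i x
    using module_hom_in[OF f[OF that(1)] that(2)] by (simp add: scalar_module_def)
  note lin_f = module_hom_compose[OF _ f]
  have bil: "bilinear_map K A B H (\<lambda>a b. sweedler K B H b (\<lambda>p q. f i q \<odot>\<^bsub>H\<^esub> (\<alpha> a \<otimes>\<^bsub>H\<^esub> \<beta> p)))" if i: "i < n" for i
    by (rule bilinear_mapI) (intro linear_intros lin_f[OF _ i] H.module_A | simp add: fc i)+
  have \<gamma>_hom: "\<gamma> i \<in> module_hom K H H" if "i < n" for i
    using H_lift_hom[OF H.module_A bil[OF that]] by (simp add: \<gamma>_def[abs_def])
  have \<gamma>_pure: "\<gamma> i (\<alpha> a \<otimes>\<^bsub>H\<^esub> \<beta> b) = sweedler K B H b (\<lambda>p q. f i q \<odot>\<^bsub>H\<^esub> (\<alpha> a \<otimes>\<^bsub>H\<^esub> \<beta> p))"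
    if "i < n" "a \<in> carrier A" "b \<in> carrier B" for i a b
    unfolding \<gamma>_def by (rule H_lift_pure[OF H.module_A bil[OF that(1)] that(2,3)])
  have \<gamma>_closed: "\<gamma> i x \<in> carrier H" if "i < n" "x \<in> carrier H" for i x
    by (rule module_hom_in[OF \<gamma>_hom[OF that(1)] that(2)])
  note lin_\<gamma> = module_hom_compose[OF _ \<gamma>_hom]
  have \<gamma>l: "\<gamma> i (\<alpha> r \<otimes>\<^bsub>H\<^esub> y) = \<alpha> r \<otimes>\<^bsub>H\<^esub> \<gamma> i y" if i: "i < n" and r: "r \<in> carrier A" and y: "y \<in> carrier H" for i r y
  proof (rule H_hom_eqI[OF H.module_A _ _ _ y])
    fix a b assume a: "a \<in> carrier A" and b: "b \<in> carrier B"
    have "\<gamma> i (\<alpha> r \<otimes>\<^bsub>H\<^esub> (\<alpha> a \<otimes>\<^bsub>H\<^esub> \<beta> b)) = \<gamma> i (\<alpha> (r \<otimes>\<^bsub>A\<^esub> a) \<otimes>\<^bsub>H\<^esub> \<beta> b)"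
      using r a b by (simp add: \<alpha>_mult H.m_assoc)
    also have "\<dots> = \<alpha> r \<otimes>\<^bsub>H\<^esub> \<gamma> i (\<alpha> a \<otimes>\<^bsub>H\<^esub> \<beta> b)"
    proof -
      have "\<alpha> (r \<otimes>\<^bsub>A\<^esub> a) \<otimes>\<^bsub>H\<^esub> \<beta> p = \<alpha> r \<otimes>\<^bsub>H\<^esub> (\<alpha> a \<otimes>\<^bsub>H\<^esub> \<beta> p)" if "p \<in> carrier B" for p
        using r a that by (simp add: \<alpha>_mult H.m_assoc)
      then show ?thesis
        unfolding \<gamma>_pure[OF i A.m_closed[OF r a] b] \<gamma>_pure[OF i a b]
        using i r a b by (simp add: hoist_left fc H.smult_mult_right)
    qed
    finally show "\<gamma> i (\<alpha> r \<otimes>\<^bsub>H\<^esub> (\<alpha> a \<otimes>\<^bsub>H\<^esub> \<beta> b)) = \<alpha> r \<otimes>\<^bsub>H\<^esub> \<gamma> i (\<alpha> a \<otimes>\<^bsub>H\<^esub> \<beta> b)" .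
  qed (intro linear_intros lin_\<gamma>[OF _ i] | simp add: r)+
  have \<gamma>\<beta>: "\<gamma> i (\<beta> b) = sweedler K B H b (\<lambda>p q. f i q \<odot>\<^bsub>H\<^esub> \<beta> p)" if "i < n" "b \<in> carrier B" for i b
    using \<gamma>_pure[OF that(1) A.one_closed that(2)] that by (simp add: \<alpha>_one)
  \<comment> \<open>Straightening b r uses up only the first leg of b. After coassociativity the
    functional sees the last leg and the first two reassemble to b_1 r; triviality of \<lhd> is what
    keeps r away from the leg seen by f_i.\<close>
  have \<gamma>_\<beta>\<alpha>: "\<gamma> i (\<beta> b \<otimes>\<^bsub>H\<^esub> \<alpha> r) = \<gamma> i (\<beta> b) \<otimes>\<^bsub>H\<^esub> \<alpha> r" if i: "i < n" and r: "r \<in> carrier A" and b: "b \<in> carrier B" for i r b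
  proof -
    have "\<gamma> i (\<beta> b \<otimes>\<^bsub>H\<^esub> \<alpha> r) = sweedler K B H b (\<lambda>x y. \<gamma> i (\<alpha> (x \<rhd> r) \<otimes>\<^bsub>H\<^esub> \<beta> y))"
      unfolding \<beta>\<alpha>_trivial_ract[OF triv r b] using r
      by (intro sweedler_module_hom[OF H.module_A H.module_A \<gamma>_hom[OF i]]) simp
    also have "\<dots> = sweedler K B H b (\<lambda>x y. sweedler K B H y (\<lambda>p q. f i q \<odot>\<^bsub>H\<^esub> (\<alpha> (x \<rhd> r) \<otimes>\<^bsub>H\<^esub> \<beta> p)))"
      using i r by (intro sweedler_cong \<gamma>_pure) simp_all
    also have "\<dots> = sweedler K B H b (\<lambda>x y. sweedler K B H x (\<lambda>p q. f i y \<odot>\<^bsub>H\<^esub> (\<alpha> (p \<rhd> r) \<otimes>\<^bsub>H\<^esub> \<beta> q)))"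
      by (rule B.sweedler_coassoc[OF H.module_A, symmetric]) (intro linear_intros lin_f[OF _ i] H.module_A | simp add: r b fc i)+
    also have "\<dots> = sweedler K B H b (\<lambda>x y. f i y \<odot>\<^bsub>H\<^esub> (\<beta> x \<otimes>\<^bsub>H\<^esub> \<alpha> r))"
      using i r by (intro sweedler_cong) (simp add: sweedler_smult[OF H.module_A, symmetric] \<beta>\<alpha>_trivial_ract[OF triv] fc)
    also have "\<dots> = \<gamma> i (\<beta> b) \<otimes>\<^bsub>H\<^esub> \<alpha> r"
      using i r b by (simp add: \<gamma>\<beta> hoist_right fc H.smult_mult_left)
    finally show ?thesis .
  qed
  have \<gamma>r: "\<gamma> i (y \<otimes>\<^bsub>H\<^esub> \<alpha> r) = \<gamma> i y \<otimes>\<^bsub>H\<^esub> \<alpha> r" if i: "i < n" and r: "r \<in> carrier A" and y: "y \<in> carrier H" for i r y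
    by (rule H_hom_eqI[OF H.module_A _ _ _ y])
      (intro linear_intros lin_\<gamma>[OF _ i] | simp add: i r H.m_assoc \<gamma>l \<gamma>_\<beta>\<alpha> \<gamma>_closed)+
  have n: "n > 0"
  proof (rule ccontr)
    assume "\<not> n > 0"
    then have "\<one>\<^bsub>B\<^esub> = \<zero>\<^bsub>B\<^esub>" using dual[OF B.one_closed] by simp
    then show False using B.one_not_zero by simp
  qed
  note ag = E.abelian_groups(2)
  have Uc: "U c \<in> carrier E.M\<^sub>2" if "c \<in> carrier B" for c
    using module_hom_in[OF U_hom that] by (simp add: E.M\<^sub>2_module_simps)
  have U_add: "U \<in> add_hom B E.M\<^sub>2"
    using module_hom_add_hom[OF U_hom] by (simp add: add_hom_def E.M\<^sub>2_module_simps)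
  show ?thesis
  proof (rule E.depth_two_leftI[OF n, of \<gamma> "\<lambda>i. U (v i)"])
    show "\<gamma> i \<in> add_hom H H" if "i < n" for i by (rule module_hom_add_hom[OF \<gamma>_hom[OF that]])
    show "\<gamma> i (r \<otimes>\<^bsub>H\<^esub> y) = r \<otimes>\<^bsub>H\<^esub> \<gamma> i y" "\<gamma> i (y \<otimes>\<^bsub>H\<^esub> r) = \<gamma> i y \<otimes>\<^bsub>H\<^esub> r"
      if "i < n" "r \<in> left_factor K A B" "y \<in> carrier H" for i r y
      using that \<gamma>l \<gamma>r by (auto simp: left_factor_eq)
    show "U (v i) \<in> carrier E.M\<^sub>2" if "i < n" for i using Uc v that by simp
    show "left_smult E.M\<^sub>2 r (U (v i)) = right_smult E.M\<^sub>2 (U (v i)) r" if "i < n" "r \<in> left_factor K A B" for i r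
      using that U(2)[OF _ v[OF that(1)]] unfolding left_factor_eq by blast
    show "(\<Oplus>\<^bsub>E.M\<^sub>2\<^esub>i\<in>{..<n}. left_smult E.M\<^sub>2 (\<gamma> i y) (U (v i))) = E.e\<^sub>2 \<one>\<^bsub>H\<^esub> y" if y: "y \<in> carrier H" for y
    proof (rule H_add_hom_eqI[OF ag _ _ _ y, of "\<lambda>y. \<Oplus>\<^bsub>E.M\<^sub>2\<^esub>i\<in>{..<n}. left_smult E.M\<^sub>2 (\<gamma> i y) (U (v i))" "E.e\<^sub>2 \<one>\<^bsub>H\<^esub>"])
      have "(\<lambda>y. left_smult E.M\<^sub>2 (\<gamma> i y) (U (v i))) \<in> add_hom H E.M\<^sub>2" if "i < n" for i
        using add_hom_compose[OF module_hom_add_hom[OF \<gamma>_hom[OF that]] E.smult_M\<^sub>2_add_hom(1)[OF Uc[OF v[OF that]]]] .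
      then show "(\<lambda>y. \<Oplus>\<^bsub>E.M\<^sub>2\<^esub>i\<in>{..<n}. left_smult E.M\<^sub>2 (\<gamma> i y) (U (v i))) \<in> add_hom H E.M\<^sub>2"
        by (intro add_hom_finsum_pointwise H.abelian_group_axioms ag) simp
      show "E.e\<^sub>2 \<one>\<^bsub>H\<^esub> \<in> add_hom H E.M\<^sub>2"
        by (rule E.balanced_add_hom_right[OF E.balanced_e\<^sub>2 H.one_closed])
      fix a b assume a: "a \<in> carrier A" and b: "b \<in> carrier B"
      have lc: "left_smult E.M\<^sub>2 h t \<in> carrier E.M\<^sub>2" if "h \<in> carrier H" "t \<in> carrier E.M\<^sub>2" for h t
        using add_hom_closed[OF E.left_smult_M\<^sub>2_hom] that by simp
      \<comment> \<open>The scalar f_i(q) is moved from the ring element into the argument of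
        \<open>U\<close>. Summing over i inside the Sweedler sum then recombines \<Sum> f_i(q) v_i
        to q, leaving the last equation of the quasi-basis lemma.\<close>
      have step: "left_smult E.M\<^sub>2 (\<gamma> i (\<alpha> a \<otimes>\<^bsub>H\<^esub> \<beta> b)) (U (v i)) =
          sweedler K B E.M\<^sub>2 b (\<lambda>p q. left_smult E.M\<^sub>2 (\<alpha> a \<otimes>\<^bsub>H\<^esub> \<beta> p) (U (f i q \<odot>\<^bsub>B\<^esub> v i)))" if i: "i < n" for i
      proof -
        have "left_smult E.M\<^sub>2 (\<gamma> i (\<alpha> a \<otimes>\<^bsub>H\<^esub> \<beta> b)) (U (v i)) =
          sweedler K B E.M\<^sub>2 b (\<lambda>p q. left_smult E.M\<^sub>2 (f i q \<odot>\<^bsub>H\<^esub> (\<alpha> a \<otimes>\<^bsub>H\<^esub> \<beta> p)) (U (v i)))"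
          unfolding \<gamma>_pure[OF i a b] using a fc[OF i]
          by (intro sweedler_hom[OF H.abelian_group_axioms ag E.smult_M\<^sub>2_add_hom(1)[OF Uc[OF v[OF i]]]]) simp
        also have "\<dots> = sweedler K B E.M\<^sub>2 b (\<lambda>p q. left_smult E.M\<^sub>2 (\<alpha> a \<otimes>\<^bsub>H\<^esub> \<beta> p) (U (f i q \<odot>\<^bsub>B\<^esub> v i)))"
          using a fc[OF i] v[OF i] Uc by (intro sweedler_cong) (simp add: E.smult_M\<^sub>2_scalar module_hom_smult[OF U_hom])
        finally show ?thesis .
      qed
      have "(\<Oplus>\<^bsub>E.M\<^sub>2\<^esub>i\<in>{..<n}. left_smult E.M\<^sub>2 (\<gamma> i (\<alpha> a \<otimes>\<^bsub>H\<^esub> \<beta> b)) (U (v i))) =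
          (\<Oplus>\<^bsub>E.M\<^sub>2\<^esub>i\<in>{..<n}. sweedler K B E.M\<^sub>2 b (\<lambda>p q. left_smult E.M\<^sub>2 (\<alpha> a \<otimes>\<^bsub>H\<^esub> \<beta> p) (U (f i q \<odot>\<^bsub>B\<^esub> v i))))"
        using a v fc Uc by (intro E.M2.add.finprod_cong') (auto intro!: step sweedler_closed ag lc)
      also have "\<dots> = sweedler K B E.M\<^sub>2 b (\<lambda>p q. \<Oplus>\<^bsub>E.M\<^sub>2\<^esub>i\<in>{..<n}. left_smult E.M\<^sub>2 (\<alpha> a \<otimes>\<^bsub>H\<^esub> \<beta> p) (U (f i q \<odot>\<^bsub>B\<^esub> v i)))"
        using a v fc Uc by (intro finsum_sweedler ag) (auto intro!: lc)
      also have "\<dots> = sweedler K B E.M\<^sub>2 b (\<lambda>p q. left_smult E.M\<^sub>2 (\<alpha> a \<otimes>\<^bsub>H\<^esub> \<beta> p) (U q))"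
      proof (rule sweedler_cong)
        fix p q assume p: "p \<in> carrier B" and q: "q \<in> carrier B"
        have h: "\<alpha> a \<otimes>\<^bsub>H\<^esub> \<beta> p \<in> carrier H" using a p by simp
        from add_hom_finsum[OF B.abelian_group_axioms ag add_hom_compose[OF U_add E.left_smult_M\<^sub>2_hom[OF h]],
            of "{..<n}" "\<lambda>i. f i q \<odot>\<^bsub>B\<^esub> v i"] v fc q
        show "(\<Oplus>\<^bsub>E.M\<^sub>2\<^esub>i\<in>{..<n}. left_smult E.M\<^sub>2 (\<alpha> a \<otimes>\<^bsub>H\<^esub> \<beta> p) (U (f i q \<odot>\<^bsub>B\<^esub> v i))) =
            left_smult E.M\<^sub>2 (\<alpha> a \<otimes>\<^bsub>H\<^esub> \<beta> p) (U q)"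
          by (simp add: dual)
      qed
      also have "\<dots> = E.e\<^sub>2 \<one>\<^bsub>H\<^esub> (\<alpha> a \<otimes>\<^bsub>H\<^esub> \<beta> b)"
        by (rule U(3)[OF a b])
      finally show "(\<Oplus>\<^bsub>E.M\<^sub>2\<^esub>i\<in>{..<n}. left_smult E.M\<^sub>2 (\<gamma> i (\<alpha> a \<otimes>\<^bsub>H\<^esub> \<beta> b)) (U (v i))) = E.e\<^sub>2 \<one>\<^bsub>H\<^esub> (\<alpha> a \<otimes>\<^bsub>H\<^esub> \<beta> b)" .
    qed
  qed
qed

end

section \<open>Trivial left action: a quasi-basis over B\<close>

context matched_pair begin

context
  assumes triv: "\<forall>a\<in>carrier A. \<forall>b\<in>carrier B. b \<rhd> a = counit B b \<odot>\<^bsub>A\<^esub> a"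
begin

text \<open>Now it is the coproduct of b that meets a counit, and b a = \<Sum> a_1 (b \<lhd> a_2): a
  smash product with the factors in the opposite roles.\<close>

lemma \<beta>\<alpha>_trivial_lact:
  assumes a: "a \<in> carrier A" and b: "b \<in> carrier B"
  shows "\<beta> b \<otimes>\<^bsub>H\<^esub> \<alpha> a = sweedler K A H a (\<lambda>u v. \<alpha> u \<otimes>\<^bsub>H\<^esub> \<beta> (b \<lhd>\<^sub>r v))"
proof -
  have "\<beta> b \<otimes>\<^bsub>H\<^esub> \<alpha> a = sweedler K B H b (\<lambda>x y. counit B x \<odot>\<^bsub>H\<^esub> sweedler K A H a (\<lambda>u v. \<alpha> u \<otimes>\<^bsub>H\<^esub> \<beta> (y \<lhd>\<^sub>r v)))"
    unfolding \<beta>\<alpha>[OF a b] by (intro sweedler_cong)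
      (simp add: triv module_hom_smult[OF \<alpha>_hom] H.smult_mult_left sweedler_smult[OF H.module_A])
  also have "\<dots> = sweedler K A H a (\<lambda>u v. \<alpha> u \<otimes>\<^bsub>H\<^esub> \<beta> (b \<lhd>\<^sub>r v))"
    by (rule B.sweedler_counit_left[OF H.module_A _ b]) (intro linear_intros H.module_A | simp add: a)+
  finally show ?thesis .
qed

text \<open>The action is the right adjoint one: straightening b a_2 in S(a_1) b a_2 gives S(a_1)
  a_2 (b \<lhd> a_3), and the first two factors cancel.\<close>

lemma ract_adjoint:
  assumes a: "a \<in> carrier A" and b: "b \<in> carrier B"
  shows "\<beta> (b \<lhd>\<^sub>r a) = sweedler K A H a (\<lambda>u v. \<alpha> (A.S u) \<otimes>\<^bsub>H\<^esub> (\<beta> b \<otimes>\<^bsub>H\<^esub> \<alpha> v))"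
proof -
  have "sweedler K A H a (\<lambda>u v. \<alpha> (A.S u) \<otimes>\<^bsub>H\<^esub> (\<beta> b \<otimes>\<^bsub>H\<^esub> \<alpha> v)) =
      sweedler K A H a (\<lambda>u v. sweedler K A H v (\<lambda>p q. \<alpha> (A.S u) \<otimes>\<^bsub>H\<^esub> (\<alpha> p \<otimes>\<^bsub>H\<^esub> \<beta> (b \<lhd>\<^sub>r q))))"
    using b by (intro sweedler_cong) (simp add: \<beta>\<alpha>_trivial_lact hoist_left)
  also have "\<dots> = sweedler K A H a (\<lambda>u v. sweedler K A H u (\<lambda>p q. \<alpha> (A.S p) \<otimes>\<^bsub>H\<^esub> (\<alpha> q \<otimes>\<^bsub>H\<^esub> \<beta> (b \<lhd>\<^sub>r v))))"
    by (rule A.sweedler_coassoc[OF H.module_A, symmetric]) (intro linear_intros | simp add: a b)+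
  also have "\<dots> = sweedler K A H a (\<lambda>u v. counit A u \<odot>\<^bsub>H\<^esub> \<beta> (b \<lhd>\<^sub>r v))"
    using b by (intro sweedler_cong \<alpha>_cancel(1)) simp_all
  also have "\<dots> = \<beta> (b \<lhd>\<^sub>r a)"
    by (rule A.sweedler_counit_left[OF H.module_A _ a]) (intro linear_intros | simp add: b)+
  finally show ?thesis by simp
qed

text \<open>By the adjoint formula the sum is S(a_1) b a_2 S(a_3), where the last two factors
  cancel.\<close>

lemma ract_antipode:
  assumes a: "a \<in> carrier A" and b: "b \<in> carrier B"
  shows "sweedler K A H a (\<lambda>u v. \<beta> (b \<lhd>\<^sub>r u) \<otimes>\<^bsub>H\<^esub> \<alpha> (A.S v)) = \<alpha> (A.S a) \<otimes>\<^bsub>H\<^esub> \<beta> b"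
proof -
  have "sweedler K A H a (\<lambda>u v. \<beta> (b \<lhd>\<^sub>r u) \<otimes>\<^bsub>H\<^esub> \<alpha> (A.S v)) =
      sweedler K A H a (\<lambda>u v. sweedler K A H u (\<lambda>p q. (\<alpha> (A.S p) \<otimes>\<^bsub>H\<^esub> \<beta> b) \<otimes>\<^bsub>H\<^esub> \<alpha> q \<otimes>\<^bsub>H\<^esub> \<alpha> (A.S v)))"
    using b by (intro sweedler_cong) (simp add: ract_adjoint hoist_right H.m_assoc)
  also have "\<dots> = sweedler K A H a (\<lambda>u v. sweedler K A H v (\<lambda>p q. (\<alpha> (A.S u) \<otimes>\<^bsub>H\<^esub> \<beta> b) \<otimes>\<^bsub>H\<^esub> \<alpha> p \<otimes>\<^bsub>H\<^esub> \<alpha> (A.S q)))"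
    by (rule A.sweedler_coassoc[OF H.module_A]) (intro linear_intros | simp add: a b)+
  also have "\<dots> = sweedler K A H a (\<lambda>u v. counit A v \<odot>\<^bsub>H\<^esub> (\<alpha> (A.S u) \<otimes>\<^bsub>H\<^esub> \<beta> b))"
    using b by (intro sweedler_cong \<alpha>_cancel(2)) simp_all
  also have "\<dots> = \<alpha> (A.S a) \<otimes>\<^bsub>H\<^esub> \<beta> b"
    by (rule A.sweedler_counit_right[OF H.module_A _ a]) (intro linear_intros | simp add: b)+
  finally show ?thesis .
qed

interpretation E: algebra_extension K H "right_factor K A B" by (rule algebra_extensions)

text \<open>The mirror element is \<Sum> c_1 \<otimes> S(c_2), with ring elements multiplied from
  the right. Reconstruction is the computation a_1 \<otimes> S(a_2) a_3 b = a \<otimes> b, after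
  which b, lying in the base ring, moves to the left leg.\<close>

lemma right_factor_quasi_basis:
  assumes b: "b \<in> carrier B"
  defines "U \<equiv> \<lambda>c. sweedler K A E.M\<^sub>2_module c (\<lambda>x y. E.e\<^sub>2 (\<alpha> x) (\<alpha> (A.S y)))"
  shows "U \<in> module_hom K A E.M\<^sub>2_module"
    and "c \<in> carrier A \<Longrightarrow> left_smult E.M\<^sub>2 (\<beta> b) (U c) = right_smult E.M\<^sub>2 (U c) (\<beta> b)"
    and "a \<in> carrier A \<Longrightarrow> sweedler K A E.M\<^sub>2 a (\<lambda>p q. right_smult E.M\<^sub>2 (U p) (\<alpha> q \<otimes>\<^bsub>H\<^esub> \<beta> b)) = E.e\<^sub>2 (\<alpha> a \<otimes>\<^bsub>H\<^esub> \<beta> b) \<one>\<^bsub>H\<^esub>"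
proof -
  note push_l = sweedler_module_hom[OF H.module_A E.module_M\<^sub>2 E.lin_e\<^sub>2(1)[OF lin_id]]
  note push_r = sweedler_module_hom[OF H.module_A E.module_M\<^sub>2 E.lin_e\<^sub>2(2)[OF _ lin_id]]
  note ag = E.abelian_groups(2)
  have \<beta>_in: "\<beta> r \<in> right_factor K A B" if "r \<in> carrier B" for r using that by (simp add: right_factor_eq)
  have pull_l: "left_smult E.M\<^sub>2 h (U c) = sweedler K A E.M\<^sub>2_module c (\<lambda>x y. E.e\<^sub>2 (h \<otimes>\<^bsub>H\<^esub> \<alpha> x) (\<alpha> (A.S y)))"
    and pull_r: "right_smult E.M\<^sub>2 (U c) h = sweedler K A E.M\<^sub>2_module c (\<lambda>x y. E.e\<^sub>2 (\<alpha> x) (\<alpha> (A.S y) \<otimes>\<^bsub>H\<^esub> h))"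
    if "h \<in> carrier H" for h c
    unfolding U_def E.sweedler_M\<^sub>2
    using sweedler_hom[OF ag ag E.left_smult_M\<^sub>2_hom[OF that], of A "\<lambda>x y. E.e\<^sub>2 (\<alpha> x) (\<alpha> (A.S y))"]
      sweedler_hom[OF ag ag E.right_smult_M\<^sub>2_hom[OF that], of A "\<lambda>x y. E.e\<^sub>2 (\<alpha> x) (\<alpha> (A.S y))"] that
    by (simp_all add: E.e\<^sub>2_closed)
  show "U \<in> module_hom K A E.M\<^sub>2_module"
    unfolding U_def by (intro linear_intros E.module_M\<^sub>2 E.lin_e\<^sub>2 | simp)+
  show "left_smult E.M\<^sub>2 (\<beta> b) (U c) = right_smult E.M\<^sub>2 (U c) (\<beta> b)" if c: "c \<in> carrier A"
  proof -
    \<comment> \<open>The chain is b c_1 \<otimes> S(c_2) = c_1 (b \<lhd> c_2) \<otimes> S(c_3) =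
      c_1 \<otimes> (b \<lhd> c_2) S(c_3) = c_1 \<otimes> S(c_2) b, the middle equality because b
      \<lhd> c_2 lies in B.\<close>
    have "left_smult E.M\<^sub>2 (\<beta> b) (U c) = sweedler K A E.M\<^sub>2_module c (\<lambda>x y. sweedler K A E.M\<^sub>2_module x (\<lambda>u v.
        E.e\<^sub>2 (\<alpha> u \<otimes>\<^bsub>H\<^esub> \<beta> (b \<lhd>\<^sub>r v)) (\<alpha> (A.S y))))"
      unfolding pull_l[OF \<beta>_closed[OF b]] using b
      by (intro sweedler_cong) (simp add: push_l[symmetric] \<beta>\<alpha>_trivial_lact)
    also have "\<dots> = sweedler K A E.M\<^sub>2_module c (\<lambda>x y. sweedler K A E.M\<^sub>2_module y (\<lambda>u v.
        E.e\<^sub>2 (\<alpha> x \<otimes>\<^bsub>H\<^esub> \<beta> (b \<lhd>\<^sub>r u)) (\<alpha> (A.S v))))"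
      by (rule A.sweedler_coassoc[OF E.module_M\<^sub>2]) (intro linear_intros E.lin_e\<^sub>2 | simp add: b c)+
    also have "\<dots> = sweedler K A E.M\<^sub>2_module c (\<lambda>x y. sweedler K A E.M\<^sub>2_module y (\<lambda>u v.
        E.e\<^sub>2 (\<alpha> x) (\<beta> (b \<lhd>\<^sub>r u) \<otimes>\<^bsub>H\<^esub> \<alpha> (A.S v))))"
      using b by (intro sweedler_cong E.balanced_middle[OF E.balanced_e\<^sub>2] \<beta>_in) simp_all
    also have "\<dots> = right_smult E.M\<^sub>2 (U c) (\<beta> b)"
      unfolding pull_r[OF \<beta>_closed[OF b]] using b
      by (intro sweedler_cong) (simp add: push_r[symmetric] ract_antipode)
    finally show ?thesis .
  qed
  show "sweedler K A E.M\<^sub>2 a (\<lambda>p q. right_smult E.M\<^sub>2 (U p) (\<alpha> q \<otimes>\<^bsub>H\<^esub> \<beta> b)) = E.e\<^sub>2 (\<alpha> a \<otimes>\<^bsub>H\<^esub> \<beta> b) \<one>\<^bsub>H\<^esub>"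
    if a: "a \<in> carrier A"
  proof -
    have "sweedler K A E.M\<^sub>2_module a (\<lambda>p q. right_smult E.M\<^sub>2 (U p) (\<alpha> q \<otimes>\<^bsub>H\<^esub> \<beta> b)) =
        sweedler K A E.M\<^sub>2_module a (\<lambda>p q. sweedler K A E.M\<^sub>2_module p (\<lambda>x y.
          E.e\<^sub>2 (\<alpha> x) (\<alpha> (A.S y) \<otimes>\<^bsub>H\<^esub> (\<alpha> q \<otimes>\<^bsub>H\<^esub> \<beta> b))))"
      using b by (intro sweedler_cong pull_r) simp
    also have "\<dots> = sweedler K A E.M\<^sub>2_module a (\<lambda>p q. sweedler K A E.M\<^sub>2_module q (\<lambda>x y.
          E.e\<^sub>2 (\<alpha> p) (\<alpha> (A.S x) \<otimes>\<^bsub>H\<^esub> (\<alpha> y \<otimes>\<^bsub>H\<^esub> \<beta> b))))"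
      by (rule A.sweedler_coassoc[OF E.module_M\<^sub>2]) (intro linear_intros E.lin_e\<^sub>2 | simp add: a b)+
    also have "\<dots> = sweedler K A E.M\<^sub>2_module a (\<lambda>p q. counit A q \<odot>\<^bsub>E.M\<^sub>2_module\<^esub> E.e\<^sub>2 (\<alpha> p) (\<beta> b))"
      using b by (intro sweedler_cong) (simp add: push_r[symmetric] \<alpha>_cancel(1) E.e\<^sub>2_smult)
    also have "\<dots> = E.e\<^sub>2 (\<alpha> a) (\<beta> b)"
      by (rule A.sweedler_counit_right[OF E.module_M\<^sub>2 _ a]) (intro linear_intros E.lin_e\<^sub>2 | simp add: b)+
    also have "\<dots> = E.e\<^sub>2 (\<alpha> a \<otimes>\<^bsub>H\<^esub> \<beta> b) \<one>\<^bsub>H\<^esub>"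
      using b E.balanced_middle[OF E.balanced_e\<^sub>2 \<alpha>_closed[OF a] \<beta>_in H.one_closed, of b] by simp
    finally show ?thesis unfolding E.sweedler_M\<^sub>2 .
  qed
qed

end

lemma right_factor_sufficient:
  assumes fin: "vectorspace.fin_dim K A"
    and triv: "\<forall>a\<in>carrier A. \<forall>b\<in>carrier B. b \<rhd> a = counit B b \<odot>\<^bsub>A\<^esub> a"
  shows "has_depth (right_factor K A B) H 2"
proof -
  interpret E: algebra_extension K H "right_factor K A B" by (rule algebra_extensions)
  obtain n :: nat and v f where v: "\<And>i. i < n \<Longrightarrow> v i \<in> carrier A"
    and f: "\<And>i. i < n \<Longrightarrow> f i \<in> module_hom K A (scalar_module K)"
    and dual: "\<And>x. x \<in> carrier A \<Longrightarrow> (\<Oplus>\<^bsub>A\<^esub>i\<in>{..<n}. f i x \<odot>\<^bsub>A\<^esub> v i) = x"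
    by (rule dual_basis[OF A.vectorspace fin]) (rule that)
  define U where "U c = sweedler K A E.M\<^sub>2_module c (\<lambda>x y. E.e\<^sub>2 (\<alpha> x) (\<alpha> (A.S y)))" for c
  note U = right_factor_quasi_basis[OF triv, folded U_def]
  note U_hom = U(1)[OF B.one_closed]
  \<comment> \<open>The functional acts on the first leg of a here and leaves the B-part alone, so
    right B-linearity is the immediate one.\<close>
  define \<gamma> where "\<gamma> i x = tensor_lift H x (\<lambda>a b. sweedler K A H a (\<lambda>p q. f i p \<odot>\<^bsub>H\<^esub> (\<alpha> q \<otimes>\<^bsub>H\<^esub> \<beta> b)))" for i x
  have fc: "f i x \<in> carrier K" if "i < n" "x \<in> carrier A" for i x
    using module_hom_in[OF f[OF that(1)] that(2)] by (simp add: scalar_module_def)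
  note lin_f = module_hom_compose[OF _ f]
  have bil: "bilinear_map K A B H (\<lambda>a b. sweedler K A H a (\<lambda>p q. f i p \<odot>\<^bsub>H\<^esub> (\<alpha> q \<otimes>\<^bsub>H\<^esub> \<beta> b)))" if i: "i < n" for i
    by (rule bilinear_mapI) (intro linear_intros lin_f[OF _ i] H.module_A | simp add: fc i)+
  have \<gamma>_hom: "\<gamma> i \<in> module_hom K H H" if "i < n" for i
    using H_lift_hom[OF H.module_A bil[OF that]] by (simp add: \<gamma>_def[abs_def])
  have \<gamma>_pure: "\<gamma> i (\<alpha> a \<otimes>\<^bsub>H\<^esub> \<beta> b) = sweedler K A H a (\<lambda>p q. f i p \<odot>\<^bsub>H\<^esub> (\<alpha> q \<otimes>\<^bsub>H\<^esub> \<beta> b))"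
    if "i < n" "a \<in> carrier A" "b \<in> carrier B" for i a b
    unfolding \<gamma>_def by (rule H_lift_pure[OF H.module_A bil[OF that(1)] that(2,3)])
  have \<gamma>_closed: "\<gamma> i x \<in> carrier H" if "i < n" "x \<in> carrier H" for i x
    by (rule module_hom_in[OF \<gamma>_hom[OF that(1)] that(2)])
  note lin_\<gamma> = module_hom_compose[OF _ \<gamma>_hom]
  have \<gamma>r: "\<gamma> i (y \<otimes>\<^bsub>H\<^esub> \<beta> r) = \<gamma> i y \<otimes>\<^bsub>H\<^esub> \<beta> r" if i: "i < n" and r: "r \<in> carrier B" and y: "y \<in> carrier H" for i r y
  proof (rule H_hom_eqI[OF H.module_A _ _ _ y])
    fix a b assume a: "a \<in> carrier A" and b: "b \<in> carrier B"
    have e: "\<alpha> q \<otimes>\<^bsub>H\<^esub> \<beta> (b \<otimes>\<^bsub>B\<^esub> r) = (\<alpha> q \<otimes>\<^bsub>H\<^esub> \<beta> b) \<otimes>\<^bsub>H\<^esub> \<beta> r" if "q \<in> carrier A" for q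
      using r b that by (simp add: \<beta>_mult H.m_assoc)
    show "\<gamma> i ((\<alpha> a \<otimes>\<^bsub>H\<^esub> \<beta> b) \<otimes>\<^bsub>H\<^esub> \<beta> r) = \<gamma> i (\<alpha> a \<otimes>\<^bsub>H\<^esub> \<beta> b) \<otimes>\<^bsub>H\<^esub> \<beta> r"
      unfolding e[OF a, symmetric] \<gamma>_pure[OF i a B.m_closed[OF b r]] \<gamma>_pure[OF i a b]
      using i r a b by (simp add: hoist_right fc H.smult_mult_left e)
  qed (intro linear_intros lin_\<gamma>[OF _ i] | simp add: r)+
  have \<gamma>\<alpha>: "\<gamma> i (\<alpha> a) = sweedler K A H a (\<lambda>p q. f i p \<odot>\<^bsub>H\<^esub> \<alpha> q)" if "i < n" "a \<in> carrier A" for i a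
    using \<gamma>_pure[OF that B.one_closed] that by (simp add: \<beta>_one)
  \<comment> \<open>Straightening r a acts through the last leg of a only, while f_i reads the
    first. After coassociativity the two remaining legs reassemble to r a_2.\<close>
  have \<gamma>_\<beta>\<alpha>: "\<gamma> i (\<beta> r \<otimes>\<^bsub>H\<^esub> \<alpha> a) = \<beta> r \<otimes>\<^bsub>H\<^esub> \<gamma> i (\<alpha> a)" if i: "i < n" and r: "r \<in> carrier B" and a: "a \<in> carrier A" for i r a
  proof -
    have "\<gamma> i (\<beta> r \<otimes>\<^bsub>H\<^esub> \<alpha> a) = sweedler K A H a (\<lambda>x y. \<gamma> i (\<alpha> x \<otimes>\<^bsub>H\<^esub> \<beta> (r \<lhd>\<^sub>r y)))"
      unfolding \<beta>\<alpha>_trivial_lact[OF triv a r] using r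
      by (intro sweedler_module_hom[OF H.module_A H.module_A \<gamma>_hom[OF i]]) simp
    also have "\<dots> = sweedler K A H a (\<lambda>x y. sweedler K A H x (\<lambda>p q. f i p \<odot>\<^bsub>H\<^esub> (\<alpha> q \<otimes>\<^bsub>H\<^esub> \<beta> (r \<lhd>\<^sub>r y))))"
      using i r by (intro sweedler_cong \<gamma>_pure) simp_all
    also have "\<dots> = sweedler K A H a (\<lambda>x y. sweedler K A H y (\<lambda>p q. f i x \<odot>\<^bsub>H\<^esub> (\<alpha> p \<otimes>\<^bsub>H\<^esub> \<beta> (r \<lhd>\<^sub>r q))))"
      by (rule A.sweedler_coassoc[OF H.module_A]) (intro linear_intros lin_f[OF _ i] H.module_A | simp add: r a fc i)+
    also have "\<dots> = sweedler K A H a (\<lambda>x y. f i x \<odot>\<^bsub>H\<^esub> (\<beta> r \<otimes>\<^bsub>H\<^esub> \<alpha> y))"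
      using i r by (intro sweedler_cong) (simp add: sweedler_smult[OF H.module_A, symmetric] \<beta>\<alpha>_trivial_lact[OF triv] fc)
    also have "\<dots> = \<beta> r \<otimes>\<^bsub>H\<^esub> \<gamma> i (\<alpha> a)"
      using i r a by (simp add: \<gamma>\<alpha> hoist_left fc H.smult_mult_right)
    finally show ?thesis .
  qed
  have \<gamma>l: "\<gamma> i (\<beta> r \<otimes>\<^bsub>H\<^esub> y) = \<beta> r \<otimes>\<^bsub>H\<^esub> \<gamma> i y" if i: "i < n" and r: "r \<in> carrier B" and y: "y \<in> carrier H" for i r y
    by (rule H_hom_eqI[OF H.module_A _ _ _ y])
      (intro linear_intros lin_\<gamma>[OF _ i] | simp add: i r H.m_assoc[symmetric] \<gamma>r \<gamma>_\<beta>\<alpha> \<gamma>_closed)+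
  have n: "n > 0"
  proof (rule ccontr)
    assume "\<not> n > 0"
    then have "\<one>\<^bsub>A\<^esub> = \<zero>\<^bsub>A\<^esub>" using dual[OF A.one_closed] by simp
    then show False using A.one_not_zero by simp
  qed
  note ag = E.abelian_groups(2)
  have Uc: "U c \<in> carrier E.M\<^sub>2" if "c \<in> carrier A" for c
    using module_hom_in[OF U_hom that] by (simp add: E.M\<^sub>2_module_simps)
  have U_add: "U \<in> add_hom A E.M\<^sub>2"
    using module_hom_add_hom[OF U_hom] by (simp add: add_hom_def E.M\<^sub>2_module_simps)
  show ?thesis
  proof (rule E.depth_two_rightI[OF n, of \<gamma> "\<lambda>i. U (v i)"])
    show "\<gamma> i \<in> add_hom H H" if "i < n" for i by (rule module_hom_add_hom[OF \<gamma>_hom[OF that]])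
    show "\<gamma> i (r \<otimes>\<^bsub>H\<^esub> y) = r \<otimes>\<^bsub>H\<^esub> \<gamma> i y" "\<gamma> i (y \<otimes>\<^bsub>H\<^esub> r) = \<gamma> i y \<otimes>\<^bsub>H\<^esub> r"
      if "i < n" "r \<in> right_factor K A B" "y \<in> carrier H" for i r y
      using that \<gamma>l \<gamma>r by (auto simp: right_factor_eq)
    show "U (v i) \<in> carrier E.M\<^sub>2" if "i < n" for i using Uc v that by simp
    show "left_smult E.M\<^sub>2 r (U (v i)) = right_smult E.M\<^sub>2 (U (v i)) r" if "i < n" "r \<in> right_factor K A B" for i r
      using that U(2)[OF _ v[OF that(1)]] unfolding right_factor_eq by blast
    show "(\<Oplus>\<^bsub>E.M\<^sub>2\<^esub>i\<in>{..<n}. right_smult E.M\<^sub>2 (U (v i)) (\<gamma> i y)) = E.e\<^sub>2 y \<one>\<^bsub>H\<^esub>" if y: "y \<in> carrier H" for y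
    proof (rule H_add_hom_eqI[OF ag _ _ _ y, of "\<lambda>y. \<Oplus>\<^bsub>E.M\<^sub>2\<^esub>i\<in>{..<n}. right_smult E.M\<^sub>2 (U (v i)) (\<gamma> i y)" "\<lambda>y. E.e\<^sub>2 y \<one>\<^bsub>H\<^esub>"])
      have "(\<lambda>y. right_smult E.M\<^sub>2 (U (v i)) (\<gamma> i y)) \<in> add_hom H E.M\<^sub>2" if "i < n" for i
        using add_hom_compose[OF module_hom_add_hom[OF \<gamma>_hom[OF that]] E.smult_M\<^sub>2_add_hom(2)[OF Uc[OF v[OF that]]]] .
      then show "(\<lambda>y. \<Oplus>\<^bsub>E.M\<^sub>2\<^esub>i\<in>{..<n}. right_smult E.M\<^sub>2 (U (v i)) (\<gamma> i y)) \<in> add_hom H E.M\<^sub>2"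
        by (intro add_hom_finsum_pointwise H.abelian_group_axioms ag) simp
      show "(\<lambda>y. E.e\<^sub>2 y \<one>\<^bsub>H\<^esub>) \<in> add_hom H E.M\<^sub>2"
        by (rule E.balanced_add_hom_left[OF E.balanced_e\<^sub>2 H.one_closed])
      fix a b assume a: "a \<in> carrier A" and b: "b \<in> carrier B"
      have rc: "right_smult E.M\<^sub>2 t h \<in> carrier E.M\<^sub>2" if "h \<in> carrier H" "t \<in> carrier E.M\<^sub>2" for h t
        using add_hom_closed[OF E.right_smult_M\<^sub>2_hom] that by simp
      \<comment> \<open>As in the case of A, f_i(p) is moved into the argument of \<open>U\<close>,
        so that summation over i restores p by the dual basis property.\<close>
      have step: "right_smult E.M\<^sub>2 (U (v i)) (\<gamma> i (\<alpha> a \<otimes>\<^bsub>H\<^esub> \<beta> b)) =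
          sweedler K A E.M\<^sub>2 a (\<lambda>p q. right_smult E.M\<^sub>2 (U (f i p \<odot>\<^bsub>A\<^esub> v i)) (\<alpha> q \<otimes>\<^bsub>H\<^esub> \<beta> b))" if i: "i < n" for i
      proof -
        have "right_smult E.M\<^sub>2 (U (v i)) (\<gamma> i (\<alpha> a \<otimes>\<^bsub>H\<^esub> \<beta> b)) =
          sweedler K A E.M\<^sub>2 a (\<lambda>p q. right_smult E.M\<^sub>2 (U (v i)) (f i p \<odot>\<^bsub>H\<^esub> (\<alpha> q \<otimes>\<^bsub>H\<^esub> \<beta> b)))"
          unfolding \<gamma>_pure[OF i a b] using b fc[OF i]
          by (intro sweedler_hom[OF H.abelian_group_axioms ag E.smult_M\<^sub>2_add_hom(2)[OF Uc[OF v[OF i]]]]) simp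
        also have "\<dots> = sweedler K A E.M\<^sub>2 a (\<lambda>p q. right_smult E.M\<^sub>2 (U (f i p \<odot>\<^bsub>A\<^esub> v i)) (\<alpha> q \<otimes>\<^bsub>H\<^esub> \<beta> b))"
          using b fc[OF i] v[OF i] Uc by (intro sweedler_cong) (simp add: E.smult_M\<^sub>2_scalar module_hom_smult[OF U_hom])
        finally show ?thesis .
      qed
      have "(\<Oplus>\<^bsub>E.M\<^sub>2\<^esub>i\<in>{..<n}. right_smult E.M\<^sub>2 (U (v i)) (\<gamma> i (\<alpha> a \<otimes>\<^bsub>H\<^esub> \<beta> b))) =
          (\<Oplus>\<^bsub>E.M\<^sub>2\<^esub>i\<in>{..<n}. sweedler K A E.M\<^sub>2 a (\<lambda>p q. right_smult E.M\<^sub>2 (U (f i p \<odot>\<^bsub>A\<^esub> v i)) (\<alpha> q \<otimes>\<^bsub>H\<^esub> \<beta> b)))"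
        using b v fc Uc by (intro E.M2.add.finprod_cong') (auto intro!: step sweedler_closed ag rc)
      also have "\<dots> = sweedler K A E.M\<^sub>2 a (\<lambda>p q. \<Oplus>\<^bsub>E.M\<^sub>2\<^esub>i\<in>{..<n}. right_smult E.M\<^sub>2 (U (f i p \<odot>\<^bsub>A\<^esub> v i)) (\<alpha> q \<otimes>\<^bsub>H\<^esub> \<beta> b))"
        using b v fc Uc by (intro finsum_sweedler ag) (auto intro!: rc)
      also have "\<dots> = sweedler K A E.M\<^sub>2 a (\<lambda>p q. right_smult E.M\<^sub>2 (U p) (\<alpha> q \<otimes>\<^bsub>H\<^esub> \<beta> b))"
      proof (rule sweedler_cong)
        fix p q assume p: "p \<in> carrier A" and q: "q \<in> carrier A"
        have h: "\<alpha> q \<otimes>\<^bsub>H\<^esub> \<beta> b \<in> carrier H" using b q by simp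
        from add_hom_finsum[OF A.abelian_group_axioms ag add_hom_compose[OF U_add E.right_smult_M\<^sub>2_hom[OF h]],
            of "{..<n}" "\<lambda>i. f i p \<odot>\<^bsub>A\<^esub> v i"] v fc p
        show "(\<Oplus>\<^bsub>E.M\<^sub>2\<^esub>i\<in>{..<n}. right_smult E.M\<^sub>2 (U (f i p \<odot>\<^bsub>A\<^esub> v i)) (\<alpha> q \<otimes>\<^bsub>H\<^esub> \<beta> b)) =
            right_smult E.M\<^sub>2 (U p) (\<alpha> q \<otimes>\<^bsub>H\<^esub> \<beta> b)"
          by (simp add: dual)
      qed
      also have "\<dots> = E.e\<^sub>2 (\<alpha> a \<otimes>\<^bsub>H\<^esub> \<beta> b) \<one>\<^bsub>H\<^esub>"
        by (rule U(3)[OF b a])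
      finally show "(\<Oplus>\<^bsub>E.M\<^sub>2\<^esub>i\<in>{..<n}. right_smult E.M\<^sub>2 (U (v i)) (\<gamma> i (\<alpha> a \<otimes>\<^bsub>H\<^esub> \<beta> b))) = E.e\<^sub>2 (\<alpha> a \<otimes>\<^bsub>H\<^esub> \<beta> b) \<one>\<^bsub>H\<^esub>" .
    qed
  qed
qed

end

theorem theorem4p1:
  fixes K :: "'k ring" and A :: "('k, 'a) bialgebra" and B :: "('k, 'b) bialgebra"
    and lact :: "'b \<Rightarrow> 'a \<Rightarrow> 'a" and ract :: "'b \<Rightarrow> 'a \<Rightarrow> 'b"
  assumes "field K" and "\<And>n::nat. n > 0 \<Longrightarrow> [n] \<cdot>\<^bsub>K\<^esub> \<one>\<^bsub>K\<^esub> \<noteq> \<zero>\<^bsub>K\<^esub>"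
    and "matched_pair K A B lact ract"
    and "vectorspace.fin_dim K A" and "vectorspace.fin_dim K B"
  shows "(min_depth (left_factor K A B) (double_cross_product K A B lact ract) \<le> 2 \<longleftrightarrow>
      (\<forall>a\<in>carrier A. \<forall>b\<in>carrier B. ract b a = counit A a \<odot>\<^bsub>B\<^esub> b)) \<and>
    (min_depth (right_factor K A B) (double_cross_product K A B lact ract) \<le> 2 \<longleftrightarrow>
      (\<forall>a\<in>carrier A. \<forall>b\<in>carrier B. lact b a = counit B b \<odot>\<^bsub>A\<^esub> a))"
proof -
  interpret matched_pair K A B lact ract by fact
  interpret left: ring_extension "left_factor K A B" H by (rule ring_extensions)
  interpret right: ring_extension "right_factor K A B" H by (rule ring_extensions)
  from left_factor_necessary left_factor_sufficient[OF assms(5)] left.min_depth_le_two_iff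
    right_factor_necessary right_factor_sufficient[OF assms(4)] right.min_depth_le_two_iff
  show ?thesis by blast
qed

end
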